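(* Let $q\ge 2$ be even. Then the expected number of iterations when adding two independent random symmetric signed digit expansions (SSDEs) of length $\ell$ with von Neumann's algorithm is $$\log_q\ell+\log_q\delta+\frac{\gamma}{\log q}+\frac52+\Psi_0(\log_q\ell+\log_q\delta)+O(\ell^{-1}\log^4\ell),$$ where $$\delta=\frac{(q-1)(4q^{10}+10q^9+18q^8-4q^7-10q^6+7q^5+44q^4-29q^3-8q^2-20q+16)}{4q^3(q+1)^2(4q^7-q^5-6q^4+8q^3+2q-4)},$$ and $\Psi_0(x)$ is a $1$-periodic function with mean $0$ given by the Fourier expansion $$\Psi_0(x)=-\frac{1}{\log q}\sum_{k\neq 0}\Gamma\Bigl(-\frac{2k\pi i}{\log q}\Bigr)e^{2k\pi ix}.$$ The variance of the number of iterations is $$\frac{\pi^2}{6\log^2q}+\frac1{12}+\Psi_1(\log_q\ell+\log_q\delta)-\frac{2\gamma}{\log q}\Psi_0(\log_q\ell+\log_q\delta)-\Psi_0^2(\log_q\ell+\log_q\delta)+O(\ell^{-1}\log^5\ell),$$ where $\Psi_1$ is a $1$-periodic function with mean $0$ given by the Fourier expansion $$\Psi_1(x)=\frac{2}{\log^2q}\sum_{k\neq 0}\Gamma'\Bigl(-\frac{2k\pi i}{\log q}\Bigr)e^{2k\pi ix}.$$ Writing $t(\boldsymbol{X},\boldsymbol{Y})$ for the number of iterations, the asymptotic formula $$\mathbb{P}_\ell\bigl(t(\boldsymbol{X},\boldsymbol{Y})\le k\bigr)=\exp(-\delta\ell/q^{k})(1+o(1))$$ holds as $\ell\to\infty$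 for $k=\log_q\ell+O(1)$. The random variable $t(\boldsymbol{X},\boldsymbol{Y})-\log_q\ell$ converges weakly to a double exponential random variable if $\ell$ runs through a subset of the positive integers such that the fractional part $\{\log_q\ell\}$ converges.
   Context: For even $q\ge 2$, an SSDE of length $\ell$ is a word $x_{\ell-1}\ldots x_0$ with digits $x_j\in\{-\frac q2,\ldots,\frac q2\}$ (leading zeros allowed) satisfying, for $0\le j<\ell-1$, the syntactical rule $$|x_j|=\tfrac q2\ \Longrightarrow\ 0\le\operatorname{sgn}(x_j)x_{j+1}\le\tfrac q2-1.$$ $\mathbb{P}_\ell$ denotes the probability measure under which $\boldsymbol{X}$ and $\boldsymbol{Y}$ are independent, each uniformly distributed on all SSDEs of length $\ell$. Bold letters denote digit sequences $\ldots x_1x_0$ padded with zeros on the left; sums of sequences are digitwise. For an integer sequence $\boldsymbol{s}=\ldots s_1s_0$ (finitely many nonzero terms) define $(\boldsymbol{z},\boldsymbol{c})=\operatorname{add}(\boldsymbol{s})$ by $c_0=0$, $$c_{j+1}=\begin{cases}\operatorname{sgn}(s_j)&\text{if }|s_j|>\frac q2,\text{ or }|s_j|=\frac q2\text{ and }(\operatorname{sgn}(s_j)s_{j+1})\bmod q\ge\frac q2,\\0&\text{otherwise,}\end{cases}\qquad z_j=s_j-c_{j+1}q,$$ where residues mod $q$ are taken in $\{0,\ldots,q-1\}$. Von Neumann's addition of SSDEs $\boldsymbol{x},\boldsymbol{y}$ starts with $\boldsymbol{z}^{(0)}=\boldsymbol{x}$, $\boldsymbol{c}^{(0)}=\boldsymbol{y}$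 and iterates $(\boldsymbol{z}^{(k+1)},\boldsymbol{c}^{(k+1)})=\operatorname{add}(\boldsymbol{z}^{(k)}+\boldsymbol{c}^{(k)})$ until $\boldsymbol{c}^{(k)}=0$. The number of iterations is $t(\boldsymbol{x},\boldsymbol{y})=\min\{k\ge 0:\boldsymbol{c}^{(k)}=0\}$ (it is known that the algorithm terminates and $\boldsymbol{z}^{(k)}$ is then the SSDE of the sum). $\gamma$ is the Euler--Mascheroni constant, $\log$ is the natural logarithm, $\log_q$ the logarithm to base $q$, $\Gamma$ the Gamma function with derivative $\Gamma'$, and the sums run over all nonzero integers $k$. "Double exponential" refers to the double exponential form of the right-hand side of the displayed asymptotic formula for the distribution function.
   Formalization: The distribution formula is proved as exp(-δℓ/q^(k-2))(1+o(1)) instead of exp(-δℓ/q^k)(1+o(1)): the printed exponent is false and contradicts the constant 5/2 in the expectation. The limiting double exponential law uses the corrected exponent too. *)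

theory Defs
  imports "HOL-Probability.Probability" "HOL-Library.Landau_Symbols"
begin

text \<open>
  A digit sequence \<open>\<dots> x\<^sub>1 x\<^sub>0\<close> is a function \<open>nat \<Rightarrow> int\<close>, the value at \<open>j\<close> being the digit
  of weight \<open>q ^ j\<close>. A word of length \<open>l\<close> is identified with its padding by zeros on the left.
  The base \<open>q\<close> is even throughout, so \<open>q div 2\<close> is exactly one half of \<open>q\<close>.
\<close>

definition SSDE :: "int \<Rightarrow> nat \<Rightarrow> (nat \<Rightarrow> int) set" where
  "SSDE q l = {x. (\<forall>j\<ge>l. x j = 0) \<and>
     (\<forall>j<l. - (q div 2) \<le> x j \<and> x j \<le> q div 2) \<and>
     (\<forall>j. Suc j < l \<longrightarrow> \<bar>x j\<bar> = q div 2 \<longrightarrow>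
        0 \<le> sgn (x j) * x (Suc j) \<and> sgn (x j) * x (Suc j) \<le> q div 2 - 1)}"

definition SSDE_pair_pmf :: "int \<Rightarrow> nat \<Rightarrow> ((nat \<Rightarrow> int) \<times> (nat \<Rightarrow> int)) pmf" where
  "SSDE_pair_pmf q l = pair_pmf (pmf_of_set (SSDE q l)) (pmf_of_set (SSDE q l))"

fun carry :: "int \<Rightarrow> (nat \<Rightarrow> int) \<Rightarrow> nat \<Rightarrow> int" where
  "carry q s 0 = 0"
| "carry q s (Suc j) =
     (if \<bar>s j\<bar> > q div 2 \<or>
         (\<bar>s j\<bar> = q div 2 \<and> (sgn (s j) * s (Suc j)) mod q \<ge> q div 2)
      then sgn (s j) else 0)"

definition add :: "int \<Rightarrow> (nat \<Rightarrow> int) \<Rightarrow> (nat \<Rightarrow> int) \<times> (nat \<Rightarrow> int)" where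
  "add q s = (\<lambda>j. s j - carry q s (Suc j) * q, carry q s)"

fun von_Neumann ::
  "int \<Rightarrow> (nat \<Rightarrow> int) \<Rightarrow> (nat \<Rightarrow> int) \<Rightarrow> nat \<Rightarrow> (nat \<Rightarrow> int) \<times> (nat \<Rightarrow> int)" where
  "von_Neumann q x y 0 = (x, y)"
| "von_Neumann q x y (Suc k) =
     (let (z, c) = von_Neumann q x y k in add q (\<lambda>j. z j + c j))"

definition iterations :: "int \<Rightarrow> (nat \<Rightarrow> int) \<times> (nat \<Rightarrow> int) \<Rightarrow> nat" where
  "iterations q p = (LEAST k. snd (von_Neumann q (fst p) (snd p) k) = (\<lambda>j. 0))"

definition delta :: "real \<Rightarrow> real" where
  "delta q =
     ((q - 1) * (4*q^10 + 10*q^9 + 18*q^8 - 4*q^7 - 10*q^6 + 7*q^5 + 44*q^4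
        - 29*q^3 - 8*q^2 - 20*q + 16)) /
     (4 * q^3 * (q + 1)^2 * (4*q^7 - q^5 - 6*q^4 + 8*q^3 + 2*q - 4))"

definition Psi0_term :: "real \<Rightarrow> real \<Rightarrow> int \<Rightarrow> complex" where
  "Psi0_term q x k = - 1 / of_real (ln q) *
     (Gamma (- (2 * of_int k * of_real pi * \<i> / of_real (ln q))) *
      exp (2 * of_int k * of_real pi * \<i> * of_real x))"

definition Psi1_term :: "real \<Rightarrow> real \<Rightarrow> int \<Rightarrow> complex" where
  "Psi1_term q x k = 2 / of_real ((ln q)^2) *
     (deriv Gamma (- (2 * of_int k * of_real pi * \<i> / of_real (ln q))) *
      exp (2 * of_int k * of_real pi * \<i> * of_real x))"

text \<open>
  The two periodic functions are real-valued: the terms for \<open>k\<close> and \<open>- k\<close> are conjugate.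
  Taking the real part only selects the type.
\<close>

definition Psi0 :: "real \<Rightarrow> real \<Rightarrow> real" where
  "Psi0 q x = Re (\<Sum>\<^sub>\<infinity>k\<in>-{0}. Psi0_term q x k)"

definition Psi1 :: "real \<Rightarrow> real \<Rightarrow> real" where
  "Psi1 q x = Re (\<Sum>\<^sub>\<infinity>k\<in>-{0}. Psi1_term q x k)"

text \<open>
  The double exponential approximation to the probability of at most \<open>k\<close> iterations for
  operands of length \<open>a\<close>. The exponent of \<open>q\<close> is \<open>k - 2\<close>, where the source prints \<open>k\<close>:
  if the probability of \<open>t \<le> k\<close> is approximately \<open>exp (- b / q ^ k)\<close>, then summing the
  probabilities of \<open>t > k\<close> over \<open>k \<ge> 0\<close> gives the mean \<open>log q b + \<gamma> / ln q + 1 / 2\<close> up to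
  the periodic fluctuation and \<open>o(1)\<close>. The mean of \<open>t\<close> has the constant \<open>5 / 2\<close> instead of
  \<open>1 / 2\<close>, which forces \<open>b = \<delta> * a * q ^ 2\<close>.

  The argument \<open>a\<close> is real because the limiting distributions use \<open>a = q powr \<theta>\<close> with \<open>\<theta>\<close> the
  limit of the fractional parts of \<open>log q l\<close>: at most \<open>x + log q l\<close> iterations means at most
  \<open>\<lfloor>x + log q l\<rfloor>\<close>, and only the difference of \<open>log q a\<close> and \<open>k\<close> enters.
\<close>

definition double_exponential :: "real \<Rightarrow> real \<Rightarrow> int \<Rightarrow> real" where
  "double_exponential q a k = exp (- (delta q * a / q powr (of_int k - 2)))"

end

theory Submission
  imports Defs "HOL-Real_Asymp.Real_Asymp"
begin

text \<open>
  A carry that keeps being passed on must follow a rigid pattern of digits in the digit sum of the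
  operands, in which every digit but the first and the last is \<open>q/2\<close>, \<open>q/2 - 1\<close> or one of these minus
  \<open>q\<close>; the number of iterations is the length of the longest such chain, up to a shift. Reading the
  digits from the right, the current lengths of the open chains form a finite automaton, and the
  probability \<open>f n\<close> that no chain of length \<open>M\<close> is closed in the first \<open>n\<close> digits is shown to
  satisfy \<open>f (n + M) - f (n + M + 1) \<approx> c * f n * q powr -M\<close>. Instead of diagonalising a transfer
  matrix, this is read off from an explicit bounded function of the state (a potential) whose
  expected increment along live words is constant, up to the influx into chains of length one. Hence
  \<open>f l \<approx> exp (- \<delta> * l / q ^ (M - 2))\<close>.

  The approximating law is that of \<open>N = \<lfloor>x - log q U\<rfloor> + 1\<close> for an exponentially distributed \<open>U\<close>
  and \<open>x = log q (\<delta> * l) + 2\<close>. Its moments are computed exactly: with the sawtooth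
  \<open>1/2 - frac t\<close> one has \<open>N = x - log q U + 1/2 + sawtooth (x - log q U)\<close>, and the Fourier
  coefficients of the expected sawtooth are values of the Gamma function and of its derivative.
\<close>

section \<open>Carry chains\<close>

text \<open>Whether a digit \<open>h = q div 2\<close> sends out a carry depends on the residue of
  its left neighbour. A carry arriving at \<open>h\<close> or \<open>h - 1\<close> can only be
  followed by knowing how the next residue compares with \<open>h\<close>, which is why a chain has
  two states, \<open>A\<close> and \<open>B\<close>, demanding opposite answers. The obstacle in the
  probabilistic part is uniformity: the number of states grows with \<open>M\<close>, and the error
  must be controlled for all \<open>M\<close> and \<open>n\<close> together. The way out is an exact
  delay. Pairs of words are weighted by an eigenfunction of the extension by one digit, and open
  chains by \<open>omA\<close> and \<open>omB\<close>, for which one more digit multiplies the mass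
  at a level by exactly \<open>1 / q\<close>. So the mass lost at one moment is a fixed multiple of
  \<open>q powr - (M - 1)\<close> times the influx into level one \<open>M - 1\<close> digits
  earlier. Discarding words disturbs the other balances by at most a constant times the discarded
  mass, and such errors have a bounded sum. For q = 2 the digit \<open>h - 1\<close> is 0 and
  \<open>h + 1\<close> is congruent to \<open>h - 1\<close>, the source of most side
  conditions.\<close>

locale even_base =
  fixes q :: int
  assumes q_even: "even q" and q_ge: "q \<ge> 2"
begin

definition h :: int where "h = q div 2"

lemma q_eq: "q = 2 * h" and h_ge: "h \<ge> 1"
  using q_even q_ge unfolding h_def by auto

text \<open>\<open>RA m s p\<close>: a positive carry leaving position \<open>p\<close> with \<open>s p \<ge> h\<close> under the condition on the
  residue of \<open>s (p + 1)\<close> is passed on over \<open>m\<close> further positions; \<open>RB\<close> is the complementary case.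
  The sequence is negated whenever the sign of the carry changes.\<close>

fun RA RB :: "nat \<Rightarrow> (nat \<Rightarrow> int) \<Rightarrow> nat \<Rightarrow> bool" where
  "RA 0 s p \<longleftrightarrow> s (Suc p) mod q \<ge> h"
| "RA (Suc m) s p \<longleftrightarrow> s (Suc p) = h \<and> RB m s (Suc p) \<or> s (Suc p) = - h \<and> RA m (- s) (Suc p)"
| "RB 0 s p \<longleftrightarrow> s (Suc p) mod q < h"
| "RB (Suc m) s p \<longleftrightarrow> s (Suc p) = h - 1 \<and> RA m s (Suc p) \<or> s (Suc p) = - h - 1 \<and> RB m (- s) (Suc p)"

definition chain :: "nat \<Rightarrow> (nat \<Rightarrow> int) \<Rightarrow> bool" where
  "chain m s \<longleftrightarrow> (\<exists>p. s p \<ge> h \<and> RA m s p \<or> s p > h \<and> RB m s p)"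

definition long_chain :: "nat \<Rightarrow> (nat \<Rightarrow> int) \<Rightarrow> bool" where
  "long_chain m s \<longleftrightarrow> chain m s \<or> chain m (- s)"

section \<open>Chain predicates and residues modulo the base\<close>

lemma mod_shift: "(a::int) + q * k = b \<Longrightarrow> 0 \<le> b \<Longrightarrow> b < q \<Longrightarrow> a mod q = b"
  by (metis mod_mult_self2 mod_pos_pos_trivial)

lemma mod_q_simps:
  "h mod q = h" "(- h) mod q = h" "(h - 1) mod q = h - 1" "(- h - 1) mod q = h - 1"
  using h_ge q_eq by (auto intro: mod_shift[where k = 0] mod_shift[where k = 1])

text \<open>The digits demanded by one more link have the residue demanded at the end of the shorter
  chain: \<open>h\<close> and \<open>- h\<close> have residue \<open>h\<close>, while
  \<open>h - 1\<close> and \<open>- h - 1\<close> have residue \<open>h - 1\<close>.\<close>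

lemma R_mono:
  "(RA (Suc m) s p \<longrightarrow> RA m s p) \<and> (RB (Suc m) s p \<longrightarrow> RB m s p)"
proof (induction m arbitrary: s p)
  case 0
  show ?case using mod_q_simps h_ge by auto
next
  case (Suc m)
  show ?case
    unfolding RA.simps(2)[of "Suc m" s p] RB.simps(2)[of "Suc m" s p] RA.simps(2)[of m s p] RB.simps(2)[of m s p]
    using Suc by blast
qed

lemma R_imp_R0: "RA m s p \<Longrightarrow> RA 0 s p" "RB m s p \<Longrightarrow> RB 0 s p"
proof (induction m)
  case (Suc m)
  { case 1 then show ?case using Suc.IH(1) R_mono by blast }
  { case 2 then show ?case using Suc.IH(2) R_mono by blast }
qed auto

lemma long_chain_antimono: "long_chain (Suc m) s \<Longrightarrow> long_chain m s"
  unfolding long_chain_def chain_def using R_mono by meson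

section \<open>The effect of one addition step on chains\<close>

lemma neg_neg: "- (- s) = (s :: nat \<Rightarrow> int)"
  by (rule ext) simp

text \<open>The sequence fed into the next step of the algorithm. With it the iteration on pairs
  becomes the iteration of one map on a single sequence.\<close>

definition carry_sum :: "(nat \<Rightarrow> int) \<Rightarrow> nat \<Rightarrow> int" where
  "carry_sum s j = s j - carry q s (Suc j) * q + carry q s j"

lemma carry_uminus: "carry q (- s) j = - carry q s j"
  by (cases j) (auto simp: sgn_minus)

lemma carry_sum_uminus: "carry_sum (- s) = - carry_sum s"
  by (rule ext) (simp add: carry_sum_def carry_uminus del: carry.simps)

lemma carry_cases:
  assumes "\<bar>s p\<bar> \<le> q"
  shows "s p > h \<Longrightarrow> carry q s (Suc p) = 1"
    "s p < - h \<Longrightarrow> carry q s (Suc p) = - 1"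
    "\<bar>s p\<bar> < h \<Longrightarrow> carry q s (Suc p) = 0"
    "s p = h \<Longrightarrow> carry q s (Suc p) = (if s (Suc p) mod q \<ge> h then 1 else 0)"
    "s p = - h \<Longrightarrow> carry q s (Suc p) = (if (- s (Suc p)) mod q \<ge> h then - 1 else 0)"
  using h_ge by (auto simp flip: h_def)

text \<open>The last two conditions are only needed for \<open>q = 2\<close>, where \<open>h + 1\<close> and \<open>h - 1\<close> are
  congruent. They hold for sums of two expansions and persist under a carry step.\<close>

definition admissible :: "(nat \<Rightarrow> int) \<Rightarrow> bool" where
  "admissible s \<longleftrightarrow> (\<forall>p. \<bar>s p\<bar> \<le> q) \<and>
     (q = 2 \<longrightarrow> (\<forall>p. (s p \<ge> 1 \<longrightarrow> s (Suc p) \<noteq> 2) \<and> (s p \<le> - 1 \<longrightarrow> s (Suc p) \<noteq> - 2)))"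

lemma admissible_uminus: "admissible (- s) \<longleftrightarrow> admissible s"
proof -
  have "- a \<ge> 1 \<longleftrightarrow> a \<le> - 1" "- a \<le> - 1 \<longleftrightarrow> a \<ge> 1" "- a = 2 \<longleftrightarrow> a = - 2" "- a = - 2 \<longleftrightarrow> a = 2" for a :: int
    by linarith+
  then show ?thesis unfolding admissible_def by (simp del: minus_le_iff) blast
qed

lemma admissible_two:
  assumes "admissible s" "q = 2"
  shows "s p \<ge> 1 \<Longrightarrow> s (Suc p) \<noteq> 2" "s p \<le> - 1 \<Longrightarrow> s (Suc p) \<noteq> - 2"
  using assms unfolding admissible_def by blast+

lemma mod_flip: "(- a) mod q \<ge> h \<longleftrightarrow> 1 \<le> a mod q \<and> a mod q \<le> h"
proof -
  have "a mod q \<ge> 0" "a mod q < q" using q_ge by auto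
  then have "a mod q = 0 \<or> 1 \<le> a mod q" "a mod q \<le> 2 * h - 1" using q_eq by linarith+
  then show ?thesis using q_eq h_ge by (auto simp: zmod_zminus1_eq_if)
qed

lemma mod_succ: "(a + 1) mod q = (if a mod q = q - 1 then 0 else a mod q + 1)"
proof -
  have "(a + 1) mod q = (a mod q + 1) mod q" by (simp add: mod_add_left_eq)
  moreover have "a mod q \<ge> 0" "a mod q < q" using q_ge by auto
  ultimately show ?thesis by (auto simp: mod_pos_pos_trivial)
qed

lemma mod_carry_sum: "carry_sum s p mod q = (s p + carry q s p) mod q"
proof -
  have "carry_sum s p = s p + carry q s p + q * (- carry q s (Suc p))"
    by (simp add: carry_sum_def algebra_simps)
  then show ?thesis by (simp only: mod_mult_self2)
qed

lemma mod_bounds: "0 \<le> a mod q" "a mod q < q" "a mod q = 0 \<or> 1 \<le> a mod q"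
proof -
  show a: "0 \<le> a mod q" "a mod q < q" using q_ge by auto
  then show "a mod q = 0 \<or> 1 \<le> a mod q" by linarith
qed

text \<open>The map from \<open>a\<close> to \<open>- a - 1\<close> reverses the residues 0, ..., q
  - 1 and so exchanges their two halves exactly, whereas plain negation fixes 0 and
  \<open>h\<close>. An arriving carry supplies the shift by one.\<close>

lemma mod_pred_flip: "(- (a + 1)) mod q \<ge> h \<longleftrightarrow> a mod q < h"
  using mod_flip[of "a + 1"] mod_succ[of a] mod_bounds[of a] q_eq h_ge by (auto split: if_splits)

lemma mod_pred_flip': "(a - 1) mod q \<ge> h \<longleftrightarrow> (- a) mod q < h"
  using mod_pred_flip[of "- a"] by (simp add: algebra_simps)

text \<open>If digit \<open>p\<close> sends no carry, the residue seen by the chain changes only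
  through its own links and the state is kept. If it sends the carry 1, the next residue is raised
  by one, and by \<open>mod_pred_flip\<close> the chain reappears in the other state for the negated
  sequence. The digits \<open>h - 1\<close>, \<open>h\<close> and \<open>h + 1\<close> are the
  starting points that the induction meets.\<close>

lemma R_carry_sum:
  assumes "admissible s"
  shows "(s p = h - 1 \<longrightarrow> (RA m (carry_sum s) p \<longleftrightarrow> RA m s p)) \<and>
    (s p = h \<and> s (Suc p) mod q \<ge> h \<longrightarrow> (RB m (- carry_sum s) p \<longleftrightarrow> RA m s p)) \<and>
    (s p = h \<and> s (Suc p) mod q < h \<longrightarrow> (RB m (carry_sum s) p \<longleftrightarrow> RB m s p)) \<and>
    (s p = h + 1 \<longrightarrow> (RA m (- carry_sum s) p \<longleftrightarrow> RB m s p))"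
  using assms
proof (induction m arbitrary: s p)
  case 0
  let ?c = "carry q s (Suc p)"
  have bd: "\<bar>s p\<bar> \<le> q" using 0 by (auto simp: admissible_def)
  note C = carry_cases[where s = s and p = p, OF bd]
  have M: "carry_sum s (Suc p) mod q = (s (Suc p) + ?c) mod q" by (rule mod_carry_sum)
  have M': "(- carry_sum s (Suc p)) mod q = (- (s (Suc p) + ?c)) mod q"
    using M by (rule mod_minus_cong)
  have "?c = 0" if "s p = h - 1" using that C(3) C(4) h_ge q_eq
    by (smt (verit))
  moreover have "\<not> (- (s (Suc p) + 1)) mod q \<ge> h" if "s (Suc p) mod q \<ge> h"
    using that mod_pred_flip[of "s (Suc p)"] by simp
  ultimately show ?case using M M' C mod_pred_flip[of "s (Suc p)"] h_ge
    by (auto simp del: carry.simps simp: not_le[symmetric])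
next
  case (Suc m)
  define v where "v = s (Suc p)"
  define w where "w = s (Suc (Suc p))"
  define u where "u = carry_sum s"
  define c1 where "c1 = carry q s (Suc p)"
  define c2 where "c2 = carry q s (Suc (Suc p))"
  have adm: "admissible s" "admissible (- s)" using Suc.prems by (simp_all add: admissible_uminus)
  have bd: "\<bar>s p\<bar> \<le> q" and bd': "\<bar>s (Suc p)\<bar> \<le> q" using adm by (auto simp: admissible_def)
  note C = carry_cases[where s = s and p = p, OF bd, folded c1_def v_def]
  note D = carry_cases[where s = s and p = "Suc p", OF bd', folded c2_def v_def w_def]
  note I = Suc.IH[OF adm(1), of "Suc p", folded u_def v_def w_def]
  \<comment> \<open>The induction hypothesis is also needed for \<open>- s\<close>, because the
    digits \<open>- h\<close> and \<open>- h - 1\<close> pass a chain on with its sign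
    reversed.\<close>
  have I': "(- v = h - 1 \<longrightarrow> (RA m (- u) (Suc p) \<longleftrightarrow> RA m (- s) (Suc p))) \<and>
    (- v = h \<and> (- w) mod q \<ge> h \<longrightarrow> (RB m u (Suc p) \<longleftrightarrow> RA m (- s) (Suc p))) \<and>
    (- v = h \<and> (- w) mod q < h \<longrightarrow> (RB m (- u) (Suc p) \<longleftrightarrow> RB m (- s) (Suc p))) \<and>
    (- v = h + 1 \<longrightarrow> (RA m u (Suc p) \<longleftrightarrow> RB m (- s) (Suc p)))"
  proof -
    define n where "n = - s"
    have n: "carry_sum n = - u" "n (Suc p) = - v" "n (Suc (Suc p)) = - w"
      by (auto simp: n_def u_def v_def w_def carry_sum_uminus)
    show ?thesis using Suc.IH[OF adm(2)[folded n_def], of "Suc p"] unfolding n neg_neg n_def[symmetric] .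
  qed
  have up: "u (Suc p) = v - c2 * q + c1"
    by (simp add: u_def carry_sum_def v_def c1_def c2_def del: carry.simps)
  have M: "u (Suc (Suc p)) mod q = (w + c2) mod q"
    unfolding u_def w_def c2_def by (rule mod_carry_sum)
  have M': "(- u (Suc (Suc p))) mod q = (- (w + c2)) mod q"
    using M by (rule mod_minus_cong)
  have RBs: "RB m s (Suc p) \<Longrightarrow> w mod q < h" using R_imp_R0(2)[of m s "Suc p"] by (simp add: w_def)
  have RAs: "RA m (- s) (Suc p) \<Longrightarrow> (- w) mod q \<ge> h" using R_imp_R0(1)[of m "- s" "Suc p"] by (simp add: w_def)
  have RAu: "RA m (- u) (Suc p) \<Longrightarrow> (- (w + c2)) mod q \<ge> h"
    using R_imp_R0(1)[of m "- u" "Suc p"] M' by simp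
  have F1: "\<not> RA m (- u) (Suc p)" if "v = h" "w mod q \<ge> h"
    using that RAu D(4) mod_pred_flip[of w] by auto
  have F2: "\<not> RA m (- u) (Suc p)" if "v = - h" "\<not> (- w) mod q \<ge> h"
    using that RAu D(5) by auto
  \<comment> \<open>For q = 2 the digit \<open>h + 1\<close> would be reduced to
    \<open>h - 1\<close> and imitate a link of the chain; admissibility excludes it here.\<close>
  have bad: "\<not> v = h + 1" if "s p \<ge> h" "q = 2"
    using that admissible_two(1)[OF adm(1) that(2), of p] h_ge q_eq unfolding v_def by linarith
  have h1: "h = 1 \<longleftrightarrow> q = 2" using q_eq by auto
  have c2: "c2 = 1 \<or> c2 = 0 \<or> c2 = - 1" using D by (smt (verit))
  have up': "c2 = 1 \<Longrightarrow> u (Suc p) = v - 2 * h + c1" "c2 = 0 \<Longrightarrow> u (Suc p) = v + c1"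
    "c2 = - 1 \<Longrightarrow> u (Suc p) = v + 2 * h + c1" using up q_eq by auto
  have vb: "v \<le> 2 * h" "v \<ge> - 2 * h" using bd' q_eq by (auto simp: v_def)
  \<comment> \<open>\<open>u (Suc p) - c1\<close> is the reduced digit before the carry from
    \<open>p\<close> is added. The three facts below say which original digits are reduced to digits
    of a chain; afterwards only the value of \<open>c1\<close> has to be inserted.\<close>
  have zA: "u (Suc p) - c1 = h \<and> RB m u (Suc p) \<or> u (Suc p) - c1 = - h \<and> RA m (- u) (Suc p) \<longleftrightarrow>
    v = h \<and> RB m s (Suc p) \<or> v = - h \<and> RA m (- s) (Suc p)"
    using D c2 up' vb h_ge I I' RBs RAs F1 F2 by (smt (z3))
  have zB: "u (Suc p) - c1 = h - 1 \<and> RA m u (Suc p) \<longleftrightarrow>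
    v = h - 1 \<and> RA m s (Suc p) \<or> v = - h - 1 \<and> RB m (- s) (Suc p)" if "s p \<ge> h"
    using D c2 up' vb h_ge I I' bad that h1 by (smt (z3))
  have zC: "u (Suc p) - c1 \<noteq> - h - 1"
    using D c2 up' vb h_ge by (smt (z3))
  have A: "RA (Suc m) s p \<longleftrightarrow> v = h \<and> RB m s (Suc p) \<or> v = - h \<and> RA m (- s) (Suc p)"
    "RB (Suc m) s p \<longleftrightarrow> v = h - 1 \<and> RA m s (Suc p) \<or> v = - h - 1 \<and> RB m (- s) (Suc p)"
    "RA (Suc m) u p \<longleftrightarrow> u (Suc p) = h \<and> RB m u (Suc p) \<or> u (Suc p) = - h \<and> RA m (- u) (Suc p)"
    "RB (Suc m) u p \<longleftrightarrow> u (Suc p) = h - 1 \<and> RA m u (Suc p) \<or> u (Suc p) = - h - 1 \<and> RB m (- u) (Suc p)"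
    "RA (Suc m) (- u) p \<longleftrightarrow> u (Suc p) = - h \<and> RB m (- u) (Suc p) \<or> u (Suc p) = h \<and> RA m u (Suc p)"
    "RB (Suc m) (- u) p \<longleftrightarrow> u (Suc p) = 1 - h \<and> RA m (- u) (Suc p) \<or> u (Suc p) = h + 1 \<and> RB m u (Suc p)"
  proof -
    have eqs: "- a = h - 1 \<longleftrightarrow> a = 1 - h" "- a = - h - 1 \<longleftrightarrow> a = h + 1" "- a = h \<longleftrightarrow> a = - h"
      "- a = - h \<longleftrightarrow> a = h" for a :: int
      by linarith+
    show "RA (Suc m) (- u) p \<longleftrightarrow> u (Suc p) = - h \<and> RB m (- u) (Suc p) \<or> u (Suc p) = h \<and> RA m u (Suc p)"
      "RB (Suc m) (- u) p \<longleftrightarrow> u (Suc p) = 1 - h \<and> RA m (- u) (Suc p) \<or> u (Suc p) = h + 1 \<and> RB m u (Suc p)"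
      by (simp_all only: RA.simps(2) RB.simps(2) uminus_apply neg_neg eqs)
  qed (simp_all only: RA.simps(2) RB.simps(2) v_def)
  show ?case unfolding u_def[symmetric] A v_def[symmetric]
  proof (intro conjI impI)
    assume "s p = h - 1"
    then have "c1 = 0" using C mod_q_simps h_ge by (smt (verit))
    then show "(u (Suc p) = h \<and> RB m u (Suc p) \<or> u (Suc p) = - h \<and> RA m (- u) (Suc p)) =
      (v = h \<and> RB m s (Suc p) \<or> v = - h \<and> RA m (- s) (Suc p))" using zA by simp
  next
    assume "s p = h \<and> h \<le> v mod q"
    then have "c1 = 1" using C by simp
    then show "(u (Suc p) = 1 - h \<and> RA m (- u) (Suc p) \<or> u (Suc p) = h + 1 \<and> RB m u (Suc p)) =
      (v = h \<and> RB m s (Suc p) \<or> v = - h \<and> RA m (- s) (Suc p))" using zA by (smt (verit))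
  next
    assume a: "s p = h \<and> v mod q < h"
    then have "c1 = 0" using C by simp
    then show "(u (Suc p) = h - 1 \<and> RA m u (Suc p) \<or> u (Suc p) = - h - 1 \<and> RB m (- u) (Suc p)) =
      (v = h - 1 \<and> RA m s (Suc p) \<or> v = - h - 1 \<and> RB m (- s) (Suc p))" using zB zC a by (smt (verit))
  next
    assume a: "s p = h + 1"
    then have "c1 = 1" using C by simp
    then show "(u (Suc p) = - h \<and> RB m (- u) (Suc p) \<or> u (Suc p) = h \<and> RA m u (Suc p)) =
      (v = h - 1 \<and> RA m s (Suc p) \<or> v = - h - 1 \<and> RB m (- s) (Suc p))" using zB zC a by (smt (verit))
  qed
qed

lemma carry_sign:
  shows "carry q s (Suc p) = 1 \<Longrightarrow> s p \<ge> h" "carry q s (Suc p) = - 1 \<Longrightarrow> s p \<le> - h"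
  using h_ge by (auto simp: sgn_if simp flip: h_def split: if_splits)

text \<open>Reduced digits are at most \<open>h\<close> in absolute value and a carry adds at most
  1. For q = 2, a new digit 2 needs an incoming carry 1. If its right neighbour is still at least 1
  after sending that carry, it was a 2 that itself received a carry, so the digit before was at
  least 1, which admissibility of the old sequence forbids.\<close>

lemma admissible_carry_sum:
  assumes "admissible s"
  shows "admissible (carry_sum s)"
proof -
  have bd: "\<bar>s p\<bar> \<le> q" for p using assms by (auto simp: admissible_def)
  have c: "carry q s p = 1 \<or> carry q s p = 0 \<or> carry q s p = - 1" for p
    by (cases p) (auto simp: sgn_if)
  note C = carry_cases[where s = s, OF bd]
  have cq: "carry q s (Suc p) * q = (if carry q s (Suc p) = 1 then 2 * h else if carry q s (Suc p) = 0 then 0 else - 2 * h)" for p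
    using c[of "Suc p"] q_eq by (auto simp del: carry.simps)
  have z: "\<bar>s p - carry q s (Suc p) * q\<bar> \<le> h" for p
    unfolding cq using C[of p] bd[of p] q_eq h_ge by (smt (z3))
  have 1: "\<bar>carry_sum s p\<bar> \<le> q" for p
    using z[of p] c[of p] q_eq h_ge unfolding carry_sum_def by linarith
  have 2: "carry_sum s (Suc p) \<noteq> 2" if "q = 2" "carry_sum s p \<ge> 1" for p
  proof
    assume a: "carry_sum s (Suc p) = 2"
    have h: "h = 1" using that q_eq by simp
    have A: "s i \<ge> 1 \<longrightarrow> s (Suc i) \<noteq> 2" for i using admissible_two(1)[OF assms that(1)] by blast
    have c1: "carry q s (Suc p) = 1"
      using a z[of "Suc p"] c[of "Suc p"] h unfolding carry_sum_def by linarith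
    then have "s p \<ge> 1" using carry_sign(1)[of s p] h by linarith
    moreover have cs: "carry_sum s p = s p - 2 + carry q s p"
      unfolding carry_sum_def c1 by (simp add: that(1) del: carry.simps)
    ultimately have sp: "s p = 2" and cp: "carry q s p = 1"
      using bd[of p] that c[of p] by linarith+
    then obtain p' where p': "p = Suc p'" by (cases p) auto
    then have "s p' \<ge> 1" using carry_sign(1)[of s p'] h cp[unfolded p'] by linarith
    then show False using A[of p'] sp p' by simp
  qed
  have 3: "carry_sum s (Suc p) \<noteq> - 2" if "q = 2" "carry_sum s p \<le> - 1" for p
  proof
    assume a: "carry_sum s (Suc p) = - 2"
    have h: "h = 1" using that q_eq by simp
    have A: "s i \<le> - 1 \<longrightarrow> s (Suc i) \<noteq> - 2" for i using admissible_two(2)[OF assms that(1)] by blast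
    have c1: "carry q s (Suc p) = - 1"
      using a z[of "Suc p"] c[of "Suc p"] h unfolding carry_sum_def by linarith
    then have "s p \<le> - 1" using carry_sign(2)[of s p] h by linarith
    moreover have cs: "carry_sum s p = s p + 2 + carry q s p"
      unfolding carry_sum_def c1 by (simp add: that(1) del: carry.simps)
    ultimately have sp: "s p = - 2" and cp: "carry q s p = - 1"
      using bd[of p] that c[of p] by linarith+
    then obtain p' where p': "p = Suc p'" by (cases p) auto
    then have "s p' \<le> - 1" using carry_sign(2)[of s p'] h cp[unfolded p'] by linarith
    then show False using A[of p'] sp p' by simp
  qed
  show ?thesis using 1 2 3 unfolding admissible_def by blast
qed

text \<open>A step uses up the first link: the carry sent from \<open>p\<close> is absorbed at
  \<open>p + 1\<close>, where the shorter chain starts. A start in state \<open>A\<close> turns into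
  the digit \<open>h + 1\<close> in state \<open>B\<close>, a start in state \<open>B\<close> into
  the digit \<open>h\<close> in state \<open>A\<close>.\<close>

lemma carry_sum_start:
  assumes "admissible s"
  shows "chain (Suc m) s \<longleftrightarrow> chain m (carry_sum s)"
proof -
  define u where "u = carry_sum s"
  have bd: "\<bar>s p\<bar> \<le> q" for p using assms by (auto simp: admissible_def)
  note C = carry_cases[where s = s, OF bd]
  have c: "carry q s p = 1 \<or> carry q s p = 0 \<or> carry q s p = - 1" for p
    by (cases p) (auto simp: sgn_if)
  have cq: "carry q s (Suc p) * q = (if carry q s (Suc p) = 1 then 2 * h else if carry q s (Suc p) = 0 then 0 else - 2 * h)" for p
    using c[of "Suc p"] q_eq by (auto simp del: carry.simps)
  have z: "\<bar>s p - carry q s (Suc p) * q\<bar> \<le> h" for p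
    unfolding cq using C[of p] bd[of p] q_eq h_ge by (smt (z3))
  have zu: "u p - carry q s p = s p - carry q s (Suc p) * q" for p
    by (simp add: u_def carry_sum_def del: carry.simps)
  have zcase: "s p - carry q s (Suc p) * q =
      (if carry q s (Suc p) = 1 then s p - 2 * h else if carry q s (Suc p) = 0 then s p else s p + 2 * h)" for p
    unfolding cq by simp
  have vb: "s p \<le> 2 * h" "- 2 * h \<le> s p" for p using bd[of p] q_eq by auto
  have bad: "\<not> s (Suc p) = h + 1" if "s p \<ge> h" "h = 1" for p
    using that admissible_two(1)[OF assms, of p] q_eq by simp
  note I = R_carry_sum[OF assms, of _ m, folded u_def]
  define n where "n = - s"
  have adn: "admissible n" using assms by (simp only: n_def admissible_uminus)
  have n: "carry_sum n = - u" "n i = - s i" for i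
    by (auto simp: n_def u_def carry_sum_uminus)
  have I': "(- s p = h - 1 \<longrightarrow> (RA m (- u) p \<longleftrightarrow> RA m n p)) \<and>
    (- s p = h \<and> (- s (Suc p)) mod q \<ge> h \<longrightarrow> (RB m u p \<longleftrightarrow> RA m n p)) \<and>
    (- s p = h \<and> (- s (Suc p)) mod q < h \<longrightarrow> (RB m (- u) p \<longleftrightarrow> RB m n p)) \<and>
    (- s p = h + 1 \<longrightarrow> (RA m u p \<longleftrightarrow> RB m n p))" for p
    using R_carry_sum[OF adn, of p m] unfolding n(1) n(2)[of p] n(2)[of "Suc p"] neg_neg .
  have zh: "s p - carry q s (Suc p) * q = h \<longleftrightarrow>
      s p = h \<and> s (Suc p) mod q < h \<or> s p = - h \<and> (- s (Suc p)) mod q \<ge> h" for p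
    using zcase[of p] C[of p] vb[of p] h_ge by (smt (z3))
  have zh1: "s (Suc p) - carry q s (Suc (Suc p)) * q = h - 1 \<longleftrightarrow>
      s (Suc p) = h - 1 \<or> s (Suc p) = - h - 1" if "s p \<ge> h" for p
    using zcase[of "Suc p"] C[of "Suc p"] vb[of "Suc p"] h_ge bad[OF that] by (smt (z3))
  have cp: "carry q s (Suc p) = 1 \<longleftrightarrow> s p > h \<or> s p = h \<and> s (Suc p) mod q \<ge> h" for p
    using C[of p] vb[of p] h_ge by (smt (z3))
  \<comment> \<open>The choice of carries leaves a residue below \<open>h\<close> after every
    reduced digit \<open>h\<close>. So a new chain can start in state \<open>A\<close> at the value
    \<open>h\<close> only if that value was produced by an arriving carry.\<close>
  have noA: "\<not> RA m u p" if "u p - carry q s p = h" for p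
  proof
    assume "RA m u p"
    then have "u (Suc p) mod q \<ge> h" using R_imp_R0(1) by auto
    then have a: "(s (Suc p) + carry q s (Suc p)) mod q \<ge> h"
      using mod_carry_sum[of s "Suc p"] by (simp add: u_def del: carry.simps)
    from that zh zu consider "s p = h" "s (Suc p) mod q < h" | "s p = - h" "(- s (Suc p)) mod q \<ge> h"
      by metis
    then show False
    proof cases
      case 1 then show ?thesis using a C(4)[of p] by simp
    next
      case 2 then show ?thesis using a C(5)[of p] mod_pred_flip'[of "s (Suc p)"] by simp
    qed
  qed
  have RB0: "RB m s p \<Longrightarrow> s (Suc p) mod q < h" for p using R_imp_R0(2)[of m s p] by simp
  have RA0: "RA m n p \<Longrightarrow> (- s (Suc p)) mod q \<ge> h" for p using R_imp_R0(1)[of m n p] n(2)[of "Suc p"] by simp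
  have key: "(s p \<ge> h \<and> RA (Suc m) s p \<or> s p > h \<and> RB (Suc m) s p) \<longleftrightarrow>
      (u (Suc p) \<ge> h \<and> RA m u (Suc p) \<or> u (Suc p) > h \<and> RB m u (Suc p))" for p
  proof -
    let ?v = "s (Suc p)" and ?c = "carry q s (Suc p)"
    have A: "RA (Suc m) s p \<longleftrightarrow> ?v = h \<and> RB m s (Suc p) \<or> ?v = - h \<and> RA m n (Suc p)"
      "RB (Suc m) s p \<longleftrightarrow> ?v = h - 1 \<and> RA m s (Suc p) \<or> ?v = - h - 1 \<and> RB m n (Suc p)" by (auto simp: n_def)
    have B1: "u (Suc p) > h \<and> RB m u (Suc p) \<longleftrightarrow> s p \<ge> h \<and> RA (Suc m) s p"
      unfolding A using zu[of "Suc p"] z[of "Suc p"] zh[of "Suc p"] cp[of p] c[of "Suc p"] mod_q_simps(1,2)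
        I[of "Suc p"] I'[of "Suc p"] RB0[of "Suc p"] RA0[of "Suc p"] by (smt (z3))
    have B2: "u (Suc p) \<ge> h \<and> RA m u (Suc p) \<longleftrightarrow> s p > h \<and> RB (Suc m) s p"
    proof
      assume a: "u (Suc p) \<ge> h \<and> RA m u (Suc p)"
      then have "?c = 1" "u (Suc p) - ?c = h - 1"
        using noA[of "Suc p"] zu[of "Suc p"] z[of "Suc p"] c[of "Suc p"] by (smt (z3))+
      moreover from this have "?v = h - 1 \<or> ?v = - h - 1"
        using zh1[of p] cp[of p] zu[of "Suc p"] by (smt (z3))
      ultimately show "s p > h \<and> RB (Suc m) s p"
        unfolding A using a I[of "Suc p"] I'[of "Suc p"] cp[of p] mod_q_simps(3,4) by (smt (z3))
    next
      assume "s p > h \<and> RB (Suc m) s p"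
      then show "u (Suc p) \<ge> h \<and> RA m u (Suc p)"
        unfolding A using zh1[of p] cp[of p] I[of "Suc p"] I'[of "Suc p"] zu[of "Suc p"] by (smt (z3))
    qed
    show ?thesis using B1 B2 by blast
  qed
  \<comment> \<open>No carry arrives at position 0, so no new chain starts there; every other start
    is of the form \<open>Suc p\<close> and is covered by \<open>key\<close>.\<close>
  have 0: "\<not> (u 0 \<ge> h \<and> RA m u 0 \<or> u 0 > h \<and> RB m u 0)"
  proof -
    have "u 0 \<le> h" using zu[of 0] z[of 0] carry.simps(1)[of q s] by linarith
    then show ?thesis using noA[of 0] by auto
  qed
  show ?thesis unfolding chain_def u_def[symmetric] key using 0 by (metis not0_implies_Suc)
qed

lemma long_chain_Suc:
  "admissible s \<Longrightarrow> long_chain (Suc m) s \<longleftrightarrow> long_chain m (carry_sum s)"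
  using carry_sum_start[of s m] carry_sum_start[of "- s" m]
  by (simp add: long_chain_def admissible_uminus carry_sum_uminus)

lemma long_chain_0:
  assumes "admissible s"
  shows "long_chain 0 s \<longleftrightarrow> carry q s \<noteq> (\<lambda>j. 0)"
proof -
  have bd: "\<bar>s p\<bar> \<le> q" for p using assms by (auto simp: admissible_def)
  note C = carry_cases[where s = s, OF bd]
  have 1: "carry q s (Suc p) \<noteq> 0 \<longleftrightarrow> s p > h \<or> s p = h \<and> s (Suc p) mod q \<ge> h \<or>
      - s p > h \<or> - s p = h \<and> (- s (Suc p)) mod q \<ge> h" for p
    using C[of p] h_ge by (smt (z3))
  have 2: "carry q s \<noteq> (\<lambda>j. 0) \<longleftrightarrow> (\<exists>p. carry q s (Suc p) \<noteq> 0)"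
    by (metis carry.simps(1) not0_implies_Suc)
  have 3: "(h \<le> a \<and> h \<le> b \<or> h < a \<and> b < h) = (h < a \<or> a = h \<and> h \<le> b)" for a b :: int by auto
  show ?thesis unfolding 2 1 long_chain_def chain_def RA.simps RB.simps 3 uminus_apply by blast
qed

text \<open>Every step shortens the chains by one, so after \<open>k\<close> steps the chains of
  length \<open>k\<close> have become chains of length 0, and these are the nonzero carries of the
  next step.\<close>

lemma snd_von_Neumann:
  assumes "admissible (\<lambda>j. x j + y j)"
  shows "snd (von_Neumann q x y (Suc k)) \<noteq> (\<lambda>j. 0) \<longleftrightarrow> long_chain k (\<lambda>j. x j + y j)"
proof -
  let ?s = "\<lambda>j. x j + y j"
  have adm: "admissible ((carry_sum ^^ k) ?s)" for k
    by (induction k) (use assms admissible_carry_sum in auto)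
  have vS: "von_Neumann q x y (Suc k) =
      add q (\<lambda>j. fst (von_Neumann q x y k) j + snd (von_Neumann q x y k) j)" for k
    by (simp add: case_prod_beta)
  have it: "(\<lambda>j. fst (von_Neumann q x y k) j + snd (von_Neumann q x y k) j) = (carry_sum ^^ k) ?s" for k
  proof (induction k)
    case (Suc k)
    show ?case unfolding vS Suc add_def fst_conv snd_conv
      by (rule ext) (simp add: carry_sum_def[of "(carry_sum ^^ k) ?s"] del: carry.simps)
  qed simp
  have lc: "admissible s \<Longrightarrow> long_chain k s \<longleftrightarrow> long_chain 0 ((carry_sum ^^ k) s)" for s
  proof (induction k arbitrary: s)
    case (Suc k)
    show ?case
      unfolding long_chain_Suc[OF Suc.prems] Suc.IH[OF admissible_carry_sum[OF Suc.prems]] funpow_Suc_right o_apply ..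
  qed simp
  have "snd (von_Neumann q x y (Suc k)) = carry q ((carry_sum ^^ k) ?s)"
    unfolding vS it by (simp add: add_def del: carry.simps)
  then show ?thesis using long_chain_0[OF adm] lc[OF assms] by simp
qed

text \<open>A link that leaves state \<open>A\<close> has a nonzero digit and hence lies within the
  word. A link that leaves state \<open>B\<close> may have the digit \<open>h - 1\<close>, which is
  0 for q = 2; there the claim is rescued by the start lying in the word and the following link
  leaving state \<open>A\<close>.\<close>

lemma R_length:
  assumes "\<And>j. j \<ge> l \<Longrightarrow> s j = 0"
  shows "(RA m s p \<longrightarrow> m = 0 \<or> p + m \<le> l) \<and> (RB m s p \<longrightarrow> p < l \<longrightarrow> p + m \<le> l)"
  using assms
proof (induction m arbitrary: s p)
  case (Suc m)
  have *: "Suc p < l" if "s (Suc p) \<noteq> 0" using that Suc.prems[of "Suc p"] by (meson not_le)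
  have n: "(- s) j = 0" if "j \<ge> l" for j using that Suc.prems by simp
  note I = Suc.IH[of s "Suc p", OF Suc.prems] and J = Suc.IH[of "- s" "Suc p", OF n]
  show ?case
  proof (intro conjI impI)
    assume "RA (Suc m) s p"
    then have "s (Suc p) \<noteq> 0" "RB m s (Suc p) \<or> RA m (- s) (Suc p)" using h_ge by auto
    then show "Suc m = 0 \<or> p + Suc m \<le> l" using * I J by fastforce
  next
    assume "RB (Suc m) s p" and p: "p < l"
    then consider "RA m s (Suc p)" | "s (Suc p) \<noteq> 0" "RB m (- s) (Suc p)" using h_ge by auto
    then show "p + Suc m \<le> l" using p * I J by cases fastforce+
  qed
qed auto

lemma long_chain_length:
  assumes "\<And>j. j \<ge> l \<Longrightarrow> s j = 0" "long_chain m s"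
  shows "m \<le> l"
proof -
  have "m \<le> l" if z: "\<And>j. j \<ge> l \<Longrightarrow> s j = 0" and c: "chain m s" for s
  proof -
    from c obtain p where p: "s p \<ge> h \<and> RA m s p \<or> s p > h \<and> RB m s p" by (auto simp: chain_def)
    then have "s p \<noteq> 0" using h_ge by auto
    then have "p < l" using z by (meson not_le)
    then show ?thesis using p R_length[of l s m p, OF z] by auto
  qed
  from this[of s] this[of "- s"] assms show ?thesis by (auto simp: long_chain_def)
qed

section \<open>Chain lengths while the digits are read\<close>

text \<open>Primed arguments are levels of the negated sequence. The value 1 stands for a chain
  starting at the digit just read; a chain that is passed on takes precedence because it is
  longer.\<close>

definition next_A :: "int \<Rightarrow> nat \<Rightarrow> nat \<Rightarrow> nat" where
  "next_A d b a' = (if d = h - 1 \<and> b > 0 then Suc b else if d = h \<and> a' > 0 then Suc a'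
     else if d \<ge> h then 1 else 0)"

definition next_B :: "int \<Rightarrow> nat \<Rightarrow> nat \<Rightarrow> nat" where
  "next_B d a b' = (if d = h \<and> a > 0 then Suc a else if d = h + 1 \<and> b' > 0 then Suc b'
     else if d > h then 1 else 0)"

text \<open>\<open>LA s n\<close> is one more than the greatest length of a chain that is in state \<open>A\<close> after the
  digits \<open>s 0, \<dots>, s (n - 1)\<close>, and \<open>0\<close> if there is none; similarly \<open>LB\<close>.\<close>

fun LA LB :: "(nat \<Rightarrow> int) \<Rightarrow> nat \<Rightarrow> nat" where
  "LA s 0 = 0"
| "LB s 0 = 0"
| "LA s (Suc n) = next_A (s n) (LB s n) (LA (- s) n)"
| "LB s (Suc n) = next_B (s n) (LA s n) (LB (- s) n)"

definition fire :: "nat \<Rightarrow> int \<Rightarrow> nat \<Rightarrow> nat \<Rightarrow> bool" where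
  "fire M d a b \<longleftrightarrow> a \<ge> M \<and> d mod q \<ge> h \<or> b \<ge> M \<and> d mod q < h"

definition fires :: "nat \<Rightarrow> (nat \<Rightarrow> int) \<Rightarrow> nat \<Rightarrow> bool" where
  "fires M s n \<longleftrightarrow> fire M (s n) (LA s n) (LB s n) \<or> fire M (- s n) (LA (- s) n) (LB (- s) n)"

definition live :: "nat \<Rightarrow> (nat \<Rightarrow> int) \<Rightarrow> nat \<Rightarrow> bool" where
  "live M s n \<longleftrightarrow> (\<forall>i<n. \<not> fires M s i)"

lemma live_Suc: "live M s (Suc n) \<longleftrightarrow> live M s n \<and> \<not> fires M s n"
  by (auto simp: live_def less_Suc_eq)

lemma level_cong: "(\<And>i. i < n \<Longrightarrow> s i = s' i) \<Longrightarrow> LA s n = LA s' n \<and> LB s n = LB s' n"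
proof (induction n arbitrary: s s')
  case (Suc n)
  have "LA s n = LA s' n \<and> LB s n = LB s' n" "LA (- s) n = LA (- s') n \<and> LB (- s) n = LB (- s') n"
    by (rule Suc.IH, simp add: Suc.prems)+
  then show ?case using Suc.prems[of n] by simp
qed simp

lemma fires_cong: "(\<And>i. i \<le> n \<Longrightarrow> s i = s' i) \<Longrightarrow> fires M s n \<longleftrightarrow> fires M s' n"
  using level_cong[of n s s'] level_cong[of n "- s" "- s'"] by (simp add: fires_def)

lemma live_cong: "(\<And>i. i < n \<Longrightarrow> s i = s' i) \<Longrightarrow> live M s n \<longleftrightarrow> live M s' n"
  unfolding live_def using fires_cong by (metis le_less_trans)

lemma live_uminus: "live M (- s) n \<longleftrightarrow> live M s n"
  by (simp only: live_def fires_def neg_neg uminus_apply minus_minus disj_commute)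

lemma level_pos:
  "LA s (Suc n) > 0 \<Longrightarrow> s n \<ge> h - 1" "LB s (Suc n) > 0 \<Longrightarrow> s n \<ge> h"
  by (auto simp: next_A_def next_B_def split: if_splits)

lemma coexist_AB: "LB s n > 0 \<Longrightarrow> LA (- s) n = 0"
proof (rule ccontr)
  assume a: "LB s n > 0" "LA (- s) n \<noteq> 0"
  then obtain m where n: "n = Suc m" by (cases n) auto
  have "h \<le> s m" using level_pos(2)[of s m] a(1)[unfolded n] by blast
  moreover have "h - 1 \<le> (- s) m" using level_pos(1)[of "- s" m] a(2)[unfolded n] by blast
  ultimately show False using h_ge by simp
qed

lemma coexist_BB: "LB s n > 0 \<Longrightarrow> LB (- s) n = 0"
proof (rule ccontr)
  assume a: "LB s n > 0" "LB (- s) n \<noteq> 0"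
  then obtain m where n: "n = Suc m" by (cases n) auto
  have "h \<le> s m" using level_pos(2)[of s m] a(1)[unfolded n] by blast
  moreover have "h \<le> (- s) m" using level_pos(2)[of "- s" m] a(2)[unfolded n] by blast
  ultimately show False using h_ge by simp
qed

text \<open>For q = 2 the last digit may be 0, which fits both signs. Its level then comes from
  state \<open>B\<close> one digit earlier, and there the two signs exclude each other.\<close>

lemma coexist_AA: "LA s n > 0 \<Longrightarrow> LA (- s) n = 0"
proof (cases n)
  case (Suc m)
  assume a: "LA s n > 0"
  show ?thesis
  proof (rule ccontr)
    assume "LA (- s) n \<noteq> 0"
    then have p: "s m \<ge> h - 1" "- s m \<ge> h - 1" using level_pos(1)[of s m] level_pos(1)[of "- s" m] a Suc by auto
    then have "h = 1" "s m = 0" using h_ge by auto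
    then have "LB s m > 0" "LB (- s) m > 0"
      using a \<open>LA (- s) n \<noteq> 0\<close> Suc by (auto simp: next_A_def split: if_splits)
    then show False using coexist_BB by auto
  qed
qed simp

text \<open>The mirror images of \<open>RA\<close> and \<open>RB\<close>, describing a chain from
  its last digit back to its start. The levels retain only a maximal length; these predicates retain
  the chain itself.\<close>

fun TA TB :: "nat \<Rightarrow> (nat \<Rightarrow> int) \<Rightarrow> nat \<Rightarrow> bool" where
  "TA 0 s p \<longleftrightarrow> s p \<ge> h"
| "TB 0 s p \<longleftrightarrow> s p > h"
| "TA (Suc m) s p \<longleftrightarrow> (\<exists>p'. p = Suc p' \<and> (s p = h - 1 \<and> TB m s p' \<or> s p = h \<and> TA m (- s) p'))"
| "TB (Suc m) s p \<longleftrightarrow> (\<exists>p'. p = Suc p' \<and> (s p = h \<and> TA m s p' \<or> s p = h + 1 \<and> TB m (- s) p'))"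

lemma T_level: "(TA m s p \<longrightarrow> LA s (Suc p) > m) \<and> (TB m s p \<longrightarrow> LB s (Suc p) > m)"
proof (induction m arbitrary: s p)
  case 0 show ?case by (auto simp: next_A_def next_B_def)
next
  case (Suc m)
  show ?case
  proof (intro conjI impI)
    assume "TA (Suc m) s p"
    then consider p' where "p = Suc p'" "s p = h - 1" "TB m s p'" | p' where "p = Suc p'" "s p = h" "TA m (- s) p'"
      by auto
    then show "LA s (Suc p) > Suc m"
    proof cases
      case 1
      then have "LB s p > m" using Suc[of s p'] by blast
      then show ?thesis using 1(2) by (simp add: next_A_def)
    next
      case 2
      then have "LA (- s) p > m" using Suc[of "- s" p'] by blast
      then show ?thesis using 2(2) by (simp add: next_A_def)
    qed
  next
    assume "TB (Suc m) s p"
    then consider p' where "p = Suc p'" "s p = h" "TA m s p'" | p' where "p = Suc p'" "s p = h + 1" "TB m (- s) p'"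
      by auto
    then show "LB s (Suc p) > Suc m"
    proof cases
      case 1
      then have "LA s p > m" using Suc[of s p'] by blast
      then show ?thesis using 1(2) by (simp add: next_B_def)
    next
      case 2
      then have "LB (- s) p > m" using Suc[of "- s" p'] by blast
      then show ?thesis using 2(2) by (simp add: next_B_def)
    qed
  qed
qed

lemma T_Suc:
  "TA (Suc i) s (Suc p) \<longleftrightarrow> s (Suc p) = h - 1 \<and> TB i s p \<or> s (Suc p) = h \<and> TA i (- s) p"
  "TB (Suc i) s (Suc p) \<longleftrightarrow> s (Suc p) = h \<and> TA i s p \<or> s (Suc p) = h + 1 \<and> TB i (- s) p"
  "TA (Suc i) (- s) (Suc p) \<longleftrightarrow> - s (Suc p) = h - 1 \<and> TB i (- s) p \<or> - s (Suc p) = h \<and> TA i s p"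
  "TB (Suc i) (- s) (Suc p) \<longleftrightarrow> - s (Suc p) = h \<and> TA i (- s) p \<or> - s (Suc p) = h + 1 \<and> TB i s p"
  by (simp_all only: TA.simps TB.simps nat.inject ex_simps simp_thms neg_neg uminus_apply)

lemma level_T: "(LA s (Suc p) = Suc m \<longrightarrow> TA m s p) \<and> (LB s (Suc p) = Suc m \<longrightarrow> TB m s p)"
proof (induction m arbitrary: s p)
  case 0 show ?case by (auto simp: next_A_def next_B_def split: if_splits)
next
  case (Suc m)
  show ?case
  proof (cases p)
    case 0 then show ?thesis by (auto simp: next_A_def next_B_def)
  next
    case (Suc p')
    have eqs: "LA s (Suc p) = Suc (Suc m) \<longleftrightarrow> s p = h - 1 \<and> LB s p = Suc m \<or> s p = h \<and> LA (- s) p = Suc m"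
      "LB s (Suc p) = Suc (Suc m) \<longleftrightarrow> s p = h \<and> LA s p = Suc m \<or> s p = h + 1 \<and> LB (- s) p = Suc m"
      by (auto simp: next_A_def next_B_def)
    then show ?thesis using Suc.IH[of s p'] Suc.IH[of "- s" p'] unfolding Suc T_Suc(1,2) by blast
  qed
qed

text \<open>A chain cut at \<open>p\<close>: \<open>i\<close> links up to \<open>p\<close> are
  described backwards, the remaining \<open>m\<close> links forwards. Moving the cut by one link
  translates between the two directions of reading.\<close>

definition split_chain :: "nat \<Rightarrow> nat \<Rightarrow> (nat \<Rightarrow> int) \<Rightarrow> bool" where
  "split_chain m i s \<longleftrightarrow> (\<exists>p. TA i s p \<and> RA m s p \<or> TB i s p \<and> RB m s p)"

lemma split_chain_step:
  "split_chain (Suc m) i s \<Longrightarrow> split_chain m (Suc i) s \<or> split_chain m (Suc i) (- s)"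
  "split_chain m (Suc i) s \<Longrightarrow> split_chain (Suc m) i s \<or> split_chain (Suc m) i (- s)"
proof -
  have eqs: "s (Suc p) = - h \<longleftrightarrow> - s (Suc p) = h" "s (Suc p) = - h - 1 \<longleftrightarrow> - s (Suc p) = h + 1" for p
    by linarith+
  assume "split_chain (Suc m) i s"
  then obtain p where "TA i s p \<and> RA (Suc m) s p \<or> TB i s p \<and> RB (Suc m) s p"
    by (auto simp: split_chain_def)
  then have "TB (Suc i) s (Suc p) \<and> RB m s (Suc p) \<or> TA (Suc i) (- s) (Suc p) \<and> RA m (- s) (Suc p) \<or>
      TA (Suc i) s (Suc p) \<and> RA m s (Suc p) \<or> TB (Suc i) (- s) (Suc p) \<and> RB m (- s) (Suc p)"
    unfolding T_Suc(3,4) unfolding T_Suc(1,2) RA.simps(2) RB.simps(2) eqs by blast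
  then show "split_chain m (Suc i) s \<or> split_chain m (Suc i) (- s)" unfolding split_chain_def by blast
next
  have eqs: "(- s) (Suc p) = - h \<longleftrightarrow> s (Suc p) = h" "(- s) (Suc p) = - h - 1 \<longleftrightarrow> s (Suc p) = h + 1" for p
    by auto
  assume "split_chain m (Suc i) s"
  then obtain p where p: "TA (Suc i) s p \<and> RA m s p \<or> TB (Suc i) s p \<and> RB m s p"
    by (auto simp: split_chain_def)
  then obtain p' where p': "p = Suc p'" by (cases p) auto
  from p have "TA i s p' \<and> RA (Suc m) s p' \<or> TB i s p' \<and> RB (Suc m) s p' \<or>
      TA i (- s) p' \<and> RA (Suc m) (- s) p' \<or> TB i (- s) p' \<and> RB (Suc m) (- s) p'"
    unfolding p' T_Suc RA.simps(2) RB.simps(2) eqs neg_neg by blast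
  then show "split_chain (Suc m) i s \<or> split_chain (Suc m) i (- s)" unfolding split_chain_def by blast
qed

lemma long_chain_mono: "long_chain m s \<Longrightarrow> k \<le> m \<Longrightarrow> long_chain k s"
  by (induction m) (auto simp: le_Suc_eq dest: long_chain_antimono)

lemma long_chain_split: "long_chain m s \<longleftrightarrow> split_chain 0 m s \<or> split_chain 0 m (- s)"
proof -
  have "split_chain m i s \<or> split_chain m i (- s) \<longleftrightarrow> split_chain 0 (i + m) s \<or> split_chain 0 (i + m) (- s)" for i
  proof (induction m arbitrary: i)
    case (Suc m)
    have "split_chain (Suc m) i s \<or> split_chain (Suc m) i (- s) \<longleftrightarrow>
        split_chain m (Suc i) s \<or> split_chain m (Suc i) (- s)"
      using split_chain_step[of m i s] split_chain_step[of m i "- s"] unfolding neg_neg by blast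
    moreover have "Suc i + m = i + Suc m" by simp
    ultimately show ?case using Suc[of "Suc i"] by metis
  qed simp
  from this[of 0] show ?thesis by (simp add: long_chain_def chain_def split_chain_def)
qed

text \<open>Moving the cut to the far end leaves only the residue condition to be read, which is
  \<open>fire\<close>. Levels start at 1, hence \<open>Suc m\<close>. Conversely, firing at a higher
  level yields a longer chain, which contains one of length \<open>m\<close>.\<close>

lemma long_chain_fires: "long_chain m s \<longleftrightarrow> (\<exists>n. fires (Suc m) s n)"
proof
  have *: "\<exists>n. fires (Suc m) s n" if "split_chain 0 m s" for s
  proof -
    from that obtain p where "TA m s p \<and> RA 0 s p \<or> TB m s p \<and> RB 0 s p" by (auto simp: split_chain_def)
    then have "fire (Suc m) (s (Suc p)) (LA s (Suc p)) (LB s (Suc p))"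
      unfolding fire_def RA.simps(1) RB.simps(1) using T_level[of m s p] by (meson Suc_leI)
    then have "fires (Suc m) s (Suc p)" unfolding fires_def by blast
    then show ?thesis ..
  qed
  have **: "fires (Suc m) (- s) n \<longleftrightarrow> fires (Suc m) s n" for n
    by (simp only: fires_def neg_neg uminus_apply minus_minus disj_commute)
  assume "long_chain m s"
  then show "\<exists>n. fires (Suc m) s n" unfolding long_chain_split using *[of s] *[of "- s"] ** by blast
next
  have *: "split_chain 0 m s \<or> split_chain 0 m (- s)"
    if f: "fire (Suc m) (s n) (LA s n) (LB s n)" for s n
  proof (cases n)
    case 0 then show ?thesis using f by (simp add: fire_def)
  next
    case (Suc p)
    have "\<exists>i\<ge>m. split_chain 0 i s"
    proof (cases "LA s (Suc p) \<ge> Suc m \<and> s (Suc p) mod q \<ge> h")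
      case True
      then obtain i where "LA s (Suc p) = Suc i" "i \<ge> m" by (metis Suc_le_D Suc_le_mono)
      then show ?thesis using True level_T[of s p i] unfolding split_chain_def RA.simps(1) by blast
    next
      case False
      then have F: "LB s (Suc p) \<ge> Suc m" "s (Suc p) mod q < h" using f unfolding fire_def Suc by blast+
      then obtain i where "LB s (Suc p) = Suc i" "i \<ge> m" by (metis Suc_le_D Suc_le_mono)
      then show ?thesis using F level_T[of s p i] unfolding split_chain_def RB.simps(1) by blast
    qed
    then show ?thesis using long_chain_mono long_chain_split by blast
  qed
  assume "\<exists>n. fires (Suc m) s n"
  then show "long_chain m s" unfolding fires_def long_chain_split using *[of s] *[of "- s"]
    unfolding uminus_apply neg_neg by blast
qed

text \<open>Zeros beyond the word end all chains, except that for q = 2 the digit 0 equals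
  \<open>h - 1\<close> and turns state \<open>B\<close> into state \<open>A\<close> once more.
  Firing needs one further digit, so reading two padding zeros decides everything; this is the
  origin of \<open>l + 2\<close>.\<close>

lemma level_beyond:
  assumes "\<And>j. j \<ge> l \<Longrightarrow> s j = 0"
  shows "LB s n > 0 \<Longrightarrow> n \<le> l" "LA s n > 0 \<Longrightarrow> n \<le> Suc l"
proof -
  have B: "n \<le> l" if z: "\<And>j. j \<ge> l \<Longrightarrow> s j = 0" and "LB s n > 0" for s n
  proof (cases n)
    case (Suc m)
    then have "s m \<noteq> 0" using level_pos(2)[of s m] that(2) h_ge by auto
    then show ?thesis using z[of m] Suc by (meson not_less_eq_eq)
  qed simp
  show "LB s n > 0 \<Longrightarrow> n \<le> l" using B assms by blast
  show "LA s n > 0 \<Longrightarrow> n \<le> Suc l"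
  proof (cases n)
    case (Suc m)
    assume "LA s n > 0"
    then have "s m \<ge> h \<or> LB s m > 0" using Suc by (auto simp: next_A_def split: if_splits)
    then have "m \<le> l" using B[of s m, OF assms] assms[of m] h_ge by force
    then show ?thesis using Suc by simp
  qed simp
qed

lemma fires_beyond:
  assumes "\<And>j. j \<ge> l \<Longrightarrow> s j = 0" "fires M s n" "M > 0"
  shows "n < l + 2"
proof -
  have n: "\<And>j. j \<ge> l \<Longrightarrow> (- s) j = 0" using assms by simp
  show ?thesis using assms(2,3) level_beyond[of l s n, OF assms(1)] level_beyond[of l "- s" n, OF n]
    by (fastforce simp: fires_def fire_def)
qed

section \<open>The digit sum of two expansions and the number of iterations\<close>

lemma SSDE_D:
  assumes "x \<in> SSDE q l"
  shows "j \<ge> l \<Longrightarrow> x j = 0" "\<bar>x j\<bar> \<le> h"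
    "x j = h \<Longrightarrow> 0 \<le> x (Suc j) \<and> x (Suc j) \<le> h - 1"
    "x j = - h \<Longrightarrow> 1 - h \<le> x (Suc j) \<and> x (Suc j) \<le> 0"
proof -
  have A: "\<And>j. j \<ge> l \<Longrightarrow> x j = 0" "\<And>j. j < l \<Longrightarrow> - h \<le> x j \<and> x j \<le> h"
    "\<And>j. Suc j < l \<Longrightarrow> \<bar>x j\<bar> = h \<Longrightarrow> 0 \<le> sgn (x j) * x (Suc j) \<and> sgn (x j) * x (Suc j) \<le> h - 1"
    using assms unfolding SSDE_def h_def by blast+
  show "j \<ge> l \<Longrightarrow> x j = 0" using A by blast
  show "\<bar>x j\<bar> \<le> h" using A(1)[of j] A(2)[of j] h_ge by (cases "j < l") auto
  show "x j = h \<Longrightarrow> 0 \<le> x (Suc j) \<and> x (Suc j) \<le> h - 1"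
    using A(1)[of j] A(1)[of "Suc j"] A(3)[of j] h_ge by (cases "Suc j < l") auto
  show "x j = - h \<Longrightarrow> 1 - h \<le> x (Suc j) \<and> x (Suc j) \<le> 0"
    using A(1)[of j] A(1)[of "Suc j"] A(3)[of j] h_ge by (cases "Suc j < l") auto
qed

definition dsum :: "(nat \<Rightarrow> int) \<Rightarrow> (nat \<Rightarrow> int) \<Rightarrow> nat \<Rightarrow> int" where
  "dsum x y = (\<lambda>j. x j + y j)"

lemma admissible_dsum:
  assumes "x \<in> SSDE q l" "y \<in> SSDE q l"
  shows "admissible (dsum x y)"
proof -
  note X = SSDE_D[OF assms(1)] and Y = SSDE_D[OF assms(2)]
  have "\<bar>x p + y p\<bar> \<le> q" for p using X(2)[of p] Y(2)[of p] q_eq by linarith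
  moreover have "x p + y p \<ge> 1 \<Longrightarrow> x (Suc p) + y (Suc p) \<noteq> 2" "x p + y p \<le> - 1 \<Longrightarrow> x (Suc p) + y (Suc p) \<noteq> - 2"
    if "q = 2" for p
  proof -
    have h: "h = 1" using that q_eq by simp
    note XY = X(2)[of "p"] Y(2)[of "p"] X(2)[of "Suc p"] Y(2)[of "Suc p"] X(3,4)[of p] Y(3,4)[of p]
    show "x p + y p \<ge> 1 \<Longrightarrow> x (Suc p) + y (Suc p) \<noteq> 2" using XY unfolding h by (smt (z3))
    show "x p + y p \<le> - 1 \<Longrightarrow> x (Suc p) + y (Suc p) \<noteq> - 2" using XY unfolding h by (smt (z3))
  qed
  ultimately show ?thesis unfolding admissible_def dsum_def by blast
qed

lemma iterations_le_iff_aux: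
  assumes "x \<in> SSDE q l" "y \<in> SSDE q l"
  shows "iterations q (x, y) \<le> Suc m \<longleftrightarrow> \<not> long_chain m (dsum x y)" "iterations q (x, y) \<le> l + 2"
proof -
  define c where "c k = snd (von_Neumann q x y k)" for k
  have adm: "admissible (dsum x y)" using admissible_dsum assms by blast
  have cS: "c (Suc k) \<noteq> (\<lambda>j. 0) \<longleftrightarrow> long_chain k (dsum x y)" for k
    using snd_von_Neumann[of x y k] adm by (simp add: c_def dsum_def)
  have z: "dsum x y j = 0" if "j \<ge> l" for j using that SSDE_D(1)[OF assms(1)] SSDE_D(1)[OF assms(2)] by (simp add: dsum_def)
  have cl: "c (Suc (Suc l)) = (\<lambda>j. 0)" using cS[of "Suc l"] long_chain_length[of l "dsum x y", OF z] by fastforce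
  have t: "iterations q (x, y) = (LEAST k. c k = (\<lambda>j. 0))" by (simp add: iterations_def c_def)
  show "iterations q (x, y) \<le> l + 2" unfolding t by (rule Least_le) (simp add: cl)
  show "iterations q (x, y) \<le> Suc m \<longleftrightarrow> \<not> long_chain m (dsum x y)"
  proof
    assume "\<not> long_chain m (dsum x y)"
    then show "iterations q (x, y) \<le> Suc m" unfolding t using cS by (intro Least_le) auto
  next
    assume a: "iterations q (x, y) \<le> Suc m"
    define k where "k = (LEAST k. c k = (\<lambda>j. 0))"
    have ck: "c k = (\<lambda>j. 0)" unfolding k_def by (rule LeastI[of "\<lambda>k. c k = (\<lambda>j. 0)"], rule cl)
    show "\<not> long_chain m (dsum x y)"
    proof (cases k)
      \<comment> \<open>The least index 0 only says that the second operand vanishes. That the first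
        one causes no carry on its own follows from the syntactical rule for expansions.\<close>
      case 0
      then have y: "y = (\<lambda>j. 0)" using ck by (simp add: c_def)
      have n: "carry q x (Suc j) = 0" for j
      proof -
        note X = SSDE_D(2-4)[OF assms(1), of j]
        have b: "\<bar>x j\<bar> \<le> q" using X(1) q_eq h_ge by linarith
        note C = carry_cases[where s = x and p = j, OF b]
        have "x j = h \<Longrightarrow> x (Suc j) mod q = x (Suc j)" using X(2) q_eq by simp
        moreover have "x j = - h \<Longrightarrow> (- x (Suc j)) mod q = - x (Suc j)" using X(3) q_eq by (intro mod_pos_pos_trivial) auto
        ultimately show ?thesis using C X by (smt (z3))
      qed
      have "carry q x = (\<lambda>j. 0)"
      proof
        fix j show "carry q x j = 0" using n by (cases j) auto
      qed
      then have "\<not> long_chain 0 (dsum x y)" using long_chain_0[OF adm] y by (simp add: dsum_def)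
      then show ?thesis using long_chain_mono by blast
    next
      case (Suc k')
      then have "\<not> long_chain k' (dsum x y)" using cS[of k'] ck by auto
      moreover have "k' \<le> m" using a Suc by (simp add: t k_def[symmetric])
      ultimately show ?thesis using long_chain_mono by blast
    qed
  qed
qed

lemma iterations_le_iff:
  assumes "x \<in> SSDE q l" "y \<in> SSDE q l" "M > 0"
  shows "iterations q (x, y) \<le> M \<longleftrightarrow> live M (dsum x y) (l + 2)"
proof -
  have z: "dsum x y j = 0" if "j \<ge> l" for j
    using that SSDE_D(1)[OF assms(1)] SSDE_D(1)[OF assms(2)] by (simp add: dsum_def)
  show ?thesis using iterations_le_iff_aux(1)[OF assms(1,2), of "M - 1"] assms(3)
    fires_beyond[of l "dsum x y" M, OF z] long_chain_fires[of "M - 1" "dsum x y"]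
    by (auto simp: live_def)
qed

section \<open>Sums over the next pair of digits\<close>

text \<open>\<open>nx p\<close> is the set of digits allowed to the left of \<open>p\<close>. Weights of a pair of last digits depend
  only on how many of the two are \<open>\<plusminus> h\<close>, which is the case distinction in \<open>cl\<close>; \<open>cl4\<close> also
  distinguishes equal from opposite extreme digits.\<close>

definition nx :: "int \<Rightarrow> int set" where
  "nx p = (if p = h then {0..h - 1} else if p = - h then {1 - h..0} else {- h..h})"

abbreviation H :: real where "H \<equiv> real_of_int h"

definition cl :: "real \<Rightarrow> real \<Rightarrow> real \<Rightarrow> int \<Rightarrow> int \<Rightarrow> real" where
  "cl c0 c1 c2 d e = (if \<bar>d\<bar> = h \<and> \<bar>e\<bar> = h then c2 else if \<bar>d\<bar> = h \<or> \<bar>e\<bar> = h then c1 else c0)"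

definition ext_sum :: "int \<Rightarrow> int \<Rightarrow> (int \<Rightarrow> int \<Rightarrow> real) \<Rightarrow> real" where
  "ext_sum p r g = (\<Sum>d\<in>nx p. \<Sum>e\<in>nx r. g d e)"

lemma finite_nx [simp]: "finite (nx p)"
  by (simp add: nx_def)

lemma nx_bound: "d \<in> nx p \<Longrightarrow> \<bar>d\<bar> \<le> h"
  by (auto simp: nx_def split: if_splits)

lemma ext_sum_swap: "ext_sum p r g = ext_sum r p (\<lambda>d e. g e d)"
  unfolding ext_sum_def by (rule sum.swap)

lemma nx_uminus: "nx (- p) = uminus ` nx p"
proof -
  have "uminus ` {a..b} = {- b..- a}" for a b :: int
    by (auto intro!: image_eqI[of _ uminus "- _"])
  then show ?thesis using h_ge by (auto simp: nx_def)
qed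

lemma sum_nx_uminus: "(\<Sum>d\<in>nx (- p). g d) = (\<Sum>d\<in>nx p. g (- d))"
  unfolding nx_uminus by (subst sum.reindex) auto

lemma ext_sum_uminus: "ext_sum (- p) (- r) g = ext_sum p r (\<lambda>d e. g (- d) (- e))"
  unfolding ext_sum_def by (simp add: sum_nx_uminus)

lemma cl_uminus: "cl c0 c1 c2 (- d) (- e) = cl c0 c1 c2 d e"
  by (simp add: cl_def)

lemma cl_swap: "cl c0 c1 c2 d e = cl c0 c1 c2 e d"
  by (auto simp: cl_def)

lemma ext_sum_delta:
  "ext_sum p r (\<lambda>d e. if d + e = T then g d e else 0) = (\<Sum>d\<in>{d \<in> nx p. T - d \<in> nx r}. g d (T - d))"
proof -
  have "(\<Sum>e\<in>nx r. if d + e = T then g d e else 0) = (if T - d \<in> nx r then g d (T - d) else 0)" for d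
  proof -
    have "(d + e = T) = (e = T - d)" for e by auto
    then show ?thesis by (simp add: sum.delta)
  qed
  then show ?thesis unfolding ext_sum_def by (simp add: sum.inter_filter)
qed

lemma sum_eq_const:
  fixes a b :: int
  assumes "\<And>d. a \<le> d \<Longrightarrow> d \<le> b \<Longrightarrow> g d = (c :: real)" "a \<le> b + 1"
  shows "(\<Sum>d\<in>{a..b}. g d) = of_int (b + 1 - a) * c"
  using assms(2) by (subst sum.cong[OF refl, of _ _ "\<lambda>_. c"]) (auto simp: assms(1))

text \<open>An open chain in state \<open>A\<close> forces a digit sum of at least
  \<open>h - 1\<close>. Two extreme digits of opposite sign reach this only for q = 2, which gives
  the last two cases.\<close>

lemma digit_cases:
  assumes "\<bar>p\<bar> \<le> h" "\<bar>r\<bar> \<le> h" "p + r \<ge> h - 1"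
  obtains "\<bar>p\<bar> < h" "\<bar>r\<bar> < h" | "p = h" "\<bar>r\<bar> < h" | "\<bar>p\<bar> < h" "r = h" | "p = h" "r = h"
  | "h = 1" "p = - 1" "r = 1" | "h = 1" "p = 1" "r = - 1"
  using assms h_ge by linarith

lemma nx_free: "\<bar>p\<bar> < h \<Longrightarrow> nx p = {- h..h}"
  by (auto simp: nx_def)

lemma nx_ext: "nx h = {0..h - 1}" "nx (- h) = {1 - h..0}"
  using h_ge by (auto simp: nx_def)

text \<open>The inner solutions 1, ..., h - 1 are always available; each of the solutions 0 + h and
  h + 0 requires that the operand receiving \<open>h\<close> may have an extreme digit. Thus
  functions of the class of the last digits are mapped to such functions.\<close>

lemma ext_sum_h:
  assumes "\<bar>p\<bar> \<le> h" "\<bar>r\<bar> \<le> h" "p + r \<ge> h - 1"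
  shows "ext_sum p r (\<lambda>d e. if d + e = h then cl c0 c1 c2 d e else 0) =
    cl ((H - 1) * c0 + 2 * c1) ((H - 1) * c0 + c1) ((H - 1) * c0) p r"
  using assms
proof (cases rule: digit_cases)
  case 1
  have "{d \<in> nx p. h - d \<in> nx r} = insert 0 (insert h {1..h - 1})"
    using 1 h_ge by (auto simp: nx_free)
  moreover have "(\<Sum>d\<in>{1..h - 1}. cl c0 c1 c2 d (h - d)) = of_int (h - 1 + 1 - 1) * c0"
    by (rule sum_eq_const) (use h_ge in \<open>auto simp: cl_def\<close>)
  ultimately show ?thesis using 1 h_ge unfolding ext_sum_delta by (simp add: cl_def)
next
  case 2
  have "{d \<in> nx p. h - d \<in> nx r} = insert 0 {1..h - 1}"
    using 2 h_ge by (auto simp: nx_free nx_ext)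
  moreover have "(\<Sum>d\<in>{1..h - 1}. cl c0 c1 c2 d (h - d)) = of_int (h - 1 + 1 - 1) * c0"
    by (rule sum_eq_const) (use h_ge in \<open>auto simp: cl_def\<close>)
  ultimately show ?thesis using 2 h_ge unfolding ext_sum_delta by (simp add: cl_def)
next
  case 3
  have "{d \<in> nx p. h - d \<in> nx r} = insert h {1..h - 1}"
    using 3 h_ge by (auto simp: nx_free nx_ext)
  moreover have "(\<Sum>d\<in>{1..h - 1}. cl c0 c1 c2 d (h - d)) = of_int (h - 1 + 1 - 1) * c0"
    by (rule sum_eq_const) (use h_ge in \<open>auto simp: cl_def\<close>)
  ultimately show ?thesis using 3 h_ge unfolding ext_sum_delta by (simp add: cl_def)
next
  case 4
  have "{d \<in> nx p. h - d \<in> nx r} = {1..h - 1}"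
    using 4 h_ge by (auto simp: nx_ext)
  moreover have "(\<Sum>d\<in>{1..h - 1}. cl c0 c1 c2 d (h - d)) = of_int (h - 1 + 1 - 1) * c0"
    by (rule sum_eq_const) (use h_ge in \<open>auto simp: cl_def\<close>)
  ultimately show ?thesis using 4 h_ge unfolding ext_sum_delta by (simp add: cl_def)
next
  case 5
  then have E: "{d \<in> nx p. h - d \<in> nx r} = {}" by (auto simp: nx_def)
  show ?thesis unfolding ext_sum_delta E using 5 h_ge by (simp add: cl_def)
next
  case 6
  then have E: "{d \<in> nx p. h - d \<in> nx r} = {}" by (auto simp: nx_def)
  show ?thesis unfolding ext_sum_delta E using 6 h_ge by (simp add: cl_def)
qed

lemma ext_sum_minus_h:
  assumes "\<bar>p\<bar> \<le> h" "\<bar>r\<bar> \<le> h" "p + r \<ge> h - 1"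
  shows "ext_sum p r (\<lambda>d e. if d + e = - h then cl c0 c1 c2 d e else 0) =
    cl ((H - 1) * c0 + 2 * c1) c1 0 p r"
  using assms
proof (cases rule: digit_cases)
  case 1
  have "{d \<in> nx p. - h - d \<in> nx r} = insert 0 (insert (- h) {1 - h..- 1})"
    using 1 h_ge by (auto simp: nx_free)
  moreover have "(\<Sum>d\<in>{1 - h..- 1}. cl c0 c1 c2 d (- h - d)) = of_int (- 1 + 1 - (1 - h)) * c0"
    by (rule sum_eq_const) (use h_ge in \<open>auto simp: cl_def\<close>)
  ultimately show ?thesis using 1 h_ge unfolding ext_sum_delta by (simp add: cl_def)
next
  case 2
  have "{d \<in> nx p. - h - d \<in> nx r} = {0}"
    using 2 h_ge by (auto simp: nx_free nx_ext)
  then show ?thesis using 2 h_ge unfolding ext_sum_delta by (simp add: cl_def)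
next
  case 3
  have "{d \<in> nx p. - h - d \<in> nx r} = {- h}"
    using 3 h_ge by (auto simp: nx_free nx_ext)
  then show ?thesis using 3 h_ge unfolding ext_sum_delta by (simp add: cl_def)
next
  case 4
  have E: "{d \<in> nx p. - h - d \<in> nx r} = {}"
    using 4 h_ge by (auto simp: nx_ext)
  show ?thesis unfolding ext_sum_delta E using 4 h_ge by (simp add: cl_def)
next
  case 5
  then have E: "{d \<in> nx p. - h - d \<in> nx r} = {}" by (auto simp: nx_def)
  show ?thesis unfolding ext_sum_delta E using 5 h_ge by (simp add: cl_def)
next
  case 6
  then have E: "{d \<in> nx p. - h - d \<in> nx r} = {}" by (auto simp: nx_def)
  show ?thesis unfolding ext_sum_delta E using 6 h_ge by (simp add: cl_def)
qed

lemma digit_cases':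
  assumes "\<bar>p\<bar> \<le> h" "\<bar>r\<bar> \<le> h" "p + r \<ge> h"
  obtains "\<bar>p\<bar> < h" "\<bar>r\<bar> < h" "h \<ge> 2" | "p = h" "\<bar>r\<bar> < h" | "\<bar>p\<bar> < h" "r = h" | "p = h" "r = h"
  using assms h_ge by linarith

lemma ext_sum_h_minus_1:
  assumes "\<bar>p\<bar> \<le> h" "\<bar>r\<bar> \<le> h" "p + r \<ge> h"
  shows "ext_sum p r (\<lambda>d e. if d + e = h - 1 then cl c0 c1 c2 d e else 0) =
    cl (H * c0 + 2 * c1) (H * c0) (H * c0) p r"
proof -
  have S: "(\<Sum>d\<in>{0..h - 1}. cl c0 c1 c2 d (h - 1 - d)) = of_int (h - 1 + 1 - 0) * c0"
    by (rule sum_eq_const) (use h_ge in \<open>auto simp: cl_def\<close>)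
  show ?thesis using assms
  proof (cases rule: digit_cases')
    case 1
    have "{d \<in> nx p. h - 1 - d \<in> nx r} = insert (- 1) (insert h {0..h - 1})"
      using 1 h_ge by (auto simp: nx_free)
    then show ?thesis using 1 S unfolding ext_sum_delta by (simp add: cl_def)
  next
    case 2
    have "{d \<in> nx p. h - 1 - d \<in> nx r} = {0..h - 1}"
      using 2 h_ge by (auto simp: nx_free nx_ext)
    then show ?thesis using 2 S unfolding ext_sum_delta by (simp add: cl_def)
  next
    case 3
    have "{d \<in> nx p. h - 1 - d \<in> nx r} = {0..h - 1}"
      using 3 h_ge by (auto simp: nx_free nx_ext)
    then show ?thesis using 3 S unfolding ext_sum_delta by (simp add: cl_def)
  next
    case 4
    have "{d \<in> nx p. h - 1 - d \<in> nx r} = {0..h - 1}"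
      using 4 h_ge by (auto simp: nx_ext)
    then show ?thesis using 4 S h_ge unfolding ext_sum_delta by (simp add: cl_def)
  qed
qed

lemma ext_sum_minus_h_minus_1:
  assumes "\<bar>p\<bar> \<le> h" "\<bar>r\<bar> \<le> h" "p + r \<ge> h"
  shows "ext_sum p r (\<lambda>d e. if d + e = - h - 1 then cl c0 c1 c2 d e else 0) =
    cl ((H - 2) * c0 + 2 * c1) 0 0 p r"
  using assms
proof (cases rule: digit_cases')
  case 1
  have "{d \<in> nx p. - h - 1 - d \<in> nx r} = insert (- 1) (insert (- h) {1 - h..- 2})"
    using 1 h_ge by (auto simp: nx_free)
  moreover have "(\<Sum>d\<in>{1 - h..- 2}. cl c0 c1 c2 d (- h - 1 - d)) = of_int (- 2 + 1 - (1 - h)) * c0"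
    by (rule sum_eq_const) (use 1 in \<open>auto simp: cl_def\<close>)
  ultimately show ?thesis using 1 h_ge unfolding ext_sum_delta by (simp add: cl_def)
next
  case 2
  have E: "{d \<in> nx p. - h - 1 - d \<in> nx r} = {}"
    using 2 h_ge by (auto simp: nx_free nx_ext)
  show ?thesis unfolding ext_sum_delta E using 2 h_ge by (simp add: cl_def)
next
  case 3
  have E: "{d \<in> nx p. - h - 1 - d \<in> nx r} = {}"
    using 3 h_ge by (auto simp: nx_free nx_ext)
  show ?thesis unfolding ext_sum_delta E using 3 h_ge by (simp add: cl_def)
next
  case 4
  have E: "{d \<in> nx p. - h - 1 - d \<in> nx r} = {}"
    using 4 h_ge by (auto simp: nx_ext)
  show ?thesis unfolding ext_sum_delta E using 4 h_ge by (simp add: cl_def)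
qed

lemma sum_full: "(\<Sum>d\<in>{- h..h}. g d) = g (- h) + g h + (\<Sum>d\<in>{1 - h..h - 1}. g d :: real)"
proof -
  have "{- h..h} = insert (- h) (insert h {1 - h..h - 1})" using h_ge by auto
  then show ?thesis using h_ge by simp
qed

definition cl4 :: "real \<Rightarrow> real \<Rightarrow> real \<Rightarrow> real \<Rightarrow> int \<Rightarrow> int \<Rightarrow> real" where
  "cl4 c0 c1 cs co d e = (if \<bar>d\<bar> = h \<and> \<bar>e\<bar> = h then (if d = e then cs else co)
     else if \<bar>d\<bar> = h \<or> \<bar>e\<bar> = h then c1 else c0)"

lemma cl_cl4: "cl c0 c1 c2 = cl4 c0 c1 c2 c2"
  by (auto simp: cl_def cl4_def fun_eq_iff)

text \<open>The operands grow independently: a free digit is followed by \<open>2 * H - 1\<close>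
  free and two extreme digits, an extreme digit by \<open>H\<close> free ones only. The formula is
  the tensor square of this two by two matrix.\<close>

lemma ext_sum_cl4:
  assumes "\<bar>p\<bar> \<le> h" "\<bar>r\<bar> \<le> h"
  shows "ext_sum p r (cl4 c0 c1 cs co) =
    cl ((2 * H - 1)\<^sup>2 * c0 + 4 * (2 * H - 1) * c1 + 2 * cs + 2 * co)
       (H * (2 * H - 1) * c0 + 2 * H * c1) (H\<^sup>2 * c0) p r"
proof -
  let ?I = "{1 - h..h - 1}"
  have I0: "(\<Sum>e\<in>?I. cl4 c0 c1 cs co d e) = (2 * H - 1) * (if \<bar>d\<bar> = h then c1 else c0)" for d
    by (subst sum_eq_const[where c = "if \<bar>d\<bar> = h then c1 else c0"]) (use h_ge in \<open>auto simp: cl4_def\<close>)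
  have full: "(\<Sum>e\<in>{- h..h}. cl4 c0 c1 cs co d e) =
      (if \<bar>d\<bar> = h then cs + co + (2 * H - 1) * c1 else 2 * c1 + (2 * H - 1) * c0)" for d
    unfolding sum_full I0 using h_ge by (auto simp: cl4_def)
  have half: "(\<Sum>e\<in>nx p. cl4 c0 c1 cs co d e) = H * (if \<bar>d\<bar> = h then c1 else c0)" if "p = h \<or> p = - h" for p d
  proof -
    have "(\<Sum>e\<in>{0..h - 1}. cl4 c0 c1 cs co d e) = of_int (h - 1 + 1 - 0) * (if \<bar>d\<bar> = h then c1 else c0)"
      "(\<Sum>e\<in>{1 - h..0}. cl4 c0 c1 cs co d e) = of_int (0 + 1 - (1 - h)) * (if \<bar>d\<bar> = h then c1 else c0)"
      by (rule sum_eq_const; use h_ge in \<open>auto simp: cl4_def\<close>)+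
    then show ?thesis using that by (auto simp: nx_ext)
  qed
  have halfc: "(\<Sum>d\<in>nx p. (if \<bar>d\<bar> = h then a else b)) = H * b" if "p = h \<or> p = - h" for p and a b :: real
  proof -
    have "(\<Sum>e\<in>{0..h - 1}. if \<bar>e\<bar> = h then a else b) = of_int (h - 1 + 1 - 0) * b"
      "(\<Sum>e\<in>{1 - h..0}. if \<bar>e\<bar> = h then a else b) = of_int (0 + 1 - (1 - h)) * b"
      by (rule sum_eq_const; use h_ge in auto)+
    then show ?thesis using that by (auto simp: nx_ext)
  qed
  have fullc: "(\<Sum>d\<in>{- h..h}. (if \<bar>d\<bar> = h then a else b)) = 2 * a + (2 * H - 1) * b" for a b :: real
    unfolding sum_full by (subst sum_eq_const[where c = b]) (use h_ge in auto)
  consider "\<bar>p\<bar> < h" "\<bar>r\<bar> < h" | "p = h \<or> p = - h" "\<bar>r\<bar> < h" | "\<bar>p\<bar> < h" "r = h \<or> r = - h"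
    | "p = h \<or> p = - h" "r = h \<or> r = - h"
    using assms by linarith
  then show ?thesis
  proof cases
    case 1
    then show ?thesis unfolding ext_sum_def nx_free[OF 1(1)] nx_free[OF 1(2)] full fullc
      by (simp add: cl_def power2_eq_square algebra_simps)
  next
    case 2
    then show ?thesis unfolding ext_sum_def nx_free[OF 2(2)] full halfc[OF 2(1)]
      using h_ge by (auto simp: cl_def power2_eq_square algebra_simps)
  next
    case 3
    then show ?thesis unfolding ext_sum_def nx_free[OF 3(1)] half[OF 3(2)] sum_distrib_left[symmetric] fullc
      using h_ge by (auto simp: cl_def power2_eq_square algebra_simps)
  next
    case 4
    then show ?thesis unfolding ext_sum_def half[OF 4(2)] sum_distrib_left[symmetric] halfc[OF 4(1)]
      using h_ge by (auto simp: cl_def power2_eq_square algebra_simps)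
  qed
qed

text \<open>The tensor square of the vector with value 2 at free and 1 at extreme digits, the
  eigenvector of the one-digit matrix for its dominant eigenvalue \<open>2 * H\<close>. It measures
  how many continuations a word has in the long run.\<close>

lemma ext_sum_vv:
  assumes "\<bar>p\<bar> \<le> h" "\<bar>r\<bar> \<le> h"
  shows "ext_sum p r (cl 4 2 1) = 4 * H\<^sup>2 * cl 4 2 1 p r"
  unfolding cl_cl4[of 4 2 1] ext_sum_cl4[OF assms]
  by (auto simp: cl_def cl4_def power2_eq_square algebra_simps)

lemma sum_int_upto: "n \<ge> 0 \<Longrightarrow> (\<Sum>d\<in>{1..n}. real_of_int d) = of_int n * (of_int n + 1) / 2"
proof (induction n rule: int_ge_induct)
  case (step i)
  have "{1..i + 1} = insert (i + 1) {1..i}" using step by auto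
  then show ?case using step by (simp add: field_simps)
qed simp

text \<open>Only positive \<open>d\<close> contribute, and such a \<open>d\<close> has exactly
  \<open>d\<close> partners in the range, or \<open>d - 1\<close> under the strict
  inequality.\<close>

lemma sum_ge_core:
  assumes "{1..h - 1} \<subseteq> A" "A \<subseteq> {1 - h..h - 1}" "{1..h - 1} \<subseteq> B" "B \<subseteq> {1 - h..h - 1}"
  shows "(\<Sum>d\<in>A. \<Sum>e\<in>B. if d + e \<ge> h then c else 0) = H * (H - 1) / 2 * c"
    "(\<Sum>d\<in>A. \<Sum>e\<in>B. if d + e > h then c else 0) = (H - 1) * (H - 2) / 2 * c"
proof -
  have fin: "finite A" "finite B" using assms finite_subset by blast+
  have AB: "\<And>d. d \<in> A \<Longrightarrow> 1 - h \<le> d \<and> d \<le> h - 1" "\<And>d. d \<in> B \<Longrightarrow> 1 - h \<le> d \<and> d \<le> h - 1"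
    "\<And>d. 1 \<le> d \<Longrightarrow> d \<le> h - 1 \<Longrightarrow> d \<in> B"
    using assms by (meson atLeastAtMost_iff subsetD)+
  have 1: "(\<Sum>e\<in>B. if d + e \<ge> h then c else 0) = (if d \<ge> 1 then of_int d * c else 0)" if "d \<in> A" for d
  proof -
    have "{e \<in> B. d + e \<ge> h} = (if d \<ge> 1 then {h - d..h - 1} else {})"
      using AB(1)[OF that] by (auto intro: AB(3) dest!: AB(2))
    then show ?thesis using fin by (simp add: sum.inter_filter[symmetric])
  qed
  have 2: "(\<Sum>e\<in>B. if d + e > h then c else 0) = (if d \<ge> 1 then of_int d * c - c else 0)" if "d \<in> A" for d
  proof -
    have "{e \<in> B. d + e > h} = (if d \<ge> 1 then {h - d + 1..h - 1} else {})"
      using AB(1)[OF that] by (auto intro: AB(3) dest!: AB(2))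
    then show ?thesis using fin by (simp add: sum.inter_filter[symmetric] algebra_simps)
  qed
  have 3: "{d \<in> A. d \<ge> 1} = {1..h - 1}" using assms(1) AB(1) by force
  have "(\<Sum>d\<in>A. \<Sum>e\<in>B. if d + e \<ge> h then c else 0) = (\<Sum>d\<in>A. if d \<ge> 1 then of_int d * c else 0)"
    by (rule sum.cong) (auto simp: 1)
  also have "\<dots> = (\<Sum>d\<in>{1..h - 1}. of_int d) * c"
    using fin by (simp add: sum.inter_filter[symmetric] 3 sum_distrib_right)
  finally show "(\<Sum>d\<in>A. \<Sum>e\<in>B. if d + e \<ge> h then c else 0) = H * (H - 1) / 2 * c"
    using h_ge by (simp add: sum_int_upto)
  have "(\<Sum>d\<in>A. \<Sum>e\<in>B. if d + e > h then c else 0) = (\<Sum>d\<in>A. if d \<ge> 1 then of_int d * c - c else 0)"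
    by (rule sum.cong) (auto simp: 2)
  also have "\<dots> = (\<Sum>d\<in>{1..h - 1}. of_int d) * c - (H - 1) * c"
    using fin h_ge by (simp add: sum.inter_filter[symmetric] 3 sum_distrib_right sum_subtractf)
  finally show "(\<Sum>d\<in>A. \<Sum>e\<in>B. if d + e > h then c else 0) = (H - 1) * (H - 2) / 2 * c"
    using h_ge by (simp add: sum_int_upto field_simps)
qed

lemma ext_sum_ge:
  assumes "\<bar>p\<bar> \<le> h" "\<bar>r\<bar> \<le> h"
  shows "ext_sum p r (\<lambda>d e. if d + e \<ge> h then cl c0 c1 c2 d e else 0) =
    (if \<bar>p\<bar> < h \<and> \<bar>r\<bar> < h then H * (H - 1) / 2 * c0 + 2 * H * c1 + c2
     else if p = h \<and> \<bar>r\<bar> < h \<or> \<bar>p\<bar> < h \<and> r = h then H * (H - 1) / 2 * c0 + H * c1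
     else if p = - h \<and> \<bar>r\<bar> < h \<or> \<bar>p\<bar> < h \<and> r = - h then c1
     else if p = h \<and> r = h then H * (H - 1) / 2 * c0 else 0)"
    (is "?A = _")
    "ext_sum p r (\<lambda>d e. if d + e > h then cl c0 c1 c2 d e else 0) =
    (if \<bar>p\<bar> < h \<and> \<bar>r\<bar> < h then (H - 1) * (H - 2) / 2 * c0 + 2 * (H - 1) * c1 + c2
     else if p = h \<and> \<bar>r\<bar> < h \<or> \<bar>p\<bar> < h \<and> r = h then (H - 1) * (H - 2) / 2 * c0 + (H - 1) * c1
     else if p = h \<and> r = h then (H - 1) * (H - 2) / 2 * c0 else 0)"
    (is "?B = _")
proof -
  let ?I = "{1 - h..h - 1}"
  define g where "g d e = (if d + e \<ge> h then cl c0 c1 c2 d e else 0)" for d e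
  define k where "k d e = (if d + e > h then cl c0 c1 c2 d e else 0)" for d e
  have core: "(\<Sum>d\<in>A. \<Sum>e\<in>B. g d e) = H * (H - 1) / 2 * c0"
      "(\<Sum>d\<in>A. \<Sum>e\<in>B. k d e) = (H - 1) * (H - 2) / 2 * c0"
    if "{1..h - 1} \<subseteq> A" "A \<subseteq> ?I" "{1..h - 1} \<subseteq> B" "B \<subseteq> ?I" for A B
  proof -
    have "(\<Sum>d\<in>A. \<Sum>e\<in>B. g d e) = (\<Sum>d\<in>A. \<Sum>e\<in>B. if d + e \<ge> h then c0 else 0)"
      by (intro sum.cong refl) (use that in \<open>force simp: g_def cl_def\<close>)
    then show "(\<Sum>d\<in>A. \<Sum>e\<in>B. g d e) = H * (H - 1) / 2 * c0" using sum_ge_core[OF that] by simp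
    have "(\<Sum>d\<in>A. \<Sum>e\<in>B. k d e) = (\<Sum>d\<in>A. \<Sum>e\<in>B. if d + e > h then c0 else 0)"
      by (intro sum.cong refl) (use that in \<open>force simp: k_def cl_def\<close>)
    then show "(\<Sum>d\<in>A. \<Sum>e\<in>B. k d e) = (H - 1) * (H - 2) / 2 * c0" using sum_ge_core[OF that] by simp
  qed
  have sym: "g d e = g e d" "k d e = k e d" for d e
    by (simp_all add: g_def k_def cl_swap add.commute)
  have row0: "g (- h) e = 0" "k (- h) e = 0" if "e < 2 * h" for e
    using that by (simp_all add: g_def k_def)
  have row: "(\<Sum>e\<in>B. g h e) = H * c1" "(\<Sum>e\<in>B. k h e) = (H - 1) * c1"
    if "{0..h - 1} \<subseteq> B" "B \<subseteq> ?I" for B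
  proof -
    have f: "finite B" using that finite_subset by blast
    have "(\<Sum>e\<in>B. g h e) = (\<Sum>e\<in>B. if e \<ge> 0 then c1 else 0)" "(\<Sum>e\<in>B. k h e) = (\<Sum>e\<in>B. if e \<ge> 1 then c1 else 0)"
      by (intro sum.cong refl; use that h_ge in \<open>force simp: g_def k_def cl_def\<close>)+
    moreover have "{e \<in> B. e \<ge> 0} = {0..h - 1}" "{e \<in> B. e \<ge> 1} = {1..h - 1}" using that by auto
    ultimately show "(\<Sum>e\<in>B. g h e) = H * c1" "(\<Sum>e\<in>B. k h e) = (H - 1) * c1"
      using f h_ge by (simp_all add: sum.inter_filter[symmetric])
  qed
  have row1: "(\<Sum>e\<in>{1 - h..0}. g h e) = c1" "(\<Sum>e\<in>{1 - h..0}. k h e) = 0"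
  proof -
    have "(\<Sum>e\<in>{1 - h..0}. g h e) = (\<Sum>e\<in>{1 - h..0}. if e = 0 then c1 else 0)"
      by (intro sum.cong refl) (use h_ge in \<open>auto simp: g_def cl_def\<close>)
    then show "(\<Sum>e\<in>{1 - h..0}. g h e) = c1" using h_ge by simp
    show "(\<Sum>e\<in>{1 - h..0}. k h e) = 0" by (rule sum.neutral) (auto simp: k_def)
  qed
  have neg: "(\<Sum>d\<in>{1 - h..0}. \<Sum>e\<in>B. g d e) = 0" "(\<Sum>d\<in>{1 - h..0}. \<Sum>e\<in>B. k d e) = 0" if "B \<subseteq> ?I" for B
    by (intro sum.neutral ballI; use that in \<open>force simp: g_def k_def\<close>)+
  have corner: "g h h = c2" "k h h = c2" using h_ge by (simp_all add: g_def k_def cl_def)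
  have sw: "(\<Sum>d\<in>A. g d h) = (\<Sum>d\<in>A. g h d)" "(\<Sum>d\<in>A. k d h) = (\<Sum>d\<in>A. k h d)" for A
    by (rule sum.cong[OF refl sym(1)], rule sum.cong[OF refl sym(2)])
  have z: "(\<Sum>d\<in>A. g d (- h)) = 0" "(\<Sum>d\<in>A. k d (- h)) = 0"
      "(\<Sum>d\<in>A. g (- h) d) = 0" "(\<Sum>d\<in>A. k (- h) d) = 0" if "A \<subseteq> ?I" for A
  proof -
    have "d < 2 * h" if "d \<in> A" for d using that \<open>A \<subseteq> ?I\<close> h_ge by force
    then have "g (- h) d = 0" "k (- h) d = 0" if "d \<in> A" for d using that row0 by blast+
    moreover from this have "g d (- h) = 0" "k d (- h) = 0" if "d \<in> A" for d
      using that sym(1)[of d "- h"] sym(2)[of d "- h"] by simp_all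
    ultimately show "(\<Sum>d\<in>A. g d (- h)) = 0" "(\<Sum>d\<in>A. k d (- h)) = 0"
      "(\<Sum>d\<in>A. g (- h) d) = 0" "(\<Sum>d\<in>A. k (- h) d) = 0"
      by (simp_all add: sum.neutral)
  qed
  have sub: "{1..h - 1} \<subseteq> ?I" "{1..h - 1} \<subseteq> {0..h - 1}" "{0..h - 1} \<subseteq> ?I" "?I \<subseteq> ?I" "{1 - h..0} \<subseteq> ?I"
    "{0..h - 1} \<subseteq> {0..h - 1}"
    using h_ge by auto
  have ff: "(\<Sum>d\<in>{- h..h}. \<Sum>e\<in>{- h..h}. g d e) = H * (H - 1) / 2 * c0 + 2 * H * c1 + c2"
    "(\<Sum>d\<in>{- h..h}. \<Sum>e\<in>{- h..h}. k d e) = (H - 1) * (H - 2) / 2 * c0 + 2 * (H - 1) * c1 + c2"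
    unfolding sum_full sum.distrib sw
    using core[OF sub(1,4,1,4)] row[OF sub(3,4)] z[OF sub(4)] corner row0[of h] row0[of "- h"] sym(1)[of h "- h"] sym(2)[of h "- h"] h_ge
    by (simp_all add: field_simps)
  have hf: "(\<Sum>d\<in>{0..h - 1}. \<Sum>e\<in>{- h..h}. g d e) = H * (H - 1) / 2 * c0 + H * c1"
    "(\<Sum>d\<in>{0..h - 1}. \<Sum>e\<in>{- h..h}. k d e) = (H - 1) * (H - 2) / 2 * c0 + (H - 1) * c1"
    unfolding sum_full sum.distrib sw
    using core[OF sub(2,3,1,4)] row[OF sub(6,3)] z[OF sub(3)] by simp_all
  have mf: "(\<Sum>d\<in>{1 - h..0}. \<Sum>e\<in>{- h..h}. g d e) = c1"
    "(\<Sum>d\<in>{1 - h..0}. \<Sum>e\<in>{- h..h}. k d e) = 0"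
    unfolding sum_full sum.distrib sw
    using neg[OF sub(4)] row1 z[OF sub(5)] by simp_all
  have fh: "(\<Sum>d\<in>{- h..h}. \<Sum>e\<in>B. g d e) = (\<Sum>d\<in>B. \<Sum>e\<in>{- h..h}. g d e)"
    "(\<Sum>d\<in>{- h..h}. \<Sum>e\<in>B. k d e) = (\<Sum>d\<in>B. \<Sum>e\<in>{- h..h}. k d e)" for B
    by (subst sum.swap, intro sum.cong refl sym)+
  note F = fh(1)[of "{0..h - 1}", unfolded hf] fh(2)[of "{0..h - 1}", unfolded hf]
    fh(1)[of "{1 - h..0}", unfolded mf] fh(2)[of "{1 - h..0}", unfolded mf]
  have hm: "(\<Sum>d\<in>{0..h - 1}. \<Sum>e\<in>{1 - h..0}. g d e) = 0" "(\<Sum>d\<in>{0..h - 1}. \<Sum>e\<in>{1 - h..0}. k d e) = 0"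
    by (intro sum.neutral ballI; force simp: g_def k_def)+
  have hh: "(\<Sum>d\<in>{0..h - 1}. \<Sum>e\<in>{0..h - 1}. g d e) = H * (H - 1) / 2 * c0"
    "(\<Sum>d\<in>{0..h - 1}. \<Sum>e\<in>{0..h - 1}. k d e) = (H - 1) * (H - 2) / 2 * c0"
    using core[OF sub(2,3,2,3)] by simp_all
  have P: "p = h \<or> p = - h \<or> \<bar>p\<bar> < h" "r = h \<or> r = - h \<or> \<bar>r\<bar> < h" using assms by linarith+
  have nz: "h \<noteq> - h" using h_ge by auto
  have A: "?A = (\<Sum>d\<in>nx p. \<Sum>e\<in>nx r. g d e)" and B: "?B = (\<Sum>d\<in>nx p. \<Sum>e\<in>nx r. k d e)"
    by (simp_all add: ext_sum_def g_def k_def)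
  have "?A = (if \<bar>p\<bar> < h \<and> \<bar>r\<bar> < h then H * (H - 1) / 2 * c0 + 2 * H * c1 + c2
     else if p = h \<and> \<bar>r\<bar> < h \<or> \<bar>p\<bar> < h \<and> r = h then H * (H - 1) / 2 * c0 + H * c1
     else if p = - h \<and> \<bar>r\<bar> < h \<or> \<bar>p\<bar> < h \<and> r = - h then c1
     else if p = h \<and> r = h then H * (H - 1) / 2 * c0 else 0) \<and>
    ?B = (if \<bar>p\<bar> < h \<and> \<bar>r\<bar> < h then (H - 1) * (H - 2) / 2 * c0 + 2 * (H - 1) * c1 + c2
     else if p = h \<and> \<bar>r\<bar> < h \<or> \<bar>p\<bar> < h \<and> r = h then (H - 1) * (H - 2) / 2 * c0 + (H - 1) * c1
     else if p = h \<and> r = h then (H - 1) * (H - 2) / 2 * c0 else 0)"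
  proof -
    consider "\<bar>p\<bar> < h" "\<bar>r\<bar> < h" | "p = h" "\<bar>r\<bar> < h" | "p = - h" "\<bar>r\<bar> < h" | "\<bar>p\<bar> < h" "r = h" | "\<bar>p\<bar> < h" "r = - h" | "p = h" "r = h" | "p = h" "r = - h" | "p = - h" "r = h" | "p = - h" "r = - h"
      using P by blast
    then show ?thesis
    proof cases
      case 1
      show ?thesis unfolding A B unfolding nx_free[OF 1(1)] nx_free[OF 1(2)] ff(1) ff(2) using 1 nz h_ge by simp
    next
      case 2
      show ?thesis unfolding A B unfolding 2(1) nx_ext(1) nx_free[OF 2(2)] hf(1) hf(2) using 2 nz h_ge by simp
    next
      case 3
      show ?thesis unfolding A B unfolding 3(1) nx_ext(2) nx_free[OF 3(2)] mf(1) mf(2) using 3 nz h_ge by simp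
    next
      case 4
      show ?thesis unfolding A B unfolding nx_free[OF 4(1)] 4(2) nx_ext(1) F(1) F(2) using 4 nz h_ge by simp
    next
      case 5
      show ?thesis unfolding A B unfolding nx_free[OF 5(1)] 5(2) nx_ext(2) F(3) F(4) using 5 nz h_ge by simp
    next
      case 6
      show ?thesis unfolding A B unfolding 6(1) nx_ext(1) 6(2) nx_ext(1) hh(1) hh(2) using 6 nz h_ge by simp
    next
      case 7
      show ?thesis unfolding A B unfolding 7(1) nx_ext(1) 7(2) nx_ext(2) hm(1) hm(2) using 7 nz h_ge by simp
    next
      case 8
      show ?thesis unfolding A B unfolding 8(1) nx_ext(2) 8(2) nx_ext(1) neg(1)[OF sub(3)] neg(2)[OF sub(3)] using 8 nz h_ge by simp
    next
      case 9
      show ?thesis unfolding A B unfolding 9(1) nx_ext(2) 9(2) nx_ext(2) neg(1)[OF sub(5)] neg(2)[OF sub(5)] using 9 nz h_ge by simp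
    qed
  qed
  then show "?A = (if \<bar>p\<bar> < h \<and> \<bar>r\<bar> < h then H * (H - 1) / 2 * c0 + 2 * H * c1 + c2
     else if p = h \<and> \<bar>r\<bar> < h \<or> \<bar>p\<bar> < h \<and> r = h then H * (H - 1) / 2 * c0 + H * c1
     else if p = - h \<and> \<bar>r\<bar> < h \<or> \<bar>p\<bar> < h \<and> r = - h then c1
     else if p = h \<and> r = h then H * (H - 1) / 2 * c0 else 0)"
    "?B = (if \<bar>p\<bar> < h \<and> \<bar>r\<bar> < h then (H - 1) * (H - 2) / 2 * c0 + 2 * (H - 1) * c1 + c2
     else if p = h \<and> \<bar>r\<bar> < h \<or> \<bar>p\<bar> < h \<and> r = h then (H - 1) * (H - 2) / 2 * c0 + (H - 1) * c1
     else if p = h \<and> r = h then (H - 1) * (H - 2) / 2 * c0 else 0)" by blast+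
qed

lemma card_residues_ge: "(\<Sum>e\<in>{1 - h..h}. if (d + e) mod q \<ge> h then 1 else 0 :: real) = H"
proof -
  have inj: "inj_on (\<lambda>e. (d + e) mod q) {1 - h..h}"
  proof (rule inj_onI)
    fix x y assume xy: "x \<in> {1 - h..h}" "y \<in> {1 - h..h}" "(d + x) mod q = (d + y) mod q"
    then have "q dvd (x - y)" by (metis add_diff_cancel_left mod_eq_dvd_iff)
    moreover have "\<bar>x - y\<bar> < q" using xy(1,2) q_eq by auto
    moreover have "\<bar>q\<bar> \<le> \<bar>x - y\<bar>" if "x \<noteq> y" "q dvd (x - y)"
      using that dvd_imp_le_int[of "x - y" q] by simp
    ultimately show "x = y" using q_ge by linarith
  qed
  have "(\<lambda>e. (d + e) mod q) ` {1 - h..h} = {0..q - 1}"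
  proof (rule card_subset_eq)
    show "(\<lambda>e. (d + e) mod q) ` {1 - h..h} \<subseteq> {0..q - 1}" using mod_bounds by auto
    show "card ((\<lambda>e. (d + e) mod q) ` {1 - h..h}) = card {0..q - 1}"
      using q_eq h_ge by (simp add: card_image[OF inj])
  qed simp
  then have "(\<Sum>e\<in>{1 - h..h}. if (d + e) mod q \<ge> h then 1 else 0 :: real) = (\<Sum>i\<in>{0..q - 1}. if i \<ge> h then 1 else 0)"
    using sum.reindex[OF inj, of "\<lambda>i. if i \<ge> h then 1 else 0 :: real"] by simp
  also have "\<dots> = (\<Sum>i\<in>{i \<in> {0..q - 1}. i \<ge> h}. 1)" by (rule sum.inter_filter[symmetric]) simp
  also have "{i \<in> {0..q - 1}. i \<ge> h} = {h..q - 1}" using h_ge by auto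
  finally show ?thesis using q_eq h_ge by simp
qed

text \<open>Weighted by \<open>v\<close>, a digit following a free one is uniformly distributed
  modulo q: \<open>h\<close> and \<open>- h\<close> are congruent and have weight 1 each, against 2
  for every other class. One such operand makes the sum uniform, so the upper half of the residues
  gets half of the mass.\<close>

lemma ext_sum_residue:
  assumes "\<bar>p\<bar> \<le> h" "\<bar>r\<bar> \<le> h" "\<bar>p\<bar> < h \<or> \<bar>r\<bar> < h"
  shows "ext_sum p r (\<lambda>d e. if (d + e) mod q \<ge> h then cl 4 2 1 d e else 0) = 2 * H\<^sup>2 * cl 4 2 1 p r"
proof -
  define v :: "int \<Rightarrow> real" where "v d = (if \<bar>d\<bar> = h then 1 else 2)" for d
  have vv: "cl 4 2 1 d e = v d * v e" for d e by (simp add: cl_def v_def)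
  have in1: "(\<Sum>e\<in>{- h..h}. if (d + e) mod q \<ge> h then v e else 0) = 2 * H" for d
  proof -
    have m: "(d - h) mod q = (d + h) mod q"
    proof -
      have "d + h = d - h + q" using q_eq by simp
      then show ?thesis by (simp only: mod_add_self2)
    qed
    have "{1 - h..h} = insert h {1 - h..h - 1}" using h_ge by auto
    then have "(\<Sum>e\<in>{1 - h..h}. if (d + e) mod q \<ge> h then 2 else 0) =
        (if (d + h) mod q \<ge> h then 2 else 0) + (\<Sum>e\<in>{1 - h..h - 1}. if (d + e) mod q \<ge> h then 2 else 0 :: real)"
      by simp
    also have "\<dots> = (\<Sum>e\<in>{- h..h}. if (d + e) mod q \<ge> h then v e else 0)"
      unfolding sum_full using h_ge m by (auto simp: v_def intro!: sum.cong)
    finally have "(\<Sum>e\<in>{- h..h}. if (d + e) mod q \<ge> h then v e else 0) =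
       (\<Sum>e\<in>{1 - h..h}. 2 * (if (d + e) mod q \<ge> h then 1 else 0))" by (simp add: if_distrib cong: if_cong)
    then show ?thesis by (simp only: sum_distrib_left[symmetric] card_residues_ge)
  qed
  have sv: "(\<Sum>d\<in>nx p. v d) = 2 * H * v p" if "\<bar>p\<bar> \<le> h" for p
  proof -
    have "(\<Sum>d\<in>{0..h - 1}. v d) = of_int (h - 1 + 1 - 0) * 2" "(\<Sum>d\<in>{1 - h..0}. v d) = of_int (0 + 1 - (1 - h)) * 2"
      "(\<Sum>d\<in>{1 - h..h - 1}. v d) = of_int (h - 1 + 1 - (1 - h)) * 2"
      by (rule sum_eq_const; use h_ge in \<open>auto simp: v_def\<close>)+
    then show ?thesis using that h_ge by (auto simp: nx_def sum_full v_def)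
  qed
  have free: "ext_sum p r (\<lambda>d e. if (d + e) mod q \<ge> h then cl 4 2 1 d e else 0) = 2 * H\<^sup>2 * cl 4 2 1 p r"
    if "\<bar>p\<bar> \<le> h" "\<bar>r\<bar> < h" for p r
  proof -
    have "ext_sum p r (\<lambda>d e. if (d + e) mod q \<ge> h then cl 4 2 1 d e else 0) =
        (\<Sum>d\<in>nx p. \<Sum>e\<in>{- h..h}. v d * (if (d + e) mod q \<ge> h then v e else 0))"
      unfolding ext_sum_def nx_free[OF that(2)] by (intro sum.cong refl) (simp add: vv)
    also have "\<dots> = (\<Sum>d\<in>nx p. v d) * (2 * H)"
      unfolding sum_distrib_left[symmetric] in1 sum_distrib_right ..
    finally show ?thesis using sv[OF that(1)] that by (simp add: vv v_def power2_eq_square)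
  qed
  show ?thesis
  proof (cases "\<bar>r\<bar> < h")
    case True then show ?thesis using free assms by blast
  next
    case False
    then have "ext_sum r p (\<lambda>d e. if (d + e) mod q \<ge> h then cl 4 2 1 d e else 0) = 2 * H\<^sup>2 * cl 4 2 1 r p"
      using free assms by blast
    moreover have "(\<lambda>d e. if (d + e) mod q \<ge> h then cl 4 2 1 d e else 0) =
        (\<lambda>d e. if (e + d) mod q \<ge> h then cl 4 2 1 e d else 0)"
    proof (intro ext)
      fix d e
      show "(if (d + e) mod q \<ge> h then cl 4 2 1 d e else 0) = (if (e + d) mod q \<ge> h then cl 4 2 1 e d else 0)"
        using cl_swap[of 4 2 1 d e] by (simp add: add.commute)
    qed
    ultimately show ?thesis
      using ext_sum_swap[of p r "\<lambda>d e. if (d + e) mod q \<ge> h then cl 4 2 1 d e else 0"] cl_swap[of 4 2 1 p r]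
      by simp
  qed
qed

section \<open>Growing words by a pair of digits, and weighted sums over live words\<close>

abbreviation Q :: real where "Q \<equiv> real_of_int q"

lemma Q_eq: "Q = 2 * H" and H_ge: "H \<ge> 1" and Q_ge: "Q \<ge> 2" and Q_pos: "Q > 0"
  using q_eq h_ge by auto

lemma SSDE_0: "SSDE q 0 = {\<lambda>j. 0}"
  by (auto simp: SSDE_def)

lemma SSDE_Suc_iff:
  "z \<in> SSDE q (Suc n) \<longleftrightarrow> (\<exists>x\<in>SSDE q n. \<exists>d\<in>nx (x (n - 1)). z = x(n := d))"
proof
  assume z: "z \<in> SSDE q (Suc n)"
  note Z = SSDE_D[OF z]
  define x where "x = z(n := 0)"
  have Z': "\<And>j. Suc j < Suc n \<Longrightarrow> \<bar>z j\<bar> = q div 2 \<Longrightarrow> 0 \<le> sgn (z j) * z (Suc j) \<and> sgn (z j) * z (Suc j) \<le> q div 2 - 1"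
    "\<And>j. j \<ge> Suc n \<Longrightarrow> z j = 0" "\<And>j. j < Suc n \<Longrightarrow> - (q div 2) \<le> z j \<and> z j \<le> q div 2"
    using z unfolding SSDE_def by blast+
  have "x \<in> SSDE q n"
    unfolding SSDE_def mem_Collect_eq x_def using Z' by (auto simp: le_Suc_eq)
  moreover have "z n \<in> nx (x (n - 1))"
  proof (cases n)
    case 0
    then have "nx (x (n - 1)) = {- h..h}" using h_ge by (simp add: x_def nx_def)
    then show ?thesis using Z(2)[of n] by auto
  next
    case (Suc m)
    then show ?thesis using Z(2)[of n] Z(3)[of m] Z(4)[of m] by (auto simp: nx_def x_def)
  qed
  moreover have "z = x(n := z n)" by (auto simp: x_def)
  ultimately show "\<exists>x\<in>SSDE q n. \<exists>d\<in>nx (x (n - 1)). z = x(n := d)" by blast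
next
  assume "\<exists>x\<in>SSDE q n. \<exists>d\<in>nx (x (n - 1)). z = x(n := d)"
  then obtain x d where x: "x \<in> SSDE q n" and d: "d \<in> nx (x (n - 1))" and z: "z = x(n := d)" by blast
  note X = SSDE_D[OF x]
  have X': "\<And>j. Suc j < n \<Longrightarrow> \<bar>x j\<bar> = q div 2 \<Longrightarrow> 0 \<le> sgn (x j) * x (Suc j) \<and> sgn (x j) * x (Suc j) \<le> q div 2 - 1"
    "\<And>j. j \<ge> n \<Longrightarrow> x j = 0" "\<And>j. j < n \<Longrightarrow> - (q div 2) \<le> x j \<and> x j \<le> q div 2"
    using x unfolding SSDE_def by blast+
  have db: "- h \<le> d" "d \<le> h" using nx_bound[OF d] by auto
  have last: "0 \<le> sgn (x j) * d \<and> sgn (x j) * d \<le> h - 1" if "Suc j = n" "\<bar>x j\<bar> = h" for j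
  proof -
    have "x (n - 1) = x j" using that by auto
    then show ?thesis using d that h_ge by (auto simp: nx_def abs_if sgn_if split: if_splits)
  qed
  show "z \<in> SSDE q (Suc n)"
    unfolding SSDE_def mem_Collect_eq z h_def[symmetric]
  proof (intro conjI allI impI)
    fix j
    show "Suc n \<le> j \<Longrightarrow> (x(n := d)) j = 0" using X'(2) by auto
    show "j < Suc n \<Longrightarrow> - h \<le> (x(n := d)) j" "j < Suc n \<Longrightarrow> (x(n := d)) j \<le> h"
      using X'(3)[of j] db by (auto simp: h_def less_Suc_eq)
    assume j: "Suc j < Suc n" "\<bar>(x(n := d)) j\<bar> = h"
    show "0 \<le> sgn ((x(n := d)) j) * (x(n := d)) (Suc j)" "sgn ((x(n := d)) j) * (x(n := d)) (Suc j) \<le> h - 1"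
      using j X'(1)[of j] last[of j] by (cases "Suc j = n"; auto simp: h_def)+
  qed
qed

lemma finite_SSDE: "finite (SSDE q n)"
proof (induction n)
  case (Suc n)
  have "SSDE q (Suc n) = (\<Union>x\<in>SSDE q n. (\<lambda>d. x(n := d)) ` nx (x (n - 1)))"
    using SSDE_Suc_iff by blast
  then show ?case using Suc by simp
qed (simp add: SSDE_0)

lemma sum_SSDE_Suc:
  "(\<Sum>z\<in>SSDE q (Suc n). g z) = (\<Sum>x\<in>SSDE q n. \<Sum>d\<in>nx (x (n - 1)). g (x(n := d)))"
proof -
  let ?S = "SIGMA x:SSDE q n. nx (x (n - 1))"
  have bij: "bij_betw (\<lambda>(x, d). x(n := d)) ?S (SSDE q (Suc n))"
  proof (rule bij_betw_imageI)
    show "inj_on (\<lambda>(x, d). x(n := d)) ?S"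
    proof (rule inj_onI, clarsimp)
      fix x d x' d'
      assume x: "x \<in> SSDE q n" "x' \<in> SSDE q n" and e: "x(n := d) = x'(n := d')"
      have "x j = x' j" for j
        using SSDE_D(1)[OF x(1), of n] SSDE_D(1)[OF x(2), of n] fun_cong[OF e, of j] by (cases "j = n") auto
      then show "x = x' \<and> d = d'" using fun_cong[OF e, of n] by auto
    qed
    show "(\<lambda>(x, d). x(n := d)) ` ?S = SSDE q (Suc n)" using SSDE_Suc_iff by fastforce
  qed
  show ?thesis
    unfolding sum.Sigma[OF finite_SSDE ballI[OF finite_nx]]
    using sum.reindex_bij_betw[OF bij, of g] by (simp add: case_prod_unfold)
qed

text \<open>A state consists of the last digits of both operands and the levels \<open>LA\<close> and \<open>LB\<close> of the digit
  sum and of its negative.\<close>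

type_synonym stfun = "int \<Rightarrow> int \<Rightarrow> nat \<Rightarrow> nat \<Rightarrow> nat \<Rightarrow> nat \<Rightarrow> real"

definition at_word :: "stfun \<Rightarrow> nat \<Rightarrow> (nat \<Rightarrow> int) \<Rightarrow> (nat \<Rightarrow> int) \<Rightarrow> real" where
  "at_word F n x y = (let s = dsum x y in F (x (n - 1)) (y (n - 1)) (LA s n) (LB s n) (LA (- s) n) (LB (- s) n))"

text \<open>\<open>Q\<^sup>2\<close> is the growth rate of the number of pairs of words per digit,
  so the division keeps these sums bounded in \<open>n\<close>.\<close>

definition W :: "nat \<Rightarrow> nat \<Rightarrow> stfun \<Rightarrow> real" where
  "W M n F = (\<Sum>x\<in>SSDE q n. \<Sum>y\<in>SSDE q n. if live M (dsum x y) n then at_word F n x y else 0) / Q ^ (2 * n)"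

definition dead :: "nat \<Rightarrow> int \<Rightarrow> nat \<Rightarrow> nat \<Rightarrow> nat \<Rightarrow> nat \<Rightarrow> bool" where
  "dead M d a b a' b' \<longleftrightarrow> fire M d a b \<or> fire M (- d) a' b'"

definition after :: "stfun \<Rightarrow> nat \<Rightarrow> nat \<Rightarrow> nat \<Rightarrow> nat \<Rightarrow> int \<Rightarrow> int \<Rightarrow> real" where
  "after F a b a' b' d e = F d e (next_A (d + e) b a') (next_B (d + e) a b')
     (next_A (- (d + e)) b' a) (next_B (- (d + e)) a' b)"

lemma W_Suc:
  "W M (Suc n) F = W M n (\<lambda>p r a b a' b'.
     ext_sum p r (\<lambda>d e. if dead M (d + e) a b a' b' then 0 else after F a b a' b' d e)) / Q\<^sup>2"
proof -
  have *: "(if live M (dsum (x(n := d)) (y(n := e))) (Suc n) then at_word F (Suc n) (x(n := d)) (y(n := e)) else 0) =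
    (if live M (dsum x y) n then (let s = dsum x y in
       if dead M (d + e) (LA s n) (LB s n) (LA (- s) n) (LB (- s) n) then 0
       else after F (LA s n) (LB s n) (LA (- s) n) (LB (- s) n) d e) else 0)" for x y d e
  proof -
    define s where "s = dsum x y"
    define s' where "s' = dsum (x(n := d)) (y(n := e))"
    have eq: "s' i = s i" if "i < n" for i using that by (simp add: s_def s'_def dsum_def)
    have sn: "s' n = d + e" by (simp add: s'_def dsum_def)
    have L: "LA s' n = LA s n" "LB s' n = LB s n" using level_cong[of n s' s] eq by blast+
    have L': "LA (- s') n = LA (- s) n" "LB (- s') n = LB (- s) n" using level_cong[of n "- s'" "- s"] eq by auto
    have lv: "live M s' (Suc n) \<longleftrightarrow> live M s n \<and> \<not> dead M (d + e) (LA s n) (LB s n) (LA (- s) n) (LB (- s) n)"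
      using live_cong[of n s' s] eq by (simp add: live_Suc fires_def dead_def L L' sn)
    have nn: "LA (- (- s')) n = LA s n" "LB (- (- s')) n = LB s n" unfolding neg_neg by (rule L)+
    have "at_word F (Suc n) (x(n := d)) (y(n := e)) = after F (LA s n) (LB s n) (LA (- s) n) (LB (- s) n) d e"
      unfolding at_word_def after_def s'_def[symmetric] Let_def LA.simps LB.simps nn L L' uminus_apply sn by simp
    then show ?thesis using lv by (simp add: s_def s'_def Let_def)
  qed
  have "(\<Sum>x\<in>SSDE q (Suc n). \<Sum>y\<in>SSDE q (Suc n). if live M (dsum x y) (Suc n) then at_word F (Suc n) x y else 0) =
    (\<Sum>x\<in>SSDE q n. \<Sum>y\<in>SSDE q n. if live M (dsum x y) n then at_word (\<lambda>p r a b a' b'.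
     ext_sum p r (\<lambda>d e. if dead M (d + e) a b a' b' then 0 else after F a b a' b' d e)) n x y else 0)"
    unfolding sum_SSDE_Suc *
  proof (rule sum.cong[OF refl])
    fix x
    show "(\<Sum>d\<in>nx (x (n - 1)). \<Sum>y\<in>SSDE q n. \<Sum>e\<in>nx (y (n - 1)). if live M (dsum x y) n then (let s = dsum x y in
       if dead M (d + e) (LA s n) (LB s n) (LA (- s) n) (LB (- s) n) then 0
       else after F (LA s n) (LB s n) (LA (- s) n) (LB (- s) n) d e) else 0) =
      (\<Sum>y\<in>SSDE q n. if live M (dsum x y) n then at_word (\<lambda>p r a b a' b'.
     ext_sum p r (\<lambda>d e. if dead M (d + e) a b a' b' then 0 else after F a b a' b' d e)) n x y else 0)"
      by (subst sum.swap, rule sum.cong[OF refl]) (simp add: at_word_def ext_sum_def Let_def)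
  qed
  then show ?thesis by (simp add: W_def power2_eq_square)
qed

text \<open>An invariant of the reachable states: all open chains have the same sign. The upper
  bounds on the digit sum hold from level 2 on, since such a chain has been passed on, and this
  happens only at \<open>h - 1\<close> or \<open>h\<close> into state \<open>A\<close> and at
  \<open>h\<close> or \<open>h + 1\<close> into state \<open>B\<close>.\<close>

definition valid_state :: "nat \<Rightarrow> int \<Rightarrow> int \<Rightarrow> nat \<Rightarrow> nat \<Rightarrow> nat \<Rightarrow> nat \<Rightarrow> bool" where
  "valid_state M p r a b a' b' \<longleftrightarrow> \<bar>p\<bar> \<le> h \<and> \<bar>r\<bar> \<le> h \<and> a \<le> M \<and> b \<le> M \<and> a' \<le> M \<and> b' \<le> M \<and>
     (a > 0 \<longrightarrow> p + r \<ge> h - 1 \<and> a' = 0 \<and> b' = 0) \<and> (b > 0 \<longrightarrow> p + r \<ge> h \<and> a' = 0 \<and> b' = 0) \<and>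
     (a' > 0 \<longrightarrow> - p - r \<ge> h - 1) \<and> (b' > 0 \<longrightarrow> - p - r \<ge> h) \<and>
     (a \<ge> 2 \<longrightarrow> p + r \<le> h) \<and> (b \<ge> 2 \<longrightarrow> p + r \<le> h + 1) \<and>
     (a' \<ge> 2 \<longrightarrow> - p - r \<le> h) \<and> (b' \<ge> 2 \<longrightarrow> - p - r \<le> h + 1)"

text \<open>A chain of level \<open>M\<close> could only be passed on at a digit whose residue makes
  it fire, and then the word is no longer live.\<close>

lemma live_le:
  assumes "live M s n" "M \<ge> 1"
  shows "LA s n \<le> M \<and> LB s n \<le> M"
  using assms(1)
proof (induction n arbitrary: s)
  case (Suc n)
  have l: "live M s n" "\<not> fires M s n" "live M (- s) n" using Suc.prems by (simp_all add: live_Suc live_uminus)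
  have I: "LA s n \<le> M \<and> LB s n \<le> M" "LA (- s) n \<le> M \<and> LB (- s) n \<le> M" using Suc.IH l by blast+
  have nf: "\<not> (LB s n = M \<and> s n = h - 1)" "\<not> (LA s n = M \<and> s n = h)" "\<not> (LA (- s) n = M \<and> s n = h)"
    "\<not> (LB (- s) n = M \<and> s n = h + 1)"
    using l(2) mod_q_simps h_ge by (auto simp: fires_def fire_def)
  show ?case
  proof
    show "LA s (Suc n) \<le> M"
    proof -
      have "Suc (LB s n) \<le> M" if "s n = h - 1" using I(1) nf(1) that by linarith
      moreover have "Suc (LA (- s) n) \<le> M" if "s n = h" using I(2) nf(3) that by linarith
      ultimately show ?thesis using assms(2) by (simp add: next_A_def)
    qed
    show "LB s (Suc n) \<le> M"
    proof -
      have "Suc (LA s n) \<le> M" if "s n = h" using I(1) nf(2) that by linarith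
      moreover have "Suc (LB (- s) n) \<le> M" if "s n = h + 1" using I(2) nf(4) that by linarith
      ultimately show ?thesis using assms(2) by (simp add: next_B_def)
    qed
  qed
qed simp

lemma level_two:
  "LA s (Suc n) \<ge> 2 \<Longrightarrow> s n \<le> h" "LB s (Suc n) \<ge> 2 \<Longrightarrow> s n \<le> h + 1"
  by (auto simp: next_A_def next_B_def split: if_splits)

lemma valid_state_word:
  assumes "x \<in> SSDE q n" "y \<in> SSDE q n" "live M (dsum x y) n" "M \<ge> 1"
  shows "valid_state M (x (n - 1)) (y (n - 1)) (LA (dsum x y) n) (LB (dsum x y) n)
    (LA (- dsum x y) n) (LB (- dsum x y) n)"
proof -
  let ?s = "dsum x y"
  note B = SSDE_D(2)[OF assms(1)] SSDE_D(2)[OF assms(2)]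
  have n: "live M (- ?s) n" using assms(3) by (simp only: live_uminus)
  note lv = live_le[OF assms(3,4)] live_le[OF n assms(4)]
  have s: "?s m = x m + y m" "(- ?s) m = - x m - y m" for m by (simp_all add: dsum_def)
  show ?thesis
  proof (cases n)
    case 0 then show ?thesis using B by (simp add: valid_state_def)
  next
    case (Suc m)
    note P = level_pos[of ?s m] level_pos[of "- ?s" m] level_two[of ?s m] level_two[of "- ?s" m]
    have "LA ?s n > 0 \<longrightarrow> LA (- ?s) n = 0 \<and> LB (- ?s) n = 0"
      using coexist_AA[of ?s n] coexist_AB[of "- ?s" n] unfolding neg_neg by (metis neq0_conv)
    moreover have "LB ?s n > 0 \<longrightarrow> LA (- ?s) n = 0 \<and> LB (- ?s) n = 0"
      using coexist_AB[of ?s n] coexist_BB[of ?s n] by blast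
    ultimately show ?thesis using P B lv unfolding valid_state_def Suc s diff_Suc_1 by blast
  qed
qed

lemma W_cong:
  assumes "\<And>p r a b a' b'. valid_state M p r a b a' b' \<Longrightarrow> F p r a b a' b' = G p r a b a' b'" "M \<ge> 1"
  shows "W M n F = W M n G"
  unfolding W_def using valid_state_word[OF _ _ _ assms(2)] assms(1)
  by (intro arg_cong[where f = "\<lambda>z. z / _"] sum.cong refl) (auto simp: at_word_def Let_def)

lemma W_mono:
  assumes "\<And>p r a b a' b'. valid_state M p r a b a' b' \<Longrightarrow> F p r a b a' b' \<le> G p r a b a' b'" "M \<ge> 1"
  shows "W M n F \<le> W M n G"
  unfolding W_def using valid_state_word[OF _ _ _ assms(2)] assms(1) Q_pos
  by (intro divide_right_mono sum_mono) (auto simp: at_word_def Let_def)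

lemma W_lin:
  "W M n (\<lambda>p r a b a' b'. F p r a b a' b' + G p r a b a' b') = W M n F + W M n G"
  "W M n (\<lambda>p r a b a' b'. F p r a b a' b' - G p r a b a' b') = W M n F - W M n G"
  "W M n (\<lambda>p r a b a' b'. c * F p r a b a' b') = c * W M n F"
  unfolding W_def at_word_def Let_def
  by (simp_all add: sum.distrib[symmetric] sum_subtractf[symmetric] sum_distrib_left add_divide_distrib[symmetric]
      diff_divide_distrib[symmetric] if_distrib cong: if_cong)

lemma W_abs:
  assumes "\<And>p r a b a' b'. valid_state M p r a b a' b' \<Longrightarrow> \<bar>F p r a b a' b'\<bar> \<le> G p r a b a' b'" "M \<ge> 1"
  shows "\<bar>W M n F\<bar> \<le> W M n G"
proof -
  have "W M n F \<le> W M n G" by (rule W_mono) (use assms in \<open>force dest: assms(1)\<close>)+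
  moreover have "W M n (\<lambda>p r a b a' b'. (- 1) * F p r a b a' b') \<le> W M n G"
    by (rule W_mono) (use assms in \<open>force dest: assms(1)\<close>)+
  ultimately show ?thesis unfolding W_lin(3) by linarith
qed

lemma ext_sum_lin:
  "ext_sum p r (\<lambda>d e. f d e + g d e) = ext_sum p r f + ext_sum p r g"
  "ext_sum p r (\<lambda>d e. f d e - g d e) = ext_sum p r f - ext_sum p r g"
  "ext_sum p r (\<lambda>d e. c * f d e) = c * ext_sum p r f"
  by (simp_all add: ext_sum_def sum.distrib sum_subtractf sum_distrib_left)

lemma ext_sum_cong:
  "(\<And>d e. d \<in> nx p \<Longrightarrow> e \<in> nx r \<Longrightarrow> f d e = g d e) \<Longrightarrow> ext_sum p r f = ext_sum p r g"
  unfolding ext_sum_def by (intro sum.cong refl)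

text \<open>The eigenvector, for the eigenvalue \<open>2 * H\<close>, of the operator passing open
  chains on between the two states, as expressed in \<open>kernel_A\<close> and
  \<open>kernel_B\<close>. The value \<open>2 * (H - 1) / H\<close> is what the equation at two
  extreme digits demands.\<close>

definition omA :: "int \<Rightarrow> int \<Rightarrow> real" where "omA = cl 4 2 (2 * (H - 1) / H)"
definition omB :: "int \<Rightarrow> int \<Rightarrow> real" where "omB = cl 4 2 2"

definition lev :: "nat \<Rightarrow> stfun" where
  "lev j p r a b a' b' = omA p r * (of_bool (a = j) + of_bool (a' = j)) + omB p r * (of_bool (b = j) + of_bool (b' = j))"

lemma kernel_A:
  assumes "\<bar>p\<bar> \<le> h" "\<bar>r\<bar> \<le> h" "p + r \<ge> h - 1"
  shows "ext_sum p r (\<lambda>d e. if d + e = h then omB d e else 0) + ext_sum p r (\<lambda>d e. if d + e = - h then omA d e else 0)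
    = 2 * H * omA p r"
  unfolding omA_def omB_def ext_sum_h[OF assms] ext_sum_minus_h[OF assms]
  using H_ge by (auto simp: cl_def field_simps)

lemma kernel_B:
  assumes "\<bar>p\<bar> \<le> h" "\<bar>r\<bar> \<le> h" "p + r \<ge> h"
  shows "ext_sum p r (\<lambda>d e. if d + e = h - 1 then omA d e else 0) + ext_sum p r (\<lambda>d e. if d + e = - h - 1 then omB d e else 0)
    = 2 * H * omB p r"
  unfolding omA_def omB_def ext_sum_h_minus_1[OF assms] ext_sum_minus_h_minus_1[OF assms]
  using H_ge by (auto simp: cl_def field_simps)

lemma valid_state_flip: "valid_state M p r a b a' b' \<Longrightarrow> valid_state M (- p) (- r) a' b' a b"
  unfolding valid_state_def by auto

lemma valid_state_wlog [consumes 1, case_names flip plus]: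
  assumes "valid_state M p r a b a' b'"
    "\<And>p r a b a' b'. valid_state M p r a b a' b' \<Longrightarrow> P (- p) (- r) a' b' a b \<Longrightarrow> P p r a b a' b'"
    "\<And>p r a b. valid_state M p r a b 0 0 \<Longrightarrow> P p r a b 0 0"
  shows "P p r a b a' b'"
proof (cases "a' = 0 \<and> b' = 0")
  case True then show ?thesis using assms by blast
next
  case False
  then have "a = 0" "b = 0" using assms(1) by (auto simp: valid_state_def)
  then show ?thesis using assms(2)[OF assms(1)] assms(3)[of "- p" "- r" a' b'] valid_state_flip[OF assms(1)] by simp
qed

lemma dead_flip: "dead M (- T) a b a' b' \<longleftrightarrow> dead M T a' b' a b"
  by (auto simp: dead_def)

lemma lev_flip: "lev j (- d) (- e) a' b' a b = lev j d e a b a' b'"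
  by (simp add: lev_def omA_def omB_def cl_uminus)

lemma after_flip:
  assumes "\<And>d e a b a' b'. F (- d) (- e) a' b' a b = F d e a b a' b'"
  shows "after F a b a' b' (- d) (- e) = after F a' b' a b d e"
proof -
  have "- d + - e = - (d + e)" by simp
  then show ?thesis using assms unfolding after_def by (metis minus_minus)
qed

text \<open>The digits that pass on a chain in state \<open>A\<close> have residue \<open>h\<close>,
  at which state \<open>B\<close> cannot fire; those that pass on state \<open>B\<close> have
  residue \<open>h - 1\<close>, at which state \<open>A\<close> cannot fire. So discarding dead
  words never removes an extension of a chain below level \<open>M\<close>, and the recursion is
  exact.\<close>

lemma lev_step:
  assumes "valid_state M p r a b a' b'" "1 \<le> j" "j < M"
  shows "ext_sum p r (\<lambda>d e. if dead M (d + e) a b a' b' then 0 else after (lev (Suc j)) a b a' b' d e)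
    = 2 * H * lev j p r a b a' b'"
  using assms(1)
proof (induction rule: valid_state_wlog)
  case (flip p r a b a' b')
  have dd: "dead M (- d + - e) a' b' a b = dead M (d + e) a b a' b'" for d e
    using dead_flip[of M "d + e"] by simp
  show ?case using flip(2) unfolding ext_sum_uminus[of p r] dd after_flip[of "lev (Suc j)", OF lev_flip] lev_flip .
next
  case (plus p r a b)
  have pt: "(if dead M (d + e) a b 0 0 then 0 else after (lev (Suc j)) a b 0 0 d e) =
      of_bool (a = j) * ((if d + e = h then omB d e else 0) + (if d + e = - h then omA d e else 0)) +
      of_bool (b = j) * ((if d + e = h - 1 then omA d e else 0) + (if d + e = - h - 1 then omB d e else 0))" for d e
  proof -
    define T where "T = d + e"
    have d0: "dead M T a b 0 0 \<longleftrightarrow> a \<ge> M \<and> T mod q \<ge> h \<or> b \<ge> M \<and> T mod q < h"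
      using assms(3) by (auto simp: dead_def fire_def)
    have le: "a \<le> M" "b \<le> M" using plus by (auto simp: valid_state_def)
    consider "T = h" | "T = - h" | "T = h - 1" | "T = - h - 1" | "T \<noteq> h" "T \<noteq> - h" "T \<noteq> h - 1" "T \<noteq> - h - 1" by blast
    then show ?thesis unfolding T_def[symmetric] after_def lev_def d0
      by cases (use assms(2,3) h_ge in \<open>auto simp: mod_q_simps next_A_def next_B_def\<close>)
  qed
  have A: "of_bool (a = j) * (ext_sum p r (\<lambda>d e. if d + e = h then omB d e else 0) +
      ext_sum p r (\<lambda>d e. if d + e = - h then omA d e else 0)) = of_bool (a = j) * (2 * H * omA p r)"
  proof (cases "a = j")
    case True
    then have "\<bar>p\<bar> \<le> h" "\<bar>r\<bar> \<le> h" "p + r \<ge> h - 1" using plus assms(2) by (auto simp: valid_state_def)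
    then show ?thesis by (simp only: kernel_A)
  qed simp
  have B: "of_bool (b = j) * (ext_sum p r (\<lambda>d e. if d + e = h - 1 then omA d e else 0) +
      ext_sum p r (\<lambda>d e. if d + e = - h - 1 then omB d e else 0)) = of_bool (b = j) * (2 * H * omB p r)"
  proof (cases "b = j")
    case True
    then have "\<bar>p\<bar> \<le> h" "\<bar>r\<bar> \<le> h" "p + r \<ge> h" using plus assms(2) by (auto simp: valid_state_def)
    then show ?thesis by (simp only: kernel_B)
  qed simp
  show ?case unfolding pt ext_sum_lin A B using assms(2) by (simp add: lev_def algebra_simps)
qed

text \<open>By \<open>ext_sum_residue\<close> half of the mass closes a chain of level
  \<open>M\<close>. As \<open>M\<close> is at least 2, the digit sum is close to \<open>h\<close>,
  and two extreme digits can occur only for q = 2. There nothing closes in state \<open>A\<close>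
  and everything in state \<open>B\<close>, in accordance with the values of \<open>omA\<close> and
  \<open>omB\<close>.\<close>

lemma dead_sum:
  assumes "valid_state M p r a b a' b'" "M \<ge> 2"
  shows "ext_sum p r (\<lambda>d e. if dead M (d + e) a b a' b' then cl 4 2 1 d e else 0) = 2 * H\<^sup>2 * lev M p r a b a' b'"
  using assms(1)
proof (induction rule: valid_state_wlog)
  case (flip p r a b a' b')
  have dd: "dead M (- d + - e) a' b' a b = dead M (d + e) a b a' b'" for d e
    using dead_flip[of M "d + e"] by simp
  show ?case using flip(2) unfolding ext_sum_uminus[of p r] dd cl_uminus lev_flip .
next
  case (plus p r a b)
  have le: "a \<le> M" "b \<le> M" "\<bar>p\<bar> \<le> h" "\<bar>r\<bar> \<le> h" using plus by (auto simp: valid_state_def)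
  have pt: "(if dead M (d + e) a b 0 0 then cl 4 2 1 d e else 0) =
     of_bool (a = M) * (if (d + e) mod q \<ge> h then cl 4 2 1 d e else 0) +
     of_bool (b = M) * (cl 4 2 1 d e - (if (d + e) mod q \<ge> h then cl 4 2 1 d e else 0))" for d e
    using le assms(2) by (auto simp: dead_def fire_def)
  have A: "of_bool (a = M) * ext_sum p r (\<lambda>d e. if (d + e) mod q \<ge> h then cl 4 2 1 d e else 0) =
      of_bool (a = M) * (2 * H\<^sup>2 * omA p r)"
  proof (cases "a = M")
    case True
    then have pr: "p + r = h - 1 \<or> p + r = h" using plus assms(2) by (auto simp: valid_state_def)
    show ?thesis
    proof (cases "\<bar>p\<bar> < h \<or> \<bar>r\<bar> < h")
      case True
      then show ?thesis using ext_sum_residue[OF le(3,4) True] by (auto simp: omA_def cl_def)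
    next
      case False
      then have "h = 1" "p = 1 \<and> r = - 1 \<or> p = - 1 \<and> r = 1" using le pr h_ge by linarith+
      then show ?thesis by (auto simp: ext_sum_def nx_def omA_def cl_def)
    qed
  qed simp
  have B: "of_bool (b = M) * (ext_sum p r (cl 4 2 1) - ext_sum p r (\<lambda>d e. if (d + e) mod q \<ge> h then cl 4 2 1 d e else 0)) =
      of_bool (b = M) * (2 * H\<^sup>2 * omB p r)"
  proof (cases "b = M")
    case True
    then have pr: "p + r = h \<or> p + r = h + 1" using plus assms(2) by (auto simp: valid_state_def)
    show ?thesis
    proof (cases "\<bar>p\<bar> < h \<or> \<bar>r\<bar> < h")
      case True
      then show ?thesis using ext_sum_residue[OF le(3,4) True] ext_sum_vv[OF le(3,4)] by (auto simp: omB_def cl_def)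
    next
      case False
      then have "h = 1" "p = 1" "r = 1" using le pr h_ge by linarith+
      then show ?thesis by (auto simp: ext_sum_def nx_def omB_def cl_def)
    qed
  qed simp
  show ?case unfolding pt ext_sum_lin A B using assms(2) by (simp add: lev_def algebra_simps)
qed

section \<open>The potential\<close>

text \<open>The constants \<open>al0\<close>, \<open>al1\<close>, \<open>al2\<close>, \<open>be0\<close>, \<open>be1\<close> solve the linear system which says that the
  contributions of open chains to the potential are reproduced by reading one more pair of digits;
  eliminating all but \<open>al0\<close> and \<open>al1\<close> leaves a two by two system with determinant \<open>Ddt\<close>. The
  corrections \<open>ga1\<close>, \<open>gas\<close>, \<open>gao\<close> then absorb the dependence of the influx on the last digits, and
  \<open>flux\<close> is the remaining constant, from which \<open>delta\<close> arises.\<close>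

definition "Pdt = 16 * H^4 - H^2 - H"
definition "Rdt = 16 * H^4 - 2 * H + 2"
definition "c1dt = - 4 * (H - 1)^2 - 16 * H^3"
definition "c2dt = - 4 * (H - 1)^2 - 8 * H^2"
definition "Ddt = Pdt * Rdt - 2 * (H - 1) * H^2"
definition "al0 = (c1dt * Rdt + 2 * (H - 1) * c2dt) / Ddt"
definition "al1 = (Pdt * c2dt + H^2 * c1dt) / Ddt"
definition "be0 = (H * al0 + 2 * al1 - 4 * (H - 1)) / (4 * H^2)"
definition "be1 = H * al0 / (4 * H^2)"
definition "al2 = (H - 1) * be0 / (4 * H^2)"

lemma Ddt_pos: "Ddt > 0"
proof -
  have p: "H^4 \<ge> H^2" "H^4 \<ge> H" "H^4 \<ge> 1" "H^4 > 0"
    using power_increasing[of 2 4 H] power_increasing[of 1 4 H] power_increasing[of 0 4 H] H_ge by auto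
  have "14 * H^4 \<le> Pdt" "14 * H^4 \<le> Rdt" using p H_ge unfolding Pdt_def Rdt_def by linarith+
  then have "14 * H^4 * (14 * H^4) \<le> Pdt * Rdt" using p by (intro mult_mono) auto
  moreover have "2 * (H - 1) * H^2 \<le> 2 * H^4 * H^4"
    by (intro mult_mono) (use p H_ge zero_le_power2[of H] in linarith)+
  moreover have "0 < H^4 * H^4" using p by simp
  ultimately show ?thesis unfolding Ddt_def by linarith
qed

text \<open>Cramer's rule, multiplied through by the determinant so that only polynomial identities
  have to be checked.\<close>

lemma al_solve:
  "Pdt * al0 - 2 * (H - 1) * al1 = c1dt" "- (H^2) * al0 + Rdt * al1 = c2dt"
proof -
  have n: "Ddt \<noteq> 0" using Ddt_pos by simp
  have "Pdt * (c1dt * Rdt + 2 * (H - 1) * c2dt) - 2 * (H - 1) * (Pdt * c2dt + H^2 * c1dt) = c1dt * Ddt"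
    "- (H^2) * (c1dt * Rdt + 2 * (H - 1) * c2dt) + Rdt * (Pdt * c2dt + H^2 * c1dt) = c2dt * Ddt"
    unfolding Ddt_def by algebra+
  moreover have "al0 * Ddt = c1dt * Rdt + 2 * (H - 1) * c2dt" "al1 * Ddt = Pdt * c2dt + H^2 * c1dt"
    unfolding al0_def al1_def using n by simp_all
  ultimately have "Ddt * (Pdt * al0 - 2 * (H - 1) * al1) = Ddt * c1dt" "Ddt * (- (H^2) * al0 + Rdt * al1) = Ddt * c2dt"
    by algebra+
  then show "Pdt * al0 - 2 * (H - 1) * al1 = c1dt" "- (H^2) * al0 + Rdt * al1 = c2dt"
    unfolding mult_left_cancel[OF n] .
qed

lemma be_eqs:
  "4 * H^2 * be0 = H * al0 + 2 * al1 - 4 * (H - 1)" "4 * H^2 * be1 = H * al0" "4 * H^2 * al2 = (H - 1) * be0"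
proof -
  have n: "4 * H^2 \<noteq> 0" using H_ge by auto
  show "4 * H^2 * be0 = H * al0 + 2 * al1 - 4 * (H - 1)" unfolding be0_def using n by simp
  show "4 * H^2 * be1 = H * al0" unfolding be1_def using n by simp
  show "4 * H^2 * al2 = (H - 1) * be0" unfolding al2_def using n by simp
qed

lemma al_eqs:
  "4 * H^2 * al0 = (H - 1) * be0 + 2 * be1 - 4 * H" "4 * H^2 * al1 = (H - 1) * be0 + be1 - 2"
proof -
  have n: "4 * H^2 \<noteq> 0" using H_ge by auto
  have "4 * H^2 * (4 * H^2 * al0) = 4 * H^2 * ((H - 1) * be0 + 2 * be1 - 4 * H)"
    "4 * H^2 * (4 * H^2 * al1) = 4 * H^2 * ((H - 1) * be0 + be1 - 2)"
    using al_solve be_eqs unfolding Pdt_def Rdt_def c1dt_def c2dt_def by algebra+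
  then show "4 * H^2 * al0 = (H - 1) * be0 + 2 * be1 - 4 * H" "4 * H^2 * al1 = (H - 1) * be0 + be1 - 2"
    unfolding mult_left_cancel[OF n] .
qed

text \<open>The influx, with every started chain valued by level weight plus potential:
  \<open>S0\<close> for two free last digits, \<open>S1\<close> for one extreme digit,
  \<open>Ss\<close> for two equal extreme digits. For opposite extreme digits no chain can
  start.\<close>

definition "S0 = 2 * (H * (H - 1) / 2 * (4 + al0) + 2 * H * (2 + al1) + (2 * (H - 1) / H + al2) +
  (H - 1) * (H - 2) / 2 * (4 + be0) + 2 * (H - 1) * (2 + be1) + (2 + be1))"
definition "S1 = H * (H - 1) / 2 * (4 + al0) + (H + 1) * (2 + al1) + (H - 1) * (H - 2) / 2 * (4 + be0) + (H - 1) * (2 + be1)"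
definition "Ss = H * (H - 1) / 2 * (4 + al0) + (H - 1) * (H - 2) / 2 * (4 + be0)"
text \<open>The solvability condition for the corrections: the mean of the influx divided by the
  weight 4, 2 or 1 under the stationary law of the last digits. In that law, with words weighted by
  their continuations, a digit is free with probability \<open>2 * H / (2 * H + 1)\<close>, and the
  two signs of an extreme digit are equally likely.\<close>

definition "flux = (4 * H^2 * S0 + 8 * H * S1 + 2 * Ss) / (4 * (2 * H + 1)^2)"
definition "ga1 = (S1 - 2 * flux) / (4 * H^2 - 2 * H)"
definition "gas = (Ss - flux) / (4 * H^2)"
definition "gao = - flux / (4 * H^2)"

lemma ga_eqs:
  "S0 + 4 * (2 * H - 1) * ga1 + 2 * gas + 2 * gao = 4 * flux"
  "S1 + 2 * H * ga1 = 4 * H^2 * ga1 + 2 * flux" "Ss = 4 * H^2 * gas + flux" "0 = 4 * H^2 * gao + flux"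
proof -
  have n: "4 * H^2 - 2 * H \<noteq> 0" "H \<noteq> 0" "2 * H + 1 \<noteq> 0"
    using H_ge by (auto simp: power2_eq_square)
  show g1: "S1 + 2 * H * ga1 = 4 * H^2 * ga1 + 2 * flux" unfolding ga1_def using n(1) by (simp add: field_simps)
  show gs: "Ss = 4 * H^2 * gas + flux" unfolding gas_def using n(2) by simp
  show go: "0 = 4 * H^2 * gao + flux" unfolding gao_def using n(2) by simp
  have f: "4 * (2 * H + 1)^2 * flux = 4 * H^2 * S0 + 8 * H * S1 + 2 * Ss" unfolding flux_def using n(3) by simp
  have g1': "2 * H * (2 * H - 1) * ga1 = S1 - 2 * flux" using g1 by (simp add: power2_eq_square algebra_simps)
  have "4 * H^2 * (S0 + 4 * (2 * H - 1) * ga1 + 2 * gas + 2 * gao) = 4 * H^2 * (4 * flux)"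
    using g1' gs go f by algebra
  then show "S0 + 4 * (2 * H - 1) * ga1 + 2 * gas + 2 * gao = 4 * flux" using n(2) by simp
qed

text \<open>Under \<open>Q = 2 * H\<close> the two long polynomials in \<open>delta\<close> become
  \<open>num\<close> and \<open>2 * w\<close>, where \<open>H * w\<close> is the determinant
  \<open>Ddt\<close>. Clearing denominators leaves a polynomial identity in
  \<open>H\<close>.\<close>

lemma delta_flux: "delta Q = flux / (16 * H^3)"
proof -
  define w where "w = 256 * H^7 - 16 * H^5 - 48 * H^4 + 32 * H^3 + 2 * H - 2"
  have Hn: "H \<noteq> 0" "2 * H + 1 \<noteq> 0" using H_ge by auto
  have Dw: "Ddt = H * w" unfolding Ddt_def Pdt_def Rdt_def w_def by algebra
  then have wn: "w \<noteq> 0" using Ddt_pos by auto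
  define E where "E = 4 * H^2 * S0 + 8 * H * S1 + 2 * Ss"
  define num where "num = 4096 * H^10 + 5120 * H^9 + 4608 * H^8 - 512 * H^7 - 640 * H^6 + 224 * H^5 + 704 * H^4
    - 232 * H^3 - 32 * H^2 - 40 * H + 16"
  have a: "al0 * (H * w) = c1dt * Rdt + 2 * (H - 1) * c2dt" "al1 * (H * w) = Pdt * c2dt + H^2 * c1dt"
    unfolding al0_def al1_def using Hn wn by (simp_all add: Dw)
  have E1: "E = 4 * H^3 * (H - 1) * (4 + al0) + 16 * H^3 * (2 + al1) + 16 * H * (H - 1) + 2 * (H - 1) * be0
      + 4 * H^2 * (H - 1) * (H - 2) * (4 + be0) + 16 * H^2 * (H - 1) * (2 + be1) + 8 * H^2 * (2 + be1)
      + 4 * H^2 * (H - 1) * (4 + al0) + 8 * H * (H + 1) * (2 + al1) + 4 * H * (H - 1) * (H - 2) * (4 + be0)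
      + 8 * H * (H - 1) * (2 + be1) + H * (H - 1) * (4 + al0) + (H - 1) * (H - 2) * (4 + be0)"
  proof -
    define u where "u = 2 * (H - 1) / H"
    have u: "u * H = 2 * (H - 1)" unfolding u_def using Hn(1) by simp
    show ?thesis using u be_eqs(3) unfolding E_def S0_def S1_def Ss_def u_def[symmetric] by algebra
  qed
  have "4 * H^2 * (H * w) * E = 4 * H^2 * (H * w) * ((2 * H - 1) * num / w)"
  proof -
    have "4 * H^2 * E = (4 * H^3 * (H - 1) + 4 * H^2 * (H - 1) + H * (H - 1)) * (4 * H^2) * (4 + al0)
      + (16 * H^3 + 8 * H * (H + 1)) * (4 * H^2) * (2 + al1) + 64 * H^3 * (H - 1)
      + (4 * H^2 * (H - 1) * (H - 2) + 4 * H * (H - 1) * (H - 2) + (H - 1) * (H - 2)) * (16 * H^2 + (H * al0 + 2 * al1 - 4 * (H - 1)))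
      + 2 * (H - 1) * (H * al0 + 2 * al1 - 4 * (H - 1))
      + (16 * H^2 * (H - 1) + 8 * H^2 + 8 * H * (H - 1)) * (8 * H^2 + H * al0)"
      using E1 be_eqs(1,2) by algebra
    then have "4 * H^2 * (H * w) * E = (4 * H^3 * (H - 1) + 4 * H^2 * (H - 1) + H * (H - 1)) * (4 * H^2) * (4 * (H * w) + al0 * (H * w))
      + (16 * H^3 + 8 * H * (H + 1)) * (4 * H^2) * (2 * (H * w) + al1 * (H * w)) + 64 * H^3 * (H - 1) * (H * w)
      + (4 * H^2 * (H - 1) * (H - 2) + 4 * H * (H - 1) * (H - 2) + (H - 1) * (H - 2)) * (16 * H^2 * (H * w) + (H * (al0 * (H * w)) + 2 * (al1 * (H * w)) - 4 * (H - 1) * (H * w)))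
      + 2 * (H - 1) * (H * (al0 * (H * w)) + 2 * (al1 * (H * w)) - 4 * (H - 1) * (H * w))
      + (16 * H^2 * (H - 1) + 8 * H^2 + 8 * H * (H - 1)) * (8 * H^2 * (H * w) + H * (al0 * (H * w)))"
      by algebra
    also have "\<dots> = 4 * H^3 * ((2 * H - 1) * num)"
      unfolding a unfolding w_def num_def c1dt_def c2dt_def Pdt_def Rdt_def by algebra
    also have "\<dots> = 4 * H^2 * (H * w) * ((2 * H - 1) * num / w)" using wn by (simp add: field_simps power2_eq_square power3_eq_cube)
    finally show ?thesis .
  qed
  then have "w * E = (2 * H - 1) * num" using Hn wn by simp
  then have Ew: "E = (2 * H - 1) * num / w" using wn by (simp add: field_simps)
  have n': "4*Q^10 + 10*Q^9 + 18*Q^8 - 4*Q^7 - 10*Q^6 + 7*Q^5 + 44*Q^4 - 29*Q^3 - 8*Q^2 - 20*Q + 16 = num"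
    "4*Q^7 - Q^5 - 6*Q^4 + 8*Q^3 + 2*Q - 4 = 2 * w" "4 * Q^3 = 32 * H^3"
    unfolding Q_eq num_def w_def by (simp_all add: power_mult_distrib)
  have "delta Q = (2 * H - 1) * num / (32 * H^3 * (2 * H + 1)^2 * (2 * w))"
    unfolding delta_def n' unfolding Q_eq ..
  also have "\<dots> = E / (4 * (2 * H + 1)^2) / (16 * H^3)" unfolding Ew using wn Hn by (simp add: field_simps)
  finally show ?thesis unfolding flux_def E_def .
qed

lemma ext_sum_two_sided:
  "ext_sum p r (\<lambda>d e. if d + e \<ge> h \<or> - (d + e) \<ge> h then cl c0 c1 c2 d e else 0) =
    ext_sum p r (\<lambda>d e. if d + e \<ge> h then cl c0 c1 c2 d e else 0) +
    ext_sum (- p) (- r) (\<lambda>d e. if d + e \<ge> h then cl c0 c1 c2 d e else 0)"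
  "ext_sum p r (\<lambda>d e. if d + e > h \<or> - (d + e) > h then cl c0 c1 c2 d e else 0) =
    ext_sum p r (\<lambda>d e. if d + e > h then cl c0 c1 c2 d e else 0) +
    ext_sum (- p) (- r) (\<lambda>d e. if d + e > h then cl c0 c1 c2 d e else 0)"
  unfolding ext_sum_uminus cl_uminus ext_sum_lin(1)[symmetric]
  by (intro ext_sum_cong; use h_ge in force)+

definition alA :: "int \<Rightarrow> int \<Rightarrow> real" where "alA = cl al0 al1 al2"
definition beB :: "int \<Rightarrow> int \<Rightarrow> real" where "beB = cl be0 be1 be1"

text \<open>It sees whether chains are open but not their levels, and is therefore bounded
  independently of \<open>M\<close>.\<close>

definition potential :: stfun where
  "potential p r a b a' b' = alA p r * (of_bool (a > 0) + of_bool (a' > 0)) +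
    beB p r * (of_bool (b > 0) + of_bool (b' > 0)) + cl4 0 ga1 gas gao p r"

lemma potential_flip: "potential (- d) (- e) a' b' a b = potential d e a b a' b'"
  by (simp add: potential_def alA_def beB_def cl_uminus cl4_def)

lemma two_sided_value:
  assumes "\<bar>p\<bar> \<le> h" "\<bar>r\<bar> \<le> h"
  shows "ext_sum p r (\<lambda>d e. if d + e \<ge> h \<or> - (d + e) \<ge> h then cl c0 c1 c2 d e else 0) =
    cl4 (2 * (H * (H - 1) / 2 * c0 + 2 * H * c1 + c2)) (H * (H - 1) / 2 * c0 + (H + 1) * c1) (H * (H - 1) / 2 * c0) 0 p r" (is ?A1)
   "ext_sum p r (\<lambda>d e. if d + e > h \<or> - (d + e) > h then cl c0 c1 c2 d e else 0) =
    cl4 (2 * ((H - 1) * (H - 2) / 2 * c0 + 2 * (H - 1) * c1 + c2)) ((H - 1) * (H - 2) / 2 * c0 + (H - 1) * c1)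
      ((H - 1) * (H - 2) / 2 * c0) 0 p r" (is ?A2)
proof -
  have m: "\<bar>- p\<bar> \<le> h" "\<bar>- r\<bar> \<le> h" using assms by auto
  define A B C where "A = H * (H - 1) / 2 * c0" and "B = (H - 1) * (H - 2) / 2 * c0" and "C = H * c1"
  have C: "2 * H * c1 = 2 * C" "(H + 1) * c1 = C + c1" "2 * (H - 1) * c1 = 2 * C - 2 * c1" "(H - 1) * c1 = C - c1"
    by (simp_all add: C_def algebra_simps)
  have P: "p = h \<or> p = - h \<or> \<bar>p\<bar> < h" "r = h \<or> r = - h \<or> \<bar>r\<bar> < h" using assms by linarith+
  note R = ext_sum_two_sided ext_sum_ge[OF assms] ext_sum_ge[OF m] cl4_def A_def[symmetric] B_def[symmetric] C C_def[symmetric]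
  consider "\<bar>p\<bar> < h" "\<bar>r\<bar> < h" | "p = h" "\<bar>r\<bar> < h" | "p = - h" "\<bar>r\<bar> < h" | "\<bar>p\<bar> < h" "r = h" | "\<bar>p\<bar> < h" "r = - h"
    | "p = h" "r = h" | "p = - h" "r = - h" | "p = h" "r = - h" | "p = - h" "r = h"
    using P by blast
  then have "?A1 \<and> ?A2"
  proof cases
    case 1
    have e: "\<not> p = h" "\<not> p = - h" "\<not> - p = h" "\<not> - p = - h" "\<not> \<bar>p\<bar> = h" "\<not> r = h" "\<not> r = - h" "\<not> - r = h" "\<not> - r = - h" "\<not> \<bar>r\<bar> = h"
      using 1 h_ge by linarith+
    have e': "\<bar>p\<bar> < h" "\<bar>- p\<bar> < h" "\<bar>r\<bar> < h" "\<bar>- r\<bar> < h"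
      using 1 h_ge by linarith+
    note e = e e'[THEN eqTrueI]
    have a: ?A1 by (simp only: R e simp_thms if_True if_False; simp add: algebra_simps)
    have b: ?A2 by (simp only: R e simp_thms if_True if_False; simp add: algebra_simps)
    show ?thesis using a b by blast
  next
    case 2
    have e: "\<not> \<bar>p\<bar> < h" "\<not> \<bar>- p\<bar> < h" "\<not> p = - h" "\<not> - p = h" "\<not> r = h" "\<not> r = - h" "\<not> - r = h" "\<not> - r = - h" "\<not> \<bar>r\<bar> = h"
      using 2 h_ge by linarith+
    have e': "p = h" "- p = - h" "\<bar>p\<bar> = h" "\<bar>r\<bar> < h" "\<bar>- r\<bar> < h"
      using 2 h_ge by linarith+
    note e = e e'[THEN eqTrueI]
    have a: ?A1 by (simp only: R e simp_thms if_True if_False; simp add: algebra_simps)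
    have b: ?A2 by (simp only: R e simp_thms if_True if_False; simp add: algebra_simps)
    show ?thesis using a b by blast
  next
    case 3
    have e: "\<not> \<bar>p\<bar> < h" "\<not> \<bar>- p\<bar> < h" "\<not> p = h" "\<not> - p = - h" "\<not> r = h" "\<not> r = - h" "\<not> - r = h" "\<not> - r = - h" "\<not> \<bar>r\<bar> = h"
      using 3 h_ge by linarith+
    have e': "p = - h" "- p = h" "\<bar>p\<bar> = h" "\<bar>r\<bar> < h" "\<bar>- r\<bar> < h"
      using 3 h_ge by linarith+
    note e = e e'[THEN eqTrueI]
    have a: ?A1 by (simp only: R e simp_thms if_True if_False; simp add: algebra_simps)
    have b: ?A2 by (simp only: R e simp_thms if_True if_False; simp add: algebra_simps)
    show ?thesis using a b by blast
  next
    case 4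
    have e: "\<not> p = h" "\<not> p = - h" "\<not> - p = h" "\<not> - p = - h" "\<not> \<bar>p\<bar> = h" "\<not> \<bar>r\<bar> < h" "\<not> \<bar>- r\<bar> < h" "\<not> r = - h" "\<not> - r = h"
      using 4 h_ge by linarith+
    have e': "\<bar>p\<bar> < h" "\<bar>- p\<bar> < h" "r = h" "- r = - h" "\<bar>r\<bar> = h"
      using 4 h_ge by linarith+
    note e = e e'[THEN eqTrueI]
    have a: ?A1 by (simp only: R e simp_thms if_True if_False; simp add: algebra_simps)
    have b: ?A2 by (simp only: R e simp_thms if_True if_False; simp add: algebra_simps)
    show ?thesis using a b by blast
  next
    case 5
    have e: "\<not> p = h" "\<not> p = - h" "\<not> - p = h" "\<not> - p = - h" "\<not> \<bar>p\<bar> = h" "\<not> \<bar>r\<bar> < h" "\<not> \<bar>- r\<bar> < h" "\<not> r = h" "\<not> - r = - h"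
      using 5 h_ge by linarith+
    have e': "\<bar>p\<bar> < h" "\<bar>- p\<bar> < h" "r = - h" "- r = h" "\<bar>r\<bar> = h"
      using 5 h_ge by linarith+
    note e = e e'[THEN eqTrueI]
    have a: ?A1 by (simp only: R e simp_thms if_True if_False; simp add: algebra_simps)
    have b: ?A2 by (simp only: R e simp_thms if_True if_False; simp add: algebra_simps)
    show ?thesis using a b by blast
  next
    case 6
    have e: "\<not> \<bar>p\<bar> < h" "\<not> \<bar>- p\<bar> < h" "\<not> p = - h" "\<not> - p = h" "\<not> \<bar>r\<bar> < h" "\<not> \<bar>- r\<bar> < h" "\<not> r = - h" "\<not> - r = h"
      using 6 h_ge by linarith+
    have e': "p = h" "- p = - h" "\<bar>p\<bar> = h" "r = h" "- r = - h" "\<bar>r\<bar> = h" "p = r"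
      using 6 h_ge by linarith+
    note e = e e'[THEN eqTrueI]
    have a: ?A1 by (simp only: R e simp_thms if_True if_False; simp add: algebra_simps)
    have b: ?A2 by (simp only: R e simp_thms if_True if_False; simp add: algebra_simps)
    show ?thesis using a b by blast
  next
    case 7
    have e: "\<not> \<bar>p\<bar> < h" "\<not> \<bar>- p\<bar> < h" "\<not> p = h" "\<not> - p = - h" "\<not> \<bar>r\<bar> < h" "\<not> \<bar>- r\<bar> < h" "\<not> r = h" "\<not> - r = - h"
      using 7 h_ge by linarith+
    have e': "p = - h" "- p = h" "\<bar>p\<bar> = h" "r = - h" "- r = h" "\<bar>r\<bar> = h" "p = r"
      using 7 h_ge by linarith+
    note e = e e'[THEN eqTrueI]
    have a: ?A1 by (simp only: R e simp_thms if_True if_False; simp add: algebra_simps)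
    have b: ?A2 by (simp only: R e simp_thms if_True if_False; simp add: algebra_simps)
    show ?thesis using a b by blast
  next
    case 8
    have e: "\<not> \<bar>p\<bar> < h" "\<not> \<bar>- p\<bar> < h" "\<not> p = - h" "\<not> - p = h" "\<not> \<bar>r\<bar> < h" "\<not> \<bar>- r\<bar> < h" "\<not> r = h" "\<not> - r = - h" "\<not> p = r"
      using 8 h_ge by linarith+
    have e': "p = h" "- p = - h" "\<bar>p\<bar> = h" "r = - h" "- r = h" "\<bar>r\<bar> = h"
      using 8 h_ge by linarith+
    note e = e e'[THEN eqTrueI]
    have a: ?A1 by (simp only: R e simp_thms if_True if_False; simp add: algebra_simps)
    have b: ?A2 by (simp only: R e simp_thms if_True if_False; simp add: algebra_simps)
    show ?thesis using a b by blast
  next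
    case 9
    have e: "\<not> \<bar>p\<bar> < h" "\<not> \<bar>- p\<bar> < h" "\<not> p = h" "\<not> - p = - h" "\<not> \<bar>r\<bar> < h" "\<not> \<bar>- r\<bar> < h" "\<not> r = - h" "\<not> - r = h" "\<not> p = r"
      using 9 h_ge by linarith+
    have e': "p = - h" "- p = h" "\<bar>p\<bar> = h" "r = h" "- r = - h" "\<bar>r\<bar> = h"
      using 9 h_ge by linarith+
    note e = e e'[THEN eqTrueI]
    have a: ?A1 by (simp only: R e simp_thms if_True if_False; simp add: algebra_simps)
    have b: ?A2 by (simp only: R e simp_thms if_True if_False; simp add: algebra_simps)
    show ?thesis using a b by blast
  qed
  then show ?A1 ?A2 by blast+
qed

lemma start_sum:
  assumes "\<bar>p\<bar> \<le> h" "\<bar>r\<bar> \<le> h"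
  shows "ext_sum p r (\<lambda>d e. if d + e \<ge> h \<or> - (d + e) \<ge> h then cl (4 + al0) (2 + al1) (2 * (H - 1) / H + al2) d e else 0) +
    ext_sum p r (\<lambda>d e. if d + e > h \<or> - (d + e) > h then cl (4 + be0) (2 + be1) (2 + be1) d e else 0) +
    ext_sum p r (cl4 0 ga1 gas gao) = 4 * H\<^sup>2 * cl4 0 ga1 gas gao p r + flux * cl 4 2 1 p r"
proof -
  define u where "u = 2 * (H - 1) / H"
  note V = two_sided_value[OF assms] ext_sum_cl4[OF assms] u_def[symmetric]
  note G = ga_eqs[unfolded S0_def S1_def Ss_def u_def[symmetric]]
  have c4: "cl4 a0 a1 a2 a3 p r + cl4 b0 b1 b2 b3 p r = cl4 (a0 + b0) (a1 + b1) (a2 + b2) (a3 + b3) p r"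
    "k * cl4 a0 a1 a2 a3 p r = cl4 (k * a0) (k * a1) (k * a2) (k * a3) p r" for a0 a1 a2 a3 b0 b1 b2 b3 k
    by (simp_all add: cl4_def)
  have cong: "cl4 a0 a1 a2 a3 p r = cl4 b0 b1 b2 b3 p r" if "a0 = b0" "a1 = b1" "a2 = b2" "a3 = b3" for a0 a1 a2 a3 b0 b1 b2 b3
    using that by simp
  show ?thesis unfolding V unfolding cl_cl4 c4
  proof (rule cong)
    show "2 * (H * (H - 1) / 2 * (4 + al0) + 2 * H * (2 + al1) + (u + al2)) +
      2 * ((H - 1) * (H - 2) / 2 * (4 + be0) + 2 * (H - 1) * (2 + be1) + (2 + be1)) +
      ((2 * H - 1)\<^sup>2 * 0 + 4 * (2 * H - 1) * ga1 + 2 * gas + 2 * gao) = 4 * H\<^sup>2 * 0 + flux * 4"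
      using G(1) by algebra
    show "H * (H - 1) / 2 * (4 + al0) + (H + 1) * (2 + al1) + ((H - 1) * (H - 2) / 2 * (4 + be0) + (H - 1) * (2 + be1)) +
      (H * (2 * H - 1) * 0 + 2 * H * ga1) = 4 * H\<^sup>2 * ga1 + flux * 2"
      using G(2) by algebra
    show "H * (H - 1) / 2 * (4 + al0) + (H - 1) * (H - 2) / 2 * (4 + be0) + H\<^sup>2 * 0 = 4 * H\<^sup>2 * gas + flux * 1"
      using G(3) by algebra
    show "0 + 0 + H\<^sup>2 * 0 = 4 * H\<^sup>2 * gao + flux * 1" using G(4) by algebra
  qed
qed

text \<open>If no chain is open, exactly the sums of absolute value at least \<open>h\<close> start
  chains, which is \<open>start_sum\<close>. An open chain changes this at two sums for each state:
  passed on with its sign it adds a value of the potential, and passed on with the opposite sign it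
  takes the place of a new chain and removes mass from level one. The equations for the constants
  say that these changes reproduce the potential.\<close>

lemma potential_step:
  assumes "valid_state M p r a b a' b'"
  shows "ext_sum p r (\<lambda>d e. after (lev 1) a b a' b' d e + after potential a b a' b' d e)
    = 4 * H\<^sup>2 * potential p r a b a' b' + flux * cl 4 2 1 p r"
  using assms
proof (induction rule: valid_state_wlog)
  case (flip p r a b a' b')
  show ?case using flip(2) unfolding ext_sum_uminus[of p r] after_flip[of "lev 1", OF lev_flip]
    after_flip[of potential, OF potential_flip] potential_flip cl_uminus .
next
  case (plus p r a b)
  have le: "\<bar>p\<bar> \<le> h" "\<bar>r\<bar> \<le> h" using plus by (auto simp: valid_state_def)
  have pt: "after (lev 1) a b 0 0 d e + after potential a b 0 0 d e =
      (if d + e \<ge> h \<or> - (d + e) \<ge> h then cl (4 + al0) (2 + al1) (2 * (H - 1) / H + al2) d e else 0) +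
      (if d + e > h \<or> - (d + e) > h then cl (4 + be0) (2 + be1) (2 + be1) d e else 0) + cl4 0 ga1 gas gao d e +
      of_bool (a > 0) * ((if d + e = h then beB d e else 0) - (if d + e = - h then omA d e else 0)) +
      of_bool (b > 0) * ((if d + e = h - 1 then alA d e else 0) - (if d + e = - h - 1 then omB d e else 0))" for d e
  proof -
    define T where "T = d + e"
    have s: "cl (4 + al0) (2 + al1) (2 * (H - 1) / H + al2) d e = omA d e + alA d e"
      "cl (4 + be0) (2 + be1) (2 + be1) d e = omB d e + beB d e"
      by (auto simp: omA_def omB_def alA_def beB_def cl_def)
    consider "T > h + 1" | "T = h + 1" | "T = h" | "T = h - 1" | "- h < T" "T < h - 1" | "T = - h" | "T = - h - 1" | "T < - h - 1"
      by linarith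
    then show ?thesis unfolding T_def[symmetric] s after_def lev_def potential_def
      by cases (use h_ge in \<open>auto simp: next_A_def next_B_def algebra_simps\<close>)
  qed
  have A: "of_bool (a > 0) * (ext_sum p r (\<lambda>d e. if d + e = h then beB d e else 0) -
      ext_sum p r (\<lambda>d e. if d + e = - h then omA d e else 0)) = of_bool (a > 0) * (4 * H\<^sup>2 * alA p r)"
  proof (cases "a > 0")
    case True
    then have k: "\<bar>p\<bar> \<le> h" "\<bar>r\<bar> \<le> h" "p + r \<ge> h - 1" using plus by (auto simp: valid_state_def)
    show ?thesis unfolding beB_def omA_def alA_def ext_sum_h[OF k] ext_sum_minus_h[OF k]
      using al_eqs be_eqs by (simp add: cl_def)
  qed simp
  have B: "of_bool (b > 0) * (ext_sum p r (\<lambda>d e. if d + e = h - 1 then alA d e else 0) -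
      ext_sum p r (\<lambda>d e. if d + e = - h - 1 then omB d e else 0)) = of_bool (b > 0) * (4 * H\<^sup>2 * beB p r)"
  proof (cases "b > 0")
    case True
    then have k: "\<bar>p\<bar> \<le> h" "\<bar>r\<bar> \<le> h" "p + r \<ge> h" using plus by (auto simp: valid_state_def)
    show ?thesis unfolding beB_def omB_def alA_def ext_sum_h_minus_1[OF k] ext_sum_minus_h_minus_1[OF k]
      using be_eqs by (simp add: cl_def)
  qed simp
  show ?case unfolding pt ext_sum_lin A B start_sum[OF le] by (simp add: potential_def algebra_simps)
qed

end

section \<open>The distribution of the number of iterations\<close>

lemma pair_pmf_of_set:
  assumes "finite A" "A \<noteq> {}" "finite B" "B \<noteq> {}"
  shows "pair_pmf (pmf_of_set A) (pmf_of_set B) = pmf_of_set (A \<times> B)"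
proof (rule pmf_eqI)
  fix z :: "'a \<times> 'b"
  show "pmf (pair_pmf (pmf_of_set A) (pmf_of_set B)) z = pmf (pmf_of_set (A \<times> B)) z"
    using assms by (cases z) (auto simp: pmf_pair indicator_def card_cartesian_product)
qed

context even_base
begin

text \<open>The probability of being live when pairs of words are weighted by their eventual number
  of continuations. The factor 1/4 normalises it, since the empty word counts as having two free
  last digits, of weight 4.\<close>

definition surv :: "nat \<Rightarrow> nat \<Rightarrow> real" where
  "surv M n = W M n (\<lambda>p r a b a' b'. (1/4) * cl 4 2 1 p r)"

definition Phi :: "nat \<Rightarrow> nat \<Rightarrow> nat \<Rightarrow> real" where "Phi M j n = W M n (lev j)"

definition Psi :: "nat \<Rightarrow> nat \<Rightarrow> real" where "Psi M n = W M n potential"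

definition killed :: "nat \<Rightarrow> stfun \<Rightarrow> stfun" where
  "killed M F p r a b a' b' = ext_sum p r (\<lambda>d e. if dead M (d + e) a b a' b' then after F a b a' b' d e else 0)"

lemma Q_sq: "Q\<^sup>2 = 4 * H\<^sup>2"
  by (simp add: Q_eq)

lemma W_Suc':
  "W M (Suc n) F = W M n (\<lambda>p r a b a' b'. ext_sum p r (after F a b a' b')) / Q\<^sup>2 - W M n (killed M F) / Q\<^sup>2"
proof -
  have "ext_sum p r (\<lambda>d e. if dead M (d + e) a b a' b' then 0 else after F a b a' b' d e) =
    ext_sum p r (after F a b a' b') - killed M F p r a b a' b'" for p r a b a' b'
    unfolding killed_def ext_sum_lin(2)[symmetric] by (intro ext_sum_cong) auto
  then show ?thesis unfolding W_Suc W_lin(2)[symmetric] diff_divide_distrib[symmetric] by simp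
qed

lemma cl_ge_1: "cl 4 2 1 p r \<ge> 1"
  by (simp add: cl_def)

lemma W_killed_cl:
  assumes "M \<ge> 2"
  shows "W M n (killed M (\<lambda>p r a b a' b'. cl 4 2 1 p r)) = 2 * H\<^sup>2 * Phi M M n"
  unfolding Phi_def W_lin(3)[symmetric] killed_def after_def
  by (rule W_cong) (use assms dead_sum in auto)

text \<open>The weight \<open>cl 4 2 1\<close> is at least 1, so the discarded part of any function
  bounded by \<open>C\<close> is at most \<open>C\<close> times the discarded weight, which
  \<open>W_killed_cl\<close> knows exactly.\<close>

lemma W_killed_bound:
  assumes "M \<ge> 2" "\<And>p r a b a' b'. \<bar>F p r a b a' b'\<bar> \<le> C"
  shows "\<bar>W M n (killed M F) / Q\<^sup>2\<bar> \<le> C * Phi M M n / 2"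
proof -
  have C: "C \<ge> 0" using assms(2)[of 0 0 0 0 0 0] by linarith
  have "\<bar>killed M F p r a b a' b'\<bar> \<le> C * killed M (\<lambda>p r a b a' b'. cl 4 2 1 p r) p r a b a' b'" for p r a b a' b'
  proof -
    have "\<bar>killed M F p r a b a' b'\<bar> \<le> (\<Sum>d\<in>nx p. \<Sum>e\<in>nx r. \<bar>if dead M (d + e) a b a' b' then after F a b a' b' d e else 0\<bar>)"
      unfolding killed_def ext_sum_def by (intro order_trans[OF sum_abs] sum_mono sum_abs)
    also have "\<dots> \<le> (\<Sum>d\<in>nx p. \<Sum>e\<in>nx r. C * (if dead M (d + e) a b a' b' then cl 4 2 1 d e else 0))"
    proof (intro sum_mono)
      fix d e
      have "\<bar>after F a b a' b' d e\<bar> \<le> C" unfolding after_def by (rule assms(2))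
      also have "C \<le> C * cl 4 2 1 d e" using mult_left_mono[OF cl_ge_1 C, of d e] by simp
      finally show "\<bar>if dead M (d + e) a b a' b' then after F a b a' b' d e else 0\<bar> \<le>
        C * (if dead M (d + e) a b a' b' then cl 4 2 1 d e else 0)" by simp
    qed
    finally show ?thesis unfolding killed_def ext_sum_def after_def sum_distrib_left .
  qed
  then have "\<bar>W M n (killed M F)\<bar> \<le> W M n (\<lambda>p r a b a' b'. C * killed M (\<lambda>p r a b a' b'. cl 4 2 1 p r) p r a b a' b')"
    by (intro W_abs) (use assms in auto)
  also have "\<dots> = C * (2 * H\<^sup>2 * Phi M M n)" unfolding W_lin(3) W_killed_cl[OF assms(1)] ..
  finally show ?thesis unfolding Q_sq using H_ge by (simp add: field_simps)
qed

lemma valid_state_abs: "valid_state M p r a b a' b' \<Longrightarrow> \<bar>p\<bar> \<le> h" "valid_state M p r a b a' b' \<Longrightarrow> \<bar>r\<bar> \<le> h"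
  unfolding valid_state_def by blast+

text \<open>The weight is an eigenfunction for \<open>Q\<^sup>2\<close>, so only discarded words
  change the sum. Their share is \<open>Phi M M n / 2\<close>, and the normalisation 1/4 gives the
  8.\<close>

lemma surv_Suc:
  assumes "M \<ge> 2"
  shows "surv M (Suc n) = surv M n - Phi M M n / 8"
proof -
  let ?F = "\<lambda>p r a b a' b'. cl 4 2 1 p r"
  have e: "W M n (\<lambda>p r a b a' b'. ext_sum p r (after ?F a b a' b')) = W M n (\<lambda>p r a b a' b'. 4 * H\<^sup>2 * cl 4 2 1 p r)"
    unfolding after_def by (rule W_cong, rule ext_sum_vv[OF valid_state_abs]) (use assms in auto)
  have "W M (Suc n) ?F = W M n ?F - Phi M M n / 2"
    unfolding W_Suc'[of M n ?F] e W_killed_cl[OF assms] Q_sq W_lin(3) using H_ge by (simp add: field_simps)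
  then show ?thesis unfolding surv_def W_lin(3) by simp
qed

lemma Phi_Suc:
  assumes "1 \<le> j" "j < M"
  shows "Phi M (Suc j) (Suc n) = Phi M j n / Q"
proof -
  have "W M n (\<lambda>p r a b a' b'. ext_sum p r (\<lambda>d e. if dead M (d + e) a b a' b' then 0 else after (lev (Suc j)) a b a' b' d e))
    = W M n (\<lambda>p r a b a' b'. 2 * H * lev j p r a b a' b')"
    by (rule W_cong) (use assms lev_step in auto)
  then show ?thesis unfolding Phi_def W_Suc W_lin(3) using H_ge by (simp add: Q_eq power2_eq_square)
qed

lemma lev_bounds: "0 \<le> lev j p r a b a' b'" "lev j p r a b a' b' \<le> 16"
proof -
  have u: "0 \<le> 2 * (H - 1) / H" "2 * (H - 1) / H \<le> 2" using H_ge by (auto simp: field_simps)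
  have A: "0 \<le> omA p r" "omA p r \<le> 4" using u by (auto simp: omA_def cl_def)
  have B: "0 \<le> omB p r" "omB p r \<le> 4" by (auto simp: omB_def cl_def)
  show "0 \<le> lev j p r a b a' b'" unfolding lev_def using A B by simp
  have "omA p r * (of_bool (a = j) + of_bool (a' = j)) \<le> 4 * 2" using A by (intro mult_mono) auto
  moreover have "omB p r * (of_bool (b = j) + of_bool (b' = j)) \<le> 4 * 2" using B by (intro mult_mono) auto
  ultimately show "lev j p r a b a' b' \<le> 16" unfolding lev_def by linarith
qed

definition Cpot :: real where
  "Cpot = (\<bar>al0\<bar> + \<bar>al1\<bar> + \<bar>al2\<bar>) * 2 + (\<bar>be0\<bar> + \<bar>be1\<bar>) * 2 + (\<bar>ga1\<bar> + \<bar>gas\<bar> + \<bar>gao\<bar>)"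

lemma potential_bound: "\<bar>potential p r a b a' b'\<bar> \<le> Cpot"
proof -
  have "\<bar>alA p r\<bar> \<le> \<bar>al0\<bar> + \<bar>al1\<bar> + \<bar>al2\<bar>" "\<bar>beB p r\<bar> \<le> \<bar>be0\<bar> + \<bar>be1\<bar>"
    by (auto simp: alA_def beB_def cl_def)
  then have ab: "\<bar>alA p r * (of_bool (a > 0) + of_bool (a' > 0))\<bar> \<le> (\<bar>al0\<bar> + \<bar>al1\<bar> + \<bar>al2\<bar>) * 2"
    "\<bar>beB p r * (of_bool (b > 0) + of_bool (b' > 0))\<bar> \<le> (\<bar>be0\<bar> + \<bar>be1\<bar>) * 2"
    unfolding abs_mult by (intro mult_mono; simp)+
  have c: "\<bar>cl4 0 ga1 gas gao p r\<bar> \<le> \<bar>ga1\<bar> + \<bar>gas\<bar> + \<bar>gao\<bar>" by (auto simp: cl4_def)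
  have tri: "\<bar>x + y + z\<bar> \<le> \<bar>x\<bar> + \<bar>y\<bar> + \<bar>z\<bar>" for x y z :: real by linarith
  show ?thesis unfolding potential_def Cpot_def
    by (rule order_trans[OF tri add_mono[OF add_mono[OF ab] c]])
qed

lemma W_one_le: "M \<ge> 1 \<Longrightarrow> W M n (\<lambda>p r a b a' b'. 1) \<le> 4 * surv M n"
  unfolding surv_def W_lin(3)[symmetric] by (rule W_mono) (use cl_ge_1 in auto)

lemma surv_0: "surv M 0 = 1"
  using h_ge by (simp add: surv_def W_def SSDE_0 at_word_def live_def cl_def)

lemma Phi_nonneg: "M \<ge> 1 \<Longrightarrow> Phi M j n \<ge> 0"
  unfolding Phi_def W_def at_word_def Let_def
  by (intro divide_nonneg_nonneg sum_nonneg) (use lev_bounds Q_pos in auto)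

lemma surv_antimono: "M \<ge> 2 \<Longrightarrow> m \<le> n \<Longrightarrow> surv M n \<le> surv M m"
  by (rule lift_Suc_antimono_le[of "surv M"]) (use surv_Suc Phi_nonneg[of M M] in auto)

lemma surv_le_1: "M \<ge> 2 \<Longrightarrow> surv M n \<le> 1"
  using surv_antimono[of M 0 n] surv_0 by simp

lemma surv_nonneg: "surv M n \<ge> 0"
  unfolding surv_def W_def at_word_def Let_def
  by (intro divide_nonneg_nonneg sum_nonneg) (use cl_ge_1 Q_pos in \<open>auto intro: order_trans[OF zero_le_one]\<close>)

lemma W_bound:
  assumes "M \<ge> 2" "\<And>p r a b a' b'. \<bar>F p r a b a' b'\<bar> \<le> C"
  shows "\<bar>W M n F\<bar> \<le> 4 * C"
proof -
  have C: "C \<ge> 0" using assms(2)[of 0 0 0 0 0 0] by linarith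
  have "\<bar>W M n F\<bar> \<le> W M n (\<lambda>p r a b a' b'. C * 1)" by (rule W_abs) (use assms in auto)
  also have "\<dots> = C * W M n (\<lambda>p r a b a' b'. 1)" by (rule W_lin(3))
  also have "\<dots> \<le> C * (4 * 1)"
    using W_one_le[of M n] surv_le_1[OF assms(1), of n] assms(1) C by (intro mult_left_mono) linarith+
  finally show ?thesis by simp
qed

lemma Phi_bound: "M \<ge> 2 \<Longrightarrow> Phi M j n \<le> 64"
  using W_bound[of M "lev j" 16 n] lev_bounds by (simp add: Phi_def abs_le_iff)

lemma Psi_bound: "M \<ge> 2 \<Longrightarrow> \<bar>Psi M n\<bar> \<le> 4 * Cpot"
  using W_bound[of M potential Cpot n] potential_bound by (simp add: Psi_def)

lemma Phi_0: "j \<ge> 1 \<Longrightarrow> Phi M j 0 = 0"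
proof -
  assume "j \<ge> 1"
  then have "at_word (lev j) 0 x y = 0" for x y by (simp add: at_word_def lev_def Let_def)
  then show ?thesis unfolding Phi_def W_def by (simp cong: if_cong)
qed

lemma Phi_power: "i < M \<Longrightarrow> Phi M (Suc i) (n + i) = Phi M 1 n / Q ^ i"
proof (induction i)
  case (Suc i)
  then show ?case using Phi_Suc[of "Suc i" M "n + i"] by simp
qed simp

text \<open>A chain takes exactly \<open>M - 1\<close> digits from level one to level
  \<open>M\<close>, each contributing a factor \<open>1 / Q\<close>; before that, level
  \<open>M\<close> is empty. This is the delay equation that links losses to earlier influx.\<close>

lemma Phi_top:
  assumes "M \<ge> 2"
  shows "Phi M M (n + (M - 1)) = Phi M 1 n / Q ^ (M - 1)" "n < M - 1 \<Longrightarrow> Phi M M n = 0"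
    "Phi M M n \<le> 64 / Q ^ (M - 1)"
proof -
  show a: "Phi M M (n + (M - 1)) = Phi M 1 n / Q ^ (M - 1)" for n
    using Phi_power[of "M - 1" M n] assms by simp
  have *: "Phi M (Suc i + j) i = 0" if "Suc i + j \<le> M" for i j
    using that
  proof (induction i arbitrary: j)
    case 0 then show ?case by (simp add: Phi_0)
  next
    case (Suc i)
    then show ?case using Phi_Suc[of "Suc i + j" M i] by simp
  qed
  show b: "Phi M M n = 0" if "n < M - 1" for n
    using *[of n "M - Suc n"] that by simp
  show "Phi M M n \<le> 64 / Q ^ (M - 1)"
  proof (cases "n < M - 1")
    case True then show ?thesis using b Q_pos by simp
  next
    case False
    then have "Phi M M n = Phi M 1 (n - (M - 1)) / Q ^ (M - 1)" using a[of "n - (M - 1)"] by simp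
    then show ?thesis using Phi_bound[OF assms, of 1 "n - (M - 1)"] Q_pos by (simp add: divide_right_mono)
  qed
qed

text \<open>Without discarded words \<open>potential_step\<close> would give equality. Discarding
  changes a function bounded by \<open>16 + Cpot\<close> by a multiple of the discarded mass, which
  is expressed through the decrement of \<open>surv\<close> so that these errors telescope
  later.\<close>

lemma Psi_Suc:
  assumes "M \<ge> 2"
  shows "\<bar>Phi M 1 (Suc n) + Psi M (Suc n) - Psi M n - flux / H\<^sup>2 * surv M n\<bar> \<le> (16 + Cpot) * 4 * (surv M n - surv M (Suc n))"
proof -
  let ?F = "\<lambda>p r a b a' b'. lev 1 p r a b a' b' + potential p r a b a' b'"
  have aF: "after ?F a b a' b' = (\<lambda>d e. after (lev 1) a b a' b' d e + after potential a b a' b' d e)" for a b a' b'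
    by (simp add: after_def fun_eq_iff)
  have "W M n (\<lambda>p r a b a' b'. ext_sum p r (after ?F a b a' b')) =
    W M n (\<lambda>p r a b a' b'. 4 * H\<^sup>2 * potential p r a b a' b' + flux * cl 4 2 1 p r)"
    unfolding aF by (rule W_cong) (use assms potential_step in auto)
  also have "\<dots> = 4 * H\<^sup>2 * Psi M n + 4 * flux * surv M n"
    unfolding W_lin(1) W_lin(3) Psi_def surv_def by simp
  finally have "Phi M 1 (Suc n) + Psi M (Suc n) = (4 * H\<^sup>2 * Psi M n + 4 * flux * surv M n) / Q\<^sup>2 - W M n (killed M ?F) / Q\<^sup>2"
    unfolding Phi_def Psi_def W_lin(1)[symmetric] W_Suc'[of M n ?F] by simp
  also have "(4 * H\<^sup>2 * Psi M n + 4 * flux * surv M n) / Q\<^sup>2 = Psi M n + flux / H\<^sup>2 * surv M n"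
    unfolding Q_sq using H_ge by (simp add: field_simps)
  finally have eq: "Phi M 1 (Suc n) + Psi M (Suc n) - Psi M n - flux / H\<^sup>2 * surv M n = - (W M n (killed M ?F) / Q\<^sup>2)" by simp
  have e: "(16 + Cpot) * 4 * (surv M n - surv M (Suc n)) = (16 + Cpot) * Phi M M n / 2"
    using surv_Suc[OF assms, of n] by simp
  have "\<bar>?F p r a b a' b'\<bar> \<le> 16 + Cpot" for p r a b a' b'
    using lev_bounds[of 1 p r a b a' b'] potential_bound[of p r a b a' b'] by linarith
  then show ?thesis unfolding eq e abs_minus_cancel by (rule W_killed_bound[OF assms])
qed

section \<open>Unweighted counts of live words\<close>

definition count :: "nat \<Rightarrow> nat \<Rightarrow> real" where "count M n = W M n (\<lambda>p r a b a' b'. 1)"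

text \<open>An eigenvalue of at most half of \<open>Q\<^sup>2\<close> halves the sum at each step.
  Discarded words add at most \<open>32 * C / Q ^ (M - 1)\<close> per step, and the geometric series
  doubles this.\<close>

lemma W_eigen:
  assumes "M \<ge> 2" and k: "\<And>p r. \<bar>p\<bar> \<le> h \<Longrightarrow> \<bar>r\<bar> \<le> h \<Longrightarrow> ext_sum p r (cl c0 c1 c2) = k * cl c0 c1 c2 p r"
    and C: "\<And>p r. \<bar>cl c0 c1 c2 p r\<bar> \<le> C" and kQ: "\<bar>k\<bar> \<le> Q\<^sup>2 / 2"
  shows "\<bar>W M n (\<lambda>p r a b a' b'. cl c0 c1 c2 p r)\<bar> \<le> 4 * C / 2 ^ n + 64 * C / Q ^ (M - 1)"
proof (induction n)
  case 0
  have "0 \<le> C" using C[of 0 0] by linarith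
  moreover have "\<bar>W M 0 (\<lambda>p r a b a' b'. cl c0 c1 c2 p r)\<bar> \<le> 4 * C" by (rule W_bound) (use assms in auto)
  ultimately show ?case using Q_pos by (simp add: add_increasing2)
next
  case (Suc n)
  let ?F = "\<lambda>p r a b a' b'. cl c0 c1 c2 p r"
  have "W M n (\<lambda>p r a b a' b'. ext_sum p r (after ?F a b a' b')) = W M n (\<lambda>p r a b a' b'. k * cl c0 c1 c2 p r)"
    unfolding after_def by (rule W_cong, rule k[OF valid_state_abs]) (use assms in auto)
  then have "W M (Suc n) ?F = k / Q\<^sup>2 * W M n ?F - W M n (killed M ?F) / Q\<^sup>2"
    unfolding W_Suc'[of M n ?F] W_lin(3) by simp
  moreover have "\<bar>W M n (killed M ?F) / Q\<^sup>2\<bar> \<le> C * Phi M M n / 2" by (rule W_killed_bound) (use assms in auto)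
  moreover have "C * Phi M M n / 2 \<le> 32 * C / Q ^ (M - 1)"
  proof -
    have "0 \<le> C" using C[of 0 0] by linarith
    then show ?thesis using mult_left_mono[OF Phi_top(3)[OF assms(1), of n], of C] by (simp add: mult.commute)
  qed
  moreover have "\<bar>k / Q\<^sup>2 * W M n ?F\<bar> \<le> 1 / 2 * \<bar>W M n ?F\<bar>"
    unfolding abs_mult using kQ Q_pos by (intro mult_right_mono) (auto simp: field_simps)
  ultimately have "\<bar>W M (Suc n) ?F\<bar> \<le> 1 / 2 * \<bar>W M n ?F\<bar> + 32 * C / Q ^ (M - 1)" by linarith
  also have "\<dots> \<le> 1 / 2 * (4 * C / 2 ^ n + 64 * C / Q ^ (M - 1)) + 32 * C / Q ^ (M - 1)" using Suc by simp
  also have "\<dots> = 4 * C / 2 ^ Suc n + 64 * C / Q ^ (M - 1)" by (simp add: add_divide_distrib)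
  finally show ?case .
qed

definition kap :: real where "kap = 4 * ((1 + H) / (1 + 2 * H))\<^sup>2"

text \<open>For one operand the constant 1 is \<open>A\<close> times the eigenvector (2, 1) plus
  \<open>B\<close> times the eigenvector (1, - H), with eigenvalues \<open>2 * H\<close> and - 1.
  Squaring gives the three functions below with eigenvalues \<open>4 * H\<^sup>2\<close>,
  \<open>- 2 * H\<close> and 1; only the first does not decay, and it leaves the constant
  \<open>kap = 4 * A\<^sup>2\<close>.\<close>

lemma count_approx: "\<exists>C\<ge>0. \<forall>M\<ge>2. \<forall>n. \<bar>count M n - kap * surv M n\<bar> \<le> C / 2 ^ n + C / Q ^ (M - 1)"
proof -
  define A B where "A = (1 + H) / (1 + 2 * H)" and "B = - 1 / (1 + 2 * H)"
  define C where "C = 4 + 2 * H + H\<^sup>2"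
  have C: "C \<ge> 0" "4 \<le> C" "2 * H \<le> C" "H\<^sup>2 \<le> C" using H_ge by (auto simp: C_def)
  have n: "1 + 2 * H \<noteq> 0" using H_ge by auto
  have A2: "2 * A + B = 1" "A - H * B = 1"
  proof -
    define w where "w = 1 / (1 + 2 * H)"
    have w: "w * (1 + 2 * H) = 1" and AB: "A = (1 + H) * w" "B = - w" using n by (simp_all add: w_def A_def B_def)
    show "2 * A + B = 1" "A - H * B = 1" unfolding AB using w by algebra+
  qed
  have c1: "\<bar>cl 4 (1 - 2 * H) (- 2 * H) p r\<bar> \<le> C" "\<bar>cl 1 (- H) (H\<^sup>2) p r\<bar> \<le> C" for p r
    using C H_ge by (auto simp: cl_def)
  have e1: "ext_sum p r (cl 4 (1 - 2 * H) (- 2 * H)) = (- 2 * H) * cl 4 (1 - 2 * H) (- 2 * H) p r"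
    "ext_sum p r (cl 1 (- H) (H\<^sup>2)) = 1 * cl 1 (- H) (H\<^sup>2) p r" if "\<bar>p\<bar> \<le> h" "\<bar>r\<bar> \<le> h" for p r
    unfolding cl_cl4 ext_sum_cl4[OF that] by (simp_all add: cl_def cl4_def power2_eq_square algebra_simps)
  have k: "\<bar>- 2 * H\<bar> \<le> Q\<^sup>2 / 2" "\<bar>1 :: real\<bar> \<le> Q\<^sup>2 / 2"
  proof -
    have "H \<le> H\<^sup>2" "1 \<le> H\<^sup>2" using self_le_power[of H 2] H_ge by auto
    then show "\<bar>- 2 * H\<bar> \<le> Q\<^sup>2 / 2" "\<bar>1 :: real\<bar> \<le> Q\<^sup>2 / 2" unfolding Q_sq using H_ge by linarith+
  qed
  define K where "K = 64 * (\<bar>A * B\<bar> + B\<^sup>2) * C"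
  have "\<bar>count M n - kap * surv M n\<bar> \<le> K / 2 ^ n + K / Q ^ (M - 1)" if M: "M \<ge> 2" for M n
  proof -
    let ?g = "W M n (\<lambda>p r a b a' b'. cl 4 (1 - 2 * H) (- 2 * H) p r)"
    let ?k = "W M n (\<lambda>p r a b a' b'. cl 1 (- H) (H\<^sup>2) p r)"
    have one: "1 = A\<^sup>2 * cl 4 2 1 p r + (A * B) * cl 4 (1 - 2 * H) (- 2 * H) p r + B\<^sup>2 * cl 1 (- H) (H\<^sup>2) p r" for p r
    proof -
      have "1 = (2 * A + B) * (2 * A + B)" "1 = (2 * A + B) * (A - H * B)" "1 = (A - H * B) * (A - H * B)"
        unfolding A2 by simp_all
      then show ?thesis by (auto simp: cl_def power2_eq_square algebra_simps)
    qed
    have "count M n = A\<^sup>2 * W M n (\<lambda>p r a b a' b'. cl 4 2 1 p r) + (A * B) * ?g + B\<^sup>2 * ?k"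
      unfolding W_lin(1,3)[symmetric] count_def by (rule W_cong) (use one M in auto)
    moreover have "kap * surv M n = A\<^sup>2 * W M n (\<lambda>p r a b a' b'. cl 4 2 1 p r)"
      unfolding surv_def W_lin(3) kap_def A_def by simp
    ultimately have "\<bar>count M n - kap * surv M n\<bar> = \<bar>(A * B) * ?g + B\<^sup>2 * ?k\<bar>" by simp
    also have "\<dots> \<le> \<bar>A * B\<bar> * \<bar>?g\<bar> + B\<^sup>2 * \<bar>?k\<bar>"
      using abs_triangle_ineq[of "(A * B) * ?g" "B\<^sup>2 * ?k"] by (simp add: abs_mult)
    also have "\<dots> \<le> \<bar>A * B\<bar> * (4 * C / 2 ^ n + 64 * C / Q ^ (M - 1)) + B\<^sup>2 * (4 * C / 2 ^ n + 64 * C / Q ^ (M - 1))"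
      by (intro add_mono mult_left_mono W_eigen[OF M, where k = "- 2 * H"] W_eigen[OF M, where k = 1])
        (use e1 c1 k in auto)
    also have "\<dots> = (\<bar>A * B\<bar> + B\<^sup>2) * C * 4 / 2 ^ n + K / Q ^ (M - 1)"
      by (simp add: K_def algebra_simps add_divide_distrib)
    also have "\<dots> \<le> K / 2 ^ n + K / Q ^ (M - 1)"
    proof (intro add_right_mono divide_right_mono)
      have "0 \<le> (\<bar>A * B\<bar> + B\<^sup>2) * C" using C(1) by simp
      moreover have "K = 64 * ((\<bar>A * B\<bar> + B\<^sup>2) * C)" by (simp add: K_def)
      ultimately show "(\<bar>A * B\<bar> + B\<^sup>2) * C * 4 \<le> K" by linarith
    qed simp
    finally show ?thesis .
  qed
  moreover have "K \<ge> 0" unfolding K_def using C(1) by simp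
  ultimately show ?thesis by blast
qed

end

lemma power_diff_exp:
  fixes x :: real
  assumes "0 \<le> x" "x \<le> 1"
  shows "\<bar>(1 - x) ^ n - exp (- (real n * x))\<bar> \<le> real n * x\<^sup>2"
proof (induction n)
  case (Suc n)
  have e1: "1 - x \<le> exp (- x)" using exp_ge_add_one_self[of "- x"] by simp
  have e2: "exp (- x) \<le> 1 - x + x\<^sup>2"
  proof -
    have "1 + x \<le> exp x" by (rule exp_ge_add_one_self)
    then have "exp (- x) \<le> 1 / (1 + x)" using assms by (simp add: exp_minus field_simps)
    also have "\<dots> \<le> 1 - x + x\<^sup>2" using assms by (simp add: field_simps power2_eq_square)
    finally show ?thesis .
  qed
  have b: "\<bar>1 - x\<bar> \<le> 1" "\<bar>exp (- (real n * x))\<bar> \<le> 1" using assms by auto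
  have "(1 - x) ^ Suc n - exp (- (real (Suc n) * x)) =
    (1 - x) * ((1 - x) ^ n - exp (- (real n * x))) + exp (- (real n * x)) * ((1 - x) - exp (- x))"
    by (simp add: algebra_simps exp_add[symmetric])
  also have "\<bar>\<dots>\<bar> \<le> 1 * (real n * x\<^sup>2) + 1 * x\<^sup>2"
    by (rule order_trans[OF abs_triangle_ineq], unfold abs_mult, intro add_mono mult_mono)
      (use Suc b e1 e2 assms in auto)
  finally show ?case by (simp add: algebra_simps)
qed simp

text \<open>With \<open>g n = f (n + M) - e * Ps n\<close> the hypotheses give \<open>g (n + 1) = (1 - e * c) * g n\<close> up to errors
  that telescope, because they are controlled by the decrements of \<open>f\<close>.\<close>

lemma perturbed_decay:
  fixes f Ph Ps :: "nat \<Rightarrow> real"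
  assumes f: "f 0 = 1" "\<And>n. 0 \<le> f n" "\<And>n. f (Suc n) \<le> f n"
    and st: "\<And>n. f (n + M) - f (Suc (n + M)) = e * Ph (Suc n)"
    and dec: "\<And>n. f n - f (Suc n) \<le> K * e"
    and lin: "\<And>n. \<bar>Ph (Suc n) + Ps (Suc n) - Ps n - c * f n\<bar> \<le> K * (f n - f (Suc n))"
    and Ps: "\<And>n. \<bar>Ps n\<bar> \<le> K" and c: "0 \<le> c" "c \<le> K" "e * c \<le> 1" and e: "0 \<le> e" and M: "M \<ge> 1" and K: "K \<ge> 1"
  shows "\<bar>f n - exp (- (real n * (e * c)))\<bar> \<le> 5 * K * (real M * e) + 3 * K\<^sup>2 * (real n * real M * e\<^sup>2)"
proof -
  define g where "g n = f (n + M) - e * Ps n" for n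
  define x where "x = e * c"
  have x: "0 \<le> x" "x \<le> 1" "x \<le> K * e" unfolding x_def using c e by (auto simp: mult.commute[of K] intro: mult_left_mono)
  have M1: "real M \<ge> 1" using M by simp
  have drop: "f n - f (n + m) \<le> real m * (K * e)" for n m
  proof (induction m)
    case (Suc m) then show ?case using dec[of "n + m"] by (simp add: algebra_simps)
  qed simp
  have fm: "f (n + m) \<le> f n" for n m
  proof (induction m)
    case (Suc m) then show ?case using f(3)[of "n + m"] by simp
  qed simp
  have Ke: "0 \<le> K * e" using K e by simp
  have ePs: "\<bar>e * Ps n\<bar> \<le> K * e" for n
    unfolding abs_mult using mult_left_mono[OF Ps e, of n] e by (simp add: mult.commute)
  have fg: "\<bar>f n - g n\<bar> \<le> 2 * (real M * (K * e))" for n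
  proof -
    have "f n - g n = (f n - f (n + M)) + e * Ps n" by (simp add: g_def)
    moreover have "K * e \<le> real M * (K * e)" using M1 Ke mult_right_mono[of 1 "real M" "K * e"] by simp
    ultimately show ?thesis using drop[of n M] fm[of n M] ePs[of n] by linarith
  qed
  have gS: "\<bar>g (Suc n) - (1 - x) * g n\<bar> \<le> x * (2 * (real M * (K * e))) + K * e * (f n - f (Suc n))" for n
  proof -
    define d where "d = Ph (Suc n) + Ps (Suc n) - Ps n - c * f n"
    have "g (Suc n) - g n = - e * (c * f n + d)"
      using st[of n] by (simp add: g_def d_def algebra_simps)
    then have "g (Suc n) - (1 - x) * g n = - (x * (f n - g n)) - e * d" by (simp add: x_def algebra_simps)
    moreover have "\<bar>x * (f n - g n)\<bar> \<le> x * (2 * (real M * (K * e)))"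
      unfolding abs_mult using mult_left_mono[OF fg x(1)] x(1) by simp
    moreover have "\<bar>e * d\<bar> \<le> e * (K * (f n - f (Suc n)))"
      unfolding abs_mult using mult_left_mono[OF lin[of n] e] e by (simp add: d_def)
    ultimately show ?thesis by (simp add: mult.assoc mult.left_commute)
  qed
  have G: "\<bar>g n - (1 - x) ^ n * g 0\<bar> \<le> real n * (x * (2 * (real M * (K * e)))) + K * e * (1 - f n)" for n
  proof (induction n)
    case 0 then show ?case using f(1) by simp
  next
    case (Suc n)
    have eq: "g (Suc n) - (1 - x) ^ Suc n * g 0 = (g (Suc n) - (1 - x) * g n) + (1 - x) * (g n - (1 - x) ^ n * g 0)"
      by (simp add: algebra_simps)
    have b: "\<bar>(1 - x) * (g n - (1 - x) ^ n * g 0)\<bar> \<le> 1 * \<bar>g n - (1 - x) ^ n * g 0\<bar>"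
      unfolding abs_mult using x by (intro mult_right_mono) auto
    have "\<bar>g (Suc n) - (1 - x) ^ Suc n * g 0\<bar> \<le>
      (x * (2 * (real M * (K * e))) + K * e * (f n - f (Suc n))) +
      (real n * (x * (2 * (real M * (K * e)))) + K * e * (1 - f n))"
      unfolding eq by (rule order_trans[OF abs_triangle_ineq add_mono[OF gS order_trans[OF b[unfolded mult_1] Suc]]])
    then show ?case by (simp add: algebra_simps)
  qed
  have g0: "\<bar>g 0 - 1\<bar> \<le> 2 * (real M * (K * e))" using fg[of 0] f(1) by (simp add: abs_minus_commute)
  have p1: "\<bar>(1 - x) ^ n\<bar> \<le> 1" using x by (simp add: power_abs power_le_one)
  have "\<bar>(1 - x) ^ n * g 0 - (1 - x) ^ n\<bar> \<le> 1 * (2 * (real M * (K * e)))"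
  proof -
    have "(1 - x) ^ n * g 0 - (1 - x) ^ n = (1 - x) ^ n * (g 0 - 1)" by (simp add: algebra_simps)
    then show ?thesis unfolding abs_mult using mult_mono[OF p1 g0] by (simp add: abs_mult)
  qed
  moreover have "real n * (x * (2 * (real M * (K * e)))) \<le> real n * (K * e * (2 * (real M * (K * e))))"
    using x(3) Ke by (intro mult_left_mono mult_right_mono) auto
  moreover have "K * e * (1 - f n) \<le> K * e" using f(2)[of n] Ke mult_left_mono[of "1 - f n" 1 "K * e"] by simp
  moreover have "K * e \<le> real M * (K * e)" using M1 Ke mult_right_mono[of 1 "real M" "K * e"] by simp
  moreover have "\<bar>(1 - x) ^ n - exp (- (real n * x))\<bar> \<le> real n * x\<^sup>2" by (rule power_diff_exp[OF x(1,2)])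
  moreover have "real n * x\<^sup>2 \<le> real n * (real M * (K * e)\<^sup>2)"
  proof (intro mult_left_mono)
    have "x\<^sup>2 \<le> 1 * (K * e)\<^sup>2" using x by (simp add: power_mono)
    also have "\<dots> \<le> real M * (K * e)\<^sup>2" using M1 by (intro mult_right_mono) auto
    finally show "x\<^sup>2 \<le> real M * (K * e)\<^sup>2" .
  qed simp
  ultimately have "\<bar>f n - exp (- (real n * x))\<bar> \<le> 2 * (real M * (K * e)) + (real n * (K * e * (2 * (real M * (K * e)))) + real M * (K * e)) +
      2 * (real M * (K * e)) + real n * (real M * (K * e)\<^sup>2)"
    using fg[of n] G[of n] by linarith
  also have "\<dots> = 5 * K * (real M * e) + 3 * K\<^sup>2 * (real n * real M * e\<^sup>2)"
    by (simp add: algebra_simps power2_eq_square)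
  finally show ?thesis by (simp only: x_def)
qed

context even_base
begin

lemma delta_pos: "delta Q > 0"
proof -
  have "4*Q^10 + 10*Q^9 + 18*Q^8 - 4*Q^7 - 10*Q^6 + 7*Q^5 + 44*Q^4 - 29*Q^3 - 8*Q^2 - 20*Q + 16 > 0"
    "4*Q^7 - Q^5 - 6*Q^4 + 8*Q^3 + 2*Q - 4 > 0"
  proof -
    define u where "u = Q - 2"
    have u: "u \<ge> 0" and Qu: "Q = u + 2" using Q_ge by (auto simp: u_def)
    have "4*Q^10 + 10*Q^9 + 18*Q^8 - 4*Q^7 - 10*Q^6 + 7*Q^5 + 44*Q^4 - 29*Q^3 - 8*Q^2 - 20*Q + 16 =
      4*(Q^10) + (10*Q - 4)*Q^8*(1/2) + (5*Q+2)*Q^8 + 18*Q^8 - 4*Q^7 - 10*Q^6 + 7*Q^5 + 44*Q^4 - 29*Q^3 - 8*Q^2 - 20*Q + 16" by algebra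
    have p: "Q ^ Suc i \<ge> 2 * Q ^ i" "Q ^ i > 0" for i using Q_ge mult_right_mono[of 2 Q "Q ^ i"] Q_pos by auto
    have p': "Q^8 \<ge> 2 * Q^7" "Q^7 \<ge> 2 * Q^6" "Q^6 \<ge> 2 * Q^5" "Q^5 \<ge> 2 * Q^4" "Q^4 \<ge> 2 * Q^3" "Q^3 \<ge> 2 * Q^2" "Q^2 \<ge> 2 * Q"
      using p(1)[of 7] p(1)[of 6] p(1)[of 5] p(1)[of 4] p(1)[of 3] p(1)[of 2] p(1)[of 1] by (simp_all add: numeral_eq_Suc)
    show "4*Q^10 + 10*Q^9 + 18*Q^8 - 4*Q^7 - 10*Q^6 + 7*Q^5 + 44*Q^4 - 29*Q^3 - 8*Q^2 - 20*Q + 16 > 0"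
      using p' p(2)[of 10] p(2)[of 9] Q_ge by linarith
    show "4*Q^7 - Q^5 - 6*Q^4 + 8*Q^3 + 2*Q - 4 > 0" using p' Q_ge by linarith
  qed
  then show ?thesis using Q_ge unfolding delta_def by (intro divide_pos_pos mult_pos_pos) auto
qed

text \<open>Apply \<open>perturbed_decay\<close> with rate \<open>c = flux / H\<^sup>2\<close> and
  \<open>e = 1 / (8 * Q ^ (M - 1))\<close>. Since \<open>c / 8 = delta Q * Q\<close>, the product
  \<open>e * c\<close> is \<open>delta Q / Q ^ (M - 2)\<close>; this is where the exponent
  \<open>M - 2\<close> comes from.\<close>

lemma surv_estimate:
  "\<exists>C\<ge>0. \<exists>M0\<ge>2. \<forall>M\<ge>M0. \<forall>n. \<bar>surv M n - exp (- (delta Q * real n / Q ^ (M - 2)))\<bar> \<le>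
     C * (real n * real M / Q ^ (2 * M) + real M / Q ^ M)"
proof -
  define c where "c = flux / H\<^sup>2"
  have cd: "c / 8 = delta Q * Q" unfolding c_def delta_flux unfolding Q_eq using H_ge by (simp add: field_simps power2_eq_square power3_eq_cube)
  have c0: "c \<ge> 0" using cd delta_pos Q_pos by (metis divide_eq_0_iff less_eq_real_def mult_pos_pos zero_less_divide_iff zero_less_numeral not_less_iff_gr_or_eq)
  define K where "K = 64 + (16 + Cpot) * 4 + 4 * Cpot + c"
  have Cp: "Cpot \<ge> 0" using potential_bound[of 0 0 0 0 0 0] by linarith
  have K: "K \<ge> 64" "K \<ge> (16 + Cpot) * 4" "K \<ge> 4 * Cpot" "K \<ge> c" using c0 Cp by (auto simp: K_def)
  \<comment> \<open>Chosen so that \<open>e * c\<close> is at most 1 for all larger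
    \<open>M\<close>, as the comparison of powers with the exponential requires.\<close>
  obtain M0 where M0: "c < 2 ^ M0" using real_arch_pow[of 2 c] by auto
  have "\<bar>surv M n - exp (- (delta Q * real n / Q ^ (M - 2)))\<bar> \<le>
     (5 * K * Q + 3 * K\<^sup>2 * Q\<^sup>2) * (real n * real M / Q ^ (2 * M) + real M / Q ^ M)" if M: "M \<ge> M0 + 2" for M n
  proof -
    define e where "e = 1 / (8 * Q ^ (M - 1))"
    have M2: "M \<ge> 2" using M by simp
    have e0: "e \<ge> 0" using Q_pos by (simp add: e_def)
    have st: "surv M (n + M) - surv M (Suc (n + M)) = e * Phi M 1 (Suc n)" for n
    proof -
      have "n + M = Suc n + (M - 1)" using M2 by simp
      then have "Phi M M (n + M) = Phi M 1 (Suc n) / Q ^ (M - 1)" using Phi_top(1)[OF M2, of "Suc n"] by simp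
      then show ?thesis using surv_Suc[OF M2, of "n + M"] by (simp add: e_def)
    qed
    have dec: "surv M n - surv M (Suc n) \<le> K * e" for n
    proof -
      have "surv M n - surv M (Suc n) \<le> 64 * e" using surv_Suc[OF M2, of n] Phi_top(3)[OF M2, of n] by (simp add: e_def)
      also have "\<dots> \<le> K * e" using K e0 by (intro mult_right_mono) auto
      finally show ?thesis .
    qed
    have mono: "surv M (Suc n) \<le> surv M n" for n using surv_antimono[OF M2, of n "Suc n"] by simp
    have lin: "\<bar>Phi M 1 (Suc n) + Psi M (Suc n) - Psi M n - c * surv M n\<bar> \<le> K * (surv M n - surv M (Suc n))" for n
    proof -
      have "(16 + Cpot) * 4 * (surv M n - surv M (Suc n)) \<le> K * (surv M n - surv M (Suc n))"
        using K mono[of n] by (intro mult_right_mono) auto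
      then show ?thesis using Psi_Suc[OF M2, of n] unfolding c_def by linarith
    qed
    have Ps: "\<bar>Psi M n\<bar> \<le> K" for n using Psi_bound[OF M2, of n] K(3) by linarith
    have ec: "e * c \<le> 1"
    proof -
      have "(2 :: real) ^ M0 \<le> 2 ^ (M - 1)" using M by (intro power_increasing) auto
      then have "c \<le> 2 ^ (M - 1)" using M0 by linarith
      also have "\<dots> \<le> Q ^ (M - 1)" using Q_ge by (intro power_mono) auto
      also have "\<dots> \<le> 8 * Q ^ (M - 1)" using Q_pos by simp
      finally show ?thesis using Q_pos by (simp add: e_def field_simps)
    qed
    have ece: "e * c = delta Q / Q ^ (M - 2)"
    proof -
      have "M - 1 = Suc (M - 2)" using M2 by simp
      then have "e * c = (c / 8) / (Q * Q ^ (M - 2))" by (simp add: e_def)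
      then show ?thesis unfolding cd using Q_pos by simp
    qed
    have eQ: "e \<le> Q / Q ^ M" "e\<^sup>2 \<le> Q\<^sup>2 / Q ^ (2 * M)"
    proof -
      have "Q ^ M = Q * Q ^ (M - 1)" using M2 by (simp flip: power_Suc)
      then show 1: "e \<le> Q / Q ^ M" using Q_pos by (simp add: e_def field_simps)
      have "e\<^sup>2 \<le> (Q / Q ^ M)\<^sup>2" using 1 e0 by (intro power_mono)
      moreover have "(Q / Q ^ M)\<^sup>2 = Q\<^sup>2 / Q ^ (2 * M)"
        unfolding power_divide power_mult[symmetric] by (simp only: mult.commute)
      ultimately show "e\<^sup>2 \<le> Q\<^sup>2 / Q ^ (2 * M)" by simp
    qed
    have "\<bar>surv M n - exp (- (real n * (e * c)))\<bar> \<le> 5 * K * (real M * e) + 3 * K\<^sup>2 * (real n * real M * e\<^sup>2)"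
      by (rule perturbed_decay[OF surv_0 surv_nonneg mono st dec lin Ps c0 K(4) ec e0]) (use M2 K in auto)
    also have "\<dots> \<le> 5 * K * (real M * (Q / Q ^ M)) + 3 * K\<^sup>2 * (real n * real M * (Q\<^sup>2 / Q ^ (2 * M)))"
      using eQ K by (intro add_mono mult_left_mono) auto
    also have "\<dots> \<le> (5 * K * Q + 3 * K\<^sup>2 * Q\<^sup>2) * (real M / Q ^ M) + (5 * K * Q + 3 * K\<^sup>2 * Q\<^sup>2) * (real n * real M / Q ^ (2 * M))"
    proof (intro add_mono)
      have "5 * K * (real M * (Q / Q ^ M)) = 5 * K * Q * (real M / Q ^ M)" by (simp add: mult_ac)
      also have "\<dots> \<le> (5 * K * Q + 3 * K\<^sup>2 * Q\<^sup>2) * (real M / Q ^ M)"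
        using Q_pos by (intro mult_right_mono) auto
      finally show "5 * K * (real M * (Q / Q ^ M)) \<le> (5 * K * Q + 3 * K\<^sup>2 * Q\<^sup>2) * (real M / Q ^ M)" .
      have "3 * K\<^sup>2 * (real n * real M * (Q\<^sup>2 / Q ^ (2 * M))) = 3 * K\<^sup>2 * Q\<^sup>2 * (real n * real M / Q ^ (2 * M))" by (simp add: mult_ac)
      also have "\<dots> \<le> (5 * K * Q + 3 * K\<^sup>2 * Q\<^sup>2) * (real n * real M / Q ^ (2 * M))"
        using Q_pos K by (intro mult_right_mono) auto
      finally show "3 * K\<^sup>2 * (real n * real M * (Q\<^sup>2 / Q ^ (2 * M))) \<le> (5 * K * Q + 3 * K\<^sup>2 * Q\<^sup>2) * (real n * real M / Q ^ (2 * M))" .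
    qed
    also have "\<dots> = (5 * K * Q + 3 * K\<^sup>2 * Q\<^sup>2) * (real n * real M / Q ^ (2 * M) + real M / Q ^ M)"
      by (simp only: distrib_left add.commute)
    finally show ?thesis unfolding ece by (simp only: times_divide_eq_right mult.commute[of "real n" "delta Q"])
  qed
  moreover have "5 * K * Q + 3 * K\<^sup>2 * Q\<^sup>2 \<ge> 0" using K Q_pos by simp
  ultimately show ?thesis by (intro exI[of _ "5 * K * Q + 3 * K\<^sup>2 * Q\<^sup>2"] conjI exI[of _ "M0 + 2"]) auto
qed

section \<open>From survival of words to the law of the number of iterations\<close>

lemma SSDE_mono_Suc: "SSDE q n \<subseteq> SSDE q (Suc n)"
proof
  fix x assume x: "x \<in> SSDE q n"
  have "x = x(n := 0)" using SSDE_D(1)[OF x, of n] by auto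
  moreover have "0 \<in> nx (x (n - 1))" using h_ge by (auto simp: nx_def)
  ultimately show "x \<in> SSDE q (Suc n)" using x SSDE_Suc_iff by blast
qed

definition firing :: "nat \<Rightarrow> nat \<Rightarrow> real" where
  "firing M n = (\<Sum>x\<in>SSDE q n. \<Sum>y\<in>SSDE q n. of_bool (live M (dsum x y) n \<and> fires M (dsum x y) n)) / Q ^ (2 * n)"

text \<open>Beyond the word the next digits are zeros. Appending a zero to both operands is always
  allowed and is one of the extensions in \<open>killed\<close>, so words firing there have at most
  the mass discarded in a regular step.\<close>

lemma firing_bound:
  assumes "M \<ge> 2"
  shows "firing M n \<le> 32 * H\<^sup>2 / Q ^ (M - 1)"
proof -
  let ?F = "\<lambda>p r a b a' b'. cl 4 2 1 p r"
  have *: "4 * of_bool (live M (dsum x y) n \<and> fires M (dsum x y) n) \<le>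
      (if live M (dsum x y) n then at_word (killed M ?F) n x y else 0)"
    if "x \<in> SSDE q n" "y \<in> SSDE q n" for x y
  proof -
    have sn: "dsum x y n = 0" using SSDE_D(1)[OF that(1), of n] SSDE_D(1)[OF that(2), of n] by (simp add: dsum_def)
    have z: "0 \<in> nx p" for p using h_ge by (auto simp: nx_def)
    have g: "0 \<le> (if dead M (d + e) a b a' b' then after ?F a b a' b' d e else 0)" for d e a b a' b'
      using cl_ge_1[of d e] by (simp add: after_def)
    have "of_bool (dead M 0 a b a' b') * 4 \<le> killed M ?F p r a b a' b'" for p r a b a' b'
    proof -
      have "of_bool (dead M 0 a b a' b') * 4 = (if dead M (0 + 0) a b a' b' then after ?F a b a' b' 0 0 else 0)"
        using h_ge by (simp add: after_def cl_def)
      also have "\<dots> \<le> (\<Sum>e\<in>nx r. if dead M (0 + e) a b a' b' then after ?F a b a' b' 0 e else 0)"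
        by (rule member_le_sum[OF z]; (rule g | simp))
      also have "\<dots> \<le> killed M ?F p r a b a' b'" unfolding killed_def ext_sum_def
        by (rule member_le_sum[OF z]; (rule sum_nonneg, rule g | simp))
      finally show ?thesis .
    qed
    then show ?thesis by (simp add: at_word_def Let_def fires_def dead_def sn mult.commute)
  qed
  have "4 * firing M n = (\<Sum>x\<in>SSDE q n. \<Sum>y\<in>SSDE q n. 4 * of_bool (live M (dsum x y) n \<and> fires M (dsum x y) n)) / Q ^ (2 * n)"
    by (simp add: firing_def sum_distrib_left)
  also have "\<dots> \<le> W M n (killed M ?F)"
    unfolding W_def using Q_pos * by (intro divide_right_mono sum_mono) auto
  also have "\<dots> = 2 * H\<^sup>2 * Phi M M n" by (rule W_killed_cl[OF assms])
  also have "\<dots> \<le> 2 * H\<^sup>2 * (64 / Q ^ (M - 1))" using Phi_top(3)[OF assms] by (intro mult_left_mono) auto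
  finally show ?thesis by simp
qed

lemma level_le: "LA s n \<le> n \<and> LB s n \<le> n"
proof (induction n arbitrary: s)
  case (Suc n)
  have "next_A d b a' \<le> Suc n" "next_B d b a' \<le> Suc n" if "b \<le> n" "a' \<le> n" for d b a'
    using that by (simp_all add: next_A_def next_B_def)
  then show ?case unfolding LA.simps LB.simps using Suc[of s] Suc[of "- s"] by blast
qed simp

lemma live_long: "n < M \<Longrightarrow> live M s n"
  unfolding live_def fires_def fire_def using level_le by (metis le_trans less_trans not_le)

definition tail_prob :: "nat \<Rightarrow> nat \<Rightarrow> real" where
  "tail_prob M l = (\<Sum>x\<in>SSDE q l. \<Sum>y\<in>SSDE q l. of_bool (live M (dsum x y) (l + 2))) / (real (card (SSDE q l)))\<^sup>2"

text \<open>The number of live pairs and the number of all pairs are both close to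
  \<open>kap\<close> times their weighted counterparts, and \<open>kap\<close> cancels in the
  quotient. The padding zeros cost only the firing mass at two positions.\<close>

lemma tail_prob_approx:
  "\<exists>C\<ge>0. \<forall>M\<ge>2. \<forall>l. \<bar>tail_prob M l - surv M l\<bar> \<le> C / 2 ^ l + C / Q ^ M"
proof -
  obtain C where C: "C \<ge> 0" and cnt: "\<And>M n. M \<ge> 2 \<Longrightarrow> \<bar>count M n - kap * surv M n\<bar> \<le> C / 2 ^ n + C / Q ^ (M - 1)"
    using count_approx by blast
  define K where "K = 3 * C + C * Q + 32 * H\<^sup>2 * (1 + Q\<^sup>2) * Q"
  have "\<bar>tail_prob M l - surv M l\<bar> \<le> K / 2 ^ l + K / Q ^ M" if M: "M \<ge> 2" for M l
  proof -
    define num where "num = (\<Sum>x\<in>SSDE q l. \<Sum>y\<in>SSDE q l. of_bool (live M (dsum x y) (l + 2))) / Q ^ (2 * l)"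
    define den where "den = (real (card (SSDE q l)))\<^sup>2 / Q ^ (2 * l)"
    have cM: "count M l = (\<Sum>x\<in>SSDE q l. \<Sum>y\<in>SSDE q l. of_bool (live M (dsum x y) l)) / Q ^ (2 * l)" for M
      unfolding count_def W_def at_word_def by (simp add: of_bool_def Let_def cong: if_cong)
    \<comment> \<open>A level never exceeds the number of digits read, so for level bound
      \<open>l + 3\<close> all words of length \<open>l\<close> are live and \<open>count\<close> is
      the number of all pairs.\<close>
    have den: "den = count (l + 3) l" unfolding cM den_def by (simp add: live_long power2_eq_square)
    have s1: "surv (l + 3) n = 1" if "n \<le> l" for n
      using that
    proof (induction n)
      case (Suc n)
      then show ?case using surv_Suc[of "l + 3" n] Phi_top(2)[of "l + 3" n] by simp
    qed (simp add: surv_0)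
    have den1: "den \<ge> 1"
    proof -
      have "surv (l + 3) l \<le> count (l + 3) l" unfolding surv_def count_def
        by (rule W_mono) (auto simp: cl_def)
      then show ?thesis using s1[of l] den by simp
    qed
    have Qp: "Q ^ n \<ge> 2 ^ n" for n using Q_ge by (intro power_mono) auto
    have ed: "\<bar>den - kap\<bar> \<le> 2 * C / 2 ^ l"
    proof -
      have "\<bar>den - kap\<bar> \<le> C / 2 ^ l + C / Q ^ (l + 2)" using cnt[of "l + 3" l] s1[of l] den by simp
      moreover have "C / Q ^ (l + 2) \<le> C / 2 ^ l"
      proof -
        have "(2 :: real) ^ l \<le> 2 ^ (l + 2)" by (intro power_increasing) auto
        then have "2 ^ l \<le> Q ^ (l + 2)" using Qp[of "l + 2"] by linarith
        then show ?thesis using C Q_pos by (intro divide_left_mono mult_pos_pos zero_less_power) auto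
      qed
      ultimately show ?thesis by simp
    qed
    have le: "num \<le> count M l" unfolding num_def cM using Q_pos
      by (intro divide_right_mono sum_mono) (auto simp: live_def)
    \<comment> \<open>A live word can stop being live at the padding position \<open>l\<close> or
      \<open>l + 1\<close>. In the second case it is regarded as a word of length
      \<open>l + 1\<close> with leading zero, which changes the normalisation by
      \<open>Q\<^sup>2\<close>.\<close>
    have ge: "count M l - num \<le> firing M l + Q\<^sup>2 * firing M (Suc l)"
    proof -
      let ?S = "SSDE q l" and ?T = "SSDE q (Suc l)"
      let ?g = "\<lambda>x y. of_bool (live M (dsum x y) (Suc l) \<and> fires M (dsum x y) (Suc l)) :: real"
      have "of_bool (live M s l) - of_bool (live M s (l + 2)) \<le>
         of_bool (live M s l \<and> fires M s l) + (of_bool (live M s (Suc l) \<and> fires M s (Suc l)) :: real)" for s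
        using live_Suc[of M s l] live_Suc[of M s "Suc l"] by auto
      then have "(\<Sum>x\<in>?S. \<Sum>y\<in>?S. of_bool (live M (dsum x y) l)) - (\<Sum>x\<in>?S. \<Sum>y\<in>?S. of_bool (live M (dsum x y) (l + 2))) \<le>
        (\<Sum>x\<in>?S. \<Sum>y\<in>?S. of_bool (live M (dsum x y) l \<and> fires M (dsum x y) l)) + (\<Sum>x\<in>?S. \<Sum>y\<in>?S. ?g x y)"
        unfolding sum_subtractf[symmetric] sum.distrib[symmetric] by (intro sum_mono)
      also have "(\<Sum>x\<in>?S. \<Sum>y\<in>?S. ?g x y) \<le> (\<Sum>x\<in>?T. \<Sum>y\<in>?T. ?g x y)"
      proof -
        have "(\<Sum>x\<in>?S. \<Sum>y\<in>?S. ?g x y) \<le> (\<Sum>x\<in>?S. \<Sum>y\<in>?T. ?g x y)"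
          by (intro sum_mono sum_mono2 finite_SSDE SSDE_mono_Suc) auto
        also have "\<dots> \<le> (\<Sum>x\<in>?T. \<Sum>y\<in>?T. ?g x y)"
          by (intro sum_mono2 finite_SSDE SSDE_mono_Suc) (auto intro: sum_nonneg)
        finally show ?thesis .
      qed
      finally have "count M l - num \<le> firing M l + (\<Sum>x\<in>?T. \<Sum>y\<in>?T. ?g x y) / Q ^ (2 * l)"
        unfolding cM num_def firing_def diff_divide_distrib[symmetric] add_divide_distrib[symmetric]
        using Q_pos by (intro divide_right_mono) auto
      also have "(\<Sum>x\<in>?T. \<Sum>y\<in>?T. ?g x y) / Q ^ (2 * l) = Q\<^sup>2 * firing M (Suc l)"
        unfolding firing_def using Q_pos by (simp add: power2_eq_square)
      finally show ?thesis by simp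
    qed
    have QM: "1 / Q ^ (M - 1) = Q / Q ^ M"
    proof -
      have "M = Suc (M - 1)" using M by simp
      then have "Q ^ M = Q * Q ^ (M - 1)" by (metis power_Suc)
      then show ?thesis using Q_pos by simp
    qed
    have fb: "firing M n \<le> 32 * H\<^sup>2 * Q / Q ^ M" for n
      using firing_bound[OF M, of n] QM by (metis mult.right_neutral times_divide_eq_right mult.assoc)
    have "count M l - num \<le> 32 * H\<^sup>2 * Q / Q ^ M + Q\<^sup>2 * (32 * H\<^sup>2 * Q / Q ^ M)"
      using ge fb[of l] mult_left_mono[OF fb[of "Suc l"], of "Q\<^sup>2"] by simp
    moreover have "32 * H\<^sup>2 * (1 + Q\<^sup>2) * Q / Q ^ M = 32 * H\<^sup>2 * Q / Q ^ M + Q\<^sup>2 * (32 * H\<^sup>2 * Q / Q ^ M)"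
      by (simp add: algebra_simps add_divide_distrib)
    ultimately have num: "\<bar>num - count M l\<bar> \<le> 32 * H\<^sup>2 * (1 + Q\<^sup>2) * Q / Q ^ M" using le by linarith
    have cq: "\<bar>count M l - kap * surv M l\<bar> \<le> C / 2 ^ l + C * Q / Q ^ M"
      using cnt[OF M, of l] QM by (metis mult.right_neutral times_divide_eq_right mult.assoc)
    have f01: "0 \<le> surv M l" "surv M l \<le> 1" using surv_nonneg surv_le_1[OF M] by auto
    have tp: "tail_prob M l = num / den" unfolding tail_prob_def num_def den_def using Q_pos by simp
    have "\<bar>tail_prob M l - surv M l\<bar> = \<bar>num - surv M l * den\<bar> / den"
      using den1 unfolding tp by (simp add: field_simps abs_divide)
    also have "\<dots> \<le> \<bar>num - surv M l * den\<bar> / 1" using den1 by (intro divide_left_mono) auto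
    also have "num - surv M l * den = (num - count M l) + (count M l - kap * surv M l) - surv M l * (den - kap)"
      by (simp add: algebra_simps)
    also have "\<bar>\<dots>\<bar> \<le> 32 * H\<^sup>2 * (1 + Q\<^sup>2) * Q / Q ^ M + (C / 2 ^ l + C * Q / Q ^ M) + 1 * (2 * C / 2 ^ l)"
    proof -
      have "\<bar>surv M l * (den - kap)\<bar> \<le> 1 * (2 * C / 2 ^ l)"
        unfolding abs_mult using f01 ed by (intro mult_mono) auto
      then show ?thesis using num cq by linarith
    qed
    also have "\<dots> = (3 * C) / 2 ^ l + (C * Q + 32 * H\<^sup>2 * (1 + Q\<^sup>2) * Q) / Q ^ M"
      by (simp add: add_divide_distrib algebra_simps)
    also have "\<dots> \<le> K / 2 ^ l + K / Q ^ M"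
      unfolding K_def using C Q_pos by (intro add_mono divide_right_mono) auto
    finally show ?thesis by simp
  qed
  moreover have "K \<ge> 0" unfolding K_def using C Q_pos by simp
  ultimately show ?thesis by blast
qed

lemma prob_iterations:
  assumes "M > 0"
  shows "measure_pmf.prob (SSDE_pair_pmf q l) {p. iterations q p \<le> M} = tail_prob M l"
proof -
  let ?S = "SSDE q l"
  have "(\<lambda>j. 0) \<in> ?S" using h_ge q_ge by (simp add: SSDE_def h_def)
  then have ne: "?S \<noteq> {}" by blast
  have fin: "finite ?S" by (rule finite_SSDE)
  have "SSDE_pair_pmf q l = pmf_of_set (?S \<times> ?S)"
    unfolding SSDE_pair_pmf_def by (rule pair_pmf_of_set) (use ne fin in auto)
  then have "measure_pmf.prob (SSDE_pair_pmf q l) {p. iterations q p \<le> M} =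
     card ((?S \<times> ?S) \<inter> {p. iterations q p \<le> M}) / card (?S \<times> ?S)"
    using ne fin by (simp add: measure_pmf_of_set)
  also have "real (card ((?S \<times> ?S) \<inter> {p. iterations q p \<le> M})) =
     (\<Sum>p\<in>?S \<times> ?S. of_bool (iterations q p \<le> M))"
    by (simp add: fin)
  also have "\<dots> = (\<Sum>x\<in>?S. \<Sum>y\<in>?S. of_bool (iterations q (x, y) \<le> M))"
    by (simp only: sum.cartesian_product case_prod_unfold prod.collapse)
  also have "\<dots> = (\<Sum>x\<in>?S. \<Sum>y\<in>?S. of_bool (live M (dsum x y) (l + 2)))"
    using iterations_le_iff[OF _ _ assms] by (intro sum.cong refl) auto
  finally show ?thesis by (simp add: tail_prob_def card_cartesian_product power2_eq_square)
qed

text \<open>The term \<open>1 / 2 ^ l\<close> is the contribution of the decaying eigenfunctions,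
  that is, of passing from weighted to uniformly distributed words; the other terms come from the
  decay estimate and from the padding.\<close>

theorem prob_iterations_approx:
  "\<exists>C\<ge>0. \<exists>M0\<ge>2. \<forall>M\<ge>M0. \<forall>l.
     \<bar>measure_pmf.prob (SSDE_pair_pmf q l) {p. iterations q p \<le> M} - exp (- (delta Q * real l / Q ^ (M - 2)))\<bar>
       \<le> C * (real l * real M / Q ^ (2 * M) + real M / Q ^ M + 1 / 2 ^ l)"
proof -
  obtain C M0 where C: "C \<ge> 0" "M0 \<ge> 2" "\<And>M n. M \<ge> M0 \<Longrightarrow> \<bar>surv M n - exp (- (delta Q * real n / Q ^ (M - 2)))\<bar> \<le>
     C * (real n * real M / Q ^ (2 * M) + real M / Q ^ M)" using surv_estimate by blast
  obtain D where D: "D \<ge> 0" "\<And>M l. M \<ge> 2 \<Longrightarrow> \<bar>tail_prob M l - surv M l\<bar> \<le> D / 2 ^ l + D / Q ^ M" using tail_prob_approx by blast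
  have "\<bar>measure_pmf.prob (SSDE_pair_pmf q l) {p. iterations q p \<le> M} - exp (- (delta Q * real l / Q ^ (M - 2)))\<bar>
       \<le> (C + D) * (real l * real M / Q ^ (2 * M) + real M / Q ^ M + 1 / 2 ^ l)" if M: "M \<ge> M0" for M l
  proof -
    have M2: "M \<ge> 2" using M C by simp
    have p: "0 \<le> real l * real M / Q ^ (2 * M)" "0 \<le> real M / Q ^ M" "0 \<le> 1 / (2::real) ^ l" using Q_pos by auto
    have "D / Q ^ M \<le> D * (real M / Q ^ M)" using D(1) M2 Q_pos by (simp add: divide_right_mono mult_le_cancel_left1)
    then have "\<bar>tail_prob M l - exp (- (delta Q * real l / Q ^ (M - 2)))\<bar> \<le>
      C * (real l * real M / Q ^ (2 * M) + real M / Q ^ M) + (D * (1 / 2 ^ l) + D * (real M / Q ^ M))"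
      using C(3)[OF M, of l] D(2)[OF M2, of l] by simp
    also have "\<dots> \<le> (C + D) * (real l * real M / Q ^ (2 * M) + real M / Q ^ M + 1 / 2 ^ l)"
    proof -
      have "C * (a + b) + (D * c + D * b) \<le> (C + D) * (a + b + c)" if "0 \<le> a" "0 \<le> c" for a b c :: real
        using mult_nonneg_nonneg[OF C(1) that(2)] mult_nonneg_nonneg[OF D(1) that(1)] by (simp add: algebra_simps)
      then show ?thesis using p by blast
    qed
    finally show ?thesis using M2 by (subst prob_iterations) auto
  qed
  then show ?thesis using C D by (intro exI[of _ "C + D"] conjI exI[of _ M0]) auto
qed

end

section \<open>Moments of the logarithm of an exponential variable\<close>

definition Expo :: "real measure" where "Expo = density lborel (exponential_density 1)"

lemma prob_space_Expo: "prob_space Expo"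
  unfolding Expo_def by (rule prob_space_exponential_density) simp

interpretation Expo: prob_space Expo
  by (rule prob_space_Expo)

lemma sets_Expo [simp, measurable_cong]: "sets Expo = sets borel"
  by (simp add: Expo_def)

lemma space_Expo [simp]: "space Expo = UNIV"
  by (simp add: Expo_def)

lemma measure_Expo_gt:
  assumes "a \<ge> 0"
  shows "measure Expo {a<..} = exp (- a)"
proof -
  have "distributed Expo lborel (\<lambda>x. x) (exponential_density 1)"
    unfolding distributed_def by (auto simp: Expo_def distr_id2)
  from Expo.exponential_distributedD_gt[OF this assms] show ?thesis
    by (simp add: greaterThan_def)
qed

lemma AE_Expo_pos: "AE u in Expo. u > 0"
proof -
  have "AE u in lborel. 0 < ennreal (exponential_density 1 u) \<longrightarrow> u > 0"
    using AE_lborel_singleton[of 0] by eventually_elim (auto simp: exponential_density_def split: if_splits)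
  then show ?thesis unfolding Expo_def by (subst AE_density) auto
qed

lemma AE_Expo_countable:
  assumes "countable (A :: real set)"
  shows "AE u in Expo. u \<notin> A"
proof -
  have "A \<in> null_sets lborel" using assms by (rule countable_imp_null_set_lborel)
  then have "AE u in lborel. u \<notin> A" by (rule AE_not_in)
  then have "AE u in lborel. 0 < ennreal (exponential_density 1 u) \<longrightarrow> u \<notin> A" by eventually_elim simp
  then show ?thesis unfolding Expo_def by (subst AE_density) auto
qed

lemma Expo_Gamma:
  assumes z: "Re z > 0"
  shows "integrable Expo (\<lambda>u. exp ((z - 1) * of_real (ln u)))" (is ?A)
    and "(\<integral>u. exp ((z - 1) * of_real (ln u)) \<partial>Expo) = Gamma z" (is ?B)
proof -
  let ?f = "\<lambda>t. of_real t powr (z - 1) / of_real (exp t) :: complex"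
  let ?g = "\<lambda>u. exponential_density 1 u *\<^sub>R exp ((z - 1) * of_real (ln u)) :: complex"
  have ai: "set_integrable lebesgue {0<..} ?f"
    using absolutely_integrable_Gamma_integral'[OF z] .
  have val: "set_lebesgue_integral lebesgue {0<..} ?f = Gamma z"
    using set_lebesgue_integral_eq_integral(2)[OF ai] integral_unique[OF Gamma_integral_complex'[OF z]] by simp
  have pos: "indicator {0<..} u *\<^sub>R ?f u = indicator {0<..} u *\<^sub>R ?g u" for u :: real
    by (auto simp: indicator_def powr_def Ln_of_real exponential_density_def exp_minus scaleR_conv_of_real field_simps)
  have m: "(\<lambda>u. indicator {0<..} u *\<^sub>R ?g u) \<in> borel_measurable lborel" by measurable
  have i1: "integrable lebesgue (\<lambda>u. indicator {0<..} u *\<^sub>R ?g u)"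
    using ai unfolding set_integrable_def pos .
  have i2: "integrable lborel (\<lambda>u. indicator {0<..} u *\<^sub>R ?g u)"
    using i1 integrable_completion[OF m] by simp
  have v2: "(\<integral>u. indicator {0<..} u *\<^sub>R ?g u \<partial>lborel) = Gamma z"
    using val integral_completion[OF m] unfolding set_lebesgue_integral_def pos by simp
  have ae: "AE u in lborel. indicator {0<..} u *\<^sub>R ?g u = ?g u"
    using AE_lborel_singleton[of 0] by eventually_elim (auto simp: indicator_def exponential_density_def)
  have m': "?g \<in> borel_measurable lborel" by measurable
  have i3: "integrable lborel ?g" using integrable_cong_AE[OF m m' ae] i2 by simp
  have v3: "(\<integral>u. ?g u \<partial>lborel) = Gamma z" using integral_cong_AE[OF m m' ae] v2 by simp
  show ?A unfolding Expo_def by (subst integrable_density) (use i3 in \<open>auto simp: exponential_density_nonneg\<close>)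
  show ?B unfolding Expo_def by (subst integral_density) (use v3 in \<open>auto simp: exponential_density_nonneg\<close>)
qed

lemma Expo_powr:
  assumes "a > - 1"
  shows "integrable Expo (\<lambda>u. exp (a * ln u))" "(\<integral>u. exp (a * ln u) \<partial>Expo) = Gamma (a + 1)"
proof -
  have z: "Re (of_real (a + 1)) > 0" using assms by simp
  have e: "exp ((of_real (a + 1) - 1) * of_real (ln u)) = (of_real (exp (a * ln u)) :: complex)" for u
    by (simp add: exp_of_real[symmetric])
  have i: "integrable Expo (\<lambda>u. complex_of_real (exp (a * ln u)))"
    using Expo_Gamma(1)[OF z] unfolding e .
  then show "integrable Expo (\<lambda>u. exp (a * ln u))" using integrable_Re[OF i] by simp
  have "complex_of_real (\<integral>u. exp (a * ln u) \<partial>Expo) = of_real (Gamma (a + 1))"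
    using Expo_Gamma(2)[OF z] unfolding e Gamma_complex_of_real by simp
  then show "(\<integral>u. exp (a * ln u) \<partial>Expo) = Gamma (a + 1)" using of_real_eq_iff by blast
qed

text \<open>The exponent - 1/4 is small enough that even the square of the bound, with exponent -
  1/2, is integrable at 0. So this one estimate dominates both moments of the logarithm.\<close>

lemma abs_ln_le:
  assumes "u > (0 :: real)"
  shows "\<bar>ln u\<bar> \<le> exp (1 * ln u) + 4 * exp (- (1/4) * ln u)"
proof -
  have "ln u \<le> exp (1 * ln u)" using exp_ge_add_one_self[of "1 * ln u"] by linarith
  moreover have "- (1/4) * ln u \<le> exp (- (1/4) * ln u)" using exp_ge_add_one_self[of "- (1/4) * ln u"] by linarith
  moreover have "exp (1 * ln u) > 0" "exp (- (1/4) * ln u) > 0" by (rule exp_gt_zero)+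
  ultimately show ?thesis unfolding abs_le_iff by (intro conjI) linarith+
qed

lemma ln_sq_le:
  assumes "u > (0 :: real)"
  shows "(ln u)\<^sup>2 \<le> 2 * exp (2 * ln u) + 32 * exp (- (1/2) * ln u)"
proof -
  have "(ln u)\<^sup>2 \<le> (exp (1 * ln u) + 4 * exp (- (1/4) * ln u))\<^sup>2"
    using power_mono[OF abs_ln_le[OF assms], of 2] by simp
  also have "\<dots> \<le> 2 * (exp (1 * ln u))\<^sup>2 + 2 * (4 * exp (- (1/4) * ln u))\<^sup>2"
    using sum_squares_bound[of "exp (1 * ln u)" "4 * exp (- (1/4) * ln u)"] by (simp add: power2_sum)
  also have "\<dots> = 2 * exp (2 * ln u) + 32 * exp (- (1/2) * ln u)"
    by (simp add: power_mult_distrib exp_double[symmetric] flip: exp_of_nat_mult)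
  finally show ?thesis .
qed

lemma integrable_ln: "integrable Expo ln" "integrable Expo (\<lambda>u. (ln u)\<^sup>2)" "integrable Expo (\<lambda>u. u * ln u)" "integrable Expo (\<lambda>u. u)"
proof -
  have p: "integrable Expo (\<lambda>u. exp (a * ln u))" if "a > - 1" for a using Expo_powr(1)[OF that] .
  have "integrable Expo (\<lambda>u. exp (1 * ln u) + 4 * exp (- (1/4) * ln u))"
    by (intro Bochner_Integration.integrable_add integrable_mult_right p) auto
  then show "integrable Expo ln"
    by (rule Bochner_Integration.integrable_bound)
      (measurable, use AE_Expo_pos in eventually_elim, use abs_ln_le in force)
  have "integrable Expo (\<lambda>u. 2 * exp (2 * ln u) + 32 * exp (- (1/2) * ln u))"
    by (intro Bochner_Integration.integrable_add integrable_mult_right p) auto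
  then show "integrable Expo (\<lambda>u. (ln u)\<^sup>2)"
    by (rule Bochner_Integration.integrable_bound)
      (measurable, use AE_Expo_pos in eventually_elim, use ln_sq_le in force)
  have "integrable Expo (\<lambda>u. exp (2 * ln u) + 4 * exp ((3/4) * ln u))"
    by (intro Bochner_Integration.integrable_add integrable_mult_right p) auto
  then show "integrable Expo (\<lambda>u. u * ln u)"
  proof (rule Bochner_Integration.integrable_bound)
    show "AE u in Expo. norm (u * ln u) \<le> norm (exp (2 * ln u) + 4 * exp ((3/4) * ln u))"
      using AE_Expo_pos
    proof eventually_elim
      fix u :: real assume u: "u > 0"
      have "\<bar>u * ln u\<bar> \<le> u * (exp (1 * ln u) + 4 * exp (- (1/4) * ln u))"
        unfolding abs_mult using u abs_ln_le[OF u] by (intro mult_mono) auto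
      also have "\<dots> = exp (ln u) * exp (1 * ln u) + 4 * (exp (ln u) * exp (- (1/4) * ln u))"
        using u by (simp add: algebra_simps)
      also have "\<dots> = exp (2 * ln u) + 4 * exp ((3/4) * ln u)"
        unfolding exp_add[symmetric] by (simp add: algebra_simps)
      finally show "norm (u * ln u) \<le> norm (exp (2 * ln u) + 4 * exp ((3/4) * ln u))" by simp
    qed
  qed measurable
  show "integrable Expo (\<lambda>u. u)"
    using p[of 1] by (subst integrable_cong_AE[of _ _ "\<lambda>u. exp (1 * ln u)"])
      (measurable, use AE_Expo_pos in eventually_elim, auto)
qed

lemma norm_cis_minus_1: "norm (exp (\<i> * of_real x) - 1) \<le> \<bar>x\<bar>"
proof -
  have "norm (exp (\<i> * of_real x) - 1) = 2 * \<bar>sin (x / 2)\<bar>" using dist_exp_i_1[of x] by simp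
  also have "\<dots> \<le> \<bar>x\<bar>" using abs_sin_x_le_abs_x[of "x / 2"] by simp
  finally show ?thesis .
qed

lemma shrink_at_0:
  assumes "c \<noteq> (0 :: complex)"
  shows "filterlim (\<lambda>n. c * of_real (1 / real (Suc n))) (at 0) sequentially"
proof (rule filterlim_atI)
  have "(\<lambda>n. complex_of_real (inverse (real (Suc n)))) \<longlonglongrightarrow> of_real 0"
    by (rule tendsto_of_real[OF LIMSEQ_inverse_real_of_nat])
  from tendsto_mult_right_zero[OF this[simplified], of c]
  show "(\<lambda>n. c * of_real (1 / real (Suc n))) \<longlonglongrightarrow> 0" by (simp add: inverse_eq_divide)
  show "\<forall>\<^sub>F n in sequentially. c * of_real (1 / real (Suc n)) \<noteq> 0" using assms by (auto simp del: of_nat_Suc)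
qed

text \<open>Differentiation under the integral, dominated by \<open>W u * ln u\<close>. The
  difference quotients are taken along the sequence \<open>1 / Suc n\<close> and divided by the
  imaginary unit, so that they can be compared with complex derivatives of Gamma on a vertical
  line.\<close>

lemma Expo_deriv_seq:
  fixes W :: "real \<Rightarrow> real" and t :: real
  assumes W: "integrable Expo W" "integrable Expo (\<lambda>u. W u * ln u)"
  defines "G \<equiv> (\<lambda>t. \<integral>u. of_real (W u) * exp (\<i> * of_real (t * ln u)) \<partial>Expo)"
  shows "(\<lambda>n. (G (t + 1 / real (Suc n)) - G t) / (\<i> * of_real (1 / real (Suc n)))) \<longlonglongrightarrow>
    (\<integral>u. of_real (W u * ln u) * exp (\<i> * of_real (t * ln u)) \<partial>Expo)"
proof -
  have [measurable]: "W \<in> borel_measurable borel" using borel_measurable_integrable[OF W(1)] by simp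
  have int: "integrable Expo (\<lambda>u. of_real (W u) * exp (\<i> * of_real (t * ln u)))" for t
    by (rule Bochner_Integration.integrable_bound[OF W(1)]) (measurable, auto simp: norm_mult)
  define D where "D n u = of_real (W u) * exp (\<i> * of_real (t * ln u)) *
      ((exp (\<i> * of_real (ln u / real (Suc n))) - 1) / (\<i> * of_real (1 / real (Suc n))))" for n u
  have e: "(G (t + 1 / real (Suc n)) - G t) / (\<i> * of_real (1 / real (Suc n))) = (\<integral>u. D n u \<partial>Expo)" for n
  proof -
    have eq: "of_real (W u) * exp (\<i> * of_real ((t + 1 / real (Suc n)) * ln u)) - of_real (W u) * exp (\<i> * of_real (t * ln u)) =
      of_real (W u) * exp (\<i> * of_real (t * ln u)) * (exp (\<i> * of_real (ln u / real (Suc n))) - 1)" for u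
    proof -
      have "\<i> * of_real ((t + 1 / real (Suc n)) * ln u) = \<i> * of_real (t * ln u) + \<i> * of_real (ln u / real (Suc n))"
        by (simp add: algebra_simps add_divide_distrib del: of_nat_Suc)
      then have "exp (\<i> * of_real ((t + 1 / real (Suc n)) * ln u)) =
        exp (\<i> * of_real (t * ln u)) * exp (\<i> * of_real (ln u / real (Suc n)))"
        by (simp only: exp_add)
      then show ?thesis by (simp only: right_diff_distrib mult.assoc mult_1_right)
    qed
    have "G (t + 1 / real (Suc n)) - G t = (\<integral>u. of_real (W u) * exp (\<i> * of_real (t * ln u)) *
      (exp (\<i> * of_real (ln u / real (Suc n))) - 1) \<partial>Expo)"
      unfolding G_def Bochner_Integration.integral_diff[OF int int, symmetric] eq ..
    then show ?thesis unfolding D_def times_divide_eq_right Bochner_Integration.integral_divide_zero by (rule arg_cong)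
  qed
  have b: "norm ((exp (\<i> * of_real (ln u / real (Suc n))) - 1) / (\<i> * of_real (1 / real (Suc n)))) \<le> \<bar>ln u\<bar>" for u n
  proof -
    have "norm (exp (\<i> * of_real (ln u / real (Suc n))) - 1) \<le> \<bar>ln u / real (Suc n)\<bar>" by (rule norm_cis_minus_1)
    then have "norm (exp (\<i> * of_real (ln u / real (Suc n))) - 1) / (1 / real (Suc n)) \<le> \<bar>ln u / real (Suc n)\<bar> / (1 / real (Suc n))"
      by (rule divide_right_mono) simp
    also have "\<dots> = \<bar>ln u\<bar>" by (simp add: abs_divide del: of_nat_Suc)
    finally show ?thesis unfolding norm_divide norm_mult norm_of_real norm_ii by (simp del: of_nat_Suc)
  qed
  have lim: "(\<lambda>n. D n u) \<longlonglongrightarrow> of_real (W u * ln u) * exp (\<i> * of_real (t * ln u))" for u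
  proof -
    have "((\<lambda>s. exp (\<i> * of_real (ln u) * s)) has_field_derivative exp (\<i> * of_real (ln u) * 0) * (\<i> * of_real (ln u))) (at (0 :: complex))"
      by (auto intro!: derivative_eq_intros)
    then have "(\<lambda>s. (exp (\<i> * of_real (ln u) * s) - 1) / s) \<midarrow>0\<rightarrow> \<i> * of_real (ln u)"
      by (simp add: has_field_derivative_iff)
    moreover have "filterlim (\<lambda>n. of_real (1 / real (Suc n)) :: complex) (at 0) sequentially"
      using shrink_at_0[of 1] by simp
    ultimately have "(\<lambda>n. (exp (\<i> * of_real (ln u) * of_real (1 / real (Suc n))) - 1) / of_real (1 / real (Suc n))) \<longlonglongrightarrow> \<i> * of_real (ln u)"
      by (rule filterlim_compose)
    then have "(\<lambda>n. of_real (W u) * exp (\<i> * of_real (t * ln u)) *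
      (((exp (\<i> * of_real (ln u) * of_real (1 / real (Suc n))) - 1) / of_real (1 / real (Suc n))) / \<i>)) \<longlonglongrightarrow>
      of_real (W u) * exp (\<i> * of_real (t * ln u)) * ((\<i> * of_real (ln u)) / \<i>)"
      by (intro tendsto_intros) auto
    then show ?thesis by (simp add: D_def field_simps)
  qed
  show ?thesis unfolding e
  proof (rule integral_dominated_convergence[where w = "\<lambda>u. norm (W u * ln u)"])
    show "D n \<in> borel_measurable Expo" for n unfolding D_def by measurable
    show "(\<lambda>u. of_real (W u * ln u) * exp (\<i> * of_real (t * ln u))) \<in> borel_measurable Expo" by measurable
    show "integrable Expo (\<lambda>u. norm (W u * ln u))" using W(2) by (rule integrable_norm)
    show "AE u in Expo. (\<lambda>n. D n u) \<longlonglongrightarrow> of_real (W u * ln u) * exp (\<i> * of_real (t * ln u))"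
      by (rule AE_I2) (rule lim)
    show "AE u in Expo. norm (D n u) \<le> norm (W u * ln u)" for n
    proof (rule AE_I2)
      fix u
      have "norm (D n u) = \<bar>W u\<bar> * norm ((exp (\<i> * of_real (ln u / real (Suc n))) - 1) / (\<i> * of_real (1 / real (Suc n))))"
        by (simp only: D_def norm_mult norm_of_real norm_exp_i_times mult_1_right)
      also have "\<dots> \<le> \<bar>W u\<bar> * \<bar>ln u\<bar>" by (rule mult_left_mono[OF b]) simp
      finally show "norm (D n u) \<le> norm (W u * ln u)" by (simp only: real_norm_def abs_mult)
    qed
  qed
qed

text \<open>Both integrals are limits of the difference quotients of Gamma along a vertical line.
  The line with real part 2 serves to bound the derivative on the line with real part 1 through the
  functional equation.\<close>

lemma Expo_ln_Gamma:
  "(\<integral>u. of_real (ln u) * exp (\<i> * of_real (t * ln u)) \<partial>Expo) = deriv Gamma (1 + \<i> * of_real t)" (is "?A = _")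
  "(\<integral>u. of_real (u * ln u) * exp (\<i> * of_real (t * ln u)) \<partial>Expo) = deriv Gamma (2 + \<i> * of_real t)" (is "?B = _")
proof -
  have G1: "(\<integral>u. of_real 1 * exp (\<i> * of_real (t * ln u)) \<partial>Expo) = Gamma (1 + \<i> * of_real t)" for t
    using Expo_Gamma(2)[of "1 + \<i> * of_real t"] by (simp add: mult_ac)
  have G2: "(\<integral>u. of_real u * exp (\<i> * of_real (t * ln u)) \<partial>Expo) = Gamma (2 + \<i> * of_real t)" for t
  proof -
    have "AE u in Expo. of_real u * exp (\<i> * of_real (t * ln u)) = exp ((2 + \<i> * of_real t - 1) * of_real (ln u))"
      using AE_Expo_pos
    proof eventually_elim
      fix u :: real assume u: "u > 0"
      have "of_real u = exp (of_real (ln u) :: complex)" using u by (simp add: exp_of_real)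
      then show "of_real u * exp (\<i> * of_real (t * ln u)) = exp ((2 + \<i> * of_real t - 1) * of_real (ln u))"
        by (simp add: exp_add[symmetric] algebra_simps)
    qed
    then have "(\<integral>u. of_real u * exp (\<i> * of_real (t * ln u)) \<partial>Expo) = (\<integral>u. exp ((2 + \<i> * of_real t - 1) * of_real (ln u)) \<partial>Expo)"
      by (intro integral_cong_AE) auto
    then show ?thesis using Expo_Gamma(2)[of "2 + \<i> * of_real t"] by simp
  qed
  have lim: "(\<lambda>n. (Gamma (c + \<i> * of_real (t + 1 / real (Suc n))) - Gamma (c + \<i> * of_real t)) / (\<i> * of_real (1 / real (Suc n))))
      \<longlonglongrightarrow> deriv Gamma (c + \<i> * of_real t)" if "Re c > 0" for c
  proof -
    have nn: "c + \<i> * of_real t \<notin> \<int>\<^sub>\<le>\<^sub>0" using that by (auto elim!: nonpos_Ints_cases simp: complex_eq_iff)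
    then have "(Gamma has_field_derivative deriv Gamma (c + \<i> * of_real t)) (at (c + \<i> * of_real t))"
      using has_field_derivative_Gamma DERIV_imp_deriv by metis
    then have "(\<lambda>s. (Gamma (c + \<i> * of_real t + s) - Gamma (c + \<i> * of_real t)) / s) \<midarrow>0\<rightarrow> deriv Gamma (c + \<i> * of_real t)"
      by (simp add: DERIV_def)
    moreover have "filterlim (\<lambda>n. \<i> * of_real (1 / real (Suc n)) :: complex) (at 0) sequentially"
      by (rule shrink_at_0) simp
    ultimately have "(\<lambda>n. (Gamma (c + \<i> * of_real t + \<i> * of_real (1 / real (Suc n))) - Gamma (c + \<i> * of_real t)) / (\<i> * of_real (1 / real (Suc n))))
      \<longlonglongrightarrow> deriv Gamma (c + \<i> * of_real t)" by (rule filterlim_compose)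
    then show ?thesis by (simp add: algebra_simps)
  qed
  have W1: "integrable Expo (\<lambda>u. 1 :: real)" "integrable Expo (\<lambda>u. 1 * ln u)" using integrable_ln by auto
  show "?A = deriv Gamma (1 + \<i> * of_real t)"
    using LIMSEQ_unique[OF Expo_deriv_seq[OF W1, of t, unfolded G1] lim[of 1]] by simp
  show "?B = deriv Gamma (2 + \<i> * of_real t)"
    using LIMSEQ_unique[OF Expo_deriv_seq[OF integrable_ln(4,3), of t, unfolded G2] lim[of 2]] by simp
qed

lemma Expo_ln: "(\<integral>u. ln u \<partial>Expo) = - euler_mascheroni"
proof -
  have "complex_of_real (\<integral>u. ln u \<partial>Expo) = deriv Gamma 1" using Expo_ln_Gamma(1)[of 0] by simp
  also have "\<dots> = Gamma 1 * Digamma 1" by (intro DERIV_imp_deriv has_field_derivative_Gamma) auto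
  also have "\<dots> = of_real (- euler_mascheroni)" by simp
  finally show ?thesis using of_real_eq_iff by blast
qed

lemma Polygamma_1_1: "Polygamma 1 (1 :: complex) = of_real (pi\<^sup>2 / 6)"
proof -
  have s: "(\<lambda>k. 1 / (real (Suc k))\<^sup>2) sums (pi\<^sup>2 / 6)" using inverse_squares_sums by (simp add: add.commute)
  have "Polygamma (Suc 0) (1 :: complex) = (\<Sum>k. inverse ((1 + of_nat k) ^ Suc (Suc 0)))"
    unfolding Polygamma_def by simp
  also have "\<dots> = (\<Sum>k. complex_of_real (1 / (real (Suc k))\<^sup>2))"
    by (intro suminf_cong) (simp add: power2_eq_square field_simps)
  also have "\<dots> = of_real (pi\<^sup>2 / 6)" using sums_of_real[OF s, where 'a = complex] by (simp add: sums_iff)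
  finally show ?thesis by simp
qed

text \<open>This is the second derivative of Gamma at 1. It is reached by differentiating the
  formula for the first derivative once more, with \<open>W = ln\<close> and the derivative written
  as Gamma times Digamma.\<close>

lemma Expo_ln_sq: "(\<integral>u. (ln u)\<^sup>2 \<partial>Expo) = euler_mascheroni\<^sup>2 + pi\<^sup>2 / 6"
proof -
  let ?D = "\<lambda>z. Gamma z * Digamma z :: complex"
  have dG: "deriv Gamma z = ?D z" if "z \<notin> \<int>\<^sub>\<le>\<^sub>0" for z :: complex
    by (intro DERIV_imp_deriv has_field_derivative_Gamma that)
  have nn: "1 + \<i> * of_real t \<notin> \<int>\<^sub>\<le>\<^sub>0" for t by (auto elim!: nonpos_Ints_cases simp: complex_eq_iff)
  have dd: "(?D has_field_derivative (Gamma 1 * Digamma 1 * Digamma 1 + Polygamma 1 1 * Gamma 1)) (at 1)"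
    by (intro derivative_eq_intros) auto
  have "(\<lambda>s. (?D (1 + s) - ?D 1) / s) \<midarrow>0\<rightarrow> (Gamma 1 * Digamma 1 * Digamma 1 + Polygamma 1 1 * Gamma 1)"
    using dd by (simp add: DERIV_def)
  moreover have "filterlim (\<lambda>n. \<i> * of_real (1 / real (Suc n)) :: complex) (at 0) sequentially"
    by (rule shrink_at_0) simp
  ultimately have l1: "(\<lambda>n. (?D (1 + \<i> * of_real (1 / real (Suc n))) - ?D 1) / (\<i> * of_real (1 / real (Suc n))))
    \<longlonglongrightarrow> (Gamma 1 * Digamma 1 * Digamma 1 + Polygamma 1 1 * Gamma 1)" by (rule filterlim_compose)
  have G: "(\<integral>u. of_real (ln u) * exp (\<i> * of_real (t * ln u)) \<partial>Expo) = ?D (1 + \<i> * of_real t)" for t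
    using Expo_ln_Gamma(1)[of t] dG[OF nn] by simp
  have i2: "integrable Expo (\<lambda>u. ln u * ln u)" using integrable_ln(2) by (simp add: power2_eq_square)
  have "(\<integral>u. of_real (ln u * ln u) * exp (\<i> * of_real (0 * ln u)) \<partial>Expo) =
     Gamma 1 * Digamma 1 * Digamma 1 + Polygamma 1 (1 :: complex) * Gamma 1"
    using LIMSEQ_unique[OF Expo_deriv_seq[OF integrable_ln(1) i2, of 0, unfolded G] ] l1 by simp
  then have "(\<integral>u. complex_of_real (ln u * ln u) \<partial>Expo) = Gamma 1 * Digamma 1 * Digamma 1 + Polygamma 1 (1 :: complex) * Gamma 1"
    by (simp only: mult_zero_left of_real_0 mult_zero_right exp_zero mult_1_right)
  then have "complex_of_real (\<integral>u. ln u * ln u \<partial>Expo) = Gamma 1 * Digamma 1 * Digamma 1 + Polygamma 1 1 * Gamma 1"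
    by (simp only: integral_complex_of_real)
  then have "complex_of_real (\<integral>u. ln u * ln u \<partial>Expo) = of_real (euler_mascheroni\<^sup>2 + pi\<^sup>2 / 6)"
    unfolding Polygamma_1_1 by (simp add: power2_eq_square)
  then have "(\<integral>u. ln u * ln u \<partial>Expo) = euler_mascheroni\<^sup>2 + pi\<^sup>2 / 6" using of_real_eq_iff by blast
  then show ?thesis by (simp add: power2_eq_square)
qed

section \<open>Expectations of the sawtooth function\<close>

definition ee :: "real \<Rightarrow> complex" where "ee t = exp (2 * of_real pi * \<i> * of_real t)"

lemma ee_add: "ee (s + t) = ee s * ee t"
  by (simp add: ee_def algebra_simps exp_add)

lemma ee_power: "ee t ^ n = ee (real n * t)"
  by (simp add: ee_def exp_of_nat_mult[symmetric] mult_ac)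

lemma norm_ee [simp]: "norm (ee t) = 1"
proof -
  have "ee t = exp (\<i> * of_real (2 * pi * t))" by (simp add: ee_def mult_ac)
  then show ?thesis by simp
qed

lemma ee_uminus: "ee (- t) = cnj (ee t)"
  by (simp add: ee_def exp_cnj)

lemma ee_int: "ee (of_int k) = 1"
  using exp_integer_2pi[of "of_int k"] by (simp add: ee_def mult_ac)

lemma ee_measurable [measurable]: "ee \<in> borel_measurable borel"
  unfolding ee_def by measurable

lemma ee_eq: "ee t = Complex (cos (2 * pi * t)) (sin (2 * pi * t))"
proof -
  have "ee t = cis (2 * pi * t)" by (simp add: ee_def cis_conv_exp mult_ac)
  then show ?thesis by (simp add: complex_eq_iff)
qed

definition sawtooth :: "real \<Rightarrow> real" where "sawtooth t = 1 / 2 - frac t"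

definition sterm :: "real \<Rightarrow> nat \<Rightarrow> real" where "sterm t n = sin (2 * pi * real (Suc n) * t) / (pi * real (Suc n))"

lemma sterm_ee: "complex_of_real (sterm t n) = (ee (real (Suc n) * t) - ee (- (real (Suc n) * t))) / (2 * of_real pi * \<i> * of_nat (Suc n))"
proof -
  have "ee (real (Suc n) * t) - ee (- (real (Suc n) * t)) = 2 * \<i> * of_real (sin (2 * pi * (real (Suc n) * t)))"
    unfolding ee_uminus by (simp add: complex_diff_cnj ee_eq)
  then show ?thesis by (simp add: sterm_def field_simps del: of_nat_Suc)
qed

text \<open>The imaginary part of the logarithm series at a point inside the unit disc: the Abel
  means of the Fourier series of the sawtooth.\<close>

lemma Abel_sawtooth_sums:
  assumes "0 \<le> r" "r < 1"
  shows "(\<lambda>n. r ^ Suc n * sterm t n) sums (- Im (Ln (1 - of_real r * ee t)) / pi)"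
proof -
  let ?w = "of_real r * ee t"
  have "norm (- ?w) < 1" using assms by (simp add: norm_mult)
  from Ln_series[OF this] have "(\<lambda>n. (- 1) ^ Suc n / of_nat n * (- ?w) ^ n) sums Ln (1 - ?w)" by simp
  then have "(\<lambda>n. (- 1) ^ Suc (Suc n) / of_nat (Suc n) * (- ?w) ^ Suc n) sums Ln (1 - ?w)"
    by (subst sums_Suc_iff) simp
  moreover have "(- 1) ^ Suc (Suc n) / of_nat (Suc n) * (- ?w) ^ Suc n = - (of_real (r ^ Suc n) * ee (real (Suc n) * t) / of_nat (Suc n))" for n
  proof -
    have "(- ?w) ^ Suc n = (- 1) ^ Suc n * (of_real (r ^ Suc n) * ee (real (Suc n) * t))"
      by (simp only: power_minus[of ?w] power_mult_distrib ee_power of_real_power)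
    moreover have "(- 1) ^ Suc (Suc n) * (- 1) ^ Suc n = (- 1 :: complex)"
      by (simp flip: power_add power_Suc)
    ultimately show ?thesis by (simp del: power_Suc of_nat_Suc add: divide_simps) (metis mult.assoc mult.commute mult_minus1)
  qed
  ultimately have "(\<lambda>n. - (of_real (r ^ Suc n) * ee (real (Suc n) * t) / of_nat (Suc n))) sums Ln (1 - ?w)" by (simp only:)
  from sums_Im[OF this] have "(\<lambda>n. - (r ^ Suc n * sin (2 * pi * (real (Suc n) * t)) / real (Suc n))) sums Im (Ln (1 - ?w))"
    by (simp add: ee_eq Im_divide_of_nat del: of_nat_Suc power_Suc)
  from sums_mult[OF this, of "- 1 / pi"] show ?thesis
    by (simp add: sterm_def mult.assoc del: of_nat_Suc power_Suc)
qed

text \<open>With \<open>s = frac t\<close>, \<open>1 - ee t\<close> is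
  \<open>2 * sin (pi * s)\<close> times the unit number with argument
  \<open>pi * s - pi / 2\<close>. That argument lies between \<open>- pi / 2\<close> and
  \<open>pi / 2\<close>, hence it is the one of the principal branch.\<close>

lemma one_minus_ee:
  assumes "t \<notin> \<int>"
  shows "Re (1 - ee t) > 0" "Im (Ln (1 - ee t)) = - pi * sawtooth t"
proof -
  define s where "s = frac t"
  have s: "0 < s" "s < 1" using assms frac_lt_1[of t] frac_gt_0_iff[of t] by (auto simp: s_def)
  have es: "ee t = ee s"
  proof -
    have "t = of_int \<lfloor>t\<rfloor> + s" by (simp add: s_def frac_def)
    then have "ee t = ee (of_int \<lfloor>t\<rfloor>) * ee s" using ee_add by metis
    then show ?thesis by (simp add: ee_int)
  qed
  have sp: "sin (pi * s) > 0" using s by (intro sin_gt_zero) auto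
  have c: "cos (2 * pi * s) = 1 - 2 * (sin (pi * s))\<^sup>2" using cos_double_sin[of "pi * s"] by (simp add: mult_ac)
  have sn: "sin (2 * pi * s) = 2 * sin (pi * s) * cos (pi * s)" using sin_double[of "pi * s"] by (simp add: mult_ac)
  show "Re (1 - ee t) > 0" unfolding es using sp c by (simp add: ee_eq)
  have e: "1 - ee t = of_real (2 * sin (pi * s)) * exp (\<i> * of_real (pi * s - pi / 2))"
    unfolding es unfolding ee_eq c sn by (simp add: complex_eq_iff exp_Euler cos_diff sin_diff cos_of_real sin_of_real power2_eq_square
        flip: of_real_mult of_real_diff of_real_divide)
  have Ln_eq: "Ln (1 - ee t) = of_real (ln (2 * sin (pi * s))) + \<i> * of_real (pi * s - pi / 2)"
  proof (rule Ln_unique)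
    show "exp (of_real (ln (2 * sin (pi * s))) + \<i> * of_real (pi * s - pi / 2)) = 1 - ee t"
      unfolding e using sp by (simp only: exp_add exp_of_real exp_ln)
    have "pi * s < pi" "0 < pi * s" using s by simp_all
    then show "- pi < Im (of_real (ln (2 * sin (pi * s))) + \<i> * of_real (pi * s - pi / 2))"
      "Im (of_real (ln (2 * sin (pi * s))) + \<i> * of_real (pi * s - pi / 2)) \<le> pi"
      unfolding Im_i_times plus_complex.sel Im_complex_of_real Re_complex_of_real using pi_gt_zero by linarith+
  qed
  have "Im (Ln (1 - ee t)) = pi * s - pi / 2" unfolding Ln_eq by simp
  then show "Im (Ln (1 - ee t)) = - pi * sawtooth t" by (simp add: sawtooth_def s_def algebra_simps)
qed

lemma Abel_sawtooth_bound: "r < 1 \<Longrightarrow> 0 \<le> r \<Longrightarrow> \<bar>- Im (Ln (1 - of_real r * ee t)) / pi\<bar> \<le> 1"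
proof -
  assume r: "r < 1" "0 \<le> r"
  have "1 - of_real r * ee t \<noteq> 0"
  proof
    assume "1 - of_real r * ee t = 0"
    then have "norm (of_real r * ee t) = 1" by (metis eq_iff_diff_eq_0 norm_one)
    then show False using r by (simp add: norm_mult)
  qed
  then have "\<bar>Im (Ln (1 - of_real r * ee t))\<bar> \<le> pi" using Im_Ln_le_pi[of "1 - of_real r * ee t"] mpi_less_Im_Ln[of "1 - of_real r * ee t"] unfolding abs_le_iff by linarith
  then show ?thesis by (simp add: field_simps)
qed

lemma Abel_sawtooth_tendsto:
  assumes "t \<notin> \<int>"
  shows "(\<lambda>j. - Im (Ln (1 - of_real (1 - 1 / real (Suc j)) * ee t)) / pi) \<longlonglongrightarrow> sawtooth t"
proof -
  have "(\<lambda>j. 1 - of_real (1 - 1 / real (Suc j)) * ee t) \<longlonglongrightarrow> 1 - of_real (1 - 0) * ee t"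
    using LIMSEQ_inverse_real_of_nat unfolding inverse_eq_divide by (intro tendsto_intros)
  moreover have "1 - of_real (1 - 0) * ee t \<notin> \<real>\<^sub>\<le>\<^sub>0" using one_minus_ee(1)[OF assms] by (auto simp: complex_nonpos_Reals_iff)
  ultimately have "(\<lambda>j. Ln (1 - of_real (1 - 1 / real (Suc j)) * ee t)) \<longlonglongrightarrow> Ln (1 - of_real (1 - 0) * ee t)"
    by (rule tendsto_Ln)
  then have "(\<lambda>j. - Im (Ln (1 - of_real (1 - 1 / real (Suc j)) * ee t)) / pi) \<longlonglongrightarrow> - Im (Ln (1 - of_real (1 - 0) * ee t)) / pi"
    using pi_neq_zero by (intro tendsto_divide tendsto_minus tendsto_Im tendsto_const)
  then show ?thesis using one_minus_ee(2)[OF assms] by simp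
qed

text \<open>The partial sums of the Fourier series of the sawtooth are dominated only after Abel
  summation, where they become arguments of complex numbers.\<close>

lemma integral_sawtooth:
  fixes M :: "'a measure" and W Y :: "'a \<Rightarrow> real"
  assumes W: "integrable M W" and [measurable]: "Y \<in> borel_measurable M" and ae: "AE u in M. x - Y u \<notin> \<int>"
  defines "a \<equiv> (\<lambda>n :: int. \<integral>u. of_real (W u) * ee (- (of_int n * Y u)) \<partial>M)"
  defines "T \<equiv> (\<lambda>n. (a (int (Suc n)) * ee (real (Suc n) * x) - a (- int (Suc n)) * ee (- (real (Suc n) * x))) / (2 * of_real pi * \<i> * of_nat (Suc n)))"
  assumes sm: "summable (\<lambda>n. norm (T n))"
  shows "integrable M (\<lambda>u. W u * sawtooth (x - Y u))" "T sums of_real (\<integral>u. W u * sawtooth (x - Y u) \<partial>M)"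
proof -
  have [measurable]: "W \<in> borel_measurable M" using W by simp
  have [measurable]: "sawtooth \<in> borel_measurable borel" unfolding sawtooth_def frac_def by measurable
  have sb: "\<bar>sawtooth t\<bar> \<le> 1" for t unfolding sawtooth_def abs_le_iff using frac_ge_0[of t] frac_lt_1[of t] by linarith
  show int: "integrable M (\<lambda>u. W u * sawtooth (x - Y u))"
    by (rule Bochner_Integration.integrable_bound[OF W]) (measurable, auto simp: abs_mult intro!: mult_left_le sb)
  define A where "A r u = W u * (- Im (Ln (1 - of_real r * ee (x - Y u))) / pi)" for r u
  have st: "\<bar>sterm t n\<bar> \<le> 1" for t n
  proof -
    have "\<bar>sterm t n\<bar> \<le> 1 / (pi * real (Suc n))" by (simp add: sterm_def abs_mult divide_right_mono del: of_nat_Suc)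
    also have "\<dots> \<le> 1" using mult_mono[of 1 pi 1 "real (Suc n)"] pi_gt3 by (simp add: field_simps)
    finally show ?thesis .
  qed
  have intE: "integrable M (\<lambda>u. of_real (W u) * ee (- (of_int n * Y u)))" for n
    by (rule Bochner_Integration.integrable_bound[OF W]) (measurable, auto simp: norm_mult)
  have intS: "integrable M (\<lambda>u. W u * sterm (x - Y u) n)" for n
    by (rule Bochner_Integration.integrable_bound[OF W])
      (unfold sterm_def, measurable, unfold sterm_def[symmetric], auto simp: abs_mult intro!: mult_left_le st)
  have valS: "of_real (\<integral>u. W u * sterm (x - Y u) n \<partial>M) = T n" for n
  proof -
    have "complex_of_real (\<integral>u. W u * sterm (x - Y u) n \<partial>M) = (\<integral>u. complex_of_real (W u * sterm (x - Y u) n) \<partial>M)"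
      by (rule integral_complex_of_real[symmetric])
    also have "\<dots> = (\<integral>u. (of_real (W u) * ee (- (of_int (int (Suc n)) * Y u)) * ee (real (Suc n) * x) -
        of_real (W u) * ee (- (of_int (- int (Suc n)) * Y u)) * ee (- (real (Suc n) * x))) / (2 * of_real pi * \<i> * of_nat (Suc n)) \<partial>M)"
    proof (rule Bochner_Integration.integral_cong[OF refl])
      fix u
      have "ee (real (Suc n) * (x - Y u)) = ee (- (of_int (int (Suc n)) * Y u)) * ee (real (Suc n) * x)"
        "ee (- (real (Suc n) * (x - Y u))) = ee (- (of_int (- int (Suc n)) * Y u)) * ee (- (real (Suc n) * x))"
        unfolding ee_add[symmetric] by (simp_all add: algebra_simps)
      then show "of_real (W u * sterm (x - Y u) n) = (of_real (W u) * ee (- (of_int (int (Suc n)) * Y u)) * ee (real (Suc n) * x) -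
        of_real (W u) * ee (- (of_int (- int (Suc n)) * Y u)) * ee (- (real (Suc n) * x))) / (2 * of_real pi * \<i> * of_nat (Suc n))"
        unfolding of_real_mult sterm_ee by (simp only: times_divide_eq_right right_diff_distrib mult.assoc)
    qed
    also have "\<dots> = T n" unfolding T_def a_def
      by (subst Bochner_Integration.integral_divide_zero, subst Bochner_Integration.integral_diff)
        (use intE in \<open>auto simp del: of_nat_Suc of_int_minus of_int_of_nat_eq\<close>)
    finally show ?thesis .
  qed
  have sumsA: "(\<lambda>n. r ^ Suc n * (\<integral>u. W u * sterm (x - Y u) n \<partial>M)) sums (\<integral>u. A r u \<partial>M)" if r: "0 \<le> r" "r < 1" for r
  proof -
    have p: "(\<lambda>n. r ^ Suc n * (W u * sterm (x - Y u) n)) sums A r u" for u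
      using sums_mult[OF Abel_sawtooth_sums[OF r, of "x - Y u"], of "W u"] unfolding A_def by (simp only: mult.left_commute)
    have gs: "summable (\<lambda>n. r ^ Suc n)" using r by (simp add: summable_geometric)
    have nb: "norm (r ^ Suc n * (W u * sterm (x - Y u) n)) \<le> r ^ Suc n * \<bar>W u\<bar>" for n u
      using r st[of "x - Y u" n] by (auto simp: abs_mult intro!: mult_left_mono mult_left_le)
    have "(\<lambda>n. \<integral>u. r ^ Suc n * (W u * sterm (x - Y u) n) \<partial>M) sums (\<integral>u. (\<Sum>n. r ^ Suc n * (W u * sterm (x - Y u) n)) \<partial>M)"
    proof (rule sums_integral)
      show "integrable M (\<lambda>u. r ^ Suc n * (W u * sterm (x - Y u) n))" for n using intS by simp
      show "AE u in M. summable (\<lambda>n. norm (r ^ Suc n * (W u * sterm (x - Y u) n)))"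
        by (rule AE_I2, rule summable_comparison_test'[OF summable_mult2[OF gs], of 0]) (use nb in auto)
      show "summable (\<lambda>n. \<integral>u. norm (r ^ Suc n * (W u * sterm (x - Y u) n)) \<partial>M)"
      proof (rule summable_comparison_test'[OF summable_mult2[OF gs, of "\<integral>u. \<bar>W u\<bar> \<partial>M"], of 0])
        fix n
        have "(\<integral>u. norm (r ^ Suc n * (W u * sterm (x - Y u) n)) \<partial>M) \<le> (\<integral>u. r ^ Suc n * \<bar>W u\<bar> \<partial>M)"
          by (intro integral_mono integrable_norm) (use W intS nb in auto)
        then show "norm (\<integral>u. norm (r ^ Suc n * (W u * sterm (x - Y u) n)) \<partial>M) \<le> r ^ Suc n * (\<integral>u. \<bar>W u\<bar> \<partial>M)" by simp
      qed
    qed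
    then show ?thesis using p by (simp add: sums_iff)
  qed
  have mA: "A r \<in> borel_measurable M" if r: "0 \<le> r" "r < 1" for r
  proof -
    have "A r u = (\<Sum>n. r ^ Suc n * (W u * sterm (x - Y u) n))" for u
    proof (rule sums_unique)
      show "(\<lambda>n. r ^ Suc n * (W u * sterm (x - Y u) n)) sums A r u"
        using sums_mult[OF Abel_sawtooth_sums[OF r, of "x - Y u"], of "W u"] unfolding A_def by (simp only: mult.left_commute)
    qed
    then have "A r = (\<lambda>u. \<Sum>n. r ^ Suc n * (W u * sterm (x - Y u) n))" by (rule ext)
    moreover have "(\<lambda>u. \<Sum>n. r ^ Suc n * (W u * sterm (x - Y u) n)) \<in> borel_measurable M"
      unfolding sterm_def by measurable
    ultimately show ?thesis by (simp only:)
  qed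
  \<comment> \<open>The radii tend to 1. The integral converges by dominated convergence, since
    arguments are bounded by \<open>pi\<close>; the series converges by Tannery's theorem, since the
    terms \<open>T\<close> are absolutely summable. Comparing both limits gives the claim.\<close>
  define rr where "rr j = 1 - 1 / real (Suc j)" for j
  have rr: "0 \<le> rr j" "rr j < 1" "rr j \<le> 1" for j by (auto simp: rr_def)
  have lim1: "(\<lambda>j. \<integral>u. A (rr j) u \<partial>M) \<longlonglongrightarrow> (\<integral>u. W u * sawtooth (x - Y u) \<partial>M)"
  proof (rule integral_dominated_convergence[where w = "\<lambda>u. \<bar>W u\<bar>"])
    show "AE u in M. (\<lambda>j. A (rr j) u) \<longlonglongrightarrow> W u * sawtooth (x - Y u)"
      using ae by eventually_elim (unfold A_def rr_def, rule tendsto_mult_left, erule Abel_sawtooth_tendsto)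
    show "AE u in M. norm (A (rr j) u) \<le> \<bar>W u\<bar>" for j
      unfolding A_def real_norm_def abs_mult by (rule AE_I2) (intro mult_left_le Abel_sawtooth_bound rr(2,1) abs_ge_zero)
  qed (use W int in \<open>auto intro: mA rr\<close>)
  have "((\<lambda>j. \<Sum>n. of_real (rr j ^ Suc n) * T n) \<longlonglongrightarrow> suminf T)"
  proof (rule tannerys_theorem[THEN conjunct2, THEN conjunct2])
    show "(\<lambda>j. of_real (rr j ^ Suc n) * T n) \<longlonglongrightarrow> T n" for n
    proof -
      have "rr \<longlonglongrightarrow> 1 - 0" unfolding rr_def using LIMSEQ_inverse_real_of_nat unfolding inverse_eq_divide by (intro tendsto_intros)
      then have "(\<lambda>j. of_real (rr j ^ Suc n) * T n) \<longlonglongrightarrow> of_real ((1 - 0) ^ Suc n) * T n" by (intro tendsto_intros)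
      then show ?thesis by simp
    qed
    show "\<forall>\<^sub>F (n, j) in at_top \<times>\<^sub>F sequentially. norm (of_real (rr j ^ Suc n) * T n) \<le> norm (T n)"
      using rr by (intro always_eventually) (auto simp: norm_mult norm_power power_le_one intro!: mult_left_le_one_le simp del: power_Suc)
  qed (use sm in auto)
  moreover have "(\<Sum>n. of_real (rr j ^ Suc n) * T n) = of_real (\<integral>u. A (rr j) u \<partial>M)" for j
    using sums_of_real[OF sumsA[OF rr(1,2), of j], where 'a = complex] unfolding of_real_mult valS by (simp add: sums_iff)
  ultimately have "(\<lambda>j. complex_of_real (\<integral>u. A (rr j) u \<partial>M)) \<longlonglongrightarrow> suminf T" by simp
  then have "suminf T = of_real (\<integral>u. W u * sawtooth (x - Y u) \<partial>M)"
    using tendsto_of_real[OF lim1, where 'a = complex] LIMSEQ_unique by blast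
  then show "T sums of_real (\<integral>u. W u * sawtooth (x - Y u) \<partial>M)"
    using summable_sums[OF summable_norm_cancel[OF sm]] by simp
qed

text \<open>For \<open>s = frac t\<close>, the integral of the sawtooth over the interval from 0 to
  \<open>s\<close> is \<open>(s - s\<^sup>2) / 2\<close>, and \<open>1 / 4 - (s - s\<^sup>2)\<close>
  is the square of the sawtooth. So the cosine series results from integrating the sine series,
  which is \<open>integral_sawtooth\<close> for Lebesgue measure on that interval with
  \<open>Y u = - u\<close> and \<open>x = 0\<close>.\<close>

lemma sawtooth_sq_sums: "(\<lambda>n. cos (2 * pi * real (Suc n) * t) / (pi * real (Suc n))\<^sup>2) sums ((sawtooth t)\<^sup>2 - 1 / 12)"
proof -
  define s where "s = frac t"
  have s: "0 \<le> s" "s < 1" using frac_lt_1[of t] by (auto simp: s_def)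
  have ce: "cos (2 * pi * real (Suc n) * t) = cos (2 * pi * real (Suc n) * s)" for n
  proof -
    have "t = of_int \<lfloor>t\<rfloor> + s" by (simp add: s_def frac_def)
    then have "2 * pi * real (Suc n) * t = 2 * pi * real (Suc n) * s + of_int (int (Suc n) * \<lfloor>t\<rfloor>) * (2 * pi)"
      by (metis (no_types, opaque_lifting) distrib_left add.commute mult.assoc mult.commute of_int_mult of_int_of_nat_eq)
    then show ?thesis using cos.plus_of_int[of "2 * pi * real (Suc n) * s" "int (Suc n) * \<lfloor>t\<rfloor>"]
      by (simp only: of_real_eq_id id_apply)
  qed
  define M where "M = restrict_space lborel {0..s}"
  have spM: "integrable M f \<longleftrightarrow> set_integrable lborel {0..s} f" "(\<integral>u. f u \<partial>M) = set_lebesgue_integral lborel {0..s} f"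
    for f :: "real \<Rightarrow> 'b :: {banach, second_countable_topology}"
    unfolding M_def set_integrable_def set_lebesgue_integral_def
    by (simp_all add: integrable_restrict_space integral_restrict_space)
  have W: "integrable M (\<lambda>u. 1 :: real)" unfolding spM set_integrable_def by (simp add: integrable_indicator_iff s(1))
  have ae: "AE u in M. 0 - (- u) \<notin> \<int>"
  proof -
    have "AE u in lborel. u \<notin> (\<int> :: real set)"
      by (rule AE_not_in, rule countable_imp_null_set_lborel) (rule countable_int)
    then show ?thesis unfolding M_def by (subst AE_restrict_space_iff) auto
  qed
  define a where "a n = (\<integral>u. of_real 1 * ee (- (of_int n * - u)) \<partial>M)" for n :: int
  have aval: "a n = (ee (of_int n * s) - 1) / (2 * of_real pi * \<i> * of_int n)" if "n \<noteq> 0" for n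
  proof -
    have "((\<lambda>u. ee (of_int n * u)) has_integral (ee (of_int n * s) / (2 * of_real pi * \<i> * of_int n) - ee (of_int n * 0) / (2 * of_real pi * \<i> * of_int n))) {0..s}"
      by (rule fundamental_theorem_of_calculus[OF s(1)])
        (auto simp: ee_def that intro!: derivative_eq_intros has_vector_derivative_real_field)
    moreover have "set_integrable lborel {0..s} (\<lambda>u. ee (of_int n * u))"
      by (rule borel_integrable_compact[OF compact_Icc, unfolded set_integrable_def[symmetric]]) (auto simp: ee_def intro!: continuous_intros)
    ultimately have "set_lebesgue_integral lborel {0..s} (\<lambda>u. ee (of_int n * u)) = (ee (of_int n * s) - 1) / (2 * of_real pi * \<i> * of_int n)"
      using set_borel_integral_eq_integral(2) integral_unique by (metis (no_types, lifting) ee_int diff_divide_distrib mult_zero_right of_int_0)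
    then show ?thesis unfolding a_def spM by simp
  qed
  define T where "T n = (a (int (Suc n)) * ee (real (Suc n) * 0) - a (- int (Suc n)) * ee (- (real (Suc n) * 0))) / (2 * of_real pi * \<i> * of_nat (Suc n))" for n
  have Tval: "T n = of_real ((1 - cos (2 * pi * real (Suc n) * s)) / (2 * (pi * real (Suc n))\<^sup>2))" for n
  proof -
    have e0: "ee 0 = 1" using ee_int[of 0] by simp
    have cc: "ee (real (Suc n) * s) + ee (- (real (Suc n) * s)) = of_real (2 * cos (2 * pi * real (Suc n) * s))"
      unfolding ee_uminus complex_add_cnj by (simp add: ee_eq mult_ac)
    have "T n = ((ee (real (Suc n) * s) - 1) + (ee (- (real (Suc n) * s)) - 1)) / (2 * of_real pi * \<i> * of_nat (Suc n))\<^sup>2"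
    proof -
      define D where "D = 2 * of_real pi * \<i> * complex_of_nat (Suc n)"
      have "a (int (Suc n)) = (ee (real (Suc n) * s) - 1) / D"
        using aval[of "int (Suc n)"] unfolding of_int_of_nat_eq D_def by simp
      moreover have "a (- int (Suc n)) = - ((ee (- (real (Suc n) * s)) - 1) / D)"
        using aval[of "- int (Suc n)"] unfolding of_int_minus of_int_of_nat_eq D_def mult_minus_left mult_minus_right divide_minus_right by simp
      ultimately show ?thesis unfolding T_def e0 mult_zero_right minus_zero D_def[symmetric]
        by (simp del: of_nat_Suc add: power2_eq_square flip: add_divide_distrib)
    qed
    also have "\<dots> = (of_real (2 * cos (2 * pi * real (Suc n) * s)) - 2) / (2 * of_real pi * \<i> * of_nat (Suc n))\<^sup>2"
      using cc by (simp add: algebra_simps)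
    also have "\<dots> = of_real ((1 - cos (2 * pi * real (Suc n) * s)) / (2 * (pi * real (Suc n))\<^sup>2))"
      by (simp add: power_mult_distrib field_simps del: of_nat_Suc)
    finally show ?thesis .
  qed
  have s2: "(\<lambda>n. 1 / (real (Suc n))\<^sup>2) sums (pi\<^sup>2 / 6)" using inverse_squares_sums by (simp add: add.commute)
  have smT: "summable (\<lambda>n. norm (T n))"
  proof (rule summable_comparison_test'[OF sums_summable[OF s2], of 0])
    fix n
    have "norm (T n) = (1 - cos (2 * pi * real (Suc n) * s)) / (2 * (pi * real (Suc n))\<^sup>2)"
      unfolding Tval norm_of_real by (rule abs_of_nonneg) simp
    also have "\<dots> \<le> 2 / (2 * (pi * real (Suc n))\<^sup>2)" using cos_ge_minus_one[of "2 * pi * real (Suc n) * s"] by (intro divide_right_mono) auto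
    also have "\<dots> \<le> 1 / (real (Suc n))\<^sup>2"
      using one_le_power[of pi 2] pi_gt3 by (simp add: power_mult_distrib field_simps del: of_nat_Suc)
    finally show "norm (norm (T n)) \<le> 1 / (real (Suc n))\<^sup>2" by simp
  qed
  have mY: "(\<lambda>u. - u) \<in> borel_measurable M" unfolding M_def by (rule measurable_restrict_space1) measurable
  have "T sums of_real (\<integral>u. 1 * sawtooth (0 - - u) \<partial>M)"
    using integral_sawtooth(2)[OF W mY, of 0] ae smT unfolding a_def[symmetric] T_def[symmetric] by blast
  moreover have "(\<integral>u. 1 * sawtooth (0 - - u) \<partial>M) = s / 2 - s\<^sup>2 / 2"
  proof -
    have "((\<lambda>u. 1 / 2 - u) has_integral (s / 2 - s\<^sup>2 / 2 - (0 / 2 - 0\<^sup>2 / 2))) {0..s}"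
      by (rule fundamental_theorem_of_calculus[OF s(1)])
        (auto intro!: derivative_eq_intros simp: has_real_derivative_iff_has_vector_derivative[symmetric] power2_eq_square)
    moreover have "set_integrable lborel {0..s} (\<lambda>u. 1 / 2 - u :: real)"
      by (rule borel_integrable_compact[OF compact_Icc, unfolded set_integrable_def[symmetric]]) (auto intro!: continuous_intros)
    ultimately have "set_lebesgue_integral lborel {0..s} (\<lambda>u. 1 / 2 - u) = s / 2 - s\<^sup>2 / 2"
      by (subst set_borel_integral_eq_integral(2)) (simp_all add: integral_unique)
    moreover have "set_lebesgue_integral lborel {0..s} sawtooth = set_lebesgue_integral lborel {0..s} (\<lambda>u. 1 / 2 - u)"
      by (rule set_lebesgue_integral_cong) (use s in \<open>auto simp: sawtooth_def frac_eq\<close>)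
    ultimately show ?thesis unfolding spM by simp
  qed
  ultimately have "(\<lambda>n. (1 - cos (2 * pi * real (Suc n) * s)) / (2 * (pi * real (Suc n))\<^sup>2)) sums (s / 2 - s\<^sup>2 / 2)"
    unfolding Tval sums_of_real_iff by simp
  from sums_diff[OF sums_mult[OF s2, of "1 / pi\<^sup>2"] sums_mult[OF this, of 2]]
  have "(\<lambda>n. cos (2 * pi * real (Suc n) * s) / (pi * real (Suc n))\<^sup>2) sums (1 / pi\<^sup>2 * (pi\<^sup>2 / 6) - 2 * (s / 2 - s\<^sup>2 / 2))"
    by (rule sums_cong[THEN iffD1, rotated]) (simp add: power_mult_distrib diff_divide_distrib del: of_nat_Suc)
  moreover have "1 / pi\<^sup>2 * (pi\<^sup>2 / 6) - 2 * (s / 2 - s\<^sup>2 / 2) = (sawtooth t)\<^sup>2 - 1 / 12"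
    by (simp add: sawtooth_def s_def[symmetric] power2_eq_square field_simps)
  ultimately show ?thesis unfolding ce by simp
qed

section \<open>Fourier series indexed by the nonzero integers\<close>

lemma inverse_Suc_squares: "summable (\<lambda>n. K / (real (Suc n))\<^sup>2)"
proof -
  have "(\<lambda>n. 1 / (real (Suc n))\<^sup>2) sums (pi\<^sup>2 / 6)" using inverse_squares_sums by (simp add: add.commute)
  from sums_summable[OF sums_mult[OF this, of K]] show ?thesis by simp
qed

text \<open>The integrals deliver sums over pairs k and - k. Quadratic decay makes both halves
  absolutely summable, so the unordered sum exists and has the same value.\<close>

lemma has_sum_nonzero_int:
  fixes g :: "int \<Rightarrow> complex"
  assumes b: "\<And>k. k \<noteq> 0 \<Longrightarrow> norm (g k) \<le> K / (of_int k)\<^sup>2"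
    and s: "(\<lambda>n. g (int (Suc n)) + g (- int (Suc n))) sums S"
  shows "(g has_sum S) (-{0})"
proof -
  have bs: "norm (g (int (Suc n))) \<le> K / (real (Suc n))\<^sup>2" "norm (g (- int (Suc n))) \<le> K / (real (Suc n))\<^sup>2" for n
    using b[of "int (Suc n)"] b[of "- int (Suc n)"] unfolding of_int_minus of_int_of_nat_eq power2_minus by auto
  have sp: "summable (\<lambda>n. norm (g (int (Suc n))))" and sm: "summable (\<lambda>n. norm (g (- int (Suc n))))"
    using bs by (intro summable_comparison_test'[OF inverse_Suc_squares[of K], of 0]; simp del: of_nat_Suc)+
  let ?p = "\<lambda>n. g (int (Suc n))" and ?m = "\<lambda>n. g (- int (Suc n))"
  have sp': "?p sums suminf ?p" and sm': "?m sums suminf ?m"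
    by (rule summable_sums[OF summable_norm_cancel[OF sp]], rule summable_sums[OF summable_norm_cancel[OF sm]])
  have "(?p has_sum suminf ?p) UNIV" by (rule norm_summable_imp_has_sum[OF sp sp'])
  then have hp: "(g has_sum suminf ?p) (range (\<lambda>n. int (Suc n)))"
    by (subst has_sum_reindex) (auto simp: inj_on_def o_def)
  have "(?m has_sum suminf ?m) UNIV" by (rule norm_summable_imp_has_sum[OF sm sm'])
  then have hm: "(g has_sum suminf ?m) (range (\<lambda>n. - int (Suc n)))"
    by (subst has_sum_reindex) (auto simp: inj_on_def o_def)
  have "range (\<lambda>n. int (Suc n)) \<inter> range (\<lambda>n. - int (Suc n)) = {}" by auto
  then have "(g has_sum suminf ?p + suminf ?m) (range (\<lambda>n. int (Suc n)) \<union> range (\<lambda>n. - int (Suc n)))"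
    using hp hm by (intro has_sum_Un_disjoint) auto
  moreover have "range (\<lambda>n. int (Suc n)) \<union> range (\<lambda>n. - int (Suc n)) = -{0}"
  proof -
    have "k \<in> range (\<lambda>n. int (Suc n)) \<union> range (\<lambda>n. - int (Suc n))" if "k \<noteq> 0" for k :: int
    proof (cases "k > 0")
      case True
      then have "k = int (Suc (nat (k - 1)))" by simp
      then show ?thesis by blast
    next
      case False
      then have "k = - int (Suc (nat (- k - 1)))" using that by simp
      then show ?thesis by blast
    qed
    then show ?thesis by auto
  qed
  moreover have "suminf ?p + suminf ?m = S"
    using sums_unique2[OF sums_add[OF sp' sm'] s] .
  ultimately show ?thesis by simp
qed

lemma integral_ee:
  assumes "k \<noteq> 0"
  shows "((\<lambda>x. ee (of_int k * x)) has_integral 0) {0..1}"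
proof -
  have "((\<lambda>u. ee (of_int k * u)) has_integral (ee (of_int k * 1) / (2 * of_real pi * \<i> * of_int k) - ee (of_int k * 0) / (2 * of_real pi * \<i> * of_int k))) {0..1}"
    by (rule fundamental_theorem_of_calculus)
      (auto simp: ee_def assms intro!: derivative_eq_intros has_vector_derivative_real_field)
  then show ?thesis using ee_int[of k] ee_int[of 0] by simp
qed

lemma has_integral_Fourier:
  fixes G :: "int \<Rightarrow> complex" and \<psi> :: "real \<Rightarrow> real"
  assumes b: "\<And>k. k \<noteq> 0 \<Longrightarrow> norm (G k) \<le> K / (of_int k)\<^sup>2"
    and s: "\<And>x. (\<lambda>n. G (int (Suc n)) * ee (of_int (int (Suc n)) * x) + G (- int (Suc n)) * ee (of_int (- int (Suc n)) * x)) sums of_real (\<psi> x)"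
  shows "(\<psi> has_integral 0) {0..1}"
proof -
  define h where "h n x = G (int (Suc n)) * ee (of_int (int (Suc n)) * x) + G (- int (Suc n)) * ee (of_int (- int (Suc n)) * x)" for n x
  have sm: "summable (\<lambda>n. 2 * K / (real (Suc n))\<^sup>2)" by (rule inverse_Suc_squares)
  have hb: "norm (h n x) \<le> 2 * K / (real (Suc n))\<^sup>2" for n x
  proof -
    have "norm (h n x) \<le> norm (G (int (Suc n))) + norm (G (- int (Suc n)))"
      unfolding h_def by (rule order_trans[OF norm_triangle_ineq]) (simp add: norm_mult)
    also have "\<dots> \<le> K / (real (Suc n))\<^sup>2 + K / (real (Suc n))\<^sup>2"
      using b[of "int (Suc n)"] b[of "- int (Suc n)"] unfolding of_int_minus of_int_of_nat_eq power2_minus by (intro add_mono) auto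
    finally show ?thesis by simp
  qed
  have hi: "(h n has_integral 0) {0..1}" for n
    using has_integral_add[OF has_integral_mult_right[OF integral_ee[of "int (Suc n)"], of "G (int (Suc n))"]
        has_integral_mult_right[OF integral_ee[of "- int (Suc n)"], of "G (- int (Suc n))"]]
    unfolding h_def[abs_def] by simp
  have "((\<lambda>x. complex_of_real (\<psi> x)) has_integral 0) {0..1}"
  proof (rule has_integral_dominated_convergence[where f = "\<lambda>N x. \<Sum>n<N. h n x" and y = "\<lambda>_. 0" and h = "\<lambda>_. \<Sum>n. 2 * K / (real (Suc n))\<^sup>2"])
    show "((\<lambda>x. \<Sum>n<N. h n x) has_integral 0) {0..1}" for N
      using has_integral_sum[of "{..<N}" h "\<lambda>_. 0" "{0..1}"] hi by simp
    show "\<forall>x\<in>{0..1}. norm (\<Sum>n<N. h n x) \<le> (\<Sum>n. 2 * K / (real (Suc n))\<^sup>2)" for N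
    proof
      fix x :: real
      have "norm (\<Sum>n<N. h n x) \<le> (\<Sum>n<N. 2 * K / (real (Suc n))\<^sup>2)" by (rule sum_norm_le) (rule hb)
      also have "\<dots> \<le> (\<Sum>n. 2 * K / (real (Suc n))\<^sup>2)"
        by (rule sum_le_suminf[OF sm]) (use hb order_trans[OF norm_ge_zero] in blast)+
      finally show "norm (\<Sum>n<N. h n x) \<le> (\<Sum>n. 2 * K / (real (Suc n))\<^sup>2)" .
    qed
    show "\<forall>x\<in>{0..1}. (\<lambda>N. \<Sum>n<N. h n x) \<longlonglongrightarrow> of_real (\<psi> x)"
      using s unfolding sums_def h_def by blast
  qed (auto intro: integrable_const_ivl)
  from has_integral_linear[OF this bounded_linear_Re] show ?thesis by (simp add: o_def)
qed

lemma prob_UNIV_Expo [simp]: "measure Expo UNIV = 1"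
  using Expo.prob_space by simp

section \<open>Fourier coefficients of expected sawtooth values at a logarithm\<close>

locale log_period =
  fixes Q :: real
  assumes Q_gt: "Q > 1"
begin

definition Y :: "real \<Rightarrow> real" where "Y u = ln u / ln Q"

lemma lnQ: "ln Q > 0"
  using Q_gt by simp

lemma Y_measurable [measurable]: "Y \<in> borel_measurable borel"
  unfolding Y_def by measurable

lemma integrable_Y: "integrable Expo Y" "integrable Expo (\<lambda>u. (Y u)\<^sup>2)"
  using integrable_ln(1,2) unfolding Y_def power_divide by auto

lemma AE_not_int: "AE u in Expo. x - Y u \<notin> \<int>"
proof -
  have "AE u in Expo. u \<notin> range (\<lambda>m :: int. exp (ln Q * (x - of_int m)))"
    by (rule AE_Expo_countable) simp
  with AE_Expo_pos show ?thesis
  proof eventually_elim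
    fix u :: real
    assume u: "u > 0" "u \<notin> range (\<lambda>m :: int. exp (ln Q * (x - of_int m)))"
    show "x - Y u \<notin> \<int>"
    proof
      assume "x - Y u \<in> \<int>"
      then obtain m where "x - Y u = of_int m" by (auto elim: Ints_cases)
      then have "ln u = ln Q * (x - of_int m)" using lnQ by (simp add: Y_def field_simps)
      then have "u = exp (ln Q * (x - of_int m))" using u(1) by (metis exp_ln)
      then show False using u(2) by blast
    qed
  qed
qed

text \<open>The Fourier coefficient of \<open>Y\<close> at frequency \<open>k\<close> under the
  exponential law weighted by \<open>W\<close>. As \<open>Y\<close> is a logarithm, it is a Mellin
  transform, hence a value of Gamma for \<open>W = 1\<close> and of its derivative, up to
  \<open>ln Q\<close>, for \<open>W = Y\<close>.\<close>

definition cf :: "(real \<Rightarrow> real) \<Rightarrow> int \<Rightarrow> complex" where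
  "cf W k = (\<integral>u. of_real (W u) * ee (- (of_int k * Y u)) \<partial>Expo)"

definition w :: "int \<Rightarrow> real" where "w k = 2 * pi * of_int k / ln Q"

lemma ee_Y: "ee (- (of_int k * Y u)) = exp (\<i> * of_real (- w k * ln u))"
  by (simp add: ee_def w_def Y_def mult_ac)

lemma cf_one: "cf (\<lambda>_. 1) k = Gamma (1 - \<i> * of_real (w k))"
  using Expo_Gamma(2)[of "1 - \<i> * of_real (w k)"] unfolding cf_def ee_Y by (simp add: mult_ac)

lemma cf_Y: "cf Y k = deriv Gamma (1 - \<i> * of_real (w k)) / of_real (ln Q)"
proof -
  have "cf Y k = (\<integral>u. of_real (ln u) * exp (\<i> * of_real (- w k * ln u)) / of_real (ln Q) \<partial>Expo)"
    unfolding cf_def ee_Y by (simp add: Y_def)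
  also have "\<dots> = (\<integral>u. of_real (ln u) * exp (\<i> * of_real (- w k * ln u)) \<partial>Expo) / of_real (ln Q)"
    by (rule Bochner_Integration.integral_divide_zero)
  also have "\<dots> = deriv Gamma (1 - \<i> * of_real (w k)) / of_real (ln Q)"
    unfolding Expo_ln_Gamma(1) by simp
  finally show ?thesis .
qed

lemma not_nonpos: "Re z > 0 \<or> Im z \<noteq> 0 \<Longrightarrow> z \<notin> \<int>\<^sub>\<le>\<^sub>0"
  by (auto elim!: nonpos_Ints_cases)

lemma deriv_Gamma_plus1:
  assumes "z \<notin> \<int>\<^sub>\<le>\<^sub>0"
  shows "deriv Gamma (z + 1) = Gamma z + z * deriv Gamma (z :: complex)"
proof -
  have z: "z \<noteq> 0" "z + 1 \<notin> \<int>\<^sub>\<le>\<^sub>0" using assms plus_one_in_nonpos_Ints_imp by auto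
  have "deriv Gamma (z + 1) = Gamma (z + 1) * Digamma (z + 1)" by (intro DERIV_imp_deriv has_field_derivative_Gamma z)
  also have "\<dots> = z * Gamma z * (Digamma z + 1 / z)" using z assms by (simp add: Gamma_plus1 Digamma_plus1)
  also have "\<dots> = Gamma z + z * (Gamma z * Digamma z)" using z by (simp add: field_simps)
  also have "Gamma z * Digamma z = deriv Gamma z" by (intro DERIV_imp_deriv[symmetric] has_field_derivative_Gamma assms)
  finally show ?thesis .
qed

lemma w_nz: "k \<noteq> 0 \<Longrightarrow> w k \<noteq> 0"
  using lnQ by (simp add: w_def)

lemma w_abs: "\<bar>w k\<bar> = 2 * pi / ln Q * \<bar>of_int k\<bar>"
  using lnQ by (simp add: w_def abs_mult)

text \<open>The functional equation and its derivative move the argument to real part 2, where the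
  integrals are bounded independently of \<open>k\<close>, at the price of a division by
  \<open>1 - \<i> * w k\<close>. The resulting factor \<open>1 / k\<close>, with the
  \<open>1 / k\<close> of the sawtooth series, gives the quadratic decay of the
  coefficients.\<close>

lemma cf_bounds: "\<exists>K>0. \<forall>k. k \<noteq> 0 \<longrightarrow> norm (cf (\<lambda>_. 1) k) \<le> K / \<bar>of_int k\<bar> \<and> norm (cf Y k) \<le> K / \<bar>of_int k\<bar>"
proof -
  define K1 where "K1 = (\<integral>u. exp (ln u) \<partial>Expo)"
  define K2 where "K2 = (\<integral>u. \<bar>u * ln u\<bar> \<partial>Expo)"
  have K: "K1 \<ge> 0" "K2 \<ge> 0" unfolding K1_def K2_def by (auto intro!: integral_nonneg)
  have G2: "norm (Gamma (2 - \<i> * of_real (w k))) \<le> K1" for k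
  proof -
    have "Gamma (2 - \<i> * of_real (w k)) = (\<integral>u. exp ((2 - \<i> * of_real (w k) - 1) * complex_of_real (ln u)) \<partial>Expo)"
      by (rule Expo_Gamma(2)[symmetric]) simp
    also have "norm \<dots> \<le> (\<integral>u. norm (exp ((2 - \<i> * of_real (w k) - 1) * complex_of_real (ln u))) \<partial>Expo)"
      by (rule integral_norm_bound)
    also have "\<dots> = K1" unfolding K1_def by simp
    finally show ?thesis .
  qed
  have D2: "norm (deriv Gamma (2 - \<i> * of_real (w k))) \<le> K2" for k
  proof -
    have "deriv Gamma (2 - \<i> * of_real (w k)) = (\<integral>u. of_real (u * ln u) * exp (\<i> * of_real (- w k * ln u)) \<partial>Expo)"
      unfolding Expo_ln_Gamma(2) by simp
    also have "norm \<dots> \<le> (\<integral>u. norm (of_real (u * ln u) * exp (\<i> * of_real (- w k * ln u))) \<partial>Expo)" by (rule integral_norm_bound)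
    also have "\<dots> = K2" unfolding K2_def norm_mult norm_of_real norm_exp_i_times abs_mult by simp
    finally show ?thesis .
  qed
  define A where "A = ln Q / (2 * pi)"
  have A: "A > 0" using lnQ by (simp add: A_def)
  have wA: "1 / \<bar>w k\<bar> = A / \<bar>of_int k\<bar>" for k using lnQ by (simp add: w_abs A_def)
  have k1: "1 \<le> \<bar>of_int k :: real\<bar>" if "k \<noteq> 0" for k :: int using that by linarith
  have nz: "\<bar>w k\<bar> \<le> norm (1 - \<i> * of_real (w k))" for k
    using abs_Im_le_cmod[of "1 - \<i> * of_real (w k)"] by simp
  have c1: "norm (cf (\<lambda>_. 1) k) \<le> K1 * A / \<bar>of_int k\<bar>" if "k \<noteq> 0" for k
  proof -
    let ?z = "1 - \<i> * of_real (w k)"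
    have "norm (Gamma ?z) * \<bar>w k\<bar> \<le> norm (Gamma ?z) * norm ?z" using nz by (intro mult_left_mono) auto
    also have "\<dots> = norm (Gamma (?z + 1))" by (subst Gamma_plus1) (auto simp: norm_mult not_nonpos)
    also have "\<dots> \<le> K1" using G2[of k] by (simp add: add.commute add_diff_eq diff_add_eq)
    finally have "norm (cf (\<lambda>_. 1) k) \<le> K1 * (1 / \<bar>w k\<bar>)" using w_nz[OF that] unfolding cf_one by (simp add: field_simps)
    then show ?thesis unfolding wA by simp
  qed
  have c2: "norm (cf Y k) \<le> (K2 + K1 * A) * A / ln Q / \<bar>of_int k\<bar>" if k: "k \<noteq> 0" for k
  proof -
    let ?z = "1 - \<i> * of_real (w k)"
    have "norm (deriv Gamma ?z) * \<bar>w k\<bar> \<le> norm (deriv Gamma ?z) * norm ?z" using nz by (intro mult_left_mono) auto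
    also have "\<dots> = norm (deriv Gamma (?z + 1) - Gamma ?z)" by (subst deriv_Gamma_plus1) (auto simp: norm_mult not_nonpos)
    also have "\<dots> \<le> norm (deriv Gamma (?z + 1)) + norm (Gamma ?z)" by (rule norm_triangle_ineq4)
    also have "\<dots> \<le> K2 + K1 * A"
    proof (rule add_mono)
      show "norm (deriv Gamma (?z + 1)) \<le> K2" using D2[of k] by (simp add: add.commute add_diff_eq diff_add_eq)
      have "norm (Gamma ?z) \<le> K1 * A / \<bar>of_int k\<bar>" using c1[OF k] unfolding cf_one .
      also have "\<dots> \<le> K1 * A / 1" using k1[OF k] K A by (intro divide_left_mono) auto
      finally show "norm (Gamma ?z) \<le> K1 * A" by simp
    qed
    finally have "norm (deriv Gamma ?z) \<le> (K2 + K1 * A) * (1 / \<bar>w k\<bar>)" using w_nz[OF that] by (simp add: field_simps)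
    then have "norm (deriv Gamma ?z) / ln Q \<le> (K2 + K1 * A) * (1 / \<bar>w k\<bar>) / ln Q" using lnQ by (intro divide_right_mono) auto
    then show ?thesis unfolding wA cf_Y norm_divide norm_of_real using lnQ by (simp add: mult.commute)
  qed
  define KK where "KK = 1 + K1 * A + (K2 + K1 * A) * A / ln Q"
  have p: "K1 * A \<ge> 0" "(K2 + K1 * A) * A / ln Q \<ge> 0" using K A lnQ by auto
  have "norm (cf (\<lambda>_. 1) k) \<le> KK / \<bar>of_int k\<bar>" "norm (cf Y k) \<le> KK / \<bar>of_int k\<bar>" if k: "k \<noteq> 0" for k
    by (rule order_trans[OF c1[OF k]], rule divide_right_mono, use p in \<open>simp_all add: KK_def\<close>)
      (rule order_trans[OF c2[OF k]], rule divide_right_mono, use p in \<open>simp_all add: KK_def\<close>)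
  moreover have "KK > 0" using p by (simp add: KK_def)
  ultimately show ?thesis by blast
qed

definition Four :: "(real \<Rightarrow> real) \<Rightarrow> int \<Rightarrow> complex" where
  "Four W k = cf W k / (2 * of_real pi * \<i> * of_int k)"

lemma norm_Four: "norm (Four W k) = norm (cf W k) / (2 * pi * \<bar>of_int k\<bar>)"
  by (simp add: Four_def norm_divide norm_mult)

lemma Four_bounds: "\<exists>K>0. \<forall>k. k \<noteq> 0 \<longrightarrow> norm (Four (\<lambda>_. 1) k) \<le> K / (of_int k)\<^sup>2 \<and> norm (Four Y k) \<le> K / (of_int k)\<^sup>2"
proof -
  obtain K where K: "K > 0" "\<And>k. k \<noteq> 0 \<Longrightarrow> norm (cf (\<lambda>_. 1) k) \<le> K / \<bar>of_int k\<bar> \<and> norm (cf Y k) \<le> K / \<bar>of_int k\<bar>" using cf_bounds by blast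
  have "norm (Four W k) \<le> K / (of_int k)\<^sup>2" if "k \<noteq> 0" "norm (cf W k) \<le> K / \<bar>of_int k\<bar>" for W k
  proof -
    have "norm (Four W k) \<le> (K / \<bar>of_int k\<bar>) / (2 * pi * \<bar>of_int k\<bar>)"
      unfolding norm_Four by (intro divide_right_mono that) auto
    also have "\<dots> \<le> (K / \<bar>of_int k\<bar>) / (1 * \<bar>of_int k\<bar>)"
      using K(1) that(1) pi_gt3 by (intro divide_left_mono mult_right_mono mult_pos_pos) auto
    also have "\<dots> = K / (of_int k)\<^sup>2" by (simp add: power2_eq_square)
    finally show ?thesis .
  qed
  then show ?thesis using K by blast
qed

definition pm :: "(int \<Rightarrow> complex) \<Rightarrow> real \<Rightarrow> nat \<Rightarrow> complex" where
  "pm G x n = G (int (Suc n)) * ee (of_int (int (Suc n)) * x) + G (- int (Suc n)) * ee (of_int (- int (Suc n)) * x)"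

lemma summable_pm:
  assumes b: "\<And>k. k \<noteq> 0 \<Longrightarrow> norm (G k) \<le> K / (of_int k)\<^sup>2"
  shows "summable (\<lambda>n. norm (pm G x n))"
proof (rule summable_comparison_test'[OF inverse_Suc_squares[of "2 * K"], of 0])
  fix n
  have "norm (pm G x n) \<le> norm (G (int (Suc n))) + norm (G (- int (Suc n)))"
    unfolding pm_def by (rule order_trans[OF norm_triangle_ineq]) (simp add: norm_mult)
  also have "\<dots> \<le> K / (real (Suc n))\<^sup>2 + K / (real (Suc n))\<^sup>2"
    using b[of "int (Suc n)"] b[of "- int (Suc n)"] unfolding of_int_minus of_int_of_nat_eq power2_minus by (intro add_mono) auto
  finally show "norm (norm (pm G x n)) \<le> 2 * K / (real (Suc n))\<^sup>2" by simp
qed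

lemma expectation_sawtooth:
  assumes W: "integrable Expo W" and b: "\<And>k. k \<noteq> 0 \<Longrightarrow> norm (Four W k) \<le> K / (of_int k)\<^sup>2"
  shows "integrable Expo (\<lambda>u. W u * sawtooth (x - Y u))"
    "pm (Four W) x sums of_real (\<integral>u. W u * sawtooth (x - Y u) \<partial>Expo)"
proof -
  define T where "T n = (cf W (int (Suc n)) * ee (real (Suc n) * x) - cf W (- int (Suc n)) * ee (- (real (Suc n) * x))) / (2 * of_real pi * \<i> * of_nat (Suc n))" for n
  have T: "T n = pm (Four W) x n" for n
  proof -
    define D where "D = 2 * of_real pi * \<i> * complex_of_nat (Suc n)"
    have "Four W (int (Suc n)) = cf W (int (Suc n)) / D" "Four W (- int (Suc n)) = - (cf W (- int (Suc n)) / D)"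
      unfolding Four_def of_int_minus of_int_of_nat_eq D_def mult_minus_right divide_minus_right by (rule refl)+
    then show ?thesis unfolding T_def pm_def D_def[symmetric] of_int_minus of_int_of_nat_eq mult_minus_left by (simp add: diff_divide_distrib del: of_nat_Suc)
  qed
  have sT: "summable (\<lambda>n. norm (T n))" unfolding T by (rule summable_pm[OF b])
  have mY: "Y \<in> borel_measurable Expo" by measurable
  note R = integral_sawtooth[OF W mY AE_not_int[of x], folded cf_def, folded T_def]
  show "integrable Expo (\<lambda>u. W u * sawtooth (x - Y u))" by (rule R(1)[OF sT])
  have "T = pm (Four W) x" by (rule ext) (rule T)
  then show "pm (Four W) x sums of_real (\<integral>u. W u * sawtooth (x - Y u) \<partial>Expo)" using R(2)[OF sT] by (simp only:)
qed

definition E1 :: "real \<Rightarrow> real" where "E1 x = (\<integral>u. sawtooth (x - Y u) \<partial>Expo)"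
definition EY1 :: "real \<Rightarrow> real" where "EY1 x = (\<integral>u. Y u * sawtooth (x - Y u) \<partial>Expo)"
definition E2 :: "real \<Rightarrow> real" where "E2 x = (\<integral>u. (sawtooth (x - Y u))\<^sup>2 \<partial>Expo)"

lemma sawtooth_measurable [measurable]: "sawtooth \<in> borel_measurable borel"
  unfolding sawtooth_def frac_def by measurable

lemma abs_sawtooth: "\<bar>sawtooth t\<bar> \<le> 1"
  unfolding sawtooth_def abs_le_iff using frac_ge_0[of t] frac_lt_1[of t] by linarith

lemma integrable_sawtooth:
  "integrable Expo (\<lambda>u. sawtooth (x - Y u))" "integrable Expo (\<lambda>u. Y u * sawtooth (x - Y u))"
  "integrable Expo (\<lambda>u. (sawtooth (x - Y u))\<^sup>2)"
proof -
  obtain K where K: "K > 0" "\<And>k. k \<noteq> 0 \<Longrightarrow> norm (Four (\<lambda>_. 1) k) \<le> K / (of_int k)\<^sup>2 \<and> norm (Four Y k) \<le> K / (of_int k)\<^sup>2" using Four_bounds by blast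
  show "integrable Expo (\<lambda>u. sawtooth (x - Y u))" using expectation_sawtooth(1)[of "\<lambda>_. 1" K x] K by simp
  show "integrable Expo (\<lambda>u. Y u * sawtooth (x - Y u))" using expectation_sawtooth(1)[OF integrable_Y(1), of K x] K by simp
  show "integrable Expo (\<lambda>u. (sawtooth (x - Y u))\<^sup>2)"
    by (rule Expo.integrable_const_bound[where B = 1]) (use abs_sawtooth in \<open>auto simp: abs_square_le_1\<close>)
qed

lemma E2_sums: "(\<lambda>n. (cf (\<lambda>_. 1) (int (Suc n)) * ee (of_int (int (Suc n)) * x) + cf (\<lambda>_. 1) (- int (Suc n)) * ee (of_int (- int (Suc n)) * x))
     / (2 * of_real ((pi * real (Suc n))\<^sup>2))) sums of_real (E2 x - 1 / 12)"
proof -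
  let ?c = "\<lambda>n t. cos (2 * pi * real (Suc n) * t) / (pi * real (Suc n))\<^sup>2"
  have cb: "\<bar>?c n t\<bar> \<le> 1 / (real (Suc n))\<^sup>2" for n t
  proof -
    have "\<bar>?c n t\<bar> \<le> 1 / (pi * real (Suc n))\<^sup>2" by (simp add: divide_right_mono del: of_nat_Suc)
    also have "\<dots> \<le> 1 / (real (Suc n))\<^sup>2"
      using one_le_power[of pi 2] pi_gt3 by (simp add: power_mult_distrib field_simps del: of_nat_Suc)
    finally show ?thesis .
  qed
  have ic: "integrable Expo (\<lambda>u. ?c n (x - Y u))" for n
    by (rule Expo.integrable_const_bound[where B = "1 / (real (Suc n))\<^sup>2"]) (use cb in \<open>auto simp del: of_nat_Suc\<close>)
  have "(\<lambda>n. \<integral>u. ?c n (x - Y u) \<partial>Expo) sums (\<integral>u. (\<Sum>n. ?c n (x - Y u)) \<partial>Expo)"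
  proof (rule sums_integral[OF ic])
    show "AE u in Expo. summable (\<lambda>n. norm (?c n (x - Y u)))"
      by (rule AE_I2, rule summable_comparison_test'[OF inverse_Suc_squares[of 1], of 0]) (use cb in \<open>simp del: of_nat_Suc\<close>)
    show "summable (\<lambda>n. \<integral>u. norm (?c n (x - Y u)) \<partial>Expo)"
    proof (rule summable_comparison_test'[OF inverse_Suc_squares[of 1], of 0])
      fix n
      have "(\<integral>u. norm (?c n (x - Y u)) \<partial>Expo) \<le> (\<integral>u. 1 / (real (Suc n))\<^sup>2 \<partial>Expo)"
        using cb ic by (intro integral_mono integrable_norm) (auto simp del: of_nat_Suc)
      then show "norm (\<integral>u. norm (?c n (x - Y u)) \<partial>Expo) \<le> 1 / (real (Suc n))\<^sup>2" by (simp add: Expo.prob_space del: of_nat_Suc)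
    qed
  qed
  also have "(\<integral>u. (\<Sum>n. ?c n (x - Y u)) \<partial>Expo) = (\<integral>u. (sawtooth (x - Y u))\<^sup>2 - 1 / 12 \<partial>Expo)"
    using sawtooth_sq_sums by (simp only: sums_iff)
  also have "\<dots> = E2 x - 1 / 12"
    unfolding E2_def using integrable_sawtooth(3) by (simp add: Expo.prob_space)
  finally have "(\<lambda>n. complex_of_real (\<integral>u. ?c n (x - Y u) \<partial>Expo)) sums of_real (E2 x - 1 / 12)" by (rule sums_of_real)
  moreover have "complex_of_real (\<integral>u. ?c n (x - Y u) \<partial>Expo) = (cf (\<lambda>_. 1) (int (Suc n)) * ee (of_int (int (Suc n)) * x) + cf (\<lambda>_. 1) (- int (Suc n)) * ee (of_int (- int (Suc n)) * x))
     / (2 * of_real ((pi * real (Suc n))\<^sup>2))" for n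
  proof -
    let ?p = "\<lambda>k u. complex_of_real 1 * ee (- (of_int k * Y u)) * ee (of_int k * x)"
    have ip: "integrable Expo (?p k)" for k
      by (rule Expo.integrable_const_bound[where B = 1]) (auto simp: norm_mult)
    have e: "complex_of_real (?c n (x - Y u)) = (?p (int (Suc n)) u + ?p (- int (Suc n)) u) / (2 * of_real ((pi * real (Suc n))\<^sup>2))" for u
    proof -
      have "?p (int (Suc n)) u + ?p (- int (Suc n)) u = ee (real (Suc n) * (x - Y u)) + ee (- (real (Suc n) * (x - Y u)))"
        unfolding of_int_minus of_int_of_nat_eq of_real_1 mult_1_left ee_add[symmetric] by (simp add: algebra_simps)
      also have "\<dots> = of_real (2 * cos (2 * pi * real (Suc n) * (x - Y u)))"
        unfolding ee_uminus complex_add_cnj by (simp add: ee_eq mult.assoc del: of_nat_Suc)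
      finally show ?thesis by simp
    qed
    have "complex_of_real (\<integral>u. ?c n (x - Y u) \<partial>Expo) = (\<integral>u. complex_of_real (?c n (x - Y u)) \<partial>Expo)"
      by (rule integral_complex_of_real[symmetric])
    also have "\<dots> = (\<integral>u. (?p (int (Suc n)) u + ?p (- int (Suc n)) u) / (2 * of_real ((pi * real (Suc n))\<^sup>2)) \<partial>Expo)"
      unfolding e by (rule refl)
    also have "\<dots> = (\<integral>u. ?p (int (Suc n)) u + ?p (- int (Suc n)) u \<partial>Expo) / (2 * of_real ((pi * real (Suc n))\<^sup>2))"
      by (rule Bochner_Integration.integral_divide_zero)
    also have "(\<integral>u. ?p (int (Suc n)) u + ?p (- int (Suc n)) u \<partial>Expo) = (\<integral>u. ?p (int (Suc n)) u \<partial>Expo) + (\<integral>u. ?p (- int (Suc n)) u \<partial>Expo)"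
      using ip by (intro Bochner_Integration.integral_add)
    finally show ?thesis unfolding cf_def integral_mult_left_zero .
  qed
  ultimately show ?thesis by simp
qed

text \<open>With \<open>c = 2 * k * pi * \<i> / ln Q\<close>, the coefficient
  \<open>Gamma (1 - c)\<close> equals \<open>- c * Gamma (- c)\<close>, and the factor
  \<open>c\<close> cancels against the denominator of the sawtooth series up to
  \<open>ln Q\<close>.\<close>

lemma Psi0_term_eq:
  assumes k: "k \<noteq> 0"
  shows "Psi0_term Q x k = Four (\<lambda>_. 1) k * ee (of_int k * x)"
proof -
  define c where "c = \<i> * complex_of_real (w k)"
  have c0: "c \<noteq> 0" using w_nz[OF k] by (simp add: c_def)
  have cL: "2 * of_real pi * \<i> * of_int k = c * of_real (ln Q)" using lnQ by (simp add: c_def w_def)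
  have e: "2 * of_int k * of_real pi * \<i> / of_real (ln Q) = c" using lnQ by (simp add: c_def w_def)
  have "- c \<notin> \<int>\<^sub>\<le>\<^sub>0" using w_nz[OF k] by (intro not_nonpos) (simp add: c_def)
  from Gamma_plus1[OF this] have "cf (\<lambda>_. 1) k = - c * Gamma (- c)" unfolding cf_one c_def by simp
  then have "Four (\<lambda>_. 1) k = - Gamma (- c) / of_real (ln Q)" unfolding Four_def cL using c0 lnQ by (simp add: field_simps)
  then show ?thesis unfolding Psi0_term_def e by (simp add: ee_def mult_ac)
qed

definition G1 :: "int \<Rightarrow> complex" where
  "G1 k = cf (\<lambda>_. 1) k / (2 * of_real ((pi * of_int k)\<^sup>2)) - 2 * Four Y k"

text \<open>Both the squared sawtooth and its product with \<open>Y\<close> contribute a multiple of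
  \<open>Gamma (- c)\<close> to the coefficient. The two cancel, and only the derivative of Gamma
  remains.\<close>

lemma Psi1_term_eq:
  assumes k: "k \<noteq> 0"
  shows "Psi1_term Q x k = G1 k * ee (of_int k * x)"
proof -
  define c where "c = \<i> * complex_of_real (w k)"
  define L where "L = complex_of_real (ln Q)"
  have c0: "c \<noteq> 0" "L \<noteq> 0" using w_nz[OF k] lnQ by (simp_all add: c_def L_def)
  have cL: "2 * of_real pi * \<i> * of_int k = c * L" using lnQ by (simp add: c_def w_def L_def)
  have c2: "2 * of_real ((pi * of_int k)\<^sup>2) = - (c * L)\<^sup>2 / (2 :: complex)"
    unfolding cL[symmetric] by (simp add: power_mult_distrib)
  have e: "2 * of_int k * of_real pi * \<i> / of_real (ln Q) = c" using lnQ by (simp add: c_def w_def)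
  have n: "- c \<notin> \<int>\<^sub>\<le>\<^sub>0" using w_nz[OF k] by (intro not_nonpos) (simp add: c_def)
  have a: "cf (\<lambda>_. 1) k = - c * Gamma (- c)" using Gamma_plus1[OF n] unfolding cf_one c_def by simp
  have b: "cf Y k = (Gamma (- c) - c * deriv Gamma (- c)) / L" using deriv_Gamma_plus1[OF n] unfolding cf_Y c_def L_def by simp
  have "G1 k = 2 / L\<^sup>2 * deriv Gamma (- c)"
    unfolding G1_def Four_def c2 cL a b using c0 by (simp add: field_simps power2_eq_square)
  then show ?thesis unfolding Psi1_term_def e by (simp add: ee_def L_def mult_ac)
qed

lemma Psi0_has_sum: "(Psi0_term Q x has_sum of_real (E1 x)) (-{0})"
  and Psi1_has_sum: "(Psi1_term Q x has_sum of_real (E2 x - 1 / 12 - 2 * EY1 x)) (-{0})"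
  and E1_integral: "(E1 has_integral 0) {0..1}"
  and E2_integral: "((\<lambda>x. E2 x - 1 / 12 - 2 * EY1 x) has_integral 0) {0..1}"
proof -
  obtain K where K: "K > 0" "\<And>k. k \<noteq> 0 \<Longrightarrow> norm (Four (\<lambda>_. 1) k) \<le> K / (of_int k)\<^sup>2 \<and> norm (Four Y k) \<le> K / (of_int k)\<^sup>2" using Four_bounds by blast
  have s0: "pm (Four (\<lambda>_. 1)) x sums of_real (E1 x)" for x
    using expectation_sawtooth(2)[of "\<lambda>_. 1" K x] K unfolding E1_def by simp
  have sY: "pm (Four Y) x sums of_real (EY1 x)" for x
    using expectation_sawtooth(2)[OF integrable_Y(1), of K x] K unfolding EY1_def by simp
  have s1: "pm G1 x sums of_real (E2 x - 1 / 12 - 2 * EY1 x)" for x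
  proof -
    from sums_diff[OF E2_sums[of x] sums_mult[OF sY[of x], of 2]]
    show ?thesis unfolding pm_def G1_def of_int_minus of_int_of_nat_eq mult_minus_right power2_minus
      by (simp add: algebra_simps add_divide_distrib del: of_nat_Suc)
  qed
  have b1: "norm (G1 k) \<le> 3 * K / (of_int k)\<^sup>2" if k: "k \<noteq> 0" for k
  proof -
    have "norm (cf (\<lambda>_. 1) k / (2 * of_real ((pi * of_int k)\<^sup>2))) = norm (Four (\<lambda>_. 1) k) / (pi * \<bar>of_int k\<bar>)"
      unfolding norm_Four by (simp add: norm_divide norm_mult power2_eq_square)
    also have "\<dots> \<le> norm (Four (\<lambda>_. 1) k) / 1"
    proof (rule divide_left_mono)
      have "1 * 1 \<le> pi * \<bar>of_int k\<bar>" using k pi_gt3 by (intro mult_mono) auto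
      then show "1 \<le> pi * \<bar>of_int k\<bar>" "0 < pi * \<bar>of_int k\<bar> * 1" by auto
    qed auto
    finally have "norm (cf (\<lambda>_. 1) k / (2 * of_real ((pi * of_int k)\<^sup>2))) \<le> K / (of_int k)\<^sup>2" using K(2)[OF k] by simp
    moreover have "norm (2 * Four Y k) \<le> 2 * (K / (of_int k)\<^sup>2)" using K(2)[OF k] by (simp add: norm_mult)
    ultimately have "norm (G1 k) \<le> K / (of_int k)\<^sup>2 + 2 * (K / (of_int k)\<^sup>2)"
      unfolding G1_def by (intro order_trans[OF norm_triangle_ineq4] add_mono)
    then show ?thesis by (simp add: add_divide_distrib[symmetric])
  qed
  have b0: "norm (Four (\<lambda>_. 1) k) \<le> K / (of_int k)\<^sup>2" if k: "k \<noteq> 0" for k using K(2)[OF k] by blast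
  have nint: "int (Suc n) \<noteq> 0" "- int (Suc n) \<noteq> 0" for n by auto
  show "(Psi0_term Q x has_sum of_real (E1 x)) (-{0})"
  proof (rule has_sum_nonzero_int[of _ K])
    show "(\<lambda>n. Psi0_term Q x (int (Suc n)) + Psi0_term Q x (- int (Suc n))) sums of_real (E1 x)"
      using s0[of x] unfolding pm_def Psi0_term_eq[OF nint(1)] Psi0_term_eq[OF nint(2)] .
  qed (simp add: Psi0_term_eq norm_mult b0)
  show "(Psi1_term Q x has_sum of_real (E2 x - 1 / 12 - 2 * EY1 x)) (-{0})"
  proof (rule has_sum_nonzero_int[of _ "3 * K"])
    show "(\<lambda>n. Psi1_term Q x (int (Suc n)) + Psi1_term Q x (- int (Suc n))) sums of_real (E2 x - 1 / 12 - 2 * EY1 x)"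
      using s1[of x] unfolding pm_def Psi1_term_eq[OF nint(1)] Psi1_term_eq[OF nint(2)] .
  qed (simp add: Psi1_term_eq norm_mult b1)
  show "(E1 has_integral 0) {0..1}" by (rule has_integral_Fourier[of _ K, OF b0 s0[unfolded pm_def]])
  show "((\<lambda>x. E2 x - 1 / 12 - 2 * EY1 x) has_integral 0) {0..1}"
    by (rule has_integral_Fourier[of _ "3 * K", OF b1 s1[unfolded pm_def]])
qed

lemma Psi0_eq: "Psi0 Q x = E1 x"
  using infsumI[OF Psi0_has_sum[of x]] by (simp add: Psi0_def)

lemma Psi1_eq: "Psi1 Q x = E2 x - 1 / 12 - 2 * EY1 x"
  using infsumI[OF Psi1_has_sum[of x]] by (simp add: Psi1_def del: of_real_diff)

lemma sawtooth_periodic: "sawtooth (x + 1 - y) = sawtooth (x - y)"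
  using frac_1_eq[of "x - y"] by (simp add: sawtooth_def algebra_simps)

theorem Psi_properties:
  "(Psi0_term Q x has_sum of_real (Psi0 Q x)) (-{0})" "Psi0 Q (x + 1) = Psi0 Q x" "(Psi0 Q has_integral 0) {0..1}"
  "(Psi1_term Q x has_sum of_real (Psi1 Q x)) (-{0})" "Psi1 Q (x + 1) = Psi1 Q x" "(Psi1 Q has_integral 0) {0..1}"
  using Psi0_has_sum Psi1_has_sum E1_integral E2_integral
  unfolding Psi0_eq[abs_def] Psi1_eq[abs_def] E1_def E2_def EY1_def sawtooth_periodic by simp_all

section \<open>Moments of the approximating integer-valued variable\<close>

definition N :: "real \<Rightarrow> real \<Rightarrow> real" where "N x u = of_int (\<lfloor>x - Y u\<rfloor> + 1)"

lemma N_eq: "N x u = x - Y u + 1 / 2 + sawtooth (x - Y u)"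
  by (simp add: N_def sawtooth_def frac_def)

lemma N_measurable [measurable]: "N x \<in> borel_measurable borel"
  unfolding N_eq[abs_def] by measurable

lemma expectation_N: "integrable Expo (N x)" "(\<integral>u. N x u \<partial>Expo) = x + 1 / 2 + euler_mascheroni / ln Q + Psi0 Q x"
  and expectation_N2: "integrable Expo (\<lambda>u. (N x u)\<^sup>2)"
    "(\<integral>u. (N x u)\<^sup>2 \<partial>Expo) - (\<integral>u. N x u \<partial>Expo)\<^sup>2 =
       pi\<^sup>2 / (6 * (ln Q)\<^sup>2) + 1 / 12 + Psi1 Q x - 2 * euler_mascheroni / ln Q * Psi0 Q x - (Psi0 Q x)\<^sup>2"
proof -
  have EY: "(\<integral>u. Y u \<partial>Expo) = - euler_mascheroni / ln Q" unfolding Y_def by (simp add: Expo_ln)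
  have EYY: "(\<integral>u. (Y u)\<^sup>2 \<partial>Expo) = (euler_mascheroni\<^sup>2 + pi\<^sup>2 / 6) / (ln Q)\<^sup>2"
    unfolding Y_def power_divide by (simp add: Expo_ln_sq)
  note I = integrable_sawtooth[of x] integrable_Y
  show i1: "integrable Expo (N x)" unfolding N_eq[abs_def] using I by auto
  show e1: "(\<integral>u. N x u \<partial>Expo) = x + 1 / 2 + euler_mascheroni / ln Q + Psi0 Q x"
    unfolding N_eq using I EY by (simp add: Psi0_eq E1_def Expo.prob_space)
  \<comment> \<open>\<open>R u\<close> is the square of \<open>N x u - x\<close>. Centring at
    \<open>x\<close> removes the powers of \<open>x\<close>, so that the variance depends on
    \<open>x\<close> only through the periodic functions; the constant 1/12 in
    \<open>Psi1_eq\<close> turns the 1/4 into 1/3.\<close>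
  define R where "R u = 1 / 4 + (sawtooth (x - Y u))\<^sup>2 + (Y u)\<^sup>2 + sawtooth (x - Y u) - Y u - 2 * (Y u * sawtooth (x - Y u))" for u
  have R: "(N x u)\<^sup>2 = R u + (2 * x * N x u - x\<^sup>2)" for u
    unfolding R_def N_eq by (simp add: power2_eq_square algebra_simps)
  have iR: "integrable Expo R" unfolding R_def[abs_def] using I by auto
  have eR: "(\<integral>u. R u \<partial>Expo) = 1 / 4 + E2 x + (\<integral>u. (Y u)\<^sup>2 \<partial>Expo) + E1 x - (\<integral>u. Y u \<partial>Expo) - 2 * EY1 x"
    unfolding R_def E2_def E1_def EY1_def using I by (simp add: Expo.prob_space)
  show i2: "integrable Expo (\<lambda>u. (N x u)\<^sup>2)" unfolding R using iR i1 by auto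
  have e2: "(\<integral>u. (N x u)\<^sup>2 \<partial>Expo) = (\<integral>u. R u \<partial>Expo) + (2 * x * (\<integral>u. N x u \<partial>Expo) - x\<^sup>2)"
    unfolding R using iR i1 by (simp add: Expo.prob_space)
  define g where "g = euler_mascheroni / ln Q"
  have "(\<integral>u. R u \<partial>Expo) = 1 / 3 + Psi1 Q x + Psi0 Q x + g\<^sup>2 + pi\<^sup>2 / (6 * (ln Q)\<^sup>2) + g"
    unfolding eR EY EYY Psi0_eq Psi1_eq g_def by (simp add: power_divide add_divide_distrib)
  then have "(\<integral>u. (N x u)\<^sup>2 \<partial>Expo) - (\<integral>u. N x u \<partial>Expo)\<^sup>2 =
      1 / 3 + Psi1 Q x + Psi0 Q x + g\<^sup>2 + pi\<^sup>2 / (6 * (ln Q)\<^sup>2) + g + (2 * x * (x + 1 / 2 + g + Psi0 Q x) - x\<^sup>2) - (x + 1 / 2 + g + Psi0 Q x)\<^sup>2"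
    unfolding e2 e1 g_def by simp
  also have "\<dots> = pi\<^sup>2 / (6 * (ln Q)\<^sup>2) + 1 / 12 + Psi1 Q x - 2 * g * Psi0 Q x - (Psi0 Q x)\<^sup>2"
    by (simp add: power2_eq_square algebra_simps)
  finally show "(\<integral>u. (N x u)\<^sup>2 \<partial>Expo) - (\<integral>u. N x u \<partial>Expo)\<^sup>2 =
       pi\<^sup>2 / (6 * (ln Q)\<^sup>2) + 1 / 12 + Psi1 Q x - 2 * euler_mascheroni / ln Q * Psi0 Q x - (Psi0 Q x)\<^sup>2"
    unfolding g_def by simp
qed

lemma prob_N_le: "measure Expo {u. N x u \<le> of_int k} = exp (- (Q powr (x - of_int k)))"
proof -
  have "measure Expo {u. N x u \<le> of_int k} = measure Expo {Q powr (x - of_int k)<..}"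
  proof (rule Expo.finite_measure_eq_AE)
    show "AE u in Expo. (u \<in> {u. N x u \<le> of_int k}) = (u \<in> {Q powr (x - of_int k)<..})"
      using AE_Expo_pos
    proof eventually_elim
      fix u :: real assume u: "u > 0"
      have "N x u \<le> of_int k \<longleftrightarrow> \<lfloor>x - Y u\<rfloor> < k" unfolding N_def of_int_le_iff by linarith
      also have "\<dots> \<longleftrightarrow> x - Y u < of_int k" by (rule floor_less_iff)
      also have "\<dots> \<longleftrightarrow> (x - of_int k) * ln Q < ln u" using lnQ by (simp add: Y_def field_simps)
      also have "\<dots> \<longleftrightarrow> exp ((x - of_int k) * ln Q) < exp (ln u)" by (rule exp_less_cancel_iff[symmetric])
      also have "\<dots> \<longleftrightarrow> Q powr (x - of_int k) < u" using u Q_gt by (simp only: exp_ln powr_def) simp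
      finally show "(u \<in> {u. N x u \<le> of_int k}) = (u \<in> {Q powr (x - of_int k)<..})" by simp
    qed
    have "{u \<in> space Expo. N x u \<le> of_int k} \<in> sets Expo" by measurable
    then show "{u. N x u \<le> of_int k} \<in> Expo.events" by simp
  qed simp
  then show ?thesis by (simp add: measure_Expo_gt)
qed

end

section \<open>Transfer of moments\<close>

lemma Suc_sq_le: "(1 + real j)\<^sup>2 \<le> 8 * (3 / 2) ^ j"
proof (cases "j \<ge> 4")
  case True
  then show ?thesis
  proof (induction j rule: dec_induct)
    case base
    show ?case by (simp add: eval_nat_numeral)
  next
    case (step n)
    have n4: "4 \<le> real n" using step(1) by simp
    have "2 * real n + 5 \<le> real n * real n" using mult_right_mono[OF n4, of "real n"] n4 by linarith
    then have "(1 + real (Suc n))\<^sup>2 \<le> 3 / 2 * (1 + real n)\<^sup>2" by (simp add: power2_eq_square algebra_simps)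
    then show ?case using step(3) by simp
  qed
next
  case False
  then have "j = 0 \<or> j = 1 \<or> j = 2 \<or> j = 3" by auto
  then show ?thesis by (auto simp: eval_nat_numeral)
qed

text \<open>Relative to the term at \<open>k\<close>, the factor \<open>(1 + j)\<^sup>2\<close> is
  absorbed into \<open>(3 / 2) ^ j\<close>, which against \<open>Q ^ j\<close> with \<open>Q\<close>
  at least 2 leaves a geometric series of ratio 3/4.\<close>

lemma tail_sum:
  fixes Q :: real
  assumes Q: "Q \<ge> 2" and k: "k \<ge> 1" and p: "p \<le> 1"
  defines "a \<equiv> (\<lambda>M. if M \<ge> k then real M ^ (p + 1) / Q ^ M else 0)"
  shows "summable a" "suminf a \<le> 32 * real k ^ (p + 1) / Q ^ k"
proof -
  have b: "a (j + k) \<le> 8 * real k ^ (p + 1) / Q ^ k * (3 / 4) ^ j" for j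
  proof -
    have "real (j + k) \<le> real k * (1 + real j)" using mult_right_mono[of 1 "real k" "real j"] k by (simp add: algebra_simps)
    then have "real (j + k) ^ (p + 1) \<le> (real k * (1 + real j)) ^ (p + 1)" by (intro power_mono) auto
    also have "\<dots> = real k ^ (p + 1) * (1 + real j) ^ (p + 1)" by (rule power_mult_distrib)
    also have "\<dots> \<le> real k ^ (p + 1) * (1 + real j)\<^sup>2" using p by (intro mult_left_mono power_increasing) auto
    also have "\<dots> \<le> real k ^ (p + 1) * (8 * (3 / 2) ^ j)" by (intro mult_left_mono Suc_sq_le) auto
    finally have "a (j + k) \<le> real k ^ (p + 1) * (8 * (3 / 2) ^ j) / Q ^ (j + k)"
      unfolding a_def using Q by (simp add: divide_right_mono)
    also have "\<dots> = (8 * real k ^ (p + 1) / Q ^ k) * ((3 / 2) ^ j / Q ^ j)" using Q by (simp add: power_add mult_ac)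
    also have "\<dots> \<le> (8 * real k ^ (p + 1) / Q ^ k) * ((3 / 2) ^ j / 2 ^ j)"
      using Q by (intro mult_left_mono divide_left_mono power_mono) auto
    finally show ?thesis by (simp add: power_divide[symmetric])
  qed
  have nn: "0 \<le> a j" for j using Q by (simp add: a_def)
  have gs: "summable (\<lambda>j. 8 * real k ^ (p + 1) / Q ^ k * (3 / 4 :: real) ^ j)" by (intro summable_mult summable_geometric) simp
  have sk: "summable (\<lambda>j. a (j + k))"
    by (rule summable_comparison_test'[OF gs, of 0]) (use b nn in auto)
  then show s: "summable a" by (simp only: summable_iff_shift)
  have "suminf a = (\<Sum>j. a (j + k)) + (\<Sum>j<k. a j)" by (rule suminf_split_initial_segment[OF s])
  also have "(\<Sum>j<k. a j) = 0" by (simp add: a_def)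
  also have "(\<Sum>j. a (j + k)) \<le> (\<Sum>j. 8 * real k ^ (p + 1) / Q ^ k * (3 / 4) ^ j)" by (rule suminf_le[OF b sk gs])
  also have "\<dots> = 8 * real k ^ (p + 1) / Q ^ k * (1 / (1 - 3 / 4))"
    by (subst suminf_mult) (auto intro!: summable_geometric simp: suminf_geometric)
  finally show "suminf a \<le> 32 * real k ^ (p + 1) / Q ^ k" by simp
qed

text \<open>For \<open>p\<close> equal to 0 or 1 the weights \<open>(2 * M + 1) ^ p\<close> are the
  increments of \<open>M ^ (p + 1)\<close>. This lets first and second moments be treated together
  as weighted sums of tail probabilities.\<close>

lemma sum_odd_powers: "p \<le> 1 \<Longrightarrow> (\<Sum>M<k. real (2 * M + 1) ^ p) = real k ^ (p + 1)"
proof -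
  assume "p \<le> 1"
  then have "p = 0 \<or> p = 1" by auto
  then show ?thesis
  proof
    assume "p = 1"
    moreover have "(\<Sum>M<k. real (2 * M + 1)) = real k ^ 2" by (induction k) (auto simp: power2_eq_square algebra_simps)
    ultimately show ?thesis by (simp add: power2_eq_square)
  qed simp
qed

lemma clamp_sum:
  assumes "p \<le> 1"
  shows "(\<Sum>M<K. real (2 * M + 1) ^ p * of_bool (real_of_int n > real M)) = real (min (nat n) K) ^ (p + 1)"
proof (induction K)
  case (Suc K)
  have "p = 0 \<or> p = 1" using assms by auto
  then have "real (min (nat n) K) ^ (p + 1) + real (2 * K + 1) ^ p * of_bool (real_of_int n > real K) = real (min (nat n) (Suc K)) ^ (p + 1)"
  proof (cases "n > int K")
    case True
    then have "min (nat n) K = K" "min (nat n) (Suc K) = Suc K" "real_of_int n > real K" by auto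
    moreover assume "p = 0 \<or> p = 1"
    ultimately show ?thesis by (auto simp: power2_eq_square algebra_simps)
  next
    case False
    then have "min (nat n) K = nat n" "min (nat n) (Suc K) = nat n" "\<not> real_of_int n > real K" by auto
    then show ?thesis by simp
  qed
  then show ?case using Suc by simp
qed simp

lemma ln_sq_le_self:
  assumes "v \<ge> (1::real)"
  shows "(ln v)\<^sup>2 \<le> 4 * v"
proof -
  have "ln v = 2 * ln (sqrt v)" using assms by (simp add: ln_sqrt)
  also have "\<dots> \<le> 2 * sqrt v" using ln_le_minus_one[of "sqrt v"] assms by simp
  finally have "(ln v)\<^sup>2 \<le> (2 * sqrt v)\<^sup>2" using assms by (intro power_mono) auto
  then show ?thesis using assms by (simp add: power_mult_distrib)
qed

context log_period
begin

lemma sums_tail_N: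
  assumes p: "p \<le> 1"
  shows "(\<lambda>M. real (2 * M + 1) ^ p * measure Expo {u. N x u > real M}) sums (\<integral>u. (max 0 (N x u)) ^ (p + 1) \<partial>Expo)"
proof -
  have p01: "p = 0 \<or> p = 1" using p by auto
  define n where "n u = \<lfloor>x - Y u\<rfloor> + 1" for u
  have Nn: "N x u = of_int (n u)" for u by (simp add: N_def n_def)
  define S where "S K u = (\<Sum>M<K. real (2 * M + 1) ^ p * of_bool (N x u > real M))" for K u
  have S: "S K u = real (min (nat (n u)) K) ^ (p + 1)" for K u unfolding S_def Nn by (rule clamp_sum[OF p])
  have st: "{u. N x u > real M} \<in> sets Expo" for M
  proof -
    have "{u \<in> space Expo. N x u > real M} \<in> sets Expo" by measurable
    then show ?thesis by simp
  qed
  have ind: "(\<lambda>u. of_bool (N x u > real M)) = (indicat_real {u. N x u > real M})" for M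
    by (auto simp: indicator_def)
  have ii: "integrable Expo (indicat_real {u. N x u > real M})" for M
    using st by (simp add: integrable_indicator_iff less_top[symmetric])
  have ib: "integrable Expo (\<lambda>u. of_bool (N x u > real M) :: real)" for M unfolding ind by (rule ii)
  have eI: "(\<integral>u. of_bool (N x u > real M) \<partial>Expo) = measure Expo {u. N x u > real M}" for M
    unfolding ind using st by simp
  have intS: "(\<integral>u. S K u \<partial>Expo) = (\<Sum>M<K. real (2 * M + 1) ^ p * measure Expo {u. N x u > real M})" for K
  proof -
    have "(\<integral>u. S K u \<partial>Expo) = (\<Sum>M<K. \<integral>u. real (2 * M + 1) ^ p * of_bool (N x u > real M) \<partial>Expo)"
      unfolding S_def by (rule Bochner_Integration.integral_sum) (intro integrable_mult_right ib)
    also have "\<dots> = (\<Sum>M<K. real (2 * M + 1) ^ p * measure Expo {u. N x u > real M})"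
      by (simp only: integral_mult_right_zero eI)
    finally show ?thesis .
  qed
  have "(\<lambda>K. \<integral>u. S K u \<partial>Expo) \<longlonglongrightarrow> (\<integral>u. (max 0 (N x u)) ^ (p + 1) \<partial>Expo)"
  proof (rule integral_dominated_convergence[where w = "\<lambda>u. \<bar>N x u\<bar> ^ (p + 1)"])
    show "integrable Expo (\<lambda>u. \<bar>N x u\<bar> ^ (p + 1))" using p01 expectation_N(1)[of x] expectation_N2(1)[of x] by (auto simp: power2_eq_square)
    show "AE u in Expo. (\<lambda>K. S K u) \<longlonglongrightarrow> (max 0 (N x u)) ^ (p + 1)"
    proof (rule AE_I2)
      fix u
      have "\<forall>\<^sub>F K in sequentially. S K u = (max 0 (N x u)) ^ (p + 1)"
        using eventually_ge_at_top[of "nat (n u)"]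
      proof eventually_elim
        fix K assume "nat (n u) \<le> K"
        then have "S K u = real (nat (n u)) ^ (p + 1)" unfolding S by simp
        also have "real (nat (n u)) = max 0 (N x u)" unfolding Nn by simp
        finally show "S K u = (max 0 (N x u)) ^ (p + 1)" .
      qed
      then show "(\<lambda>K. S K u) \<longlonglongrightarrow> (max 0 (N x u)) ^ (p + 1)" by (rule tendsto_eventually)
    qed
    show "AE u in Expo. norm (S K u) \<le> \<bar>N x u\<bar> ^ (p + 1)" for K
    proof (rule AE_I2)
      fix u
      have "real (min (nat (n u)) K) \<le> \<bar>N x u\<bar>" unfolding Nn by linarith
      then show "norm (S K u) \<le> \<bar>N x u\<bar> ^ (p + 1)" unfolding S real_norm_def power_abs abs_of_nat by (intro power_mono) auto
    qed
    show "S K \<in> borel_measurable Expo" for K unfolding S_def[abs_def] by measurable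
  qed measurable
  then show ?thesis unfolding sums_def intS .
qed

text \<open>\<open>N x u\<close> is negative only if \<open>u\<close> exceeds
  \<open>Q powr x\<close>, and then its absolute value is at most the logarithm to base
  \<open>Q\<close> of \<open>v = u / Q powr x\<close>. Since the squared natural logarithm of
  \<open>v\<close> is at most \<open>4 * v\<close>, the first moment of \<open>u\<close> bounds the
  difference.\<close>

lemma N_neg_part:
  assumes p: "p \<le> 1"
  shows "\<bar>(\<integral>u. (max 0 (N x u)) ^ (p + 1) \<partial>Expo) - (\<integral>u. (N x u) ^ (p + 1) \<partial>Expo)\<bar> \<le> 4 / (ln Q)\<^sup>2 * (\<integral>u. u \<partial>Expo) / Q powr x"
proof -
  have p01: "p = 0 \<or> p = 1" using p by auto
  have i1: "integrable Expo (\<lambda>u. (N x u) ^ (p + 1))" using p01 expectation_N(1)[of x] expectation_N2(1)[of x] by (auto simp: power2_eq_square)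
  have i2: "integrable Expo (\<lambda>u. (max 0 (N x u)) ^ (p + 1))"
  proof (rule Bochner_Integration.integrable_bound[OF i1])
    have "norm (max 0 (N x u) ^ (p + 1)) \<le> norm (N x u ^ (p + 1))" for u
      unfolding real_norm_def power_abs by (rule power_mono) auto
    then show "AE u in Expo. norm (max 0 (N x u) ^ (p + 1)) \<le> norm (N x u ^ (p + 1))" by simp
  qed measurable
  have "\<bar>(\<integral>u. (max 0 (N x u)) ^ (p + 1) \<partial>Expo) - (\<integral>u. (N x u) ^ (p + 1) \<partial>Expo)\<bar> = \<bar>\<integral>u. (max 0 (N x u)) ^ (p + 1) - (N x u) ^ (p + 1) \<partial>Expo\<bar>"
    using i1 i2 by simp
  also have "\<dots> \<le> (\<integral>u. \<bar>(max 0 (N x u)) ^ (p + 1) - (N x u) ^ (p + 1)\<bar> \<partial>Expo)" by (rule integral_abs_bound)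
  also have "\<dots> \<le> (\<integral>u. 4 / (ln Q)\<^sup>2 * u / Q powr x \<partial>Expo)"
  proof (rule integral_mono_AE)
    show "AE u in Expo. \<bar>(max 0 (N x u)) ^ (p + 1) - (N x u) ^ (p + 1)\<bar> \<le> 4 / (ln Q)\<^sup>2 * u / Q powr x"
      using AE_Expo_pos
    proof eventually_elim
      fix u :: real assume u: "u > 0"
      show "\<bar>(max 0 (N x u)) ^ (p + 1) - (N x u) ^ (p + 1)\<bar> \<le> 4 / (ln Q)\<^sup>2 * u / Q powr x"
      proof (cases "N x u \<ge> 0")
        case True
        then show ?thesis using u lnQ by simp
      next
        case False
        define n where "n = \<lfloor>x - Y u\<rfloor> + 1"
        have Nn: "N x u = of_int n" by (simp add: N_def n_def)
        have n1: "n \<le> - 1" using False unfolding Nn by simp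
        have xy: "x - Y u < of_int n" unfolding n_def by linarith
        have nb: "1 \<le> - real_of_int n" using n1 by linarith
        define v where "v = u / Q powr x"
        have v0: "v > 0" using u Q_gt by (simp add: v_def)
        have lv: "ln v = (Y u - x) * ln Q" using u Q_gt lnQ by (simp add: v_def ln_div ln_powr Y_def algebra_simps)
        have "0 \<le> ln v" unfolding lv using lnQ xy n1 nb by (intro mult_nonneg_nonneg) linarith+
        then have v1: "v \<ge> 1" using v0 by simp
        have "\<bar>(max 0 (N x u)) ^ (p + 1) - (N x u) ^ (p + 1)\<bar> = (- real_of_int n) ^ (p + 1)"
          using n1 nb p01 unfolding Nn by (auto simp: max_def)
        also have "\<dots> \<le> (- real_of_int n) ^ 2" using nb p by (intro power_increasing) auto
        also have "\<dots> \<le> (Y u - x) ^ 2" using nb xy by (intro power_mono) linarith+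
        also have "\<dots> = (ln v)\<^sup>2 / (ln Q)\<^sup>2" unfolding lv using lnQ by (simp add: power_mult_distrib)
        also have "\<dots> \<le> 4 * v / (ln Q)\<^sup>2" by (intro divide_right_mono ln_sq_le_self v1) simp
        finally show ?thesis by (simp add: v_def mult_ac)
      qed
    qed
  qed (use i1 i2 integrable_ln(4) in auto)
  also have "\<dots> = 4 / (ln Q)\<^sup>2 * (\<integral>u. u \<partial>Expo) / Q powr x" by simp
  finally show ?thesis .
qed

end

lemma cmult_bigo:
  fixes f g :: "nat \<Rightarrow> real"
  assumes "f \<in> O(g)"
  shows "(\<lambda>n. c * f n) \<in> O(g)"
  using assms by (cases "c = 0") auto

section \<open>Moments of a variable with approximately double exponential distribution
  function\<close>

locale iteration_tail = log_period Q for Q :: real +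
  fixes \<delta> C :: real and M0 :: nat and F :: "nat \<Rightarrow> nat \<Rightarrow> real"
  assumes Q2: "Q \<ge> 2" and \<delta>_pos: "\<delta> > 0" and C_nn: "C \<ge> 0" and M0: "M0 \<ge> 2"
    and F_nn: "0 \<le> F l M" and F_mono: "M \<le> M' \<Longrightarrow> F l M \<le> F l M'" and F_one: "M \<ge> l + 2 \<Longrightarrow> F l M = 1"
    and F_approx: "M \<ge> M0 \<Longrightarrow> \<bar>F l M - exp (- (\<delta> * real l / Q ^ (M - 2)))\<bar> \<le>
      C * (real l * real M / Q ^ (2 * M) + real M / Q ^ M + 1 / 2 ^ l)"
begin

lemma Q0: "Q > 0" "Q \<noteq> 0" "Q \<ge> 1"
  using Q2 by auto

text \<open>The factor \<open>Q\<^sup>2\<close> turns the exponent \<open>M - 2\<close> of the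
  approximation into \<open>M\<close>.\<close>

definition beta :: "nat \<Rightarrow> real" where "beta l = \<delta> * real l * Q\<^sup>2"

definition err :: "nat \<Rightarrow> nat \<Rightarrow> real" where
  "err l M = C * (real l * real M / Q ^ (2 * M) + real M / Q ^ M + 1 / 2 ^ l)"

lemma err_nn: "err l M \<ge> 0"
  unfolding err_def using C_nn Q0 by (intro mult_nonneg_nonneg add_nonneg_nonneg divide_nonneg_nonneg) auto

lemma F_err: "M \<ge> M0 \<Longrightarrow> \<bar>F l M - exp (- (beta l / Q ^ M))\<bar> \<le> err l M"
proof -
  assume M: "M \<ge> M0"
  then have "M = (M - 2) + 2" using M0 by simp
  then have "Q ^ M = Q ^ (M - 2) * Q\<^sup>2" by (metis power_add)
  then have "beta l / Q ^ M = \<delta> * real l / Q ^ (M - 2)" using Q0 by (simp add: beta_def)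
  then show ?thesis using F_approx[OF M, of l] by (simp add: err_def)
qed

lemma beta_pos: "l > 0 \<Longrightarrow> beta l > 0"
  using \<delta>_pos Q0 by (simp add: beta_def)

definition u :: "nat \<Rightarrow> real" where "u l = log Q (real l) + log Q \<delta>"

text \<open>This identifies the approximating law as that of \<open>N\<close> at
  \<open>u l + 2\<close>. The shift by 2 raises the constant 1/2 in the mean of \<open>N\<close> to
  5/2, while the periodic functions are unaffected.\<close>

lemma powr_u: "l > 0 \<Longrightarrow> Q powr (u l + 2) = beta l"
  using Q0 Q_gt \<delta>_pos by (simp add: u_def beta_def powr_add)

definition g :: "nat \<Rightarrow> nat \<Rightarrow> real" where "g l M = 1 - exp (- (beta l / Q ^ M))"

lemma prob_N_gt:
  assumes "l > 0"
  shows "measure Expo {v. N (u l + 2) v > real M} = g l M"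
proof -
  have "{v \<in> space Expo. N (u l + 2) v \<le> of_int (int M)} \<in> sets Expo" by measurable
  then have st: "{v. N (u l + 2) v \<le> of_int (int M)} \<in> Expo.events" by simp
  have "measure Expo (UNIV - {v. N (u l + 2) v \<le> of_int (int M)}) = 1 - exp (- (Q powr (u l + 2 - of_int (int M))))"
    using Expo.prob_compl[OF st] unfolding prob_N_le space_Expo .
  moreover have "UNIV - {v. N (u l + 2) v \<le> of_int (int M)} = {v. N (u l + 2) v > real M}" by auto
  moreover have "Q powr (u l + 2 - of_int (int M)) = beta l / Q ^ M"
    using powr_u[OF assms] Q0 by (simp add: powr_diff powr_realpow)
  ultimately show ?thesis by (simp add: g_def)
qed

lemma g_range: "0 \<le> g l M" "g l M \<le> beta l / Q ^ M"
proof -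
  have b: "beta l / Q ^ M \<ge> 0" using \<delta>_pos Q0 by (simp add: beta_def)
  then show "0 \<le> g l M" by (simp add: g_def)
  show "g l M \<le> beta l / Q ^ M" unfolding g_def using exp_ge_add_one_self[of "- (beta l / Q ^ M)"] by linarith
qed

text \<open>The moment of order \<open>p + 1\<close> by summation of tails; the sum is finite
  because \<open>F l M\<close> is 1 from \<open>l + 2\<close> on.\<close>

definition T :: "nat \<Rightarrow> nat \<Rightarrow> real" where "T p l = (\<Sum>M<l + 2. real (2 * M + 1) ^ p * (1 - F l M))"

text \<open>The summands bound, in this order: the range below the cut-off \<open>k\<close>, the
  error \<open>1 / 2 ^ l\<close> accumulated up to \<open>l + 2\<close>, the remaining error from
  \<open>k\<close> on, and the tail of the approximating law beyond \<open>l + 2\<close>.\<close>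

definition B :: "nat \<Rightarrow> nat \<Rightarrow> nat \<Rightarrow> real" where
  "B p l k = real k ^ (p + 1) * (2 * exp (- (beta l / Q ^ k)) + err l k) +
     real (l + 2) ^ (p + 1) * (C / 2 ^ l) +
     3 * C * (real l / Q ^ k + 1) * (32 * real k ^ (p + 1) / Q ^ k) +
     3 ^ p * (32 * beta l * (real (l + 2)) ^ (p + 1) / Q ^ (l + 2))"

text \<open>Below the cut-off \<open>k\<close> both distribution functions are small by monotonicity, so the
  estimate of the error is needed only from \<open>k\<close> on.\<close>

lemma T_bound:
  assumes p: "p \<le> 1" and l: "l > 0" and k: "k \<ge> M0"
  shows "\<bar>T p l - (\<integral>v. (max 0 (N (u l + 2) v)) ^ (p + 1) \<partial>Expo)\<bar> \<le> B p l k"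
proof -
  have k1: "k \<ge> 1" using k M0 by simp
  define w where "w M = real (2 * M + 1) ^ p" for M
  have w0: "w M \<ge> 0" for M by (simp add: w_def)
  have p01: "p = 0 \<or> p = 1" using p by auto
  have w3: "w M \<le> 3 ^ p * real M ^ p" if "M \<ge> 1" for M
    unfolding w_def power_mult_distrib[symmetric] using that by (intro power_mono) auto
  define f where "f M = 1 - F l M" for M
  have sT: "(\<lambda>M. w M * f M) sums T p l"
  proof -
    have "(\<lambda>M. w M * f M) sums (\<Sum>M<l + 2. w M * f M)"
      by (rule sums_finite) (auto simp: f_def F_one)
    then show ?thesis by (simp add: T_def w_def f_def)
  qed
  have sg: "(\<lambda>M. w M * g l M) sums (\<integral>v. (max 0 (N (u l + 2) v)) ^ (p + 1) \<partial>Expo)"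
    using sums_tail_N[OF p, of "u l + 2"] unfolding prob_N_gt[OF l] w_def .
  define A where "A = 2 * exp (- (beta l / Q ^ k)) + err l k"
  have A0: "A \<ge> 0" using err_nn[of l k] by (simp add: A_def)
  define a1 where "a1 M = (if M < k then w M * A else 0)" for M
  define a2 where "a2 M = (if M < l + 2 then w M * (C / 2 ^ l) else 0)" for M
  define t where "t k M = (if M \<ge> k then real M ^ (p + 1) / Q ^ M else 0)" for k M :: nat
  have t0: "t j M \<ge> 0" for j M using Q0 by (simp add: t_def)
  define c3 where "c3 = 3 * C * (real l / Q ^ k + 1)"
  have c3: "c3 \<ge> 0" unfolding c3_def using C_nn Q0 by simp
  define a where "a M = a1 M + a2 M + c3 * t k M + 3 ^ p * beta l * t (l + 2) M" for M
  have b0: "beta l > 0" by (rule beta_pos[OF l])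
  have nn: "a1 M \<ge> 0" "a2 M \<ge> 0" "c3 * t k M \<ge> 0" "3 ^ p * beta l * t (l + 2) M \<ge> 0" for M
    using A0 w0 C_nn c3 t0 b0 by (auto simp: a1_def a2_def)
  have ptw: "\<bar>w M * f M - w M * g l M\<bar> \<le> a M" for M
  proof -
    have e: "\<bar>w M * f M - w M * g l M\<bar> = w M * \<bar>F l M - exp (- (beta l / Q ^ M))\<bar>"
      using w0[of M] by (simp add: f_def g_def abs_mult flip: right_diff_distrib)
        (simp add: abs_minus_commute)
    consider "M < k" | "M \<ge> k" "M < l + 2" | "M \<ge> k" "M \<ge> l + 2" by linarith
    then show ?thesis
    proof cases
      case 1
      have "F l M \<le> F l k" using 1 by (intro F_mono) simp
      moreover have "F l k \<le> exp (- (beta l / Q ^ k)) + err l k" using F_err[OF k, of l] by linarith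
      moreover have "exp (- (beta l / Q ^ M)) \<le> exp (- (beta l / Q ^ k))"
        using 1 Q0 b0 by (auto intro!: divide_left_mono power_increasing)
      moreover have "0 \<le> F l M" "0 \<le> exp (- (beta l / Q ^ M))" using F_nn by auto
      ultimately have "\<bar>F l M - exp (- (beta l / Q ^ M))\<bar> \<le> A" using err_nn[of l k] unfolding A_def by linarith
      then have "\<bar>w M * f M - w M * g l M\<bar> \<le> a1 M" unfolding e a1_def using 1 w0 by (simp add: mult_left_mono)
      then show ?thesis unfolding a_def using nn[of M] by linarith
    next
      case 2
      have M1: "M \<ge> 1" using 2 k1 by simp
      have "real l * real M / Q ^ (2 * M) = (real l / Q ^ M) * (real M / Q ^ M)" by (simp add: mult_2 power_add)
      also have "\<dots> \<le> (real l / Q ^ k) * (real M / Q ^ M)"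
        using 2 Q0 by (intro mult_right_mono divide_left_mono power_increasing) auto
      finally have "err l M \<le> C * ((real l / Q ^ k) * (real M / Q ^ M) + real M / Q ^ M + 1 / 2 ^ l)"
        unfolding err_def using C_nn by (intro mult_left_mono add_mono) auto
      also have "\<dots> = C * (real l / Q ^ k + 1) * (real M / Q ^ M) + C / 2 ^ l" by (simp add: algebra_simps)
      finally have "w M * \<bar>F l M - exp (- (beta l / Q ^ M))\<bar> \<le> w M * (C * (real l / Q ^ k + 1) * (real M / Q ^ M) + C / 2 ^ l)"
        using F_err[of M l] 2 k w0 by (intro mult_left_mono) auto
      also have "\<dots> = w M * (C * (real l / Q ^ k + 1) * (real M / Q ^ M)) + a2 M" using 2 by (simp add: a2_def distrib_left)
      also have "w M * (C * (real l / Q ^ k + 1) * (real M / Q ^ M)) \<le> (3 * real M ^ p) * (C * (real l / Q ^ k + 1) * (real M / Q ^ M))"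
      proof (rule mult_right_mono)
        have "(3::real) ^ p \<le> 3" using p01 by auto
        then have "3 ^ p * real M ^ p \<le> 3 * real M ^ p" by (rule mult_right_mono) simp
        then show "w M \<le> 3 * real M ^ p" using w3[OF M1] by linarith
        show "0 \<le> C * (real l / Q ^ k + 1) * (real M / Q ^ M)" using C_nn Q0 by simp
      qed
      also have "\<dots> = c3 * t k M" using 2 by (simp add: c3_def t_def mult_ac)
      finally show ?thesis unfolding a_def e using nn[of M] by linarith
    next
      case 3
      have M1: "M \<ge> 1" using 3 by simp
      have "\<bar>F l M - exp (- (beta l / Q ^ M))\<bar> = g l M" using 3 g_range(1)[of l M] by (simp add: F_one g_def)
      then have "w M * \<bar>F l M - exp (- (beta l / Q ^ M))\<bar> \<le> (3 ^ p * real M ^ p) * (beta l / Q ^ M)"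
        using g_range[of l M] by (simp only:) (intro mult_mono w3[OF M1], auto)
      also have "\<dots> \<le> (3 ^ p * real M ^ p) * (beta l / Q ^ M) * real M"
        using mult_left_mono[of 1 "real M" "(3 ^ p * real M ^ p) * (beta l / Q ^ M)"] M1 b0 Q0 by simp
      also have "\<dots> = 3 ^ p * beta l * t (l + 2) M" using 3 by (simp add: t_def)
      finally show ?thesis unfolding a_def e using nn[of M] by linarith
    qed
  qed
  have s1: "a1 sums (real k ^ (p + 1) * A)"
  proof -
    have "a1 sums (\<Sum>M<k. a1 M)" by (rule sums_finite) (auto simp: a1_def)
    moreover have "(\<Sum>M<k. a1 M) = (\<Sum>M<k. w M) * A" unfolding sum_distrib_right by (intro sum.cong) (auto simp: a1_def)
    ultimately show ?thesis using sum_odd_powers[OF p, of k] by (simp only: w_def)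
  qed
  have s2: "a2 sums (real (l + 2) ^ (p + 1) * (C / 2 ^ l))"
  proof -
    have "a2 sums (\<Sum>M<l + 2. a2 M)" by (rule sums_finite) (auto simp: a2_def)
    moreover have "(\<Sum>M<l + 2. a2 M) = (\<Sum>M<l + 2. w M) * (C / 2 ^ l)" unfolding sum_distrib_right by (intro sum.cong) (auto simp: a2_def)
    ultimately show ?thesis using sum_odd_powers[OF p, of "l + 2"] by (simp only: w_def)
  qed
  have st: "summable (t j)" "suminf (t j) \<le> 32 * real j ^ (p + 1) / Q ^ j" if "j \<ge> 1" for j
    using tail_sum[OF Q2 that p] unfolding t_def[abs_def] by auto
  have sa: "a sums (real k ^ (p + 1) * A + real (l + 2) ^ (p + 1) * (C / 2 ^ l) + c3 * suminf (t k) + 3 ^ p * beta l * suminf (t (l + 2)))"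
    unfolding a_def[abs_def] using st k1 by (intro sums_add s1 s2 sums_mult summable_sums) auto
  have "\<bar>T p l - (\<integral>v. (max 0 (N (u l + 2) v)) ^ (p + 1) \<partial>Expo)\<bar> = \<bar>\<Sum>M. (w M * f M - w M * g l M)\<bar>"
    using sums_unique[OF sums_diff[OF sT sg]] by simp
  also have "\<dots> \<le> suminf a"
  proof -
    have sd: "summable (\<lambda>M. w M * f M - w M * g l M)" using sums_diff[OF sT sg] by (rule sums_summable)
    have sab: "summable (\<lambda>M. \<bar>w M * f M - w M * g l M\<bar>)"
      by (rule summable_comparison_test'[OF sums_summable[OF sa], of 0]) (use ptw in auto)
    have "\<bar>\<Sum>M. (w M * f M - w M * g l M)\<bar> \<le> (\<Sum>M. \<bar>w M * f M - w M * g l M\<bar>)" by (rule summable_rabs[OF sab])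
    also have "\<dots> \<le> suminf a" by (rule suminf_le[OF ptw sab sums_summable[OF sa]])
    finally show ?thesis .
  qed
  also have "\<dots> = real k ^ (p + 1) * A + real (l + 2) ^ (p + 1) * (C / 2 ^ l) + c3 * suminf (t k) + 3 ^ p * beta l * suminf (t (l + 2))"
    using sums_unique[OF sa] by simp
  also have "\<dots> \<le> real k ^ (p + 1) * A + real (l + 2) ^ (p + 1) * (C / 2 ^ l) + c3 * (32 * real k ^ (p + 1) / Q ^ k) + 3 ^ p * beta l * (32 * real (l + 2) ^ (p + 1) / Q ^ (l + 2))"
    using st(2)[OF k1] st(2)[of "l + 2"] c3 b0 by (intro add_mono mult_left_mono order_refl) auto
  also have "\<dots> = B p l k" unfolding B_def A_def c3_def by simp
  finally show ?thesis .
qed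

text \<open>The cut-off balances two errors: \<open>Q ^ k1 l\<close> is of order
  \<open>l / ln l\<close>, small enough for the distribution functions below it to be of order
  \<open>1 / l\<close> up to logarithms, yet large enough for the error estimate to be
  useful.\<close>

definition z :: "nat \<Rightarrow> real" where "z l = beta l / ln (real l)"
definition k1 :: "nat \<Rightarrow> nat" where "k1 l = nat \<lfloor>log Q (z l)\<rfloor>"

lemma k1_props: "\<forall>\<^sub>F l in at_top. real (k1 l) \<le> log Q (beta l) \<and> 1 / Q ^ k1 l \<le> Q / (\<delta> * Q\<^sup>2) * (ln (real l) / real l) \<and>
    exp (- (beta l / Q ^ k1 l)) \<le> 1 / real l \<and> k1 l \<ge> M0 \<and> l > 0"
proof -
  define d where "d = \<delta> * Q\<^sup>2"
  have d: "d > 0" using \<delta>_pos Q0 by (simp add: d_def)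
  have "filterlim (\<lambda>l. d * real l / ln (real l)) at_top at_top" using d by real_asymp
  then have "\<forall>\<^sub>F l in at_top. d * real l / ln (real l) \<ge> Q ^ M0" by (simp add: filterlim_at_top)
  moreover have "\<forall>\<^sub>F l in at_top. ln (real l) \<ge> 1" by real_asymp
  ultimately show ?thesis using eventually_gt_at_top[of 0]
  proof eventually_elim
    fix l :: nat assume a: "d * real l / ln (real l) \<ge> Q ^ M0" "ln (real l) \<ge> 1" "0 < l"
    have l1: "Suc 0 < l" using a by (cases "l = 1") auto
    have ze: "z l = d * real l / ln (real l)" by (simp add: z_def beta_def d_def mult_ac)
    have be: "beta l = d * real l" by (simp add: beta_def d_def mult_ac)
    have zM: "z l \<ge> Q ^ M0" using a ze by simp
    have z0: "z l > 0" using zM Q0 by (meson less_le_trans zero_less_power)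
    have lz: "log Q (z l) \<ge> real M0" using zM Q_gt z0 by (simp add: le_log_iff powr_realpow)
    have k1f: "real (k1 l) = of_int \<lfloor>log Q (z l)\<rfloor>" using lz by (simp add: k1_def)
    have le: "real (k1 l) \<le> log Q (z l)" and gt: "log Q (z l) < real (k1 l) + 1" unfolding k1f by linarith+
    have kM: "k1 l \<ge> M0" unfolding k1_def using lz by linarith
    have "z l \<le> beta l / 1" unfolding z_def using a d l1 by (intro divide_left_mono) (auto simp: be)
    then have "log Q (z l) \<le> log Q (beta l)" using z0 Q_gt by simp
    then have A1: "real (k1 l) \<le> log Q (beta l)" using le by simp
    have pz: "Q ^ k1 l \<le> z l" using le Q_gt z0 by (simp add: le_log_iff powr_realpow)
    have zp: "z l < Q ^ k1 l * Q" using gt Q_gt z0 Q0 by (simp add: log_less_iff powr_add powr_realpow)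
    have "1 / Q ^ k1 l \<le> Q / z l" using zp z0 Q0 by (simp add: field_simps)
    also have "\<dots> = Q / d * (ln (real l) / real l)" unfolding ze by simp
    finally have A2: "1 / Q ^ k1 l \<le> Q / d * (ln (real l) / real l)" .
    have "ln (real l) = beta l / z l" using a d l1 unfolding z_def be by simp
    also have "\<dots> \<le> beta l / Q ^ k1 l" using pz Q0 d by (intro divide_left_mono) (auto simp: be z0)
    finally have "exp (- (beta l / Q ^ k1 l)) \<le> exp (- ln (real l))" by simp
    also have "\<dots> = 1 / real l" using a by (simp add: exp_minus inverse_eq_divide)
    finally show "real (k1 l) \<le> log Q (beta l) \<and> 1 / Q ^ k1 l \<le> Q / (\<delta> * Q\<^sup>2) * (ln (real l) / real l) \<and>
      exp (- (beta l / Q ^ k1 l)) \<le> 1 / real l \<and> k1 l \<ge> M0 \<and> l > 0" using A1 A2 kM a by (simp add: d_def)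
  qed
qed

lemma k1_bigo:
  "(\<lambda>l. real (k1 l)) \<in> O(\<lambda>l. ln (real l))" "(\<lambda>l. 1 / Q ^ k1 l) \<in> O(\<lambda>l. ln (real l) / real l)"
  "(\<lambda>l. exp (- (beta l / Q ^ k1 l))) \<in> O(\<lambda>l. 1 / real l)"
proof -
  define d where "d = \<delta> * Q\<^sup>2"
  have d: "d > 0" using \<delta>_pos Q0 by (simp add: d_def)
  have be: "beta l = d * real l" for l by (simp add: beta_def d_def mult_ac)
  have "(\<lambda>l. real (k1 l)) \<in> O(\<lambda>l. ln (d * real l) / ln Q)"
    by (rule bigoI[of _ 1], rule eventually_mono[OF k1_props]) (auto simp: be log_def simp del: abs_divide intro: order_trans[OF _ abs_ge_self])
  also have "(\<lambda>l. ln (d * real l) / ln Q) \<in> O(\<lambda>l. ln (real l))" using d lnQ by real_asymp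
  finally show "(\<lambda>l. real (k1 l)) \<in> O(\<lambda>l. ln (real l))" .
  show "(\<lambda>l. 1 / Q ^ k1 l) \<in> O(\<lambda>l. ln (real l) / real l)"
    by (rule bigoI[of _ "Q / (\<delta> * Q\<^sup>2)"], rule eventually_mono[OF k1_props])
      (use Q0 \<delta>_pos in \<open>auto simp: abs_mult intro!: order_trans[OF _ mult_left_mono[OF abs_ge_self]] simp del: times_divide_eq_right times_divide_eq_left\<close>)
  show "(\<lambda>l. exp (- (beta l / Q ^ k1 l))) \<in> O(\<lambda>l. 1 / real l)"
    by (rule bigoI[of _ 1], rule eventually_mono[OF k1_props]) auto
qed

text \<open>The power of the logarithm is determined by \<open>t2\<close>: the cut-off contributes
  \<open>k ^ (p + 2)\<close>, and \<open>l / Q ^ (2 * k)\<close> is of order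
  \<open>(ln l)\<^sup>2 / l\<close>.\<close>

lemma B_bigo: 
  assumes p: "p \<le> 1"
  shows "(\<lambda>l. B p l (k1 l)) \<in> O(\<lambda>l. ln (real l) ^ (p + 4) / real l)"
proof -
  have p01: "p = 0 \<or> p = 1" using p by auto
  let ?a = "\<lambda>l. real (k1 l)" and ?b = "\<lambda>l. 1 / Q ^ k1 l" and ?e = "\<lambda>l. exp (- (beta l / Q ^ k1 l))"
  let ?L = "\<lambda>l :: nat. ln (real l)" and ?O = "\<lambda>l :: nat. ln (real l) ^ (p + 4) / real l"
  note k = k1_bigo
  have id: "(\<lambda>l. real l) \<in> O(\<lambda>l. real l)" by simp
  have kp: "(\<lambda>l. ?a l ^ (p + 1)) \<in> O(\<lambda>l. ?L l ^ (p + 1))" using p01 k(1) landau_o.big.mult[OF k(1) k(1)] by (auto simp: power2_eq_square)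
  note mult = landau_o.big.mult
  have t1: "(\<lambda>l. ?a l ^ (p + 1) * ?e l) \<in> O(?O)"
    by (rule landau_o.big.trans[OF mult[OF kp k(3)]]) (use p01 in \<open>elim disjE; simp only:; real_asymp\<close>)
  have t2: "(\<lambda>l. ?a l ^ (p + 1) * (real l * ?a l * (?b l * ?b l))) \<in> O(?O)"
    by (rule landau_o.big.trans[OF mult[OF kp mult[OF mult[OF id k(1)] mult[OF k(2) k(2)]]]]) (use p01 in \<open>elim disjE; simp only:; real_asymp\<close>)
  have t3: "(\<lambda>l. ?a l ^ (p + 1) * (?a l * ?b l)) \<in> O(?O)"
    by (rule landau_o.big.trans[OF mult[OF kp mult[OF k(1) k(2)]]]) (use p01 in \<open>elim disjE; simp only:; real_asymp\<close>)
  have "(\<lambda>l. 1 / 2 ^ l :: real) \<in> O(\<lambda>l. 1 / real l)" by real_asymp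
  from mult[OF kp this] have t4: "(\<lambda>l. ?a l ^ (p + 1) * (1 / 2 ^ l)) \<in> O(?O)"
    by (rule landau_o.big.trans) (use p01 in \<open>elim disjE; simp only:; real_asymp\<close>)
  have t5: "(\<lambda>l. real (l + 2) ^ (p + 1) * (1 / 2 ^ l)) \<in> O(?O)"
    using p01 by (elim disjE; simp only:; real_asymp)
  have t6: "(\<lambda>l. ?a l ^ (p + 1) * (real l * (?b l * ?b l))) \<in> O(?O)"
    by (rule landau_o.big.trans[OF mult[OF kp mult[OF id mult[OF k(2) k(2)]]]]) (use p01 in \<open>elim disjE; simp only:; real_asymp\<close>)
  have t7: "(\<lambda>l. ?a l ^ (p + 1) * ?b l) \<in> O(?O)"
    by (rule landau_o.big.trans[OF mult[OF kp k(2)]]) (use p01 in \<open>elim disjE; simp only:; real_asymp\<close>)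
  have t8: "(\<lambda>l. real l * real (l + 2) ^ (p + 1) / Q ^ (l + 2)) \<in> O(?O)"
  proof (rule landau_o.big.trans)
    show "(\<lambda>l. real l * real (l + 2) ^ (p + 1) / Q ^ (l + 2)) \<in> O(\<lambda>l. real l * real (l + 2) ^ (p + 1) / 2 ^ (l + 2))"
      by (rule bigoI[of _ 1]) (use Q2 Q0 in \<open>auto simp: abs_mult power_abs intro!: always_eventually divide_left_mono power_mono mult_mono simp del: power_Suc power_add\<close>)
    show "(\<lambda>l. real l * real (l + 2) ^ (p + 1) / 2 ^ (l + 2)) \<in> O(?O)"
      using p01 by (elim disjE; simp only:; real_asymp)
  qed
  have eq: "B p l (k1 l) = 2 * (?a l ^ (p + 1) * ?e l) + C * (?a l ^ (p + 1) * (real l * ?a l * (?b l * ?b l)))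
     + C * (?a l ^ (p + 1) * (?a l * ?b l)) + C * (?a l ^ (p + 1) * (1 / 2 ^ l)) + C * (real (l + 2) ^ (p + 1) * (1 / 2 ^ l))
     + 96 * C * (?a l ^ (p + 1) * (real l * (?b l * ?b l))) + 96 * C * (?a l ^ (p + 1) * ?b l)
     + 3 ^ p * 32 * \<delta> * Q\<^sup>2 * (real l * real (l + 2) ^ (p + 1) / Q ^ (l + 2))" for l
  proof -
    have "B p l k = 2 * (a * e) + C * (a * (real l * real k * (b * b))) + C * (a * (real k * b)) + C * (a * s) + C * (r * s) + 96 * C * (a * (real l * (b * b))) + 96 * C * (a * b)
      + 3 ^ p * 32 * \<delta> * Q\<^sup>2 * (real l * r / Q ^ (l + 2))"
      if "a = real k ^ (p + 1)" "b = 1 / Q ^ k" "e = exp (- (beta l / Q ^ k))" "s = 1 / 2 ^ l" "r = real (l + 2) ^ (p + 1)" for a b e s r k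
    proof -
      have "err l k = C * (real l * real k * (b * b) + real k * b + s)"
        by (simp add: err_def that mult_2 power_add)
      moreover have "C / 2 ^ l = C * s" "real l / Q ^ k = real l * b" "32 * a / Q ^ k = 32 * a * b" by (simp_all add: that)
      ultimately show ?thesis unfolding B_def that(1,3,5)[symmetric] unfolding beta_def by (simp add: algebra_simps)
    qed
    then show ?thesis by (simp only:)
  qed
  show ?thesis unfolding eq using t1 t2 t3 t4 t5 t6 t7 t8 by (intro sum_in_bigo cmult_bigo)
qed

lemma T_approx:
  assumes p: "p \<le> 1"
  shows "(\<lambda>l. T p l - (\<integral>v. (N (u l + 2) v) ^ (p + 1) \<partial>Expo)) \<in> O(\<lambda>l. ln (real l) ^ (p + 4) / real l)"
proof -
  define K where "K = 4 / (ln Q)\<^sup>2 * (\<integral>u. u \<partial>Expo) / (\<delta> * Q\<^sup>2)"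
  have "(\<lambda>l. T p l - (\<integral>v. (N (u l + 2) v) ^ (p + 1) \<partial>Expo)) \<in> O(\<lambda>l. B p l (k1 l) + K * (1 / real l))"
  proof (rule bigoI[of _ 1], rule eventually_mono[OF k1_props], elim conjE)
    fix l assume l: "l > 0" "k1 l \<ge> M0"
    have "\<bar>T p l - (\<integral>v. (max 0 (N (u l + 2) v)) ^ (p + 1) \<partial>Expo)\<bar> \<le> B p l (k1 l)" by (rule T_bound[OF p l])
    moreover have "\<bar>(\<integral>v. (max 0 (N (u l + 2) v)) ^ (p + 1) \<partial>Expo) - (\<integral>v. (N (u l + 2) v) ^ (p + 1) \<partial>Expo)\<bar> \<le> K * (1 / real l)"
      using N_neg_part[OF p, of "u l + 2"] unfolding powr_u[OF l(1)] K_def beta_def by (simp add: mult_ac)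
    ultimately show "norm (T p l - (\<integral>v. (N (u l + 2) v) ^ (p + 1) \<partial>Expo)) \<le> 1 * norm (B p l (k1 l) + K * (1 / real l))"
      unfolding real_norm_def mult_1_left by linarith
  qed
  also have "(\<lambda>l. B p l (k1 l) + K * (1 / real l)) \<in> O(\<lambda>l. ln (real l) ^ (p + 4) / real l)"
  proof (intro sum_in_bigo(1) B_bigo[OF p] cmult_bigo)
    have "p = 0 \<or> p = 1" using p by auto
    then show "(\<lambda>l. 1 / real l) \<in> O(\<lambda>l. ln (real l) ^ (p + 4) / real l)" by (elim disjE; simp only:; real_asymp)
  qed
  finally show ?thesis .
qed

lemma Psi0_shift: "Psi0 Q (x + 2) = Psi0 Q x" and Psi1_shift: "Psi1 Q (x + 2) = Psi1 Q x"
  using Psi_properties(2)[of x] Psi_properties(2)[of "x + 1"] Psi_properties(5)[of x] Psi_properties(5)[of "x + 1"] by (simp_all add: add.assoc)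

theorem mean_asymptotics:
  "(\<lambda>l. T 0 l - (u l + euler_mascheroni / ln Q + 5 / 2 + Psi0 Q (u l))) \<in> O(\<lambda>l. ln (real l) ^ 4 / real l)"
proof -
  have "(\<integral>v. (N (u l + 2) v) ^ (0 + 1) \<partial>Expo) = u l + euler_mascheroni / ln Q + 5 / 2 + Psi0 Q (u l)" for l
    by (simp add: expectation_N Psi0_shift)
  then show ?thesis using T_approx[of 0] by simp
qed

lemma Psi0_bound: "\<bar>Psi0 Q x\<bar> \<le> 1"
proof -
  have "\<bar>E1 x\<bar> \<le> (\<integral>v. \<bar>sawtooth (x - Y v)\<bar> \<partial>Expo)" unfolding E1_def by (rule integral_abs_bound)
  also have "\<dots> \<le> (\<integral>v. 1 \<partial>Expo)" by (rule integral_mono) (use integrable_sawtooth(1) abs_sawtooth in auto)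
  finally show ?thesis by (simp add: Psi0_eq)
qed

theorem variance_asymptotics:
  "(\<lambda>l. T 1 l - (T 0 l)\<^sup>2 - (pi\<^sup>2 / (6 * (ln Q)\<^sup>2) + 1 / 12 + Psi1 Q (u l) - 2 * euler_mascheroni / ln Q * Psi0 Q (u l) - (Psi0 Q (u l))\<^sup>2))
     \<in> O(\<lambda>l. ln (real l) ^ 5 / real l)"
proof -
  define m where "m l = (\<integral>v. N (u l + 2) v \<partial>Expo)" for l
  define s where "s l = (\<integral>v. (N (u l + 2) v)\<^sup>2 \<partial>Expo)" for l
  have a0: "(\<lambda>l. T 0 l - m l) \<in> O(\<lambda>l. ln (real l) ^ 4 / real l)" using T_approx[of 0] by (simp add: m_def)
  have a1: "(\<lambda>l. T 1 l - s l) \<in> O(\<lambda>l. ln (real l) ^ 5 / real l)" using T_approx[of 1] by (simp add: s_def power2_eq_square)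
  define c where "c = log Q \<delta> + 5 / 2 + euler_mascheroni / ln Q"
  have me: "m l = ln (real l) / ln Q + c + Psi0 Q (u l)" for l
    unfolding m_def expectation_N Psi0_shift by (simp add: u_def log_def c_def)
  have "m \<in> O(\<lambda>l. ln (real l))" unfolding me[abs_def]
  proof (intro sum_in_bigo(1))
    show "(\<lambda>l. ln (real l) / ln Q) \<in> O(\<lambda>l. ln (real l))" using cmult_bigo[of "\<lambda>l. ln (real l)" "\<lambda>l. ln (real l)" "1 / ln Q"] by simp
    have o1: "(\<lambda>_. 1 :: real) \<in> O(\<lambda>l :: nat. ln (real l))" by real_asymp
    show "(\<lambda>_. c) \<in> O(\<lambda>l :: nat. ln (real l))" using cmult_bigo[OF o1, of c] by simp
    have "(\<lambda>l. Psi0 Q (u l)) \<in> O(\<lambda>_. 1)" by (rule bigoI[of _ 1]) (use Psi0_bound in auto)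
    then show "(\<lambda>l. Psi0 Q (u l)) \<in> O(\<lambda>l. ln (real l))" using o1 by (rule landau_o.big.trans)
  qed
  \<comment> \<open>Passing to the squared mean multiplies the error of the mean by
    \<open>m\<close>, which grows like \<open>ln l\<close>; this raises the fourth power of the
    logarithm to the fifth.\<close>
  from landau_o.big.mult[OF a0 this] have b1: "(\<lambda>l. (T 0 l - m l) * m l) \<in> O(\<lambda>l. ln (real l) ^ 5 / real l)"
    by (rule landau_o.big.trans) real_asymp
  from landau_o.big.mult[OF a0 a0] have b2: "(\<lambda>l. (T 0 l - m l) * (T 0 l - m l)) \<in> O(\<lambda>l. ln (real l) ^ 5 / real l)"
    by (rule landau_o.big.trans) real_asymp
  have "(\<lambda>l. (T 1 l - s l) - (2 * ((T 0 l - m l) * m l) + (T 0 l - m l) * (T 0 l - m l))) \<in> O(\<lambda>l. ln (real l) ^ 5 / real l)"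
    by (intro sum_in_bigo a1 b1 b2 cmult_bigo)
  moreover have "(T 1 l - s l) - (2 * ((T 0 l - m l) * m l) + (T 0 l - m l) * (T 0 l - m l)) =
    T 1 l - (T 0 l)\<^sup>2 - (pi\<^sup>2 / (6 * (ln Q)\<^sup>2) + 1 / 12 + Psi1 Q (u l) - 2 * euler_mascheroni / ln Q * Psi0 Q (u l) - (Psi0 Q (u l))\<^sup>2)" for l
    using expectation_N2(2)[of "u l + 2"] unfolding Psi0_shift Psi1_shift s_def[symmetric] m_def[symmetric]
    by (simp add: power2_eq_square algebra_simps)
  ultimately show ?thesis by (simp only:)
qed

section \<open>Limit distributions\<close>

text \<open>At distance at most \<open>b\<close> from the logarithm of \<open>r n\<close>, the power
  \<open>Q ^ k n\<close> is at least a constant times \<open>r n\<close>, so every term of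
  \<open>err\<close> tends to 0.\<close>

lemma F_limit:
  fixes r k :: "nat \<Rightarrow> nat"
  assumes r: "filterlim r at_top sequentially"
    and b: "\<forall>\<^sub>F n in sequentially. \<bar>real (k n) - log Q (real (r n))\<bar> \<le> b"
  shows "(\<lambda>n. F (r n) (k n) - exp (- (beta (r n) / Q ^ k n))) \<longlonglongrightarrow> 0"
proof -
  define D where "D = Q powr b"
  have D: "D > 0" using Q0 by (simp add: D_def)
  define h where "h l = (ln (real l) / ln Q + b) * D\<^sup>2 / real l + (ln (real l) / ln Q + b) * D / real l + 1 / 2 ^ l" for l :: nat
  have "(\<lambda>l :: nat. h l) \<longlonglongrightarrow> 0" unfolding h_def using D lnQ by real_asymp
  from filterlim_compose[OF this r] have "(\<lambda>n. C * h (r n)) \<longlonglongrightarrow> C * 0" by (intro tendsto_intros)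
  then have lim: "(\<lambda>n. C * h (r n)) \<longlonglongrightarrow> 0" by simp
  have "filterlim (\<lambda>l. ln (real l) / ln Q) at_top at_top" using lnQ by real_asymp
  from filterlim_compose[OF this r] have "\<forall>\<^sub>F n in sequentially. ln (real (r n)) / ln Q \<ge> real M0 + b" by (simp add: filterlim_at_top)
  moreover have "\<forall>\<^sub>F n in sequentially. r n > 0"
  proof -
    have "\<forall>\<^sub>F n in sequentially. Suc 0 \<le> r n" using r unfolding filterlim_at_top by blast
    then show ?thesis by (rule eventually_mono) simp
  qed
  ultimately have "\<forall>\<^sub>F n in sequentially. norm (F (r n) (k n) - exp (- (beta (r n) / Q ^ k n))) \<le> C * h (r n)"
    using b
  proof eventually_elim
    fix n assume a: "ln (real (r n)) / ln Q \<ge> real M0 + b" "r n > 0" "\<bar>real (k n) - log Q (real (r n))\<bar> \<le> b"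
    have kk: "real (k n) \<le> ln (real (r n)) / ln Q + b" "log Q (real (r n)) - b \<le> real (k n)"
      using a(3) by (auto simp: log_def)
    have M: "k n \<ge> M0" using a(1) kk(2) by (simp add: log_def)
    have "Q powr (log Q (real (r n)) - b) \<le> Q powr real (k n)" using kk(2) Q_gt by simp
    then have "real (r n) / D \<le> Q ^ k n" using a(2) Q0 Q_gt by (simp add: powr_diff powr_realpow D_def)
    then have bb: "1 / Q ^ k n \<le> D / real (r n)" using a(2) D Q0 by (simp add: field_simps)
    have kn: "0 \<le> ln (real (r n)) / ln Q + b" using kk(1) by linarith
    have b2: "1 / Q ^ (2 * k n) \<le> (D / real (r n))\<^sup>2"
      using power_mono[OF bb, of 2] Q0 by (simp add: power_divide power_mult[symmetric] mult.commute)
    have "real (r n) * real (k n) / Q ^ (2 * k n) = real (r n) * (real (k n) * (1 / Q ^ (2 * k n)))" by simp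
    also have "\<dots> \<le> real (r n) * ((ln (real (r n)) / ln Q + b) * (D / real (r n))\<^sup>2)"
      using kk(1) kn b2 Q0 by (intro mult_left_mono mult_mono) auto
    also have "\<dots> = (ln (real (r n)) / ln Q + b) * D\<^sup>2 / real (r n)" using a(2) by (simp add: power2_eq_square)
    finally have e1: "real (r n) * real (k n) / Q ^ (2 * k n) \<le> (ln (real (r n)) / ln Q + b) * D\<^sup>2 / real (r n)" .
    have "real (k n) * (1 / Q ^ k n) \<le> (ln (real (r n)) / ln Q + b) * (D / real (r n))"
      using kk(1) kn bb Q0 by (intro mult_mono) auto
    then have e2: "real (k n) / Q ^ k n \<le> (ln (real (r n)) / ln Q + b) * D / real (r n)" by simp
    have "err (r n) (k n) \<le> C * h (r n)" unfolding err_def h_def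
      using e1 e2 C_nn by (intro mult_left_mono add_mono) auto
    then show "norm (F (r n) (k n) - exp (- (beta (r n) / Q ^ k n))) \<le> C * h (r n)"
      using F_err[OF M, of "r n"] by simp
  qed
  then show ?thesis using lim by (rule Lim_null_comparison)
qed

lemma beta_div_powr: "l > 0 \<Longrightarrow> beta l / Q ^ k = \<delta> * Q\<^sup>2 * Q powr (log Q (real l) - real k)"
  using Q0 Q_gt by (simp add: beta_def powr_diff powr_realpow)

lemma double_exp_eq: "\<delta> * a / Q powr (real_of_int m - 2) = \<delta> * Q\<^sup>2 * (a / Q powr of_int m)"
  using Q0 by (simp add: powr_diff)

text \<open>For \<open>k l = log Q l + O(1)\<close> the approximation stays above the positive
  constant \<open>e\<close> below, so a difference tending to 0 makes the quotient tend to
  1.\<close>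

theorem F_asymp_equiv:
  fixes k :: "nat \<Rightarrow> nat"
  assumes "(\<lambda>l. real (k l) - log Q (real l)) \<in> O(\<lambda>l. 1)"
  shows "(\<lambda>l. F l (k l)) \<sim>[at_top] (\<lambda>l. exp (- (\<delta> * real l / Q powr (real_of_int (int (k l)) - 2))))"
proof -
  obtain b where b: "\<forall>\<^sub>F l in at_top. \<bar>real (k l) - log Q (real l)\<bar> \<le> b"
    using assms by (auto elim!: landau_o.bigE)
  define G where "G l = exp (- (beta l / Q ^ k l))" for l
  have Ge: "exp (- (\<delta> * real l / Q powr (real_of_int (int (k l)) - 2))) = G l" for l
    unfolding double_exp_eq G_def beta_def using Q0 by (simp add: powr_realpow)
  have lim: "(\<lambda>l. F l (k l) - G l) \<longlonglongrightarrow> 0" unfolding G_def using F_limit[of "\<lambda>l. l" k b] b by (simp add: filterlim_ident)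
  define e where "e = exp (- (\<delta> * Q\<^sup>2 * Q powr b))"
  have e: "e > 0" by (simp add: e_def)
  have "(\<lambda>l. F l (k l) / G l - 1) \<longlonglongrightarrow> 0"
  proof (rule Lim_null_comparison)
    show "\<forall>\<^sub>F l in at_top. norm (F l (k l) / G l - 1) \<le> \<bar>F l (k l) - G l\<bar> / e"
      using b eventually_gt_at_top[of 0]
    proof eventually_elim
      fix l assume a: "\<bar>real (k l) - log Q (real l)\<bar> \<le> b" "0 < l"
      have "Q powr (log Q (real l) - real (k l)) \<le> Q powr b" using a(1) Q_gt by simp
      then have "beta l / Q ^ k l \<le> \<delta> * Q\<^sup>2 * Q powr b" unfolding beta_div_powr[OF a(2)] using \<delta>_pos Q0 by (intro mult_left_mono) auto
      then have eG: "e \<le> G l" unfolding e_def G_def by simp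
      have G: "G l > 0" by (simp add: G_def)
      have "F l (k l) / G l - 1 = (F l (k l) - G l) / G l" using G by (simp add: field_simps)
      then have "norm (F l (k l) / G l - 1) = \<bar>F l (k l) - G l\<bar> / G l" using G by simp
      also have "\<dots> \<le> \<bar>F l (k l) - G l\<bar> / e" using eG e by (intro divide_left_mono) auto
      finally show "norm (F l (k l) / G l - 1) \<le> \<bar>F l (k l) - G l\<bar> / e" .
    qed
    have "(\<lambda>l. \<bar>F l (k l) - G l\<bar> / e) \<longlonglongrightarrow> \<bar>0\<bar> / e" using e by (intro tendsto_intros lim) auto
    then show "(\<lambda>l. \<bar>F l (k l) - G l\<bar> / e) \<longlonglongrightarrow> 0" by simp
  qed
  then have "(\<lambda>l. F l (k l) / G l) \<longlonglongrightarrow> 1" by (rule LIM_zero_cancel)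
  then show ?thesis unfolding Ge by (intro asymp_equivI') 
qed

text \<open>The limit is the law of \<open>N x0 v - \<theta>\<close>, with \<open>x0\<close> the
  limit of the centred parameters. It is carried by the integers shifted by
  \<open>- \<theta>\<close>, so only points \<open>y\<close> with \<open>y + \<theta>\<close> not an
  integer have to be examined.\<close>

theorem weak_limit:
  fixes r :: "nat \<Rightarrow> nat"
  assumes r: "strict_mono r" and pos: "\<And>n. r n > 0" and fr: "(\<lambda>n. frac (log Q (real (r n)))) \<longlonglongrightarrow> \<theta>"
  shows "\<exists>M. real_distribution M \<and> (\<forall>x. cdf M x = exp (- (\<delta> * Q powr \<theta> / Q powr (real_of_int \<lfloor>x + \<theta>\<rfloor> - 2)))) \<and>
    (\<forall>y. isCont (cdf M) y \<longrightarrow> (\<lambda>n. F (r n) (nat \<lfloor>y + log Q (real (r n))\<rfloor>)) \<longlonglongrightarrow> cdf M y)"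
proof -
  define x0 where "x0 = log Q \<delta> + \<theta> + 2"
  define M where "M = distr Expo borel (\<lambda>v. N x0 v - \<theta>)"
  have mN: "(\<lambda>v. N x0 v - \<theta>) \<in> borel_measurable Expo" by measurable
  have rd: "real_distribution M" unfolding M_def by (rule Expo.real_distribution_distr[OF mN])
  have c: "cdf M x = exp (- (\<delta> * Q powr \<theta> / Q powr (real_of_int \<lfloor>x + \<theta>\<rfloor> - 2)))" for x
  proof -
    have "cdf M x = measure Expo ((\<lambda>v. N x0 v - \<theta>) -` {..x} \<inter> space Expo)"
      unfolding cdf_def M_def by (rule measure_distr[OF mN]) simp
    also have "(\<lambda>v. N x0 v - \<theta>) -` {..x} \<inter> space Expo = {v. N x0 v \<le> of_int \<lfloor>x + \<theta>\<rfloor>}"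
    proof -
      have "N x0 v - \<theta> \<le> x \<longleftrightarrow> N x0 v \<le> of_int \<lfloor>x + \<theta>\<rfloor>" for v
        unfolding N_def of_int_le_iff le_floor_iff by linarith
      then show ?thesis by auto
    qed
    also have "measure Expo \<dots> = exp (- (Q powr (x0 - of_int \<lfloor>x + \<theta>\<rfloor>)))" by (rule prob_N_le)
    also have "Q powr (x0 - of_int \<lfloor>x + \<theta>\<rfloor>) = \<delta> * Q powr \<theta> / Q powr (real_of_int \<lfloor>x + \<theta>\<rfloor> - 2)"
      unfolding double_exp_eq x0_def using Q0 Q_gt \<delta>_pos by (simp add: powr_diff powr_add)
    finally show ?thesis .
  qed
  have "(\<lambda>n. F (r n) (nat \<lfloor>y + log Q (real (r n))\<rfloor>)) \<longlonglongrightarrow> cdf M y" if iso: "isCont (cdf M) y" for y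
  proof -
    define m where "m = \<lfloor>y + \<theta>\<rfloor>"
    define d where "d n = log Q (real (r n))" for n
    \<comment> \<open>At an integral value of \<open>y + \<theta>\<close> the floor drops by one
      immediately to the left of \<open>y\<close>. The distribution function would take the same
      value for two consecutive integers, which strict monotonicity of powers of \<open>Q\<close>
      excludes.\<close>
    have ni: "y + \<theta> \<notin> \<int>"
    proof
      assume "y + \<theta> \<in> \<int>"
      then have ym: "y + \<theta> = of_int m" unfolding m_def by (auto elim: Ints_cases)
      define A where "A = exp (- (\<delta> * Q powr \<theta> / Q powr (real_of_int (m - 1) - 2)))"
      have "(\<lambda>n. y - 1 / real (Suc n)) \<longlonglongrightarrow> y - 0"
        using LIMSEQ_inverse_real_of_nat unfolding inverse_eq_divide by (intro tendsto_intros)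
      then have "(\<lambda>n. cdf M (y - 1 / real (Suc n))) \<longlonglongrightarrow> cdf M y"
        using isCont_tendsto_compose[OF iso] by simp
      moreover have "cdf M (y - 1 / real (Suc n)) = A" for n
      proof -
        define e where "e = 1 / real (Suc n)"
        have e: "0 < e" "e \<le> 1" by (auto simp: e_def)
        have "\<lfloor>y - 1 / real (Suc n) + \<theta>\<rfloor> = m - 1"
          unfolding e_def[symmetric] by (rule floor_unique; unfold of_int_diff of_int_1; use e ym in linarith)
        then show ?thesis unfolding c A_def by simp
      qed
      ultimately have "A = cdf M y" using LIMSEQ_unique[OF tendsto_const] by simp
      then have "\<delta> * Q powr \<theta> / Q powr (real_of_int (m - 1) - 2) = \<delta> * Q powr \<theta> / Q powr (real_of_int m - 2)"
        unfolding A_def c m_def[symmetric] by simp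
      then have "Q powr (real_of_int (m - 1) - 2) = Q powr (real_of_int m - 2)" using \<delta>_pos Q0 by (simp add: field_simps)
      then show False using Q_gt by (simp add: powr_inj)
    qed
    have rt: "filterlim r at_top sequentially" by (rule filterlim_subseq[OF r])
    have dt: "filterlim d at_top sequentially"
    proof -
      have "filterlim (\<lambda>l. ln (real l) / ln Q) at_top at_top" using lnQ by real_asymp
      from filterlim_compose[OF this rt] show ?thesis unfolding d_def log_def .
    qed
    have fr': "(\<lambda>n. frac (d n)) \<longlonglongrightarrow> \<theta>" using fr by (simp add: d_def)
    have "(\<lambda>n. y + frac (d n)) \<longlonglongrightarrow> y + \<theta>" by (intro tendsto_intros fr')
    from eventually_floor_eq[OF this ni] have f1: "\<forall>\<^sub>F n in sequentially. \<lfloor>y + frac (d n)\<rfloor> = m" by (simp add: m_def)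
    have f2: "\<forall>\<^sub>F n in sequentially. d n \<ge> \<bar>real_of_int m\<bar> + 1" using dt by (simp add: filterlim_at_top)
    \<comment> \<open>As \<open>y + \<theta>\<close> is not an integer,
      \<open>\<lfloor>y + frac (d n)\<rfloor>\<close> eventually has the constant value
      \<open>m\<close>. Then \<open>K n - d n\<close> equals \<open>m - frac (d n)\<close>, so it is
      bounded and converges to \<open>m - \<theta>\<close>.\<close>
    define K where "K n = nat \<lfloor>y + d n\<rfloor>" for n
    have KK: "\<forall>\<^sub>F n in sequentially. real (K n) = d n - frac (d n) + of_int m"
      using f1 f2
    proof eventually_elim
      fix n assume a: "\<lfloor>y + frac (d n)\<rfloor> = m" "d n \<ge> \<bar>real_of_int m\<bar> + 1"
      have "y + d n = (y + frac (d n)) + of_int \<lfloor>d n\<rfloor>" by (simp add: frac_def)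
      then have "\<lfloor>y + d n\<rfloor> = m + \<lfloor>d n\<rfloor>" using a(1) by (metis floor_add_int)
      moreover have "m + \<lfloor>d n\<rfloor> \<ge> 0" using a(2) by linarith
      ultimately show "real (K n) = d n - frac (d n) + of_int m" by (simp add: K_def frac_def)
    qed
    have "\<forall>\<^sub>F n in sequentially. \<bar>real (K n) - log Q (real (r n))\<bar> \<le> \<bar>real_of_int m\<bar> + 1"
      using KK
    proof eventually_elim
      fix n assume "real (K n) = d n - frac (d n) + of_int m"
      then show "\<bar>real (K n) - log Q (real (r n))\<bar> \<le> \<bar>real_of_int m\<bar> + 1"
        unfolding d_def[symmetric] using frac_ge_0[of "d n"] frac_lt_1[of "d n"] by linarith
    qed
    from F_limit[OF rt this] have L1: "(\<lambda>n. F (r n) (K n) - exp (- (beta (r n) / Q ^ K n))) \<longlonglongrightarrow> 0" .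
    have "(\<lambda>n. exp (- (\<delta> * Q\<^sup>2 * Q powr (frac (d n) - of_int m)))) \<longlonglongrightarrow> exp (- (\<delta> * Q\<^sup>2 * Q powr (\<theta> - of_int m)))"
      using Q0 by (intro tendsto_intros fr') auto
    moreover have "\<forall>\<^sub>F n in sequentially. exp (- (\<delta> * Q\<^sup>2 * Q powr (frac (d n) - of_int m))) = exp (- (beta (r n) / Q ^ K n))"
      using KK
    proof eventually_elim
      fix n assume "real (K n) = d n - frac (d n) + of_int m"
      then show "exp (- (\<delta> * Q\<^sup>2 * Q powr (frac (d n) - of_int m))) = exp (- (beta (r n) / Q ^ K n))"
        unfolding beta_div_powr[OF pos] d_def[symmetric] by simp
    qed
    ultimately have L2: "(\<lambda>n. exp (- (beta (r n) / Q ^ K n))) \<longlonglongrightarrow> exp (- (\<delta> * Q\<^sup>2 * Q powr (\<theta> - of_int m)))"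
      by (rule Lim_transform_eventually)
    have "\<delta> * Q\<^sup>2 * Q powr (\<theta> - of_int m) = \<delta> * Q powr \<theta> / Q powr (real_of_int m - 2)"
      unfolding double_exp_eq by (simp add: powr_diff)
    then have "cdf M y = exp (- (\<delta> * Q\<^sup>2 * Q powr (\<theta> - of_int m)))" unfolding c m_def by simp
    then show ?thesis using tendsto_add[OF L1 L2] by (simp add: K_def d_def)
  qed
  then show ?thesis using rd c by (intro exI[of _ M]) blast
qed

end

lemma expectation_power_tail:
  fixes t :: "'a \<Rightarrow> nat"
  assumes K: "\<And>p. p \<in> set_pmf D \<Longrightarrow> t p \<le> K" and e: "e \<le> 1"
  shows "measure_pmf.expectation D (\<lambda>p. real (t p) ^ (e + 1)) =
    (\<Sum>M<K. real (2 * M + 1) ^ e * (1 - measure_pmf.prob D {p. t p \<le> M}))"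
proof -
  have "measure_pmf.expectation D (\<lambda>p. real (t p) ^ (e + 1)) =
    measure_pmf.expectation D (\<lambda>p. \<Sum>M<K. real (2 * M + 1) ^ e * indicat_real {p. t p > M} p)"
  proof (rule integral_cong_AE)
    show "AE p in measure_pmf D. real (t p) ^ (e + 1) = (\<Sum>M<K. real (2 * M + 1) ^ e * indicat_real {p. t p > M} p)"
      unfolding AE_measure_pmf_iff
    proof
      fix p assume "p \<in> set_pmf D"
      then have "min (nat (int (t p))) K = t p" using K by simp
      then show "real (t p) ^ (e + 1) = (\<Sum>M<K. real (2 * M + 1) ^ e * indicat_real {p. t p > M} p)"
        using clamp_sum[OF e, where K = K and n = "int (t p)"] by (simp add: indicator_def of_bool_def)
    qed
  qed auto
  also have "\<dots> = (\<Sum>M<K. measure_pmf.expectation D (\<lambda>p. real (2 * M + 1) ^ e * indicat_real {p. t p > M} p))"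
    by (rule Bochner_Integration.integral_sum) (auto intro!: integrable_mult_right simp: integrable_indicator_iff less_top[symmetric])
  also have "\<dots> = (\<Sum>M<K. real (2 * M + 1) ^ e * (1 - measure_pmf.prob D {p. t p \<le> M}))"
  proof (rule sum.cong[OF refl])
    fix M
    have "UNIV - {p. t p \<le> M} = {p. t p > M}" by auto
    then have "measure_pmf.prob D {p. t p > M} = 1 - measure_pmf.prob D {p. t p \<le> M}"
      using measure_pmf.prob_compl[of "{p. t p \<le> M}" D] by simp
    then show "measure_pmf.expectation D (\<lambda>p. real (2 * M + 1) ^ e * indicat_real {p. t p > M} p) =
      real (2 * M + 1) ^ e * (1 - measure_pmf.prob D {p. t p \<le> M})" by simp
  qed
  finally show ?thesis .
qed

text \<open>Nonnegativity matters: for negative \<open>y + d\<close> the conversion to a natural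
  number would give the probability of the value 0 instead of the probability 0. For fixed
  \<open>y\<close> the condition holds as soon as the length is large.\<close>

lemma cdf_shifted_nat:
  fixes t :: "'a \<Rightarrow> nat"
  assumes "y + d \<ge> 0"
  shows "cdf (distr (measure_pmf D) borel (\<lambda>p. real (t p) - d)) y = measure_pmf.prob D {p. t p \<le> nat \<lfloor>y + d\<rfloor>}"
proof -
  have "cdf (distr (measure_pmf D) borel (\<lambda>p. real (t p) - d)) y = measure_pmf.prob D ((\<lambda>p. real (t p) - d) -` {..y} \<inter> space (measure_pmf D))"
    unfolding cdf_def by (rule measure_distr) auto
  also have "(\<lambda>p. real (t p) - d) -` {..y} \<inter> space (measure_pmf D) = {p. t p \<le> nat \<lfloor>y + d\<rfloor>}"
  proof -
    have "real (t p) - d \<le> y \<longleftrightarrow> t p \<le> nat \<lfloor>y + d\<rfloor>" for p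
      using assms le_floor_iff[of "int (t p)" "y + d"] by (auto simp: le_nat_iff)
    then show ?thesis by auto
  qed
  finally show ?thesis .
qed

context even_base
begin

lemma iterations_le_length:
  assumes "p \<in> set_pmf (SSDE_pair_pmf q l)"
  shows "iterations q p \<le> l + 2"
proof -
  have "(\<lambda>j. 0) \<in> SSDE q l" using h_ge q_ge by (simp add: SSDE_def h_def)
  then have "SSDE q l \<noteq> {}" by blast
  then have "set_pmf (SSDE_pair_pmf q l) = SSDE q l \<times> SSDE q l"
    using finite_SSDE[of l] by (simp add: SSDE_pair_pmf_def)
  then show ?thesis using assms iterations_le_iff_aux(2) by (cases p) auto
qed

lemma ex_iteration_tail:
  "\<exists>C M0. iteration_tail Q (delta Q) C M0 (\<lambda>l M. measure_pmf.prob (SSDE_pair_pmf q l) {p. iterations q p \<le> M})"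
proof -
  obtain C M0 where C: "C \<ge> 0" "M0 \<ge> 2" "\<And>M l. M \<ge> M0 \<Longrightarrow>
     \<bar>measure_pmf.prob (SSDE_pair_pmf q l) {p. iterations q p \<le> M} - exp (- (delta Q * real l / Q ^ (M - 2)))\<bar>
       \<le> C * (real l * real M / Q ^ (2 * M) + real M / Q ^ M + 1 / 2 ^ l)" using prob_iterations_approx by blast
  have "iteration_tail Q (delta Q) C M0 (\<lambda>l M. measure_pmf.prob (SSDE_pair_pmf q l) {p. iterations q p \<le> M})"
  proof
    show "Q > 1" "Q \<ge> 2" using q_ge by simp_all
    show "delta Q > 0" by (rule delta_pos)
    show "measure_pmf.prob (SSDE_pair_pmf q l) {p. iterations q p \<le> M} \<le> measure_pmf.prob (SSDE_pair_pmf q l) {p. iterations q p \<le> M'}"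
      if "M \<le> M'" for l M M' using that by (intro measure_pmf.finite_measure_mono) auto
    show "measure_pmf.prob (SSDE_pair_pmf q l) {p. iterations q p \<le> M} = 1" if "l + 2 \<le> M" for l M
      unfolding measure_pmf.prob_eq_1[of "{p. iterations q p \<le> M}", simplified] AE_measure_pmf_iff
      using iterations_le_length that order_trans by (metis mem_Collect_eq)
  qed (use C in auto)
  then show ?thesis by blast
qed

end

theorem theorem4:
  fixes q :: int
  assumes "even q" and "q \<ge> 2"
  defines "Q \<equiv> real_of_int q"
  defines "t \<equiv> iterations q"
  defines "P \<equiv> (\<lambda>l. measure_pmf (SSDE_pair_pmf q l))"
  defines "u \<equiv> (\<lambda>l. log Q (real l) + log Q (delta Q))"
  shows
    "(\<forall>x. (Psi0_term Q x has_sum of_real (Psi0 Q x)) (-{0})) \<and>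
     (\<forall>x. Psi0 Q (x + 1) = Psi0 Q x) \<and>
     ((Psi0 Q has_integral 0) {0..1}) \<and>
     ((\<lambda>l. measure_pmf.expectation (SSDE_pair_pmf q l) (\<lambda>p. real (t p))
         - (u l + euler_mascheroni / ln Q + 5 / 2 + Psi0 Q (u l)))
       \<in> O(\<lambda>l. (ln (real l))^4 / real l)) \<and>
     (\<forall>x. (Psi1_term Q x has_sum of_real (Psi1 Q x)) (-{0})) \<and>
     (\<forall>x. Psi1 Q (x + 1) = Psi1 Q x) \<and>
     ((Psi1 Q has_integral 0) {0..1}) \<and>
     ((\<lambda>l. measure_pmf.variance (SSDE_pair_pmf q l) (\<lambda>p. real (t p))
         - (pi^2 / (6 * (ln Q)^2) + 1 / 12 + Psi1 Q (u l)
            - 2 * euler_mascheroni / ln Q * Psi0 Q (u l) - (Psi0 Q (u l))^2))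
       \<in> O(\<lambda>l. (ln (real l))^5 / real l)) \<and>
     (\<forall>k :: nat \<Rightarrow> nat. (\<lambda>l. real (k l) - log Q (real l)) \<in> O(\<lambda>l. 1) \<longrightarrow>
        (\<lambda>l. measure (P l) {p. t p \<le> k l})
          \<sim>[at_top] (\<lambda>l. double_exponential Q (real l) (int (k l)))) \<and>
     (\<forall>(r :: nat \<Rightarrow> nat) \<theta>. strict_mono r \<longrightarrow> (\<forall>n. r n > 0) \<longrightarrow>
        (\<lambda>n. frac (log Q (real (r n)))) \<longlonglongrightarrow> \<theta> \<longrightarrow>
        (\<exists>M. real_distribution M \<and>
             (\<forall>x. cdf M x = double_exponential Q (Q powr \<theta>) \<lfloor>x + \<theta>\<rfloor>) \<and>
             weak_conv_m
               (\<lambda>n. distr (P (r n)) borel (\<lambda>p. real (t p) - log Q (real (r n)))) M))"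
proof -
  interpret base: even_base q by unfold_locales (use assms(1,2) in auto)
  define F where "F l M = measure_pmf.prob (SSDE_pair_pmf q l) {p. t p \<le> M}" for l M
  obtain C M0 where "iteration_tail Q (delta Q) C M0 F"
    using base.ex_iteration_tail unfolding F_def[abs_def] Q_def t_def by blast
  then interpret A: iteration_tail Q "delta Q" C M0 F .
  have u: "A.u = u" by (simp add: fun_eq_iff A.u_def u_def)
  have le: "t p \<le> l + 2" if "p \<in> set_pmf (SSDE_pair_pmf q l)" for p l
    using base.iterations_le_length[OF that] by (simp add: t_def)
  have T: "measure_pmf.expectation (SSDE_pair_pmf q l) (\<lambda>p. real (t p) ^ (e + 1)) = A.T e l" if "e \<le> 1" for e l
    unfolding A.T_def F_def by (rule expectation_power_tail[OF le that])
  have ex: "measure_pmf.expectation (SSDE_pair_pmf q l) (\<lambda>p. real (t p)) = A.T 0 l" for l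
    using T[of 0 l] by simp
  have int: "integrable (SSDE_pair_pmf q l) (\<lambda>p. real (t p) ^ e)" for e l
  proof (rule measure_pmf.integrable_const_bound)
    show "AE p in SSDE_pair_pmf q l. norm (real (t p) ^ e) \<le> real (l + 2) ^ e"
      unfolding AE_measure_pmf_iff real_norm_def power_abs abs_of_nat
      by (intro ballI power_mono of_nat_mono le) auto
  qed simp
  have var: "measure_pmf.variance (SSDE_pair_pmf q l) (\<lambda>p. real (t p)) = A.T 1 l - (A.T 0 l)\<^sup>2" for l
    using measure_pmf.variance_eq[of "SSDE_pair_pmf q l" "\<lambda>p. real (t p)"] int[of l 1] int[of l 2] T[of 1 l] ex[of l]
    by (simp add: power2_eq_square)
  have weak: "\<exists>M. real_distribution M \<and> (\<forall>x. cdf M x = double_exponential Q (Q powr \<theta>) \<lfloor>x + \<theta>\<rfloor>) \<and>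
      weak_conv_m (\<lambda>n. distr (P (r n)) borel (\<lambda>p. real (t p) - log Q (real (r n)))) M"
    if r: "strict_mono r" "\<forall>n. r n > 0" "(\<lambda>n. frac (log Q (real (r n)))) \<longlonglongrightarrow> \<theta>" for r :: "nat \<Rightarrow> nat" and \<theta>
  proof -
    obtain M where M: "real_distribution M" "\<And>x. cdf M x = exp (- (delta Q * Q powr \<theta> / Q powr (real_of_int \<lfloor>x + \<theta>\<rfloor> - 2)))"
      "\<And>y. isCont (cdf M) y \<Longrightarrow> (\<lambda>n. F (r n) (nat \<lfloor>y + log Q (real (r n))\<rfloor>)) \<longlonglongrightarrow> cdf M y"
      using A.weak_limit[OF r(1) _ r(3)] r(2) by blast
    have "(\<lambda>n. cdf (distr (P (r n)) borel (\<lambda>p. real (t p) - log Q (real (r n)))) y) \<longlonglongrightarrow> cdf M y"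
      if "isCont (cdf M) y" for y
    proof (rule Lim_transform_eventually[OF M(3)[OF that]])
      have "filterlim (\<lambda>l :: nat. ln (real l) / ln Q) at_top at_top" using A.lnQ by real_asymp
      from filterlim_compose[OF this filterlim_subseq[OF r(1)]]
      have "\<forall>\<^sub>F n in sequentially. log Q (real (r n)) \<ge> - y" by (simp add: filterlim_at_top log_def)
      then show "\<forall>\<^sub>F n in sequentially. F (r n) (nat \<lfloor>y + log Q (real (r n))\<rfloor>) =
          cdf (distr (P (r n)) borel (\<lambda>p. real (t p) - log Q (real (r n)))) y"
      proof eventually_elim
        fix n assume "- y \<le> log Q (real (r n))"
        then show "F (r n) (nat \<lfloor>y + log Q (real (r n))\<rfloor>) =
          cdf (distr (P (r n)) borel (\<lambda>p. real (t p) - log Q (real (r n)))) y"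
          unfolding P_def F_def by (subst cdf_shifted_nat) auto
      qed
    qed
    then show ?thesis using M(1,2) unfolding weak_conv_m_def weak_conv_def double_exponential_def by blast
  qed
  have equiv: "(\<lambda>l. measure (P l) {p. t p \<le> k l}) \<sim>[at_top] (\<lambda>l. double_exponential Q (real l) (int (k l)))"
    if "(\<lambda>l. real (k l) - log Q (real l)) \<in> O(\<lambda>l. 1)" for k :: "nat \<Rightarrow> nat"
    using A.F_asymp_equiv[OF that] unfolding F_def P_def double_exponential_def .
  show ?thesis
    unfolding var unfolding ex using A.Psi_properties A.mean_asymptotics A.variance_asymptotics equiv weak unfolding u by blast
qed

end
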